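(* Let $H$ be a finite graded connected cocommutative Hopf algebra over a field $k$ of characteristic $p>0$. Suppose $H$ has a nontrivial normal Hopf subalgebra $Z$ (that is, $Z\neq k$ and $Z\neq H$) such that $H//Z$ has detect property in $gr(H//Z)$ with detecting set $\mathcal{B}=\{B_i\mid i\in I\}$. Let $\mathcal{E}=\{E_i\mid i\in I\}$, where $E_i$ is a Hopf subalgebra of $H$ containing $Z$ with $E_i//Z=B_i$. Then the restriction map $$Res:\mathbb{T}(H)\longrightarrow\prod_{E\in\mathcal{E}}\mathbb{T}(E)$$ is injective.
   Context: Hopf algebras are finite-dimensional, non-negatively graded, connected ($H_0=k$) and cocommutative; Hopf subalgebras are graded. For a Hopf algebra $H$ with coproduct $\triangle$, counit $\epsilon$, antipode $S$, $grH$ is the category of finitely generated graded left $H$-modules and degree-preserving maps; "free" means a direct sum of shifts of $H$. $M\otimes N$ (over $k$) is an $H$-module via $\triangle$, and $M^*=Hom_k(M,k)$ via $(h\cdot f)(v)=f(S(h)v)$. $k$ also denotes the trivial module concentrated in degree $0$. A Hopf subalgebra $Z\subset H$ is normal if $HZ^+=Z^+H$, where $Z^+=Z\cap\ker\epsilon$; then $H//Z=H/HZ^+$, a quotient Hopf algebra. Detect property: let $A$ be an algebra and $\mathcal{B}=\{B_i\mid i\in I\}$ a collection of nontrivial subalgebras of $A$ (nontrivial: $B_i\neq A$ and $B_i\neq k$). $A$ has detect property in $grA$ with detecting set $\mathcal{B}$ if a module $M$ in $grA$ is free if and only if its restriction to every $B\in\mathcal{B}$ is free. Endotrivial group: a module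 $M$ is endotrivial if $End_k(M)\cong M\otimes M^*\cong k\oplus F$ as $H$-modules with $F$ free. Two endotrivial modules $M,N$ are equivalent if $M\cong N\oplus(\text{free})$ or $N\cong M\oplus(\text{free})$. $\mathbb{T}(H)$ is the abelian group of equivalence classes $[M]$ of endotrivial $H$-modules with $[M]+[N]=[M\otimes N]$ and unit $[k]$. $Res$ is induced by restricting modules to the Hopf subalgebras $E$. *)

theory Defs
  imports
    Complex_Main
    "HOL-Library.Function_Algebras"
    "HOL-Library.Product_Plus"
    "HOL-Algebra.Product_Groups"
begin

section \<open>Graded vector spaces and their tensor products\<close>

text \<open>
  A vector space over the field \<^typ>\<open>'k\<close> is a subspace \<open>V\<close> of an ambient type carrying a
  scalar multiplication that makes the whole type a \<^locale>\<open>vector_space\<close>.  All gradings are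
  indexed by the integers; a nonnegative grading is one that vanishes in negative degrees.
\<close>

definition decomposes :: "(int \<Rightarrow> 'v::ab_group_add set) \<Rightarrow> 'v \<Rightarrow> (int \<Rightarrow> 'v) \<Rightarrow> bool" where
  "decomposes G v c \<longleftrightarrow>
     (\<forall>i. c i \<in> G i) \<and> finite {i. c i \<noteq> 0} \<and> v = (\<Sum>i | c i \<noteq> 0. c i)"

definition graded_by ::
  "('k::field \<Rightarrow> 'v::ab_group_add \<Rightarrow> 'v) \<Rightarrow> 'v set \<Rightarrow> (int \<Rightarrow> 'v set) \<Rightarrow> bool" where
  "graded_by sc V G \<longleftrightarrow>
     (\<forall>i. Modules.module.subspace sc (G i) \<and> G i \<subseteq> V) \<and> (\<forall>v\<in>V. \<exists>!c. decomposes G v c)"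

definition hcomp :: "(int \<Rightarrow> 'v::ab_group_add set) \<Rightarrow> 'v \<Rightarrow> int \<Rightarrow> 'v" where
  "hcomp G v = (THE c. decomposes G v c)"

text \<open>\<open>hext G F\<close> extends \<open>F\<close>, given on homogeneous elements together with their degree, additively.\<close>

definition hext ::
  "(int \<Rightarrow> 'v::ab_group_add set) \<Rightarrow> (int \<Rightarrow> 'v \<Rightarrow> 'u::comm_monoid_add) \<Rightarrow> 'v \<Rightarrow> 'u" where
  "hext G F v = (\<Sum>i | hcomp G v i \<noteq> 0. F i (hcomp G v i))"

text \<open>
  The sign that appears when homogeneous elements of degrees \<open>i\<close> and \<open>j\<close> are interchanged:
  \<open>s = 1\<close> is the sign-free convention, \<open>s = -1\<close> is the Koszul rule.
\<close>

definition xsign :: "'k::field \<Rightarrow> int \<Rightarrow> int \<Rightarrow> 'k" where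
  "xsign s i j = (if odd i \<and> odd j then s else 1)"

definition linear_on ::
  "('k::field \<Rightarrow> 'v::ab_group_add \<Rightarrow> 'v) \<Rightarrow> ('k \<Rightarrow> 'w::ab_group_add \<Rightarrow> 'w) \<Rightarrow> 'v set \<Rightarrow> ('v \<Rightarrow> 'w) \<Rightarrow> bool"
  where
  "linear_on sc1 sc2 V f \<longleftrightarrow>
     (\<forall>x\<in>V. \<forall>y\<in>V. f (x + y) = f x + f y) \<and> (\<forall>c. \<forall>x\<in>V. f (sc1 c x) = sc2 c (f x))"

definition fscale :: "'k::field \<Rightarrow> ('x \<Rightarrow> 'k) \<Rightarrow> 'x \<Rightarrow> 'k" where
  "fscale c f = (\<lambda>x. c * f x)"

definition bilinear_form ::
  "('k::field \<Rightarrow> 'v::ab_group_add \<Rightarrow> 'v) \<Rightarrow> ('k \<Rightarrow> 'w::ab_group_add \<Rightarrow> 'w) \<Rightarrow> ('v \<Rightarrow> 'w \<Rightarrow> 'k) \<Rightarrow> bool"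
  where
  "bilinear_form sc1 sc2 \<beta> \<longleftrightarrow>
     (\<forall>v. linear_on sc2 (*) UNIV (\<beta> v)) \<and> (\<forall>w. linear_on sc1 (*) UNIV (\<lambda>v. \<beta> v w))"

text \<open>
  Tensor products over the field are realised inside the dual of the space of bilinear forms:
  \<open>v \<otimes> w\<close> is evaluation at \<open>(v, w)\<close>, and \<open>V \<otimes> W\<close> is the span of the \<open>v \<otimes> w\<close>.  Bilinear forms
  are taken on the ambient spaces; as forms on subspaces extend, \<open>V \<otimes> W\<close> is the tensor product
  of \<open>V\<close> and \<open>W\<close>, and \<open>V' \<otimes> W' \<subseteq> V \<otimes> W\<close> holds literally for subspaces.
\<close>

type_synonym ('k, 'v, 'w) tensor = "('v \<Rightarrow> 'w \<Rightarrow> 'k) \<Rightarrow> 'k"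

definition tens ::
  "('k::field \<Rightarrow> 'v::ab_group_add \<Rightarrow> 'v) \<Rightarrow> ('k \<Rightarrow> 'w::ab_group_add \<Rightarrow> 'w) \<Rightarrow> 'v \<Rightarrow> 'w \<Rightarrow> ('k, 'v, 'w) tensor"
  where
  "tens sc1 sc2 v w = (\<lambda>\<beta>. if bilinear_form sc1 sc2 \<beta> then \<beta> v w else 0)"

definition tprod ::
  "('k::field \<Rightarrow> 'v::ab_group_add \<Rightarrow> 'v) \<Rightarrow> ('k \<Rightarrow> 'w::ab_group_add \<Rightarrow> 'w) \<Rightarrow> 'v set \<Rightarrow> 'w set
    \<Rightarrow> ('k, 'v, 'w) tensor set" where
  "tprod sc1 sc2 V W = Modules.module.span fscale {tens sc1 sc2 v w | v w. v \<in> V \<and> w \<in> W}"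

definition tgrade ::
  "('k::field \<Rightarrow> 'v::ab_group_add \<Rightarrow> 'v) \<Rightarrow> ('k \<Rightarrow> 'w::ab_group_add \<Rightarrow> 'w)
    \<Rightarrow> (int \<Rightarrow> 'v set) \<Rightarrow> (int \<Rightarrow> 'w set) \<Rightarrow> int \<Rightarrow> ('k, 'v, 'w) tensor set" where
  "tgrade sc1 sc2 G1 G2 n =
     Modules.module.span fscale {tens sc1 sc2 v w | v w. \<exists>i. v \<in> G1 i \<and> w \<in> G2 (n - i)}"

text \<open>
  The linear map on \<open>V \<otimes> W\<close> induced by a map \<open>F\<close> that is bilinear on \<open>V \<times> W\<close>.  Every element of
  \<open>V \<otimes> W\<close> is a finite sum of pure tensors, and the value does not depend on the chosen sum.
\<close>

definition tlift ::
  "('k::field \<Rightarrow> 'v::ab_group_add \<Rightarrow> 'v) \<Rightarrow> ('k \<Rightarrow> 'w::ab_group_add \<Rightarrow> 'w) \<Rightarrow> 'v set \<Rightarrow> 'w set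
    \<Rightarrow> ('v \<Rightarrow> 'w \<Rightarrow> 'u::ab_group_add) \<Rightarrow> ('k, 'v, 'w) tensor \<Rightarrow> 'u" where
  "tlift sc1 sc2 V W F t =
     (THE u. \<exists>xs. set xs \<subseteq> V \<times> W \<and> t = (\<Sum>(v, w)\<leftarrow>xs. tens sc1 sc2 v w) \<and> u = (\<Sum>(v, w)\<leftarrow>xs. F v w))"


section \<open>Graded algebras and graded modules\<close>

text \<open>
  The operations of an algebra are explicit, so that a quotient algebra can have cosets as its
  elements.
\<close>

record ('k, 'a) galgebra =
  acarrier :: "'a set"
  aadd :: "'a \<Rightarrow> 'a \<Rightarrow> 'a"
  azero :: 'a
  amult :: "'a \<Rightarrow> 'a \<Rightarrow> 'a"
  aone :: 'a
  ascale :: "'k \<Rightarrow> 'a \<Rightarrow> 'a"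
  agrade :: "int \<Rightarrow> 'a set"

definition graded_subalgebra :: "('k, 'a) galgebra \<Rightarrow> 'a set \<Rightarrow> bool" where
  "graded_subalgebra A B \<longleftrightarrow>
     B \<subseteq> acarrier A \<and> azero A \<in> B \<and> aone A \<in> B
     \<and> (\<forall>x\<in>B. \<forall>y\<in>B. aadd A x y \<in> B \<and> amult A x y \<in> B) \<and> (\<forall>c. \<forall>x\<in>B. ascale A c x \<in> B)
     \<and> (\<forall>x\<in>B. \<exists>xs. set xs \<subseteq> (\<Union>i. B \<inter> agrade A i) \<and> x = foldr (aadd A) xs (azero A))"

definition nontrivial_subalgebra :: "('k, 'a) galgebra \<Rightarrow> 'a set \<Rightarrow> bool" where
  "nontrivial_subalgebra A B \<longleftrightarrow>
     graded_subalgebra A B \<and> B \<noteq> acarrier A \<and> B \<noteq> range (\<lambda>c. ascale A c (aone A))"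

definition subalg :: "('k, 'a) galgebra \<Rightarrow> 'a set \<Rightarrow> ('k, 'a) galgebra" where
  "subalg A B = A\<lparr>acarrier := B, agrade := (\<lambda>i. agrade A i \<inter> B)\<rparr>"

record ('k, 'a, 'v) gmodule =
  mcarrier :: "'v set"
  mscale :: "'k \<Rightarrow> 'v \<Rightarrow> 'v"
  mact :: "'a \<Rightarrow> 'v \<Rightarrow> 'v"
  mgrade :: "int \<Rightarrow> 'v set"

definition graded_module ::
  "('k::field, 'a) galgebra \<Rightarrow> ('k, 'a, 'v::ab_group_add) gmodule \<Rightarrow> bool" where
  "graded_module A M \<longleftrightarrow>
     vector_space (mscale M) \<and> Modules.module.subspace (mscale M) (mcarrier M)
     \<and> graded_by (mscale M) (mcarrier M) (mgrade M)
     \<and> (\<forall>a\<in>acarrier A. \<forall>m\<in>mcarrier M. mact M a m \<in> mcarrier M)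
     \<and> (\<forall>a\<in>acarrier A. linear_on (mscale M) (mscale M) (mcarrier M) (mact M a))
     \<and> (\<forall>a\<in>acarrier A. \<forall>b\<in>acarrier A. \<forall>m\<in>mcarrier M.
          mact M (aadd A a b) m = mact M a m + mact M b m
          \<and> mact M (amult A a b) m = mact M a (mact M b m))
     \<and> (\<forall>c. \<forall>a\<in>acarrier A. \<forall>m\<in>mcarrier M. mact M (ascale A c a) m = mscale M c (mact M a m))
     \<and> (\<forall>m\<in>mcarrier M. mact M (aone A) m = m)
     \<and> (\<forall>i j. \<forall>a\<in>agrade A i. \<forall>m\<in>mgrade M j. mact M a m \<in> mgrade M (i + j))"

text \<open>
  The objects of the category of finitely generated graded modules.  As axioms only concern the
  action of elements of \<open>acarrier A\<close>, the restriction of \<open>M\<close> to a subalgebra is \<open>M\<close> itself,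
  regarded as a module over the subalgebra.
\<close>

definition gr :: "('k::field, 'a) galgebra \<Rightarrow> ('k, 'a, 'v::ab_group_add) gmodule \<Rightarrow> bool" where
  "gr A M \<longleftrightarrow> graded_module A M
     \<and> (\<exists>S. finite S \<and> S \<subseteq> mcarrier M
          \<and> (\<forall>m\<in>mcarrier M. \<exists>f. (\<forall>x\<in>S. f x \<in> acarrier A) \<and> m = (\<Sum>x\<in>S. mact M (f x) x)))"

definition gmod_iso ::
  "('k, 'a) galgebra \<Rightarrow> ('k, 'a, 'v::ab_group_add) gmodule \<Rightarrow> ('k, 'a, 'w::ab_group_add) gmodule \<Rightarrow> bool"
  where
  "gmod_iso A M N \<longleftrightarrow>
     (\<exists>\<phi>. bij_betw \<phi> (mcarrier M) (mcarrier N)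
        \<and> (\<forall>x\<in>mcarrier M. \<forall>y\<in>mcarrier M. \<phi> (x + y) = \<phi> x + \<phi> y)
        \<and> (\<forall>a\<in>acarrier A. \<forall>x\<in>mcarrier M. \<phi> (mact M a x) = mact N a (\<phi> x))
        \<and> (\<forall>i. \<phi> ` mgrade M i \<subseteq> mgrade N i))"

text \<open>
  \<open>\<phi>\<close> is an isomorphism onto \<open>M\<close> from the direct sum of the shifts \<open>A[d 0], \<dots>, A[d (n - 1)]\<close>, where
  the degree \<open>i\<close> part of \<open>A[d]\<close> is the degree \<open>i - d\<close> part of \<open>A\<close>.
\<close>

definition gfree :: "('k, 'a) galgebra \<Rightarrow> ('k, 'a, 'v::ab_group_add) gmodule \<Rightarrow> bool" where
  "gfree A M \<longleftrightarrow>
     (\<exists>(n::nat) (d :: nat \<Rightarrow> int) \<phi>. let D = (\<Pi>\<^sub>E j\<in>{..<n}. acarrier A) in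
        bij_betw \<phi> D (mcarrier M)
        \<and> (\<forall>x\<in>D. \<forall>y\<in>D. \<phi> (\<lambda>j\<in>{..<n}. aadd A (x j) (y j)) = \<phi> x + \<phi> y)
        \<and> (\<forall>a\<in>acarrier A. \<forall>x\<in>D. \<phi> (\<lambda>j\<in>{..<n}. amult A a (x j)) = mact M a (\<phi> x))
        \<and> (\<forall>i. \<phi> ` (\<Pi>\<^sub>E j\<in>{..<n}. agrade A (i - d j)) \<subseteq> mgrade M i))"

text \<open>
  Finitely generated modules over a finite-dimensional algebra are finite-dimensional over
  \<^typ>\<open>'k\<close>, so each of them is isomorphic to one whose elements have type \<^typ>\<open>nat \<Rightarrow> 'k\<close>.
\<close>

definition detect_property :: "('k::field, 'a) galgebra \<Rightarrow> 'a set set \<Rightarrow> bool" where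
  "detect_property A \<B> \<longleftrightarrow>
     (\<forall>B\<in>\<B>. nontrivial_subalgebra A B)
     \<and> (\<forall>M :: ('k, 'a, nat \<Rightarrow> 'k) gmodule. gr A M \<longrightarrow>
          (gfree A M \<longleftrightarrow> (\<forall>B\<in>\<B>. gfree (subalg A B) M)))"

definition dsum ::
  "('k, 'a, 'v::ab_group_add) gmodule \<Rightarrow> ('k, 'a, 'w::ab_group_add) gmodule \<Rightarrow> ('k, 'a, 'v \<times> 'w) gmodule"
  where
  "dsum M N =
     \<lparr>mcarrier = mcarrier M \<times> mcarrier N,
      mscale = (\<lambda>c (v, w). (mscale M c v, mscale N c w)),
      mact = (\<lambda>a (v, w). (mact M a v, mact N a w)),
      mgrade = (\<lambda>i. mgrade M i \<times> mgrade N i)\<rparr>"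


section \<open>Graded Hopf algebras\<close>

text \<open>Addition and multiplication are those of the ambient ring.\<close>

record ('k, 'h) hopf =
  hcarrier :: "'h set"
  hscale :: "'k \<Rightarrow> 'h \<Rightarrow> 'h"
  hgrade :: "int \<Rightarrow> 'h set"
  coprod :: "'h \<Rightarrow> ('k, 'h, 'h) tensor"
  counit :: "'h \<Rightarrow> 'k"
  antipode :: "'h \<Rightarrow> 'h"

text \<open>\<open>sweedler H F h\<close> is \<open>\<Sum> F h' h''\<close>, where the coproduct of \<open>h\<close> is \<open>\<Sum> h' \<otimes> h''\<close>.\<close>

definition sweedler ::
  "('k::field, 'h::ring_1) hopf \<Rightarrow> ('h \<Rightarrow> 'h \<Rightarrow> 'u::ab_group_add) \<Rightarrow> 'h \<Rightarrow> 'u" where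
  "sweedler H F h = tlift (hscale H) (hscale H) (hcarrier H) (hcarrier H) F (coprod H h)"

abbreviation hh_tens :: "('k::field, 'h::ring_1) hopf \<Rightarrow> 'h \<Rightarrow> 'h \<Rightarrow> ('k, 'h, 'h) tensor" where
  "hh_tens H \<equiv> tens (hscale H) (hscale H)"

text \<open>
  A finite-dimensional, nonnegatively graded, connected, cocommutative Hopf algebra.  In
  multiplicativity of the coproduct and in cocommutativity, the signs are those of
  \<open>(a \<otimes> b) (c \<otimes> d) = \<plusminus> a c \<otimes> b d\<close> and \<open>a \<otimes> b \<mapsto> \<plusminus> b \<otimes> a\<close>.
\<close>

definition graded_algebra_part :: "('k::field, 'h::ring_1) hopf \<Rightarrow> bool" where
  "graded_algebra_part H \<longleftrightarrow>
     vector_space (hscale H) \<and> Modules.module.subspace (hscale H) (hcarrier H)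
     \<and> (\<exists>B. finite B \<and> hcarrier H = Modules.module.span (hscale H) B)
     \<and> 1 \<in> hcarrier H \<and> (\<forall>x\<in>hcarrier H. \<forall>y\<in>hcarrier H. x * y \<in> hcarrier H)
     \<and> (\<forall>c. \<forall>x\<in>hcarrier H. \<forall>y\<in>hcarrier H.
          hscale H c (x * y) = hscale H c x * y \<and> hscale H c (x * y) = x * hscale H c y)
     \<and> graded_by (hscale H) (hcarrier H) (hgrade H)
     \<and> (\<forall>i j. \<forall>x\<in>hgrade H i. \<forall>y\<in>hgrade H j. x * y \<in> hgrade H (i + j))
     \<and> (\<forall>i<0. hgrade H i = {0})
     \<and> hgrade H 0 = range (\<lambda>c. hscale H c 1)"

definition graded_coalgebra_part :: "('k::field, 'h::ring_1) hopf \<Rightarrow> bool" where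
  "graded_coalgebra_part H \<longleftrightarrow>
     linear_on (hscale H) fscale (hcarrier H) (coprod H)
     \<and> (\<forall>x\<in>hcarrier H. coprod H x \<in> tprod (hscale H) (hscale H) (hcarrier H) (hcarrier H))
     \<and> (\<forall>i. \<forall>x\<in>hgrade H i. coprod H x \<in> tgrade (hscale H) (hscale H) (hgrade H) (hgrade H) i)
     \<and> linear_on (hscale H) (*) (hcarrier H) (counit H)
     \<and> (\<forall>i. i \<noteq> 0 \<longrightarrow> (\<forall>x\<in>hgrade H i. counit H x = 0))
     \<and> (\<forall>x\<in>hcarrier H.
          sweedler H (\<lambda>a b. sweedler H (\<lambda>a' a''. tens (hscale H) fscale a' (hh_tens H a'' b)) a) x
          = sweedler H (\<lambda>a b. tens (hscale H) fscale a (coprod H b)) x)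
     \<and> (\<forall>x\<in>hcarrier H. sweedler H (\<lambda>a b. hscale H (counit H a) b) x = x
                     \<and> sweedler H (\<lambda>a b. hscale H (counit H b) a) x = x)"

definition hopf_algebra :: "'k::field \<Rightarrow> ('k, 'h::ring_1) hopf \<Rightarrow> bool" where
  "hopf_algebra s H \<longleftrightarrow>
     graded_algebra_part H \<and> graded_coalgebra_part H
     \<and> counit H 1 = 1 \<and> (\<forall>x\<in>hcarrier H. \<forall>y\<in>hcarrier H. counit H (x * y) = counit H x * counit H y)
     \<and> coprod H 1 = hh_tens H 1 1
     \<and> (\<forall>x\<in>hcarrier H. \<forall>y\<in>hcarrier H.
          coprod H (x * y) =
            sweedler H (\<lambda>a b. sweedler H (\<lambda>c d.
              hext (hgrade H) (\<lambda>i b. hext (hgrade H) (\<lambda>j c.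
                fscale (xsign s i j) (hh_tens H (a * c) (b * d))) c) b) y) x)
     \<and> linear_on (hscale H) (hscale H) (hcarrier H) (antipode H)
     \<and> (\<forall>x\<in>hcarrier H. antipode H x \<in> hcarrier H)
     \<and> (\<forall>i. \<forall>x\<in>hgrade H i. antipode H x \<in> hgrade H i)
     \<and> (\<forall>x\<in>hcarrier H. sweedler H (\<lambda>a b. antipode H a * b) x = hscale H (counit H x) 1
                     \<and> sweedler H (\<lambda>a b. a * antipode H b) x = hscale H (counit H x) 1)
     \<and> (\<forall>x\<in>hcarrier H.
          sweedler H (\<lambda>a b. hext (hgrade H) (\<lambda>i a. hext (hgrade H) (\<lambda>j b.
            fscale (xsign s i j) (hh_tens H b a)) b) a) x = coprod H x)"

definition alg :: "('k, 'h::ring_1) hopf \<Rightarrow> ('k, 'h) galgebra" where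
  "alg H = \<lparr>acarrier = hcarrier H, aadd = (+), azero = 0, amult = (*), aone = 1,
            ascale = hscale H, agrade = hgrade H\<rparr>"

definition hopf_subalgebra :: "('k::field, 'h::ring_1) hopf \<Rightarrow> 'h set \<Rightarrow> bool" where
  "hopf_subalgebra H E \<longleftrightarrow>
     E \<subseteq> hcarrier H \<and> Modules.module.subspace (hscale H) E \<and> 1 \<in> E \<and> (\<forall>x\<in>E. \<forall>y\<in>E. x * y \<in> E)
     \<and> (\<forall>x\<in>E. \<forall>i. hcomp (hgrade H) x i \<in> E)
     \<and> (\<forall>x\<in>E. coprod H x \<in> tprod (hscale H) (hscale H) E E)
     \<and> (\<forall>x\<in>E. antipode H x \<in> E)"

definition subhopf :: "('k, 'h) hopf \<Rightarrow> 'h set \<Rightarrow> ('k, 'h) hopf" where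
  "subhopf H E = H\<lparr>hcarrier := E, hgrade := (\<lambda>i. hgrade H i \<inter> E)\<rparr>"

definition augmentation_ideal :: "('k::field, 'h::ring_1) hopf \<Rightarrow> 'h set \<Rightarrow> 'h set" where
  "augmentation_ideal H Z = {z \<in> Z. counit H z = 0}"

definition set_prod :: "('k::field, 'h::ring_1) hopf \<Rightarrow> 'h set \<Rightarrow> 'h set \<Rightarrow> 'h set" where
  "set_prod H X Y = Modules.module.span (hscale H) {x * y | x y. x \<in> X \<and> y \<in> Y}"

definition normal_hopf_subalgebra :: "('k::field, 'h::ring_1) hopf \<Rightarrow> 'h set \<Rightarrow> bool" where
  "normal_hopf_subalgebra H Z \<longleftrightarrow>
     hopf_subalgebra H Z
     \<and> set_prod H (hcarrier H) (augmentation_ideal H Z) = set_prod H (augmentation_ideal H Z) (hcarrier H)"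

text \<open>The class of \<open>x\<close> in \<open>H//Z = H / H Z\<^sup>+\<close>.\<close>

definition qclass :: "('k::field, 'h::ring_1) hopf \<Rightarrow> 'h set \<Rightarrow> 'h \<Rightarrow> 'h set" where
  "qclass H Z x = (\<lambda>y. x + y) ` set_prod H (hcarrier H) (augmentation_ideal H Z)"

definition hquot :: "('k::field, 'h::ring_1) hopf \<Rightarrow> 'h set \<Rightarrow> ('k, 'h set) galgebra" where
  "hquot H Z =
     \<lparr>acarrier = qclass H Z ` hcarrier H,
      aadd = (\<lambda>X Y. \<Union>x\<in>X. \<Union>y\<in>Y. qclass H Z (x + y)),
      azero = qclass H Z 0,
      amult = (\<lambda>X Y. \<Union>x\<in>X. \<Union>y\<in>Y. qclass H Z (x * y)),
      aone = qclass H Z 1,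
      ascale = (\<lambda>c X. \<Union>x\<in>X. qclass H Z (hscale H c x)),
      agrade = (\<lambda>i. qclass H Z ` hgrade H i)\<rparr>"

definition triv :: "('k::field, 'h) hopf \<Rightarrow> ('k, 'h, 'k) gmodule" where
  "triv H = \<lparr>mcarrier = UNIV, mscale = (*), mact = (\<lambda>h c. counit H h * c),
             mgrade = (\<lambda>i. if i = 0 then UNIV else {0})\<rparr>"

text \<open>\<open>h (v \<otimes> w) = \<Sum> \<plusminus> h' v \<otimes> h'' w\<close>, where \<open>h''\<close> and \<open>v\<close> are interchanged.\<close>

definition mtensor ::
  "'k::field \<Rightarrow> ('k, 'h::ring_1) hopf \<Rightarrow> ('k, 'h, 'v::ab_group_add) gmodule \<Rightarrow> ('k, 'h, 'w::ab_group_add) gmodule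
    \<Rightarrow> ('k, 'h, ('k, 'v, 'w) tensor) gmodule" where
  "mtensor s H M N =
     \<lparr>mcarrier = tprod (mscale M) (mscale N) (mcarrier M) (mcarrier N),
      mscale = fscale,
      mact = (\<lambda>h t. sweedler H (\<lambda>a b.
        tlift (mscale M) (mscale N) (mcarrier M) (mcarrier N) (\<lambda>v w.
          hext (hgrade H) (\<lambda>i b. hext (mgrade M) (\<lambda>j v.
            fscale (xsign s i j) (tens (mscale M) (mscale N) (mact M a v) (mact N b w))) v) b) t) h),
      mgrade = tgrade (mscale M) (mscale N) (mgrade M) (mgrade N)\<rparr>"

text \<open>
  Linear functionals on \<open>M\<close> are extended by \<open>0\<close> to the ambient type.  For \<open>s = 1\<close> the action is
  \<open>(h f) v = f (S h v)\<close>; for \<open>s = -1\<close> this formula gives a module only with the Koszul sign of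
  the interchange of \<open>h\<close> and \<open>f\<close>.
\<close>

definition dual_grade ::
  "('k::field, 'h, 'v::ab_group_add) gmodule \<Rightarrow> int \<Rightarrow> ('v \<Rightarrow> 'k) set" where
  "dual_grade M i =
     {f. linear_on (mscale M) (*) (mcarrier M) f \<and> (\<forall>v. v \<notin> mcarrier M \<longrightarrow> f v = 0)
         \<and> (\<forall>j. j \<noteq> - i \<longrightarrow> (\<forall>v\<in>mgrade M j. f v = 0))}"

definition mdual ::
  "'k::field \<Rightarrow> ('k, 'h::ring_1) hopf \<Rightarrow> ('k, 'h, 'v::ab_group_add) gmodule \<Rightarrow> ('k, 'h, 'v \<Rightarrow> 'k) gmodule"
  where
  "mdual s H M =
     \<lparr>mcarrier = {f. linear_on (mscale M) (*) (mcarrier M) f \<and> (\<forall>v. v \<notin> mcarrier M \<longrightarrow> f v = 0)},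
      mscale = fscale,
      mact = (\<lambda>h f v. if v \<in> mcarrier M
        then hext (hgrade H) (\<lambda>i h. hext (dual_grade M) (\<lambda>j f.
               xsign s i j * f (mact M (antipode H h) v)) f) h
        else 0),
      mgrade = dual_grade M\<rparr>"


section \<open>The group of endotrivial modules\<close>

type_synonym ('k, 'h) umodule = "('k, 'h, nat \<Rightarrow> 'k) gmodule"

definition endotrivial :: "'k::field \<Rightarrow> ('k, 'h::ring_1) hopf \<Rightarrow> ('k, 'h) umodule \<Rightarrow> bool" where
  "endotrivial s H M \<longleftrightarrow>
     gr (alg H) M
     \<and> (\<exists>F :: ('k, 'h) umodule. gr (alg H) F \<and> gfree (alg H) F
          \<and> gmod_iso (alg H) (mtensor s H M (mdual s H M)) (dsum (triv H) F))"

definition free_summand :: "('k::field, 'h::ring_1) hopf \<Rightarrow> ('k, 'h) umodule \<Rightarrow> ('k, 'h) umodule \<Rightarrow> bool" where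
  "free_summand H M N \<longleftrightarrow>
     (\<exists>F :: ('k, 'h) umodule. gr (alg H) F \<and> gfree (alg H) F \<and> gmod_iso (alg H) M (dsum N F))"

text \<open>
  The relation ``\<open>M \<cong> N \<oplus> free\<close> or \<open>N \<cong> M \<oplus> free\<close>'' is reflexive and symmetric but not transitive
  (compare \<open>k \<oplus> H[1]\<close> and \<open>k \<oplus> H[2]\<close>); the equivalence relation it generates is its transitive
  closure.
\<close>

definition stable_equiv :: "'k::field \<Rightarrow> ('k, 'h::ring_1) hopf \<Rightarrow> ('k, 'h) umodule rel" where
  "stable_equiv s H =
     {(M, N). endotrivial s H M \<and> endotrivial s H N \<and> (free_summand H M N \<or> free_summand H N M)}\<^sup>+"

text \<open>
  The union in the product is over all models \<open>P\<close> of \<open>M \<otimes> N\<close> with elements of type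
  \<^typ>\<open>nat \<Rightarrow> 'k\<close>; they all belong to one class.
\<close>

definition endotrivial_group ::
  "'k::field \<Rightarrow> ('k, 'h::ring_1) hopf \<Rightarrow> ('k, 'h) umodule set monoid" where
  "endotrivial_group s H =
     \<lparr>carrier = {M. endotrivial s H M} // stable_equiv s H,
      mult = (\<lambda>X Y. \<Union>M\<in>X. \<Union>N\<in>Y. \<Union>P\<in>{P. gr (alg H) P \<and> gmod_iso (alg H) P (mtensor s H M N)}.
                stable_equiv s H `` {P}),
      one = (\<Union>P\<in>{P. gr (alg H) P \<and> gmod_iso (alg H) P (triv H)}. stable_equiv s H `` {P})\<rparr>"

definition restriction_map ::
  "'k::field \<Rightarrow> ('k, 'h::ring_1) hopf \<Rightarrow> 'h set set \<Rightarrow> ('k, 'h) umodule set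
    \<Rightarrow> ('h set \<Rightarrow> ('k, 'h) umodule set)" where
  "restriction_map s H \<E> = (\<lambda>X. \<lambda>E\<in>\<E>. \<Union>M\<in>X. stable_equiv s (subhopf H E) `` {M})"

end

theory Submission imports Defs
begin

text \<open>
  A finite-dimensional connected Hopf algebra has an integral \<open>Lam\<close> spanning its top degree, and is free over Hopf
  subalgebras; free modules are injective, and linear maps to or from a free module form a free module.
  Hence \<open>M\<close> is endotrivial iff \<open>Hom(M, M)\<close> is \<open>k \<oplus>\<close> free, and if \<open>M\<close>, \<open>N\<close> are endotrivial with equivalent
  restrictions to all \<open>E\<close>, then \<open>L = Hom(N, M)\<close> is \<open>k \<oplus>\<close> free over each \<open>E\<close>. With \<open>z\<close> the integral of \<open>Z\<close>, the
  \<open>H//Z\<close>-module \<open>z L\<close> is then free over each \<open>B\<close>, hence free over \<open>H//Z\<close>, and lifting a basis gives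
  \<open>L = k f \<oplus>\<close> free over \<open>H\<close>; likewise \<open>Hom(M, N) = k f' \<oplus>\<close> free. Comparing socles over one \<open>E\<close> shows that
  \<open>f' f\<close> and \<open>f f'\<close> are nonzero scalars modulo maps divisible by \<open>Lam\<close>, so \<open>f'\<close> induces an isomorphism between
  the summands of \<open>M\<close> and \<open>N\<close> complementary to maximal free ones.
\<close>

subsection \<open>Linear maps on subspaces\<close>

text \<open>\<open>Hom\<close> replaces the tensor product because its elements compose: a degree 0
  generator of the copy of \<open>k\<close> in \<open>Hom(N, M)\<close> is a homomorphism. Detection
  yields one in each direction but says nothing about their composites, and over H nothing else
  compares M with N. Over E there is a comparison, but only through a chain of modules linked by
  adding or removing free summands, since equivalence is a transitive closure. So two properties of
  a pair are carried along the chain: \<open>Hom(N, M)\<close> is \<open>k\<close> plus free, and a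
  homomorphism not divisible by the integral is injective on invariants modulo multiples of the
  integral. The second lets homomorphisms be composed and forces the scalar in \<open>f' f\<close>
  to be nonzero. One E must exist for this; an empty detecting set would make \<open>k\<close> free
  over \<open>H//Z\<close>, hence \<open>Z = H\<close>. Connectedness makes integrals explicit: they
  are the elements of top degree, every nonzero homogeneous element has them among its left
  multiples, and their coefficient is a Frobenius form. In \<open>k\<close> plus free the copy of
  \<open>k\<close> is required to sit in degree 0, which excludes shifts.\<close>

lemma vector_space_fscale:"vector_space (fscale :: 'k::field => ('x => 'k) => _)"
 by unfold_locales (auto simp:fscale_def fun_eq_iff algebra_simps)

lemma module_fscale:"Modules.module (fscale :: 'k::field => ('x => 'k) => _)"
 using vector_space_fscale by(simp add:module_iff_vector_space)

lemma vector_space_times:"vector_space ((*) :: 'k::field => 'k => 'k)"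
 by unfold_locales (auto simp:algebra_simps)

lemma linear_onI:
 assumes "!!x y. x:V==>y:V==>f (x + y) = f x + f y"
  and "!!c x. x:V==>f (sc1 c x) = sc2 c (f x)"
 shows "linear_on sc1 sc2 V f"
 using assms by(auto simp:linear_on_def)

lemma linear_on_add:"linear_on sc1 sc2 V f==>x:V==>y:V==>f (x + y) = f x + f y"
 by(auto simp:linear_on_def)

lemma linear_on_scale:"linear_on sc1 sc2 V f==>x:V==>f (sc1 c x) = sc2 c (f x)"
 by(auto simp:linear_on_def)

lemma linear_on_subset:"linear_on sc1 sc2 V f==>U <= V==>linear_on sc1 sc2 U f"
 by(auto simp:linear_on_def subset_iff)

context vector_space
begin

lemma linear_on_0:"linear_on scale sc2 V f==>subspace V==>f 0 = 0"
 using linear_on_add[of scale sc2 V f 0 0] by(simp add:subspace_0)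

lemma linear_on_minus:"linear_on scale sc2 V f==>subspace V==>x:V==>f (- x) = - f x"
 using linear_on_add[of scale sc2 V f x "- x"] linear_on_0[of sc2 V f]
 by(simp add:subspace_neg eq_neg_iff_add_eq_0 add.commute)

lemma linear_on_diff:
 "linear_on scale sc2 V f==>subspace V==>x:V==>y:V==>f (x - y) = f x - f y"
 using linear_on_add[of scale sc2 V f x "- y"] linear_on_minus[of sc2 V f y]
 by(simp add:subspace_neg)

lemma linear_on_sum:
 assumes "linear_on scale sc2 V f" "subspace V" "!!i. i:I==>g i:V"
 shows "f (SUM i:I. g i) = (SUM i:I. f (g i))"
 using assms(3)
proof (induction I rule: infinite_finite_induct)
 case (insert i I)
 then show ?case
  using linear_on_add[OF assms(1),of "g i" "sum g I"] by(auto intro!:subspace_sum assms(2))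
qed (use linear_on_0[OF assms(1,2)] in auto)

lemma subspace_sum_list:"subspace V==>(!!x. x:set xs==>g x:V)==>(SUM x<-xs. g x):V"
 by(induction xs) (auto intro: subspace_0 subspace_add)

lemma linear_on_sum_list:
 assumes "linear_on scale sc2 V f" "subspace V" "!!x. x:set xs==>g x:V"
 shows "f (SUM x<-xs. g x) = (SUM x<-xs. f (g x))"
 using assms(3)
proof (induction xs)
 case (Cons x xs)
 then show ?case
  using linear_on_add[OF assms(1),of "g x" "SUM x<-xs. g x"]
  by(auto intro!:subspace_sum_list assms(2))
qed (use linear_on_0[OF assms(1,2)] in auto)

lemma scale_sum_list:"scale c (SUM x<-xs. g x) = (SUM x<-xs. scale c (g x))"
 by(induction xs) (auto simp:scale_right_distrib)

lemma linear_on_extend: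
 assumes "vector_space sc2" and P:"subspace P" and f:"linear_on scale sc2 P f"
 obtains g where "linear_on scale sc2 UNIV g" "!!x. x:P==>g x = f x"
proof -
 interpret V2: vector_space sc2 by fact
 interpret vp: vector_space_pair scale sc2 by unfold_locales
 obtain B where B:"B <= P" "independent B" "P <= span B"
  using maximal_independent_subset by blast
 obtain g where g:"Vector_Spaces.linear scale sc2 g" "ALL x:B. g x = f x"
  using vp.linear_independent_extend[OF B(2)] by blast
 interpret g: Vector_Spaces.linear scale sc2 g by fact
 have "x:P & g x = f x" if "x:span B" for x
  using that
 proof (induction rule: span_induct_alt)
  case base
  show ?case using P f by(auto simp:subspace_0 linear_on_0 g.zero)
 next
  case (step c x y)
  then show ?case using B(1) P f g(2)
  by(auto simp:subspace_add subspace_scale g.add g.scale linear_on_add[of scale sc2 P] linear_on_scale[of scale sc2 P])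
 qed
 then show thesis using B(3) that[of g] by(auto simp:linear_on_def g.add g.scale)
qed

lemma functional_separating:
 assumes U:"subspace U" and x:"x ~: U"
 obtains mu where "linear_on scale (*) UNIV mu" "mu x = 1" "!!u. u:U==>mu u = 0"
proof -
 interpret K: vector_space "(*) :: 'a => 'a => 'a" by(rule vector_space_times)
 interpret vp: vector_space_pair scale "(*) :: 'a => 'a => 'a" by unfold_locales
 obtain B where B:"B <= U" "independent B" "U <= span B"
  using maximal_independent_subset by blast
 then have sp:"span B = U" using U by(simp add:span_subspace)
 then have "independent (insert x B)" using x B by(simp add:independent_insertI)
 from vp.linear_independent_extend[OF this,of "%b. if b = x then 1 else 0"]
 obtain g where g:"Vector_Spaces.linear scale (*) g" "ALL b:insert x B. g b = (if b = x then 1 else 0)"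
  by blast
 interpret g: Vector_Spaces.linear scale "(*)" g by fact
 have "!!u. u:U==>g u = 0" unfolding sp[symmetric]
  by(rule g.eq_0_on_span) (use g B x in auto)
 then show thesis using g(2) that[of g] by(auto simp:linear_on_def g.add g.scale)
qed

lemma subspace_complement_projection:
 assumes "subspace P"
 obtains g where "linear_on scale scale UNIV g" "!!x. g x:P" "!!x. x:P==>g x = x"
proof -
 interpret vp: vector_space_pair scale scale by unfold_locales
 obtain B where B:"B <= P" "independent B" "P <= span B"
  using maximal_independent_subset by blast
 then have sp:"span B = P" using assms by(simp add:span_subspace)
 obtain g where g:"Vector_Spaces.linear scale scale g" "ALL x:B. g x = x" "range g = span ((%x. x) ` B)"
  using vp.linear_independent_extend_subspace[OF B(2),of "%x. x"] by blast
 interpret g: Vector_Spaces.linear scale scale g by fact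
 have "g x = x" if "x:P" for x
 proof -
  have "x:span B" using that sp by simp
  then show ?thesis
  by(induction rule: span_induct_alt) (use g(2) in "auto simp:g.zero g.add g.scale")
 qed
 moreover have "g x:P" for x using g(3) sp by auto
 ultimately show thesis using that[of g] by(auto simp:linear_on_def g.add g.scale)
qed

end

subsection \<open>Graded vector spaces\<close>

locale gvs = vector_space sc for sc :: "'k::field => 'v::ab_group_add => 'v" +
 fixes V :: "'v set" and G :: "int => 'v set"
 assumes subV:"subspace V" and graded:"graded_by sc V G"
begin

lemma subG:"subspace (G i)" and G_V:"x:G i==>x:V"
 using graded by(auto simp:graded_by_def)

lemma G0 [simp]: "0:G i"
 by(rule subspace_0[OF subG])

lemma decomposes_hcomp:"v:V==>decomposes G v (hcomp G v)"
 unfolding hcomp_def by(rule theI'[of "decomposes G v"]) (use graded in "simp add:graded_by_def")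

lemma hcomp_unique:"v:V==>decomposes G v c==>hcomp G v = c"
 using graded decomposes_hcomp by(auto simp:graded_by_def)

lemma hcomp_G:"v:V==>hcomp G v i:G i"
 and hcomp_finite:"v:V==>finite {i. hcomp G v i ~= 0}"
 using decomposes_hcomp[of v] unfolding decomposes_def by blast+

lemma hcomp_sum':
 assumes "v:V"
 shows "v = (SUM i | hcomp G v i ~= 0. hcomp G v i)"
 using decomposes_hcomp[OF assms] unfolding decomposes_def by(elim conjE)

lemma hcomp_V:"v:V==>hcomp G v i:V"
 using hcomp_G G_V by blast

lemma hcomp_sum:
 assumes "v:V" "finite D" "!!i. i ~: D==>hcomp G v i = 0"
 shows "v = (SUM i:D. hcomp G v i)"
proof -
 have "v = (SUM i | hcomp G v i ~= 0. hcomp G v i)" by(rule hcomp_sum') fact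
 also have "... = (SUM i:D. hcomp G v i)"
  by(rule sum.mono_neutral_left) (use assms in auto)
 finally show ?thesis .
qed

lemma hcomp_eqI:
 assumes "finite D" "!!i. c i:G i" "!!i. i ~: D==>c i = 0" "v = (SUM i:D. c i)"
 shows "hcomp G v = c"
proof (rule hcomp_unique)
 show "v:V" unfolding assms(4) using assms(2) G_V by(intro subspace_sum subV) blast
 have "(SUM i:D. c i) = (SUM i | c i ~= 0. c i)"
  by(rule sum.mono_neutral_right) (use assms in auto)
 moreover have "finite {i. c i ~= 0}"
  by(rule finite_subset[OF _ assms(1)]) (use assms(3) in auto)
 ultimately show "decomposes G v c" using assms by(auto simp:decomposes_def)
qed

lemma hcomp_homog:"x:G i==>hcomp G x = (%j. if j = i then x else 0)"
 by(rule hcomp_eqI[of "{i}"]) auto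

lemma hcomp_add:
 assumes a:"x:V" "y:V"
 shows "hcomp G (x + y) = (%i. hcomp G x i + hcomp G y i)"
proof -
 define D where "D = {i. hcomp G x i ~= 0} Un {i. hcomp G y i ~= 0}"
 have D:"finite D" using a hcomp_finite unfolding D_def by simp
 have z:"hcomp G x i = 0" "hcomp G y i = 0" if "i ~: D" for i using that by(auto simp:D_def)
 have "x = (SUM i:D. hcomp G x i)" by(rule hcomp_sum[OF a(1) D z(1)])
 moreover have "y = (SUM i:D. hcomp G y i)" by(rule hcomp_sum[OF a(2) D z(2)])
 ultimately have "x + y = (SUM i:D. hcomp G x i) + (SUM i:D. hcomp G y i)" by(rule arg_cong2)
 then have s:"x + y = (SUM i:D. hcomp G x i + hcomp G y i)" by(subst sum.distrib)
 show ?thesis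
  by(rule hcomp_eqI[OF D _ _ s]) (use a z in "auto intro!:subspace_add[OF subG] hcomp_G")
qed

lemma hcomp_scale:
 assumes a:"x:V"
 shows "hcomp G (sc c x) = (%i. sc c (hcomp G x i))"
proof (rule hcomp_eqI)
 show "sc c x = (SUM i | hcomp G x i ~= 0. sc c (hcomp G x i))"
  by(subst (1) hcomp_sum'[OF a]) (rule scale_sum_right)
qed (use a in "auto intro: hcomp_finite subspace_scale[OF subG] hcomp_G")

lemma hcomp_zero [simp]: "hcomp G 0 = (%i. 0)"
 using hcomp_homog[OF G0,of 0] by auto

lemma linear_on_hcomp:"linear_on sc sc V (%v. hcomp G v i)"
 by(rule linear_onI) (auto simp:hcomp_add hcomp_scale)

lemma hcomp_sums:"(!!i. i:I==>f i:V)==>hcomp G (SUM i:I. f i) j = (SUM i:I. hcomp G (f i) j)"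
 by(rule linear_on_sum[OF linear_on_hcomp subV])

lemma V_eqI:"x:V==>y:V==>(!!i. hcomp G x i = hcomp G y i)==>x = y"
proof -
 assume a:"x:V" "y:V" "!!i. hcomp G x i = hcomp G y i"
 have "x = (SUM i | hcomp G x i ~= 0. hcomp G x i)" by(rule hcomp_sum') fact
 also have "... = (SUM i | hcomp G y i ~= 0. hcomp G y i)" using a by simp
 also have "... = y" by(rule hcomp_sum'[symmetric]) fact
 finally show ?thesis .
qed

lemma G_disjoint:"x:G i==>x:G j==>i ~= j==>x = 0"
 using hcomp_homog[of x i] hcomp_homog[of x j] by(metis)

lemma homog_induct [consumes 1,case_names zero add homog]:
 assumes "v:V" "P 0" "!!x y. x:V==>y:V==>P x==>P y==>P (x + y)"
  "!!i x. x:G i==>P x"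
 shows "P v"
proof -
 have "(SUM i:D. hcomp G v i):V & P (SUM i:D. hcomp G v i)" if "finite D" for D
  using that
 proof induction
  case (insert i D)
  have "hcomp G v i:G i" using assms(1) by(rule hcomp_G)
  then show ?case using insert assms(3)[of "hcomp G v i"] assms(4) G_V
  by(auto intro!:subspace_add subV)
 qed (auto simp:assms subspace_0 subV)
 from this[OF hcomp_finite[OF assms(1)]] have "P (SUM i | hcomp G v i ~= 0. hcomp G v i)" by simp
 then show ?thesis by(subst hcomp_sum'[OF assms(1)])
qed

lemma linear_on_eqI:
 assumes "linear_on sc sc2 V f" "linear_on sc sc2 V g" "!!i x. x:G i==>f x = g x" "v:V"
 shows "f v = g v"
 using assms(4)
proof (induction rule: homog_induct)
 case zero
 show ?case using assms linear_on_0[OF _ subV] by simp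
next
 case (add x y)
 then show ?case using assms(1,2) by(simp add:linear_on_add)
qed (rule assms(3))

lemma hext_homog:"x:G i==>F i 0 = 0==>hext G F x = F i x"
 by(cases "x = 0") (auto simp:hext_def hcomp_homog)

lemma hext_sum:
 assumes "finite D" "!!i. i ~: D==>hcomp G v i = 0" "!!i. F i 0 = 0"
 shows "hext G F v = (SUM i:D. F i (hcomp G v i))"
 unfolding hext_def by(rule sum.mono_neutral_left) (use assms in auto)

lemma linear_on_hext:
 assumes "vector_space sc2" "!!i. linear_on sc sc2 (G i) (F i)"
 shows "linear_on sc sc2 V (hext G F)"
proof (rule linear_onI)
 interpret V2: vector_space sc2 by fact
 have F0:"F i 0 = 0" for i using linear_on_0[OF assms(2) subG] .
 fix x y assume a:"x:V" "y:V"
 let ?D = "{i. hcomp G x i ~= 0} Un {i. hcomp G y i ~= 0}"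
 have f:"finite ?D" using a hcomp_finite by auto
 show "hext G F (x + y) = hext G F x + hext G F y"
  using a F0 by(subst (1 2 3) hext_sum[OF f])
  (auto simp:hcomp_add sum.distrib[symmetric] linear_on_add[OF assms(2)] hcomp_G intro!:sum.cong)
next
 interpret V2: vector_space sc2 by fact
 have F0:"F i 0 = 0" for i using linear_on_0[OF assms(2) subG] .
 fix c x assume a:"x:V"
 let ?D = "{i. hcomp G x i ~= 0}"
 have f:"finite ?D" using a hcomp_finite by auto
 show "hext G F (sc c x) = sc2 c (hext G F x)"
  using a F0 by(subst (1 2) hext_sum[OF f])
  (auto simp:hcomp_scale V2.scale_sum_right linear_on_scale[OF assms(2)] hcomp_G intro!:sum.cong)
qed

lemma hext_cong:"v:V==>(!!i x. x:G i==>F i x = F' i x)==>hext G F v = hext G F' v"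
 unfolding hext_def by(auto intro!:sum.cong hcomp_G)

text \<open>Closure under homogeneous components is what makes the intersections
  \<open>G i Int W\<close> a grading of \<open>W\<close>; see \<open>gvs_sub\<close>.\<close>

definition graded_sub :: "'v set => bool" where
 "graded_sub W \<longleftrightarrow> subspace W & W <= V & (ALL w:W. ALL i. hcomp G w i:W)"

lemma graded_sub_V:"graded_sub V"
 by(auto simp:graded_sub_def subV hcomp_V)

lemma gvs_sub:
 assumes "graded_sub W"
 shows "gvs sc W (%i. G i Int W)"
  and "w:W==>hcomp (%i. G i Int W) w = hcomp G w"
proof -
 have sub:"subspace W" and WV:"W <= V" and c:"!!w i. w:W==>hcomp G w i:W"
  using assms by(auto simp:graded_sub_def)
 have *: "decomposes (%i. G i Int W) v d \<longleftrightarrow> d = hcomp G v" if "v:W" for v d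
 proof
  assume "decomposes (%i. G i Int W) v d"
  then have "decomposes G v d" by(auto simp:decomposes_def)
  then show "d = hcomp G v" using hcomp_unique[of v d] that WV by auto
 next
  assume d:"d = hcomp G v"
  have "decomposes G v (hcomp G v)" using decomposes_hcomp that WV by auto
  then show "decomposes (%i. G i Int W) v d" using d c that by(auto simp:decomposes_def)
 qed
 have "graded_by sc W (%i. G i Int W)"
  unfolding graded_by_def using * by(auto intro!:subspace_inter subG sub)
 then show "gvs sc W (%i. G i Int W)"
  by unfold_locales (auto intro: sub)
 show "w:W==>hcomp (%i. G i Int W) w = hcomp G w"
  unfolding hcomp_def[of "%i. G i Int W"] using * by auto
qed

lemma hext_linear_param:
 assumes "vector_space sc2" "vector_space sc3" "!!i x. x:G i==>linear_on sc3 sc2 U (%u. F u i x)" "v:V"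
 shows "linear_on sc3 sc2 U (%u. hext G (F u) v)"
proof (rule linear_onI)
 interpret V2: vector_space sc2 by fact
 fix x y c assume "x:U" "y:U"
 then show "hext G (F (x + y)) v = hext G (F x) v + hext G (F y) v"
  unfolding hext_def
  by(simp add:sum.distrib[symmetric] linear_on_add[OF assms(3)] hcomp_G[OF assms(4)])
next
 interpret V2: vector_space sc2 by fact
 fix x c assume "x:U"
 then show "hext G (F (sc3 c x)) v = sc2 c (hext G (F x) v)"
  unfolding hext_def
  by(simp add:V2.scale_sum_right linear_on_scale[OF assms(3)] hcomp_G[OF assms(4)])
qed

text \<open>A functional separating \<open>x\<close> from \<open>W\<close> is composed with the
  projection onto degree \<open>r\<close>. It still vanishes on \<open>W\<close>, because
  \<open>W\<close> contains the components of its elements.\<close>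

lemma graded_functional:
 assumes W:"graded_sub W" and x:"x:G r" "x ~: W"
 obtains mu where "linear_on sc (*) V mu" "mu x = 1" "!!w. w:W==>mu w = 0"
  "!!i y. y:G i==>i ~= r==>mu y = 0"
proof -
 obtain f where f:"linear_on sc (*) UNIV f" "f x = 1" "!!w. w:W==>f w = 0"
  using functional_separating[of W x] W x by(auto simp:graded_sub_def)
 let ?m = "%v. f (hcomp G v r)"
 show thesis
 proof (rule that[of ?m])
  show "linear_on sc (*) V ?m"
  by(rule linear_onI) (auto simp:hcomp_add hcomp_scale linear_on_add[OF f(1)] linear_on_scale[OF f(1)])
  show "?m x = 1" using x f by(simp add:hcomp_homog)
  show "?m w = 0" if "w:W" for w using that W f by(auto simp:graded_sub_def)
  show "?m y = 0" if "y:G i" "i ~= r" for i y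
  using that linear_on_0[OF f(1)] by(simp add:hcomp_homog)
 qed
qed

lemma graded_subI:
 assumes "subspace W" "!!w. w:W==>w:V" "!!w i. w:W==>hcomp G w i:W"
 shows "graded_sub W"
 using assms by(auto simp:graded_sub_def)

lemma graded_sub_span:
 assumes "S <= (UN i. G i)"
 shows "graded_sub (span S)"
proof (rule graded_subI)
 have SV:"S <= V" using assms G_V by auto
 have "span S <= {w:V. ALL i. hcomp G w i:span S}"
 proof (rule span_minimal)
  show "S <= {w:V. ALL i. hcomp G w i:span S}"
  proof
  fix x assume x:"x:S"
  then obtain j where "x:G j" using assms by auto
  then show "x:{w:V. ALL i. hcomp G w i:span S}"
  using x SV by(auto simp:hcomp_homog span_base span_zero)
  qed
  show "subspace {w:V. ALL i. hcomp G w i:span S}"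
  by(rule subspaceI) (auto simp:hcomp_add hcomp_scale span_zero span_add span_scale
  subspace_0[OF subV] subspace_add[OF subV] subspace_scale[OF subV])
 qed
 then show "w:V" "hcomp G w i:span S" if "w:span S" for w i using that by auto
qed auto

end

locale fgvs = gvs +
 assumes fd:"EX B. finite B & V <= span B"
begin

text \<open>A maximal independent set \<open>C\<close> of homogeneous elements is finite and spans
  all of them, so a degree in which no member of \<open>C\<close> has a component is zero.\<close>

lemma finite_degrees:"finite {i. G i ~= {0}}"
proof -
 obtain B where B:"finite B" "V <= span B" using fd by blast
 obtain C where C:"C <= (UN i. G i)" "independent C" "(UN i. G i) <= span C"
  using maximal_independent_subset by blast
 then have "C <= span B" using G_V B(2) by blast
 then have finC:"finite C" using independent_span_bound[OF B(1) C(2)] by simp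
 have "{i. G i ~= {0}} <= (UN c:C. {i. hcomp G c i ~= 0})"
 proof
  fix i assume "i:{i. G i ~= {0}}"
  then obtain x where x:"x:G i" "x ~= 0" using G0 by blast
  show "i:(UN c:C. {i. hcomp G c i ~= 0})"
  proof (rule ccontr)
  assume "i ~: (UN c:C. {i. hcomp G c i ~= 0})"
  then have z:"hcomp G c i = 0" if "c:C" for c using that by auto
  have CV:"C <= V" using C(1) G_V by auto
  have "span C <= {v:V. hcomp G v i = 0}"
  proof (rule span_minimal)
  show "subspace {v:V. hcomp G v i = 0}"
  by(rule subspaceI) (auto simp:hcomp_add hcomp_scale
  subspace_0[OF subV] subspace_add[OF subV] subspace_scale[OF subV])
  qed (use z CV in auto)
  then have "hcomp G x i = 0" using x C(3) by auto
  then show False using x by(simp add:hcomp_homog)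
  qed
 qed
 moreover have "finite (UN c:C. {i. hcomp G c i ~= 0})"
  using finC C(1) G_V by(auto intro!:hcomp_finite)
 ultimately show ?thesis by(rule finite_subset)
qed

lemma independent_finite:"independent B==>B <= V==>finite B"
 using fd independent_span_bound by(metis order_trans)

lemma fgvs_sub:
 assumes "graded_sub W"
 shows "fgvs sc W (%i. G i Int W)"
proof -
 interpret W: gvs sc W "%i. G i Int W" by(rule gvs_sub[OF assms])
 show ?thesis by unfold_locales (use fd assms in "auto simp:graded_sub_def")
qed

text \<open>\<open>B\<close> may consist of inhomogeneous elements: it only has to span the graded
  subspace \<open>W\<close>. The added vectors are homogeneous, as \<open>free_over_sub\<close>
  requires for \<open>W = aug_right\<close>.\<close>

lemma homog_basis_extend:
 assumes "graded_sub W" "S <= (UN i. G i)" "B <= W" "W <= span B" "independent (B Un S)" "B Int S = {}"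
 obtains X where "finite X" "S <= X" "X <= (UN i. G i)" "V = span (B Un X)" "independent (B Un X)" "B Int X = {}"
proof -
 obtain C where C:"B Un S <= C" "C <= B Un (UN i. G i)" "independent C" "B Un (UN i. G i) <= span C"
  using maximal_independent_subset_extend[of "B Un S" "B Un (UN i. G i)"] assms(2,5) by blast
 have WV:"W <= V" using assms(1) by(simp add:graded_sub_def)
 have CV:"C <= V" using C(2) assms(3) WV G_V by blast
 have BC:"B Un (C - B) = C" using C(1) by auto
 have "V <= span C"
 proof
  fix v assume "v:V"
  then show "v:span C"
  by(induction rule: homog_induct) (use C(4) in "auto simp:span_zero span_add")
 qed
 then have "V = span C" using CV span_minimal[OF CV subV] by auto
 moreover have "S <= C - B" "C - B <= (UN i. G i)" using C(1,2) assms(6) by blast+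
 ultimately show thesis
  using that[of "C - B"] C(3) BC independent_finite[OF C(3) CV] by simp
qed

end

subsection \<open>Tensor products\<close>

definition bilinear_on :: "('k::field => 'v::ab_group_add => 'v) => ('k => 'w::ab_group_add => 'w)
  => ('k => 'u::ab_group_add => 'u) => 'v set => 'w set => ('v => 'w => 'u) => bool" where
 "bilinear_on sc1 sc2 scu V W F \<longleftrightarrow>
  (ALL v:V. linear_on sc2 scu W (F v)) & (ALL w:W. linear_on sc1 scu V (%v. F v w))"

lemma bilinear_onI:
 assumes "!!v v' w. v:V==>v':V==>w:W==>F (v + v') w = F v w + F v' w"
  "!!v w w'. v:V==>w:W==>w':W==>F v (w + w') = F v w + F v w'"
  "!!c v w. v:V==>w:W==>F (sc1 c v) w = scu c (F v w)"
  "!!c v w. v:V==>w:W==>F v (sc2 c w) = scu c (F v w)"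
 shows "bilinear_on sc1 sc2 scu V W F"
 using assms by(auto simp:bilinear_on_def linear_on_def)

lemma bilinear_onD:
 assumes "bilinear_on sc1 sc2 scu V W F" "v:V" "w:W"
 shows "v':V==>F (v + v') w = F v w + F v' w"
  "w':W==>F v (w + w') = F v w + F v w'"
  "F (sc1 c v) w = scu c (F v w)" "F v (sc2 c w) = scu c (F v w)"
 using assms by(auto simp:bilinear_on_def linear_on_def)

lemma bilinear_on_subset:
 "bilinear_on sc1 sc2 scu V W F==>V' <= V==>W' <= W==>bilinear_on sc1 sc2 scu V' W' F"
 by(auto simp:bilinear_on_def linear_on_def subset_iff)

lemma tens_add_left:"tens sc1 sc2 (v + v') w = tens sc1 sc2 v w + tens sc1 sc2 v' w"
 and tens_add_right:"tens sc1 sc2 v (w + w') = tens sc1 sc2 v w + tens sc1 sc2 v w'"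
 and tens_scale_left:"tens sc1 sc2 (sc1 c v) w = fscale c (tens sc1 sc2 v w)"
 and tens_scale_right:"tens sc1 sc2 v (sc2 c w) = fscale c (tens sc1 sc2 v w)"
 by(auto simp:tens_def fun_eq_iff fscale_def bilinear_form_def linear_on_def)

lemma sum_list_apply:"(SUM x<-xs. f x) y = (SUM x<-xs. f x y)"
 by(induction xs) auto

text \<open>This is what makes \<open>tlift\<close> well defined. Two distinct values would be
  separated by a functional \<open>mu\<close>; composing \<open>mu\<close> and \<open>F\<close> with
  projections onto \<open>V\<close> and \<open>W\<close> gives a bilinear form on the ambient
  spaces, where equal tensors must agree.\<close>

lemma tensor_sum_eq:
 assumes vs:"vector_space sc1" "vector_space sc2" "vector_space scu"
  and V:"Modules.module.subspace sc1 V" and W:"Modules.module.subspace sc2 W"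
  and F:"bilinear_on sc1 sc2 scu V W F"
  and xs:"set xs <= V \<times> W" and ys:"set ys <= V \<times> W"
  and eq:"(SUM (v,w)<-xs. tens sc1 sc2 v w) = (SUM (v,w)<-ys. tens sc1 sc2 v w)"
 shows "(SUM (v,w)<-xs. F v w) = (SUM (v,w)<-ys. F v w)"
proof (rule ccontr)
 interpret V1: vector_space sc1 by fact
 interpret V2: vector_space sc2 by fact
 interpret U: vector_space scu by fact
 let ?d = "(SUM (v,w)<-xs. F v w) - (SUM (v,w)<-ys. F v w)"
 assume "(SUM (v,w)<-xs. F v w) ~= (SUM (v,w)<-ys. F v w)"
 then have "?d ~: {0}" by simp
 then obtain mu where mu:"linear_on scu (*) UNIV mu" "mu ?d = 1"
  using U.functional_separating[of "{0}" ?d] by auto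
 obtain p where p:"linear_on sc1 sc1 UNIV p" "!!x. p x:V" "!!x. x:V==>p x = x"
  using V1.subspace_complement_projection[OF V] by blast
 obtain q where q:"linear_on sc2 sc2 UNIV q" "!!x. q x:W" "!!x. x:W==>q x = x"
  using V2.subspace_complement_projection[OF W] by blast
 let ?b = "%v w. mu (F (p v) (q w))"
 have b:"bilinear_form sc1 sc2 ?b"
  using p q by(auto simp:bilinear_form_def linear_on_def bilinear_onD[OF F] linear_on_add[OF mu(1)]
  linear_on_scale[OF mu(1)])
 have ev:"(SUM (v,w)<-zs. tens sc1 sc2 v w) ?b = mu (SUM (v,w)<-zs. F v w)" if "set zs <= V \<times> W" for zs
  using that
 proof (induction zs)
  case Nil
  then show ?case using U.linear_on_0[OF mu(1)] by simp
 next
  case (Cons z zs)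
  then show ?case using b by(auto simp:tens_def p q linear_on_add[OF mu(1)])
 qed
 have "mu ?d = 0" using ev[OF xs] ev[OF ys] eq U.linear_on_diff[OF mu(1)] by simp
 then show False using mu by simp
qed

lemma tlift_eval:
 assumes vs:"vector_space sc1" "vector_space sc2" "vector_space scu"
  and V:"Modules.module.subspace sc1 V" and W:"Modules.module.subspace sc2 W"
  and F:"bilinear_on sc1 sc2 scu V W F" and xs:"set xs <= V \<times> W"
 shows "tlift sc1 sc2 V W F (SUM (v,w)<-xs. tens sc1 sc2 v w) = (SUM (v,w)<-xs. F v w)"
 unfolding tlift_def
proof (rule the_equality)
 show "EX xs'. set xs' <= V \<times> W & (SUM (v,w)<-xs. tens sc1 sc2 v w) = (SUM (v,w)<-xs'. tens sc1 sc2 v w)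
  & (SUM (v,w)<-xs. F v w) = (SUM (v,w)<-xs'. F v w)"
  using xs by blast
 fix u
 assume "EX xs'. set xs' <= V \<times> W & (SUM (v,w)<-xs. tens sc1 sc2 v w) = (SUM (v,w)<-xs'. tens sc1 sc2 v w)
  & u = (SUM (v,w)<-xs'. F v w)"
 then show "u = (SUM (v,w)<-xs. F v w)"
  by(elim exE conjE) (simp only: tensor_sum_eq[OF vs V W F xs])
qed

lemma tlift_cong:
 assumes "!!v w. v:V==>w:W==>F v w = F' v w"
 shows "tlift sc1 sc2 V W F t = tlift sc1 sc2 V W F' t"
proof -
 have "(SUM (v,w)<-xs. F v w) = (SUM (v,w)<-xs. F' v w)" if "set xs <= V \<times> W" for xs
  using that assms by(intro arg_cong[of _ _ sum_list] map_cong) auto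
 then have "(EX xs. set xs <= V \<times> W & t = (SUM (v,w)<-xs. tens sc1 sc2 v w) & u = (SUM (v,w)<-xs. F v w))
  = (EX xs. set xs <= V \<times> W & t = (SUM (v,w)<-xs. tens sc1 sc2 v w) & u = (SUM (v,w)<-xs. F' v w))" for u
  by(intro ex_cong1 conj_cong) auto
 then show ?thesis unfolding tlift_def by(simp only:)
qed

text \<open>A scalar can be absorbed into the left factor of a pure tensor, so linear combinations
  become plain sums, the form in which \<open>tlift\<close> is evaluated.\<close>

lemma span_fscale_pure:
 fixes sc1 :: "'k::field => 'v::ab_group_add => 'v" and sc2 :: "'k => 'w::ab_group_add => 'w"
 assumes T:"!!v w c. (v,w):T==>(sc1 c v,w):T"
  and t:"t:Modules.module.span fscale {tens sc1 sc2 v w | v w. (v,w):T}"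
 shows "EX xs. set xs <= T & t = (SUM (v,w)<-xs. tens sc1 sc2 v w)"
proof -
 interpret T: vector_space "fscale :: 'k => ('k,'v,'w) tensor => _" by(rule vector_space_fscale)
 show ?thesis using t
 proof (induction rule: T.span_induct_alt)
  case base
  show ?case by(rule exI[of _ "[]"]) simp
 next
  case (step c x y)
  then obtain v w xs where "x = tens sc1 sc2 v w" "(v,w):T" "set xs <= T"
  "y = (SUM (v,w)<-xs. tens sc1 sc2 v w)" by blast
  then show ?case
  by(intro exI[of _ "(sc1 c v,w) # xs"]) (auto simp:T tens_scale_left[symmetric])
 qed
qed

lemma tprod_rep:
 assumes "vector_space sc1" "Modules.module.subspace sc1 V" "t:tprod sc1 sc2 V W"
 shows "EX xs. set xs <= V \<times> W & t = (SUM (v,w)<-xs. tens sc1 sc2 v w)"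
proof -
 interpret V1: vector_space sc1 by fact
 show ?thesis
  by(rule span_fscale_pure) (use assms V1.subspace_scale in "auto simp:tprod_def")
qed

lemma tgrade_rep:
 assumes "vector_space sc1" "!!i. Modules.module.subspace sc1 (G1 i)" "t:tgrade sc1 sc2 G1 G2 n"
 shows "EX xs. (ALL (i,v,w):set xs. v:G1 i & w:G2 (n - i)) & t = (SUM (i,v,w)<-xs. tens sc1 sc2 v w)"
proof -
 interpret V1: vector_space sc1 by fact
 let ?T = "{(v,w). EX i. v:G1 i & w:G2 (n - i)}"
 have "EX xs. set xs <= ?T & t = (SUM (v,w)<-xs. tens sc1 sc2 v w)"
  by(rule span_fscale_pure) (use assms(2,3) V1.subspace_scale in "(fastforce simp:tgrade_def)+")
 then obtain xs where xs:"set xs <= ?T" "t = (SUM (v,w)<-xs. tens sc1 sc2 v w)" by blast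
 \<comment> \<open>The degree has to be chosen, since the zero vector lies in every degree.\<close>
 let ?f = "%(v,w). (SOME i. v:G1 i & w:G2 (n - i),v,w)"
 show ?thesis
 proof (intro exI[of _ "map ?f xs"] conjI ballI)
  fix z assume "z:set (map ?f xs)"
  then obtain v w where "(v,w):set xs" "z = ?f (v,w)" by auto
  moreover from this have "EX i. v:G1 i & w:G2 (n - i)" using xs(1) by auto
  from someI_ex[OF this] have "v:G1 (SOME i. v:G1 i & w:G2 (n - i))
  & w:G2 (n - (SOME i. v:G1 i & w:G2 (n - i)))" .
  ultimately show "case z of (i,v,w) => v:G1 i & w:G2 (n - i)" by simp
 qed (simp add:xs(2) case_prod_unfold o_def)
qed

lemma tens_in_tprod:"v:V==>w:W==>tens sc1 sc2 v w:tprod sc1 sc2 V W"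
 unfolding tprod_def
 by(rule module.span_base[OF module_fscale]) auto

lemma tens_in_tgrade:"v:G1 i==>w:G2 (n - i)==>tens sc1 sc2 v w:tgrade sc1 sc2 G1 G2 n"
 unfolding tgrade_def
 by(rule module.span_base[OF module_fscale]) auto

lemma subspace_tprod:"Modules.module.subspace fscale (tprod sc1 sc2 V W)"
 and subspace_tgrade:"Modules.module.subspace fscale (tgrade sc1 sc2 G1 G2 n)"
 unfolding tprod_def tgrade_def by(rule module.subspace_span[OF module_fscale])+

subsection \<open>Coproducts in graded Hopf algebras\<close>

lemma xsign_commute:"xsign s i j = xsign s j i"
 by(auto simp:xsign_def)

lemma xsign_0 [simp]: "xsign s 0 j = 1" "xsign s j 0 = 1"
 by(auto simp:xsign_def)

lemma sum_list_zero2:"(!!i a b. (i,a,b):set xs==>F i a b = 0)==>(SUM (i,a,b)<-xs. F i a b) = 0"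
 by(induction xs) auto

locale hopf =
 fixes s :: "'k::field" and H :: "('k,'h::ring_1) hopf"
 assumes sign:"s = 1 | s = -1" and hopf:"hopf_algebra s H"
begin

lemma ss [simp]: "s * s = 1"
 using sign by auto

lemma xsign_square [simp]: "xsign s i j * xsign s i j = 1"
 by(simp add:xsign_def)

lemma xsign_add:"xsign s i (j + k) = xsign s i j * xsign s i k"
 "xsign s (j + k) i = xsign s j i * xsign s k i"
 by(auto simp:xsign_def)

lemma xsign_diff:"xsign s i (j - k) = xsign s i j * xsign s i k"
 "xsign s (j - k) i = xsign s j i * xsign s k i"
 by(auto simp:xsign_def)

abbreviation "hc == hcarrier H"
abbreviation "hs == hscale H"
abbreviation "hg == hgrade H"
abbreviation "eps == counit H"
abbreviation "S == antipode H"
abbreviation "T == hh_tens H"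

lemma alg_part:"graded_algebra_part H" and coalg_part:"graded_coalgebra_part H"
 using hopf by(auto simp:hopf_algebra_def)

sublocale h: fgvs hs hc hg
proof -
 interpret vector_space hs using alg_part by(simp add:graded_algebra_part_def)
 show "fgvs hs hc hg"
  using alg_part by unfold_locales (auto simp:graded_algebra_part_def)
qed

lemma one_hc [simp]: "1:hc"
 and mult_hc [simp]: "x:hc==>y:hc==>x * y:hc"
 and scale_mult_left:"x:hc==>y:hc==>hs c x * y = hs c (x * y)"
 and scale_mult_right:"x:hc==>y:hc==>x * hs c y = hs c (x * y)"
 and mult_hg:"x:hg i==>y:hg j==>x * y:hg (i + j)"
 and hg_neg:"i < 0==>hg i = {0}"
 and hg_0:"hg 0 = range (%c. hs c 1)"
 using alg_part unfolding graded_algebra_part_def by metis+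

lemma hg_hc:"x:hg i==>x:hc"
 by(rule h.G_V)

lemma hc_add [simp]: "x:hc==>y:hc==>x + y:hc"
 and hc_scale [simp]: "x:hc==>hs c x:hc"
 and hc_0 [simp]: "0:hc"
 and hc_uminus [simp]: "x:hc==>- x:hc"
 and hc_diff [simp]: "x:hc==>y:hc==>x - y:hc"
 by(auto intro: h.subspace_add h.subspace_scale h.subspace_0 h.subspace_neg h.subspace_diff h.subV)

lemma one_hg [simp]: "1:hg 0"
 using hg_0 by(metis h.scale_one rangeI)

lemma hg_nonneg:"x:hg i==>x ~= 0==>0 <= i"
 using hg_neg[of i] by(cases "i < 0") auto

lemma coprod_linear:"linear_on hs fscale hc (coprod H)"
 and coprod_tgrade:"x:hg i==>coprod H x:tgrade hs hs hg hg i"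
 and coprod_tprod:"x:hc==>coprod H x:tprod hs hs hc hc"
 and counit_linear:"linear_on hs (*) hc eps"
 and counit_hg:"x:hg i==>i ~= 0==>eps x = 0"
 and counit_left:"x:hc==>sweedler H (%a b. hs (eps a) b) x = x"
 and counit_right:"x:hc==>sweedler H (%a b. hs (eps b) a) x = x"
 using coalg_part by(auto simp:graded_coalgebra_part_def)

lemma coassoc:"x:hc ==>
  sweedler H (%a b. sweedler H (%a' a''. tens hs fscale a' (T a'' b)) a) x
  = sweedler H (%a b. tens hs fscale a (coprod H b)) x"
 using coalg_part by(auto simp:graded_coalgebra_part_def)

lemma counit_1 [simp]: "eps 1 = 1"
 and counit_mult:"x:hc==>y:hc==>eps (x * y) = eps x * eps y"
 and coprod_1:"coprod H 1 = T 1 1"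
 and S_linear:"linear_on hs hs hc S"
 and S_hc [simp]: "x:hc==>S x:hc"
 and S_hg:"x:hg i==>S x:hg i"
 and S_left:"x:hc==>sweedler H (%a b. S a * b) x = hs (eps x) 1"
 and S_right:"x:hc==>sweedler H (%a b. a * S b) x = hs (eps x) 1"
 using hopf by(auto simp:hopf_algebra_def)

lemma coprod_mult:"x:hc==>y:hc==>coprod H (x * y) =
 sweedler H (%a b. sweedler H (%c d. hext hg (%i b. hext hg (%j c.
  fscale (xsign s i j) (T (a * c) (b * d))) c) b) y) x"
 using hopf by(auto simp:hopf_algebra_def)

lemma cocomm:"x:hc ==>
 sweedler H (%a b. hext hg (%i a. hext hg (%j b. fscale (xsign s i j) (T b a)) b) a) x = coprod H x"
 using hopf by(auto simp:hopf_algebra_def)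

lemma one_neq_0:"(1::'h) ~= 0"
 using counit_1 h.linear_on_0[OF counit_linear h.subV] by auto

lemma counit_0 [simp]: "eps 0 = 0"
 by(rule h.linear_on_0[OF counit_linear h.subV])

lemma S_0 [simp]: "S 0 = 0"
 by(rule h.linear_on_0[OF S_linear h.subV])

lemma coprod_0:"coprod H 0 = 0"
 by(rule h.linear_on_0[OF coprod_linear h.subV])

lemma hg_0_counit:"x:hg 0==>x = hs (eps x) 1"
 using linear_on_scale[OF counit_linear one_hc] by(auto simp:hg_0)

lemma sweedler_list:
 assumes "vector_space scu" "bilinear_on hs hs scu hc hc F" "set xs <= hc \<times> hc"
  "coprod H x = (SUM (a,b)<-xs. T a b)"
 shows "sweedler H F x = (SUM (a,b)<-xs. F a b)"
 unfolding sweedler_def assms(4)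
 by(rule tlift_eval[OF h.vector_space_axioms h.vector_space_axioms assms(1) h.subV h.subV assms(2,3)])

lemma sweedler_cong:
 "(!!a b. a:hc==>b:hc==>F a b = F' a b)==>sweedler H F x = sweedler H F' x"
 unfolding sweedler_def by(rule tlift_cong)

lemma coprod_list:
 assumes "x:hc"
 obtains xs where "set xs <= hc \<times> hc" "coprod H x = (SUM (a,b)<-xs. T a b)"
 using tprod_rep[OF h.vector_space_axioms h.subV coprod_tprod[OF assms]] by blast

text \<open>A list representing the coproduct of a homogeneous element records the degree of the first
  tensor factor.\<close>

definition rep :: "int => 'h => (int \<times> 'h \<times> 'h) list => bool" where
 "rep n x xs \<longleftrightarrow> (ALL (i,a,b):set xs. a:hg i & b:hg (n - i))
  & coprod H x = (SUM (i,a,b)<-xs. T a b)"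

lemma rep_ex:"x:hg n==>EX xs. rep n x xs"
 unfolding rep_def using tgrade_rep[OF h.vector_space_axioms h.subG coprod_tgrade] by blast

lemma rep_mem:"rep n x xs==>(i,a,b):set xs==>a:hg i & b:hg (n - i)"
 by(auto simp:rep_def)

lemma rep_mem_hc:"rep n x xs==>(i,a,b):set xs==>a:hc & b:hc"
 using rep_mem hg_hc by blast

lemma rep_eval:
 assumes "rep n x xs" "vector_space scu" "bilinear_on hs hs scu hc hc F"
 shows "sweedler H F x = (SUM (i,a,b)<-xs. F a b)"
proof -
 have "set (map snd xs) <= hc \<times> hc" using rep_mem_hc[OF assms(1)] by auto
 moreover have "coprod H x = (SUM (a,b)<-map snd xs. T a b)"
  using assms(1) by(simp add:rep_def case_prod_unfold o_def)
 ultimately have "sweedler H F x = (SUM (a,b)<-map snd xs. F a b)"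
  by(rule sweedler_list[OF assms(2,3)])
 then show ?thesis by(simp add:case_prod_unfold o_def)
qed

lemma rep_zero:"rep n 0 []"
 by(simp add:rep_def coprod_0)

lemma sum_list_split:
 "(SUM x<-xs. f x) = (SUM x<-filter P xs. f x) + (SUM x<-filter (%x. ~ P x) xs. (f x :: 'u::comm_monoid_add))"
 by(induction xs) (auto simp:algebra_simps)

lemma T_0 [simp]: "T 0 b = 0" "T a 0 = 0"
 using tens_scale_left[of hs hs 0 0 b] tens_scale_right[of hs hs a 0 0]
 by(auto simp:fscale_def fun_eq_iff)

lemma T_sum_left:"(SUM x<-xs. T (f x) y) = T (SUM x<-xs. f x) y"
 by(induction xs) (simp_all add:tens_add_left)

lemma T_sum_right:"(SUM x<-xs. T y (f x)) = T y (SUM x<-xs. f x)"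
 by(induction xs) (simp_all add:tens_add_right)

lemma bilinear_counit:"bilinear_on hs hs hs hc hc (%a b. hs (eps b) a)"
 "bilinear_on hs hs hs hc hc (%a b. hs (eps a) b)"
 by(auto intro!:bilinear_onI simp:h.scale_right_distrib h.scale_left_distrib
  linear_on_add[OF counit_linear] linear_on_scale[OF counit_linear] mult_ac)

text \<open>The coproduct of \<open>x\<close> is \<open>x \<otimes> 1\<close> plus terms whose
  second factor has positive degree. Connectedness makes a second factor of degree 0 a scalar, which
  moves to the left, and the counit identifies the collected left factor as
  \<open>x\<close>.\<close>

lemma rep_right:
 assumes "x:hg n" "rep n x xs"
 shows "rep n x ((n,x,1) # filter (%(i,a,b). 0 <= i & i < n) xs)"
proof -
 let ?P = "%(i,a,b). 0 <= i & i < n"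
 have z:"hs (eps b) a = 0" if "(i,a,b):set xs" "i < n" for i a b
  using rep_mem[OF assms(2) that(1)] that(2) counit_hg by auto
 have one:"T a b = T (hs (eps b) a) 1" if "(i,a,b):set xs" "~ (0 <= i & i < n)" for i a b
 proof -
  consider "i < 0" | "i > n" | "i = n" using \<open>~ (0 <= i & i < n)\<close> by linarith
  then show ?thesis
  proof cases
  case 3
  then have "b:hg 0" using rep_mem[OF assms(2) that(1)] by simp
  then have "b = hs (eps b) 1" by(rule hg_0_counit)
  then have "T a b = fscale (eps b) (T a 1)" by(metis tens_scale_right)
  then show ?thesis by(simp add:tens_scale_left)
  qed (use rep_mem[OF assms(2) that(1)] hg_neg in "auto")
 qed
 have "x = (SUM (i,a,b)<-xs. hs (eps b) a)"
  using counit_right[OF hg_hc[OF assms(1)]] rep_eval[OF assms(2) h.vector_space_axioms bilinear_counit(1)]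
  by simp
 also have "... = (SUM (i,a,b)<-filter (%x. ~ ?P x) xs. hs (eps b) a)"
 proof -
  have "(SUM (i,a,b)<-filter ?P xs. hs (eps b) a) = 0"
  using z by(intro sum_list_zero2) auto
  then show ?thesis by(subst sum_list_split[of _ xs ?P]) simp
 qed
 finally have x:"x = (SUM (i,a,b)<-filter (%x. ~ ?P x) xs. hs (eps b) a)" .
 have "coprod H x = (SUM (i,a,b)<-xs. T a b)" using assms(2) by(simp add:rep_def)
 also have "... = (SUM (i,a,b)<-filter ?P xs. T a b) + (SUM (i,a,b)<-filter (%x. ~ ?P x) xs. T a b)"
  by(rule sum_list_split)
 also have "(SUM (i,a,b)<-filter (%x. ~ ?P x) xs. T a b)
  = (SUM (i,a,b)<-filter (%x. ~ ?P x) xs. T (hs (eps b) a) 1)"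
  using one by(intro arg_cong[of _ _ sum_list] map_cong) auto
 also have "... = T x 1"
  by(subst x) (simp add:case_prod_unfold T_sum_left)
 finally show ?thesis
  using assms(1) rep_mem[OF assms(2)] by(auto simp:rep_def add.commute)
qed

text \<open>Mirror image of \<open>rep_right\<close>: the leading term is
  \<open>1 \<otimes> x\<close>, and the first factors in the rest have positive degree.\<close>

lemma rep_left:
 assumes "x:hg n" "rep n x xs"
 shows "rep n x ((0,1,x) # filter (%(i,a,b). 0 < i & i <= n) xs)"
proof -
 let ?P = "%(i,a,b). 0 < i & i <= n"
 have z:"hs (eps a) b = 0" if "(i,a,b):set xs" "0 < i" for i a b
  using rep_mem[OF assms(2) that(1)] that(2) counit_hg[of a i] by auto
 have one:"T a b = T 1 (hs (eps a) b)" if "(i,a,b):set xs" "~ (0 < i & i <= n)" for i a b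
 proof -
  consider "i < 0" | "i > n" | "i = 0" using \<open>~ (0 < i & i <= n)\<close> by linarith
  then show ?thesis
  proof cases
  case 3
  then have "a:hg 0" using rep_mem[OF assms(2) that(1)] by simp
  then have "a = hs (eps a) 1" by(rule hg_0_counit)
  then have "T a b = fscale (eps a) (T 1 b)" by(metis tens_scale_left)
  then show ?thesis by(simp add:tens_scale_right)
  qed (use rep_mem[OF assms(2) that(1)] hg_neg in "auto")
 qed
 have "x = (SUM (i,a,b)<-xs. hs (eps a) b)"
  using counit_left[OF hg_hc[OF assms(1)]] rep_eval[OF assms(2) h.vector_space_axioms bilinear_counit(2)]
  by simp
 also have "... = (SUM (i,a,b)<-filter (%x. ~ ?P x) xs. hs (eps a) b)"
 proof -
  have "(SUM (i,a,b)<-filter ?P xs. hs (eps a) b) = 0"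
  using z by(intro sum_list_zero2) auto
  then show ?thesis by(subst sum_list_split[of _ xs ?P]) simp
 qed
 finally have x:"x = (SUM (i,a,b)<-filter (%x. ~ ?P x) xs. hs (eps a) b)" .
 have "coprod H x = (SUM (i,a,b)<-xs. T a b)" using assms(2) by(simp add:rep_def)
 also have "... = (SUM (i,a,b)<-filter ?P xs. T a b) + (SUM (i,a,b)<-filter (%x. ~ ?P x) xs. T a b)"
  by(rule sum_list_split)
 also have "(SUM (i,a,b)<-filter (%x. ~ ?P x) xs. T a b)
  = (SUM (i,a,b)<-filter (%x. ~ ?P x) xs. T 1 (hs (eps a) b))"
  using one by(intro arg_cong[of _ _ sum_list] map_cong) auto
 also have "... = T 1 x"
  by(subst x) (simp add:case_prod_unfold T_sum_right)
 finally show ?thesis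
  using assms(1) rep_mem[OF assms(2)] by(auto simp:rep_def add.commute)
qed

lemma sweedler_linear:
 assumes "vector_space scu" "bilinear_on hs hs scu hc hc F"
 shows "linear_on hs scu hc (sweedler H F)"
proof (rule linear_onI)
 interpret U: vector_space scu by fact
 fix x y assume a:"x:hc" "y:hc"
 obtain xs where xs:"set xs <= hc \<times> hc" "coprod H x = (SUM (a,b)<-xs. T a b)" using coprod_list[OF a(1)] .
 obtain ys where ys:"set ys <= hc \<times> hc" "coprod H y = (SUM (a,b)<-ys. T a b)" using coprod_list[OF a(2)] .
 have "sweedler H F (x + y) = (SUM (a,b)<-xs @ ys. F a b)"
  by(rule sweedler_list[OF assms]) (use xs ys a in "auto simp:linear_on_add[OF coprod_linear]")
 then show "sweedler H F (x + y) = sweedler H F x + sweedler H F y"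
  using sweedler_list[OF assms xs] sweedler_list[OF assms ys] by simp
next
 interpret U: vector_space scu by fact
 fix c x assume a:"x:hc"
 obtain xs where xs:"set xs <= hc \<times> hc" "coprod H x = (SUM (a,b)<-xs. T a b)" using coprod_list[OF a] .
 have 1:"(SUM (a,b)<-map (%(a,b). (hs c a,b)) zs. F a b) = scu c (SUM (a,b)<-zs. F a b)"
  if "set zs <= hc \<times> hc" for zs
  using that by(induction zs) (auto simp:U.scale_right_distrib bilinear_onD[OF assms(2)])
 have 2:"(SUM (a,b)<-map (%(a,b). (hs c a,b)) zs. T a b) = fscale c (SUM (a,b)<-zs. T a b)" for zs
  by(induction zs) (auto simp:tens_scale_left fscale_def fun_eq_iff algebra_simps)
 have "sweedler H F (hs c x) = (SUM (a,b)<-map (%(a,b). (hs c a,b)) xs. F a b)"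
  by(rule sweedler_list[OF assms])
  (use xs a 2[of xs] in "auto simp:linear_on_scale[OF coprod_linear]")
 then show "sweedler H F (hs c x) = scu c (sweedler H F x)"
  using 1[OF xs(1)] sweedler_list[OF assms xs] by simp
qed

lemma bilinear_mult:"bilinear_on hs hs hs hc hc (%a b. f a * g b)"
 if "linear_on hs hs hc f" "linear_on hs hs hc g" "!!x. x:hc==>f x:hc" "!!x. x:hc==>g x:hc"
 using that by(auto intro!:bilinear_onI simp:linear_on_def distrib_left distrib_right
  scale_mult_left scale_mult_right)

lemma linear_id:"linear_on hs hs hc (%x. x)"
 by(auto simp:linear_on_def)

text \<open>\<open>braid a b c d\<close> is \<open>\<plusminus> a c \<otimes> b d\<close>, where \<open>b\<close> and \<open>c\<close> are interchanged.\<close>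

definition braid :: "'h => 'h => 'h => 'h => ('k,'h,'h) tensor" where
 "braid a b c d = hext hg (%i b. hext hg (%j c. fscale (xsign s i j) (T (a * c) (b * d))) c) b"

definition degs :: "int set" where
 "degs = {i. hg i ~= {0}}"

lemma finite_degs:"finite degs"
 unfolding degs_def by(rule h.finite_degrees)

lemma hcomp_degs:"v:hc==>i ~: degs==>hcomp hg v i = 0"
 using h.hcomp_G[of v i] by(auto simp:degs_def)

lemma fscale_0 [simp]: "fscale c 0 = 0"
 by(auto simp:fscale_def)

text \<open>Summing over the fixed finite set \<open>degs\<close> instead of the support of each
  argument reduces bilinearity to termwise linearity.\<close>

lemma braid_eq:
 assumes "a:hc" "b:hc" "c:hc" "d:hc"
 shows "braid a b c d = (SUM i:degs. SUM j:degs.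
  fscale (xsign s i j) (T (a * hcomp hg c j) (hcomp hg b i * d)))"
 unfolding braid_def
 by(subst h.hext_sum[OF finite_degs],use assms in "auto simp:hcomp_degs hext_def")
  (rule sum.cong[OF refl],subst h.hext_sum[OF finite_degs,unfolded hext_def],auto simp:hcomp_degs)

lemma braid_homog:
 "b:hg i==>c:hg j==>braid a b c d = fscale (xsign s i j) (T (a * c) (b * d))"
 unfolding braid_def by(subst h.hext_homog,assumption,simp add:hext_def)
  (subst h.hext_homog,assumption,simp_all)

lemma braid_bilinear_cd:
 assumes "a:hc" "b:hc"
 shows "bilinear_on hs hs fscale hc hc (braid a b)"
proof -
 interpret F: vector_space "fscale :: 'k => ('k,'h,'h) tensor => _" by(rule vector_space_fscale)
 show ?thesis
  using assms h.hcomp_V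
  by(auto intro!:bilinear_onI simp:braid_eq h.hcomp_add h.hcomp_scale distrib_left scale_mult_right
  tens_add_left tens_add_right tens_scale_left tens_scale_right F.scale_right_distrib
  sum.distrib[symmetric] F.scale_sum_right mult_ac intro!:sum.cong)
qed

lemma braid_bilinear_ab:
 assumes "c:hc" "d:hc"
 shows "bilinear_on hs hs fscale hc hc (%a b. braid a b c d)"
proof -
 interpret F: vector_space "fscale :: 'k => ('k,'h,'h) tensor => _" by(rule vector_space_fscale)
 show ?thesis
  using assms h.hcomp_V
  by(auto intro!:bilinear_onI simp:braid_eq h.hcomp_add h.hcomp_scale distrib_right scale_mult_left
  tens_add_left tens_add_right tens_scale_left tens_scale_right F.scale_right_distrib
  sum.distrib[symmetric] F.scale_sum_right mult_ac intro!:sum.cong)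
qed

lemma bilinear_sweedler:
 assumes "vector_space scu" "!!a b. a:hc==>b:hc==>bilinear_on hs hs scu hc hc (K a b)"
  "!!c d. c:hc==>d:hc==>bilinear_on hs hs scu hc hc (%a b. K a b c d)" "y:hc"
 shows "bilinear_on hs hs scu hc hc (%a b. sweedler H (K a b) y)"
proof -
 interpret U: vector_space scu by fact
 obtain ys where ys:"set ys <= hc \<times> hc" "coprod H y = (SUM (a,b)<-ys. T a b)" using coprod_list[OF assms(4)] .
 have e:"sweedler H (K a b) y = (SUM (c,d)<-ys. K a b c d)" if "a:hc" "b:hc" for a b
  by(rule sweedler_list[OF assms(1) assms(2)[OF that] ys])
 have "bilinear_on hs hs scu hc hc (%a b. SUM (c,d)<-ys. K a b c d)"
  using ys(1)
 proof (induction ys)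
  case Nil
  show ?case by(auto intro!:bilinear_onI)
 next
  case (Cons p ys)
  obtain c d where p:"p = (c,d)" by fastforce
  have 1:"bilinear_on hs hs scu hc hc (%a b. K a b c d)" using Cons.prems assms(3) p by auto
  have 2:"bilinear_on hs hs scu hc hc (%a b. SUM (c,d)<-ys. K a b c d)" using Cons by auto
  show ?case
  by(rule bilinear_onI)
  (simp_all add:p bilinear_onD[OF 1] bilinear_onD[OF 2] U.scale_right_distrib algebra_simps)
 qed
 then show ?thesis using e by(auto simp:bilinear_on_def linear_on_def)
qed

text \<open>A representing list for a product: the sign for moving \<open>b\<close>, of degree
  \<open>n - i\<close>, past \<open>c\<close>, of degree \<open>j\<close>, is put into the first
  factor.\<close>

definition rep_times where
 "rep_times n xs ys = concat (map (%(i,a,b). map (%(j,c,e). (i + j,hs (xsign s (n - i) j) (a * c),b * e)) ys) xs)"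

lemma sum_rep_times:
 "(SUM (i,a,b)<-rep_times n xs ys. F a b) =
  (SUM (i,a,b)<-xs. SUM (j,c,e)<-ys. F (hs (xsign s (n - i) j) (a * c)) (b * e))"
 unfolding rep_times_def by(induction xs) (auto simp:case_prod_unfold o_def)

lemma sum_list_cong2:
 "(!!i a b. (i,a,b):set xs==>F i a b = F' i a b) ==>
  (SUM (i,a,b)<-xs. F i a b) = (SUM (i,a,b)<-xs. F' i a b)"
 by(intro arg_cong[of _ _ sum_list] map_cong) auto

lemma rep_mult:
 assumes x:"rep n x xs" "x:hc" and y:"rep m y ys" "y:hc"
 shows "rep (n + m) (x * y) (rep_times n xs ys)"
proof -
 have "coprod H (x * y) = sweedler H (%a b. sweedler H (braid a b) y) x"
  using coprod_mult[OF x(2) y(2)] by(simp add:braid_def[abs_def])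
 also have "... = (SUM (i,a,b)<-xs. sweedler H (braid a b) y)"
  by(rule rep_eval[OF x(1) vector_space_fscale bilinear_sweedler[OF vector_space_fscale braid_bilinear_cd braid_bilinear_ab y(2)]])
 also have "... = (SUM (i,a,b)<-xs. SUM (j,c,e)<-ys. T (hs (xsign s (n - i) j) (a * c)) (b * e))"
 proof (rule sum_list_cong2)
  fix i a b assume i:"(i,a,b):set xs"
  then have ab:"a:hc" "b:hc" "b:hg (n - i)" using rep_mem[OF x(1) i] hg_hc by auto
  have "sweedler H (braid a b) y = (SUM (j,c,e)<-ys. braid a b c e)"
  by(rule rep_eval[OF y(1) vector_space_fscale braid_bilinear_cd[OF ab(1,2)]])
  also have "... = (SUM (j,c,e)<-ys. T (hs (xsign s (n - i) j) (a * c)) (b * e))"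
  by(rule sum_list_cong2) (use rep_mem[OF y(1)] in "auto simp:braid_homog[OF ab(3)] tens_scale_left")
  finally show "sweedler H (braid a b) y = (SUM (j,c,e)<-ys. T (hs (xsign s (n - i) j) (a * c)) (b * e))" .
 qed
 also have "... = (SUM (i,a,b)<-rep_times n xs ys. T a b)" by(rule sum_rep_times[symmetric])
 finally have "coprod H (x * y) = (SUM (i,a,b)<-rep_times n xs ys. T a b)" .
 moreover have "a:hg i & b:hg (n + m - i)" if t:"(i,a,b):set (rep_times n xs ys)" for i a b
 proof -
  obtain i' a' b' j c e where *: "(i',a',b'):set xs" "(j,c,e):set ys"
  "i = i' + j" "a = hs (xsign s (n - i') j) (a' * c)" "b = b' * e"
  using t by(fastforce simp:rep_times_def)
  have "n + m - i = (n - i') + (m - j)" using * by simp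
  then show ?thesis
  using * rep_mem[OF x(1) *(1)] rep_mem[OF y(1) *(2)] mult_hg h.subspace_scale[OF h.subG] by metis
 qed
 ultimately show ?thesis by(auto simp:rep_def)
qed

lemma rep_times_eval:
 assumes "rep n x xs" "x:hc" "rep m y ys" "y:hc" "vector_space scu" "bilinear_on hs hs scu hc hc F"
 shows "sweedler H F (x * y) =
  (SUM (i,a,b)<-xs. SUM (j,c,e)<-ys. scu (xsign s (n - i) j) (F (a * c) (b * e)))"
 unfolding rep_eval[OF rep_mult[OF assms(1-4)] assms(5,6)] sum_rep_times
 by(intro sum_list_cong2)
  (use rep_mem_hc[OF assms(1)] rep_mem_hc[OF assms(3)] in "simp add:bilinear_onD[OF assms(6)]")

end

context hopf
begin

subsection \<open>Antipode\<close>

lemma sum_list_swap2: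
 "(SUM (i,a,b)<-xs. SUM (j,c,e)<-ys. F i a b j c e) = (SUM (j,c,e)<-ys. SUM (i,a,b)<-xs. (F i a b j c e :: 'u::comm_monoid_add))"
proof (induction xs)
 case Nil
 show ?case by(simp add:sum_list_zero2)
next
 case (Cons p xs)
 then show ?case by(simp add:case_prod_unfold sum_list_addf)
qed

lemma rep_right_ex:
 assumes "x:hg n"
 obtains xs where "rep n x ((n,x,1) # xs)" "!!i a b. (i,a,b):set xs==>0 <= i & i < n"
proof -
 obtain xs where "rep n x xs" using rep_ex[OF assms] by blast
 from that[OF rep_right[OF assms this]] show thesis by auto
qed

lemma rep_left_ex:
 assumes "x:hg n"
 obtains xs where "rep n x ((0,1,x) # xs)" "!!i a b. (i,a,b):set xs==>0 < i & i <= n"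
proof -
 obtain xs where "rep n x xs" using rep_ex[OF assms] by blast
 from that[OF rep_left[OF assms this]] show thesis by auto
qed

lemma S_1 [simp]: "S 1 = 1"
proof -
 have "sweedler H (%a b. S a * b) 1 = (SUM (a,b)<-[(1,1)]. S a * b)"
  by(rule sweedler_list[OF h.vector_space_axioms bilinear_mult[OF S_linear linear_id]]) (auto simp:coprod_1)
 then show ?thesis using S_left[OF one_hc] by simp
qed

lemma sum_list_diff2:
 "(SUM (i,a,b)<-xs. F i a b - G i a b) = (SUM (i,a,b)<-xs. F i a b) - (SUM (i,a,b)<-xs. (G i a b :: 'u::ab_group_add))"
 by(induction xs) auto

lemma sum_list_mult_left2:"(SUM (i,a,b)<-xs. c * F i a b) = c * (SUM (i,a,b)<-xs. (F i a b :: 'u::ring_1))"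
 by(induction xs) (auto simp:distrib_left)

lemma sum_list_mult_right2:"(SUM (i,a,b)<-xs. F i a b * c) = (SUM (i,a,b)<-xs. (F i a b :: 'u::ring_1)) * c"
 by(induction xs) (auto simp:distrib_right)

lemma sum_list_scale2:"(SUM (i,a,b)<-xs. hs t (F i a b)) = hs t (SUM (i,a,b)<-xs. F i a b)"
 by(induction xs) (auto simp:h.scale_right_distrib)

text \<open>Both \<open>S (x * y)\<close> and the signed product \<open>S y * S x\<close> are left
  convolution inverses of multiplication. Subtracting the two identities and inducting on the total
  degree leaves only the term at \<open>(x, y)\<close>.\<close>

lemma S_mult:
 assumes "x:hg n" "y:hg m"
 shows "S (x * y) = hs (xsign s n m) (S y * S x)"
 using assms
proof (induction "nat n + nat m" arbitrary: n m x y rule: less_induct)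
 case less
 show ?case
 proof (cases "x = 0 | y = 0")
  case True
  then show ?thesis by auto
 next
  case False
  then have nm:"n >= 0" "m >= 0" using less.prems hg_nonneg by auto
  have xy:"x:hc" "y:hc" using less.prems hg_hc by auto
  obtain xs where xs:"rep n x ((n,x,1) # xs)" "!!i a b. (i,a,b):set xs==>0 <= i & i < n"
  using rep_right_ex[OF less.prems(1)] by blast
  obtain ys where ys:"rep m y ((m,y,1) # ys)" "!!i a b. (i,a,b):set ys==>0 <= i & i < m"
  using rep_right_ex[OF less.prems(2)] by blast
  define X Y where "X = (n,x,1) # xs" and "Y = (m,y,1) # ys"
  have X:"rep n x X" and Y:"rep m y Y" using xs ys by(auto simp:X_def Y_def)
  note bil = bilinear_mult[OF S_linear linear_id S_hc]
  have E1:"(SUM (i,a,b)<-X. SUM (j,c,e)<-Y. hs (xsign s (n - i) j) (S (a * c) * (b * e))) = hs (eps (x * y)) 1"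
  using rep_times_eval[OF X xy(1) Y xy(2) h.vector_space_axioms bil] S_left[of "x * y"] xy by simp
  have "(SUM (i,a,b)<-X. SUM (j,c,e)<-Y. hs (xsign s (n - i) j) (hs (xsign s i j) (S c * S a) * (b * e)))
  = (SUM (i,a,b)<-X. SUM (j,c,e)<-Y. hs (xsign s n j) (S c * (S a * b) * e))"
  proof (intro sum_list_cong2)
  fix i a b j c e assume "(i,a,b):set X" "(j,c,e):set Y"
  then have "a:hc" "b:hc" "c:hc" "e:hc" using rep_mem_hc[OF X] rep_mem_hc[OF Y] by auto
  then show "hs (xsign s (n - i) j) (hs (xsign s i j) (S c * S a) * (b * e)) = hs (xsign s n j) (S c * (S a * b) * e)"
  by(simp add:scale_mult_left xsign_diff mult.assoc)
  qed
  also have "... = (SUM (j,c,e)<-Y. SUM (i,a,b)<-X. hs (xsign s n j) (S c * (S a * b) * e))"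
  by(rule sum_list_swap2)
  also have "... = (SUM (j,c,e)<-Y. hs (xsign s n j) (S c * (SUM (i,a,b)<-X. S a * b) * e))"
  by(simp add:sum_list_scale2 sum_list_mult_left2 sum_list_mult_right2)
  also have "(SUM (i,a,b)<-X. S a * b) = hs (eps x) 1"
  using rep_eval[OF X h.vector_space_axioms bil] S_left[OF xy(1)] by simp
  also have "(SUM (j,c,e)<-Y. hs (xsign s n j) (S c * hs (eps x) 1 * e)) = (SUM (j,c,e)<-Y. hs (eps x) (S c * e))"
  proof (rule sum_list_cong2)
  fix j c e assume "(j,c,e):set Y"
  then have "c:hc" "e:hc" using rep_mem_hc[OF Y] by auto
  \<comment> \<open>The counit of \<open>x\<close> vanishes unless \<open>n = 0\<close>, and then
    the sign is 1.\<close>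
  then show "hs (xsign s n j) (S c * hs (eps x) 1 * e) = hs (eps x) (S c * e)"
  using counit_hg[OF less.prems(1)] by(cases "n = 0") (simp_all add:scale_mult_left scale_mult_right)
  qed
  also have "... = hs (eps x) (hs (eps y) 1)"
  using rep_eval[OF Y h.vector_space_axioms bil] S_left[OF xy(2)] by(simp add:sum_list_scale2)
  finally have E2:"(SUM (i,a,b)<-X. SUM (j,c,e)<-Y. hs (xsign s (n - i) j) (hs (xsign s i j) (S c * S a) * (b * e)))
  = hs (eps (x * y)) 1"
  using xy by(simp add:counit_mult)
  define D where "D i j a c = S (a * c) - hs (xsign s i j) (S c * S a)" for i j a c
  \<comment> \<open>Terms of lower total degree in \<open>a\<close> and \<open>c\<close> vanish by
    induction, so \<open>D\<close> at \<open>(x, y)\<close> is the only survivor.\<close>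
  have E:"(SUM (i,a,b)<-X. SUM (j,c,e)<-Y. hs (xsign s (n - i) j) (D i j a c * (b * e))) = 0"
  unfolding D_def left_diff_distrib h.scale_right_diff_distrib sum_list_diff2 E1 E2 by simp
  have D0:"D i j a c = 0" if "nat i + nat j < nat n + nat m" "a:hg i" "c:hg j" for i j a c
  using less.hyps[OF that] by(simp add:D_def)
  have "(SUM (i,a,b)<-xs. SUM (j,c,e)<-Y. hs (xsign s (n - i) j) (D i j a c * (b * e))) = 0"
  proof (intro sum_list_zero2)
  fix i a b j c e assume 1:"(i,a,b):set xs" "(j,c,e):set Y"
  have "j <= m" "0 <= i" "i < n" using 1 xs(2) ys(2) nm by(force simp:Y_def)+
  then have "D i j a c = 0" using 1 rep_mem[OF Y 1(2)] rep_mem[OF X] nm by(intro D0) (auto simp:X_def)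
  then show "hs (xsign s (n - i) j) (D i j a c * (b * e)) = 0" by simp
  qed
  moreover have "(SUM (j,c,e)<-ys. hs (xsign s (n - n) j) (D n j x c * (1 * e))) = 0"
  proof (intro sum_list_zero2)
  fix j c e assume 1:"(j,c,e):set ys"
  then have "D n j x c = 0" using less.prems ys(2)[OF 1] rep_mem[OF Y] nm by(intro D0) (auto simp:Y_def)
  then show "hs (xsign s (n - n) j) (D n j x c * (1 * e)) = 0" by simp
  qed
  ultimately have "D n m x y = 0" using E by(simp add:X_def Y_def)
  then show ?thesis by(simp add:D_def)
 qed
qed

text \<open>In positive degree the antipode identity expresses \<open>x\<close> by products
  \<open>S a * b\<close> with \<open>b\<close> of smaller degree. By induction
  \<open>b = S b'\<close>, and \<open>S a * S b'\<close> is up to sign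
  \<open>S (b' * a)\<close>.\<close>

lemma S_surj:"x:hg n==>EX y:hg n. x = S y"
proof (induction "nat n" arbitrary: n x rule: less_induct)
 case less
 show ?case
 proof (cases "x = 0 | n <= 0")
  case True
  then consider "x = 0" | "n = 0" using hg_nonneg[OF less.prems] by force
  then show ?thesis
  proof cases
  case 2
  then have "x = hs (eps x) 1" using less.prems hg_0_counit by simp
  also have "... = S (hs (eps x) 1)" by(simp add:linear_on_scale[OF S_linear])
  finally show ?thesis using 2 h.subspace_scale[OF h.subG one_hg] by blast
  qed (auto intro: bexI[of _ 0])
 next
  case False
  obtain xs where xs:"rep n x ((0,1,x) # xs)" "!!i a b. (i,a,b):set xs==>0 < i & i <= n"
  using rep_left_ex[OF less.prems] by blast
  have "0 = hs (eps x) 1" using counit_hg[OF less.prems] False by simp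
  also have "... = x + (SUM (i,a,b)<-xs. S a * b)"
  using S_left[OF hg_hc[OF less.prems]] rep_eval[OF xs(1) h.vector_space_axioms bilinear_mult[OF S_linear linear_id S_hc]]
  by simp
  finally have x:"x = - (SUM (i,a,b)<-xs. S a * b)" by(simp add:eq_neg_iff_add_eq_0)
  have "EX y:hg n. (SUM (i,a,b)<-zs. S a * b) = S y" if "set zs <= set xs" for zs
  using that
  proof (induction zs)
  case (Cons p zs)
  obtain i a b where p:"p = (i,a,b)" by(cases p)
  obtain y where y:"y:hg n" "(SUM (i,a,b)<-zs. S a * b) = S y" using Cons by auto
  have i:"0 < i" "i <= n" and ab:"a:hg i" "b:hg (n - i)"
  using Cons.prems xs(2)[of i a b] rep_mem[OF xs(1),of i a b] p by auto
  obtain b' where b':"b':hg (n - i)" "b = S b'" using less.hyps[OF _ ab(2)] i by auto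
  have "S a * b = hs (xsign s (n - i) i) (S (b' * a))"
  using S_mult[OF b'(1) ab(1)] b' by(simp)
  also have "... = S (hs (xsign s (n - i) i) (b' * a))"
  using b' ab hg_hc by(simp add:linear_on_scale[OF S_linear])
  finally have "S a * b = S (hs (xsign s (n - i) i) (b' * a))" .
  moreover have g:"hs (xsign s (n - i) i) (b' * a):hg n"
  using mult_hg[OF b'(1) ab(1)] by(auto intro: h.subspace_scale[OF h.subG])
  ultimately have "(SUM (i,a,b)<-p # zs. S a * b) = S (hs (xsign s (n - i) i) (b' * a) + y)"
  using p y hg_hc linear_on_add[OF S_linear,of "hs (xsign s (n - i) i) (b' * a)" y] by simp
  then show ?case using g y h.subspace_add[OF h.subG] by blast
  qed (auto intro: bexI[of _ 0])
  then obtain y where "y:hg n" "(SUM (i,a,b)<-xs. S a * b) = S y" by blast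
  then show ?thesis using x h.linear_on_minus[OF S_linear h.subV] h.subspace_neg[OF h.subG] hg_hc
  by(metis)
 qed
qed

subsection \<open>Integrals and the Frobenius form\<close>

text \<open>A homogeneous left integral \<open>z\<close> spans the top degree: if \<open>x\<close> were a further element of degree
  at least that of \<open>z\<close>, a functional \<open>\<mu>\<close> separating it from \<open>z\<close> would satisfy
  \<open>\<Sum> \<mu> (h z') z'' = 0\<close> for all \<open>h\<close>, which for \<open>h = x\<close> reads \<open>z = 0\<close>.\<close>

lemma integral_top:
 assumes z:"z:hg m" "z ~= 0" and int:"!!i a. i > 0==>a:hg i==>a * z = 0"
  and x:"x:hg r" "r >= m"
 shows "x:h.span {z}"
proof (rule ccontr)
 assume nx:"x ~: h.span {z}"
 have W:"h.graded_sub (h.span {z})" by(rule h.graded_sub_span) (use z in auto)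
 obtain mu where mu:"linear_on hs (*) hc mu" "mu x = 1" "!!w. w:h.span {z}==>mu w = 0"
  "!!i y. y:hg i==>i ~= r==>mu y = 0"
  using h.graded_functional[OF W x(1) nx] by blast
 have mu0:"mu 0 = 0" by(rule h.linear_on_0[OF mu(1) h.subV])
 have bil:"bilinear_on hs hs hs hc hc (%c e. hs (mu (h * c)) e)" if "h:hc" for h
  using that by(auto intro!:bilinear_onI simp:distrib_left scale_mult_right h.scale_right_distrib
  h.scale_left_distrib linear_on_add[OF mu(1)] linear_on_scale[OF mu(1)] mult_ac)
 have bil':"bilinear_on hs hs hs hc hc (%a b. hs (mu a) b)"
  using bil[OF one_hc] by simp
 obtain zr where zr:"rep m z ((m,z,1) # zr)" "!!i a b. (i,a,b):set zr==>0 <= i & i < m"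
  using rep_right_ex[OF z(1)] by blast
 define zs where "zs = (m,z,1) # zr"
 have zs:"rep m z zs" using zr(1) by(simp add:zs_def)
 have zhc:"z:hc" using z hg_hc by auto
 note ev = rep_eval[OF zs h.vector_space_axioms bil]
 \<comment> \<open>Expanding \<open>h * z = 0\<close> and applying \<open>mu\<close> to the first
   factors gives the sum for \<open>h\<close> plus left multiples of the same sums for elements
   \<open>a\<close> of smaller degree.\<close>
 have D:"sweedler H (%c e. hs (mu (h * c)) e) z = 0" if "h:hg n" for h n
  using that
 proof (induction "nat n" arbitrary: n h rule: less_induct)
  case less
  have hhc:"h:hc" using less.prems hg_hc by auto
  consider "h = 0" | "n = 0" | "n > 0" using hg_nonneg[OF less.prems] by force
  then show ?case
  proof cases
  case 1
  then show ?thesis unfolding ev[OF hhc] by(intro sum_list_zero2) (simp add:mu0)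
  next
  case 2
  then obtain t where t:"h = hs t 1" using less.prems hg_0 by auto
  show ?thesis unfolding ev[OF hhc]
  proof (intro sum_list_zero2)
  fix j c e assume j:"(j,c,e):set zs"
  have c:"c:hg j" using rep_mem[OF zs j] by simp
  have "mu c = 0"
  proof (cases "j = m")
  case True
  then have "c = z" using j zr(2) by(auto simp:zs_def)
  then show ?thesis using mu(3) h.span_base by auto
  next
  case False
  then have "j < m" using j zr(2) by(auto simp:zs_def)
  then show ?thesis using mu(4)[OF c] x(2) by simp
  qed
  then show "hs (mu (h * c)) e = 0"
  using t c hg_hc linear_on_scale[OF mu(1)] by(simp add:scale_mult_left)
  qed
  next
  case 3
  obtain hr where hr:"rep n h ((n,h,1) # hr)" "!!i a b. (i,a,b):set hr==>0 <= i & i < n"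
  using rep_right_ex[OF less.prems] by blast
  have "h * z = 0" using int 3 less.prems by blast
  then have "0 = sweedler H (%a b. hs (mu a) b) (h * z)"
  using rep_eval[OF rep_zero h.vector_space_axioms bil'] by simp
  also have "... = (SUM (i,a,b)<-(n,h,1) # hr. SUM (j,c,e)<-zs. hs (xsign s (n - i) j) (hs (mu (a * c)) (b * e)))"
  by(rule rep_times_eval[OF hr(1) hhc zs zhc h.vector_space_axioms bil'])
  also have "... = (SUM (j,c,e)<-zs. hs (mu (h * c)) e)
  + (SUM (i,a,b)<-hr. SUM (j,c,e)<-zs. hs (xsign s (n - i) j) (hs (mu (a * c)) (b * e)))"
  by simp
  also have "(SUM (i,a,b)<-hr. SUM (j,c,e)<-zs. hs (xsign s (n - i) j) (hs (mu (a * c)) (b * e))) = 0"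
  proof (rule sum_list_zero2)
  fix i a b assume i:"(i,a,b):set hr"
  then have ab:"a:hg i" "b:hc" "0 <= i" "i < n"
  using rep_mem[OF hr(1),of i a b] rep_mem_hc[OF hr(1),of i a b] hr(2) by auto
  \<comment> \<open>\<open>mu (a * c)\<close> is zero unless \<open>j = r - i\<close>, so the sign
    no longer depends on \<open>j\<close> and leaves the sum.\<close>
  have "(SUM (j,c,e)<-zs. hs (xsign s (n - i) j) (hs (mu (a * c)) (b * e)))
  = (SUM (j,c,e)<-zs. hs (xsign s (n - i) (r - i)) (b * hs (mu (a * c)) e))"
  proof (rule sum_list_cong2)
  fix j c e assume j:"(j,c,e):set zs"
  have ce:"c:hg j" "e:hc" using rep_mem[OF zs j] rep_mem_hc[OF zs j] by auto
  show "hs (xsign s (n - i) j) (hs (mu (a * c)) (b * e)) = hs (xsign s (n - i) (r - i)) (b * hs (mu (a * c)) e)"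
  proof (cases "i + j = r")
  case True
  then have "j = r - i" by simp
  then show ?thesis using ab ce by(simp add:scale_mult_right)
  next
  case False
  then show ?thesis using mu(4)[OF mult_hg[OF ab(1) ce(1)]] by simp
  qed
  qed
  also have "... = hs (xsign s (n - i) (r - i)) (b * (SUM (j,c,e)<-zs. hs (mu (a * c)) e))"
  by(simp add:sum_list_scale2 sum_list_mult_left2)
  also have "... = 0"
  using less.hyps[OF _ ab(1)] ab ev[OF hg_hc[OF ab(1)]] by simp
  finally show "(SUM (j,c,e)<-zs. hs (xsign s (n - i) j) (hs (mu (a * c)) (b * e))) = 0" .
  qed
  finally show ?thesis using ev[OF hhc] by simp
  qed
 qed
 \<comment> \<open>For \<open>h = x\<close> only the leading term \<open>1 \<otimes> z\<close>
   survives: in the others \<open>x * c\<close> has degree above \<open>r\<close>, where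
   \<open>mu\<close> vanishes.\<close>
 obtain zl where zl:"rep m z ((0,1,z) # zl)" "!!i a b. (i,a,b):set zl==>0 < i & i <= m"
  using rep_left_ex[OF z(1)] by blast
 have "0 = hs (mu (x * 1)) z + (SUM (j,c,e)<-zl. hs (mu (x * c)) e)"
  using D[OF x(1)] rep_eval[OF zl(1) h.vector_space_axioms bil[OF hg_hc[OF x(1)]]] by simp
 also have "(SUM (j,c,e)<-zl. hs (mu (x * c)) e) = 0"
 proof (rule sum_list_zero2)
  fix j c e assume j:"(j,c,e):set zl"
  then have "c:hg j" "0 < j" using rep_mem[OF zl(1),of j c e] zl(2) by auto
  then show "hs (mu (x * c)) e = 0" using mu(4)[OF mult_hg[OF x(1)],of c j] by simp
 qed
 finally show False using mu(2) z(2) by simp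
qed

definition htop :: int where "htop = Max degs"
text \<open>An arbitrary nonzero element of top degree. It is a two-sided integral for degree
  reasons, and unique up to a scalar by \<open>hg_htop\<close>.\<close>

definition Lam :: 'h where "Lam = (SOME z. z:hg htop & z ~= 0)"

lemma degs_0:"0:degs"
 using one_hg one_neq_0 unfolding degs_def by(metis mem_Collect_eq singletonD)

lemma htop_nonneg:"0 <= htop"
 unfolding htop_def using degs_0 finite_degs by auto

lemma hg_above:"i > htop==>hg i = {0}"
 using Max_ge[OF finite_degs,of i] unfolding htop_def by(force simp:degs_def)

lemma Lam_hg:"Lam:hg htop" and Lam_neq_0:"Lam ~= 0"
proof -
 have "htop:degs" unfolding htop_def using finite_degs degs_0 by(intro Max_in) auto
 then have "EX z. z:hg htop & z ~= 0" using h.G0 by(auto simp:degs_def)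
 from someI_ex[OF this] show "Lam:hg htop" "Lam ~= 0" unfolding Lam_def by auto
qed

lemma Lam_hc [simp]: "Lam:hc" using Lam_hg hg_hc by blast

lemma mult_Lam:"a:hg i==>i > 0==>a * Lam = 0" "a:hg i==>i > 0==>Lam * a = 0"
 using mult_hg[OF _ Lam_hg,of a i] mult_hg[OF Lam_hg,of a i] hg_above[of "i + htop"] hg_above[of "htop + i"] by auto

lemma hg_htop:"x:hg htop==>EX c. x = hs c Lam"
 using integral_top[of Lam htop x htop] Lam_hg Lam_neq_0 mult_Lam(1) by(auto simp:h.span_singleton)

text \<open>Applied to an integral \<open>z\<close>, \<open>integral_top\<close> puts
  \<open>Lam\<close> into its span, which fixes the degree of \<open>z\<close>.\<close>

lemma integral_unique:
 assumes z:"z:hg m" "z ~= 0" and int:"!!i a. i > 0==>a:hg i==>a * z = 0"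
 shows "m = htop" "EX c. z = hs c Lam & c ~= 0"
proof -
 have "m:degs" using z by(auto simp:degs_def)
 then have "m <= htop" unfolding htop_def using finite_degs by simp
 then have "Lam:h.span {z}" by(intro integral_top[OF z int Lam_hg])
 then obtain c where c:"Lam = hs c z" by(auto simp:h.span_singleton)
 then have "Lam:hg m" using z h.subspace_scale[OF h.subG] by simp
 then show "m = htop" using h.G_disjoint[OF _ Lam_hg] Lam_neq_0 by blast
 then show "EX c. z = hs c Lam & c ~= 0" using hg_htop z by(metis h.scale_zero_left)
qed

text \<open>The scalar is nonzero because \<open>S\<close> is onto in the top degree, which is
  one-dimensional.\<close>

lemma S_Lam:"EX c. S Lam = hs c Lam & c ~= 0"
proof -
 obtain c where c:"S Lam = hs c Lam" using hg_htop S_hg[OF Lam_hg] by blast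
 obtain y where y:"y:hg htop" "Lam = S y" using S_surj[OF Lam_hg] by blast
 obtain d where "y = hs d Lam" using hg_htop y by blast
 then have "S y = hs d (S Lam)" using linear_on_scale[OF S_linear Lam_hc] by simp
 then have "Lam = hs d (S Lam)" using y by simp
 then have "S Lam ~= 0" using Lam_neq_0 by auto
 then show ?thesis using c by auto
qed

text \<open>The coefficient of \<open>Lam\<close> in the top degree. The form
  \<open>frob (y * x)\<close> makes H a Frobenius algebra.\<close>

definition frob :: "'h => 'k" where
 "frob = (SOME f. linear_on hs (*) hc f & f Lam = 1 & (ALL i y. y:hg i --> i ~= htop --> f y = 0))"

lemma frob_linear:"linear_on hs (*) hc frob"
 and frob_Lam [simp]: "frob Lam = 1"
 and frob_hg:"y:hg i==>i ~= htop==>frob y = 0"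
proof -
 have "h.graded_sub {0}" by(rule h.graded_subI) auto
 then obtain f where "linear_on hs (*) hc f & f Lam = 1 & (ALL i y. y:hg i --> i ~= htop --> f y = 0)"
  using h.graded_functional[of "{0}" Lam htop] Lam_hg Lam_neq_0 by(metis singletonD)
 from someI[of "%f. linear_on hs (*) hc f & f Lam = 1 & (ALL i y. y:hg i --> i ~= htop --> f y = 0)",OF this]
 show "linear_on hs (*) hc frob" "frob Lam = 1" "y:hg i==>i ~= htop==>frob y = 0"
  unfolding frob_def by auto
qed

lemma frob_0 [simp]: "frob 0 = 0"
 by(rule h.linear_on_0[OF frob_linear h.subV])

text \<open>Downward induction on the degree. Left multiples of \<open>x\<close> by positive degree
  elements satisfy the same hypothesis, hence vanish; so \<open>x\<close> is an integral, and
  \<open>y = 1\<close> detects a nonzero multiple of \<open>Lam\<close>.\<close>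

lemma frob_nondeg_homog:
 assumes "x:hg n" "!!j y. y:hg j==>frob (y * x) = 0"
 shows "x = 0"
 using assms
proof (induction "nat (htop - n)" arbitrary: n x rule: less_induct)
 case less
 show ?case
 proof (rule ccontr)
  assume x:"x ~= 0"
  have "a * x = 0" if "i > 0" "a:hg i" for i a
  proof (cases "n < htop")
  case True
  show ?thesis
  proof (rule less.hyps[of "i + n"])
  show "frob (y * (a * x)) = 0" if "y:hg j" for j y
  using less.prems(2)[OF mult_hg[OF that \<open>a:hg i\<close>]] by(simp add:mult.assoc)
  qed (use that True mult_hg less.prems in auto)
  next
  case False
  then show ?thesis using mult_hg[OF that(2) less.prems(1)] that hg_above[of "i + n"] by auto
  qed
  then have "EX c. x = hs c Lam & c ~= 0" by(intro integral_unique(2)[OF less.prems(1) x])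
  then obtain c where "x = hs c Lam" "c ~= 0" by blast
  then show False using less.prems(2)[OF one_hg] linear_on_scale[OF frob_linear Lam_hc] by simp
 qed
qed

lemma frob_nondeg:
 assumes "x:hc" "!!y. y:hc==>frob (y * x) = 0"
 shows "x = 0"
proof -
 have "hcomp hg x n = 0" for n
 proof (rule frob_nondeg_homog[OF h.hcomp_G[OF assms(1)]])
  fix j y assume y:"y:hg j"
  \<comment> \<open>A test element of degree \<open>j\<close> sees only the component of
    \<open>x\<close> in degree \<open>htop - j\<close>.\<close>
  show "frob (y * hcomp hg x n) = 0"
  proof (cases "j + n = htop")
  case True
  have m:"linear_on hs (*) hc (%x. frob (y * x))"
  using y hg_hc by(auto intro!:linear_onI simp:distrib_left scale_mult_right
  linear_on_add[OF frob_linear] linear_on_scale[OF frob_linear])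
  have "0 = frob (y * x)" using assms(2) y hg_hc by auto
  also have "x = (SUM i | hcomp hg x i ~= 0. hcomp hg x i)" by(rule h.hcomp_sum'[OF assms(1)])
  also have "frob (y * (SUM i | hcomp hg x i ~= 0. hcomp hg x i)) = (SUM i | hcomp hg x i ~= 0. frob (y * hcomp hg x i))"
  by(rule h.linear_on_sum[OF m h.subV]) (use assms(1) h.hcomp_V in auto)
  also have "... = (SUM i | hcomp hg x i ~= 0. if i = n then frob (y * hcomp hg x n) else 0)"
  proof (rule sum.cong[OF refl])
  fix i
  show "frob (y * hcomp hg x i) = (if i = n then frob (y * hcomp hg x n) else 0)"
  using frob_hg[OF mult_hg[OF y h.hcomp_G[OF assms(1),of i]]] True by auto
  qed
  also have "... = frob (y * hcomp hg x n)"
  using h.hcomp_finite[OF assms(1)] by(simp)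
  finally show ?thesis by simp
  next
  case False
  then show ?thesis using frob_hg[OF mult_hg[OF y h.hcomp_G[OF assms(1)]]] by auto
  qed
 qed
 then show ?thesis using h.V_eqI[OF assms(1),of 0] by simp
qed

end

section \<open>Representing functionals by a nondegenerate form, and annihilators\<close>

lemma sum_apply:"(SUM x:A. f x) y = (SUM x:A. f x y)"
 by(induction A rule: infinite_finite_induct) auto

text \<open>Dimension count: evaluating the form on a basis \<open>B\<close> embeds \<open>V\<close>
  into the functions supported on \<open>B\<close>. Their dimension is at most the size of
  \<open>B\<close>, so every functional is reached.\<close>

lemma (in fgvs) nondegenerate_represents:
 assumes be1:"!!y. y:V==>linear_on sc (*) V (be y)"
  and be2:"!!x. x:V==>linear_on sc (*) V (%y. be y x)"
  and nondeg:"!!x. x:V==>(!!y. y:V==>be y x = 0)==>x = 0"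
  and g:"linear_on sc (*) V g"
 obtains x where "x:V" "!!y. y:V==>g y = be y x"
proof -
 interpret K: vector_space "fscale :: 'a => ('b => 'a) => _" by(rule vector_space_fscale)
 interpret vp: vector_space_pair sc "fscale :: 'a => ('b => 'a) => _" by unfold_locales
 obtain B where B:"B <= V" "independent B" "V <= span B"
  using maximal_independent_subset by blast
 have spB:"span B = V" by(rule span_subspace[OF B(1,3) subV])
 have finB:"finite B" by(rule independent_finite[OF B(2,1)])
 define ev where "ev x = (%b. if b:B then be b x else 0)" for x
 define e where "e b = (%x::'b. if x = b then 1 else (0::'a))" for b
 have "linear_on sc fscale V ev"
  using B(1) be1 by(intro linear_onI) (auto simp:ev_def fun_eq_iff fscale_def linear_on_def subset_iff)
 then obtain f where f:"linear_on sc fscale UNIV f" "!!x. x:V==>f x = ev x"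
  using linear_on_extend[OF vector_space_fscale subV] by blast
 interpret f: Vector_Spaces.linear sc "fscale :: 'a => ('b => 'a) => _" f
  using f(1) by unfold_locales (auto simp:linear_on_def)
 have inj:"inj_on f (span B)"
 proof (rule f.inj_on_iff_eq_0[THEN iffD2],simp,intro ballI impI)
  fix x assume "x:span B" "f x = 0"
  then have x:"x:V" "ev x = 0" using f(2) spB by auto
  have "be y x = 0" if "y:V" for y
  proof -
  have "B <= {y:V. be y x = 0}" using x(2) B(1) by(auto simp:ev_def fun_eq_iff) metis
  moreover have "subspace {y:V. be y x = 0}"
  by(rule subspaceI) (auto simp:subspace_0[OF subV] subspace_add[OF subV] subspace_scale[OF subV]
  linear_on_0[OF be2[OF x(1)] subV] linear_on_add[OF be2[OF x(1)]] linear_on_scale[OF be2[OF x(1)]])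
  ultimately have "span B <= {y:V. be y x = 0}" by(rule span_minimal)
  then show ?thesis using that spB by auto
  qed
  then show "x = 0" by(rule nondeg[OF x(1)])
 qed
 have ind:"K.independent (f ` B)" by(rule f.independent_injective_image[OF B(2) inj])
 have sum_e:"h = (SUM b:B. fscale (h b) (e b))" if "!!b. b ~: B==>h b = 0" for h
 proof
  fix b
  have "(SUM c:B. fscale (h c) (e c)) b = (SUM c:B. if b = c then h b else 0)"
  unfolding sum_apply by(intro sum.cong) (auto simp:fscale_def e_def)
  then show "h b = (SUM c:B. fscale (h c) (e c)) b" using finB that by simp
 qed
 have span_e:"h:K.span (e ` B)" if "!!b. b ~: B==>h b = 0" for h
 proof -
  have "(SUM b:B. fscale (h b) (e b)):K.span (e ` B)"
  by(intro K.span_sum K.span_scale K.span_base imageI)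
  moreover have eq:"h = (SUM b:B. fscale (h b) (e b))" by(rule sum_e) (rule that)
  ultimately show ?thesis by(intro ssubst[OF eq,where P = "%h. h:K.span (e ` B)"])
 qed
 have fe:"f ` B <= K.span (e ` B)"
 proof (rule image_subsetI)
  fix b assume "b:B"
  then have "f b = ev b" using B(1) f(2) by blast
  moreover have "ev b:K.span (e ` B)" by(rule span_e) (simp add:ev_def)
  ultimately show "f b:K.span (e ` B)" by simp
 qed
 have "inj_on f B" using inj by(rule inj_on_subset) (rule span_superset)
 then have card:"card (e ` B) <= card (f ` B)" using card_image_le[OF finB,of e] by(simp add:card_image)
 \<comment> \<open>A delta function outside this span would give an independent set larger than a
   spanning set.\<close>
 have "e ` B <= K.span (f ` B)"
 proof
  fix c assume c:"c:e ` B"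
  show "c:K.span (f ` B)"
  proof (rule ccontr)
  assume n:"c ~: K.span (f ` B)"
  have "insert c (f ` B) <= K.span (e ` B)" using fe c K.span_base by auto
  from K.independent_span_bound[OF finite_imageI[OF finB] K.independent_insertI[OF n ind] this]
  have "card (insert c (f ` B)) <= card (e ` B)" by simp
  moreover have "c ~: f ` B" using n K.span_base by auto
  ultimately show False using card finB by simp
  qed
 qed
 then have "K.span (e ` B) <= K.span (f ` B)" by(rule K.span_minimal) simp
 also have "... = f ` V" using f.span_image[of B] spB by simp
 finally have "K.span (e ` B) <= f ` V" .
 moreover have "(%b. if b:B then g b else 0):K.span (e ` B)" by(rule span_e) simp
 ultimately obtain x where x:"x:V" "(%b. if b:B then g b else 0) = ev x" using f(2) by auto
 have "g y = be y x" if "y:V" for y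
 proof -
  have "B <= {y:V. g y = be y x}" using x(2) B(1) by(auto simp:ev_def fun_eq_iff) metis
  moreover have "subspace {y:V. g y = be y x}"
  by(rule subspaceI) (auto simp:subspace_0[OF subV] subspace_add[OF subV] subspace_scale[OF subV]
  linear_on_0[OF be2[OF x(1)] subV] linear_on_add[OF be2[OF x(1)]] linear_on_scale[OF be2[OF x(1)]]
  linear_on_0[OF g subV] linear_on_add[OF g] linear_on_scale[OF g])
  ultimately have "span B <= {y:V. g y = be y x}" by(rule span_minimal)
  then show ?thesis using that spB by auto
 qed
 then show thesis using that[OF x(1)] by blast
qed

context hopf
begin

lemma frob_bilinear:
 "y:hc==>linear_on hs (*) hc (%x. frob (y * x))"
 "x:hc==>linear_on hs (*) hc (%y. frob (y * x))"
 by(auto intro!:linear_onI simp:distrib_left distrib_right scale_mult_left scale_mult_right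
  linear_on_add[OF frob_linear] linear_on_scale[OF frob_linear])

lemma frob_represents:
 assumes "linear_on hs (*) hc g"
 obtains x where "x:hc" "!!y. y:hc==>g y = frob (y * x)"
 using h.nondegenerate_represents[of "%y x. frob (y * x)" g,OF frob_bilinear frob_nondeg assms] by blast

lemma frob_nondeg_left:
 assumes "x:hc" "!!y. y:hc==>frob (x * y) = 0"
 shows "x = 0"
proof (rule ccontr)
 assume x:"x ~= 0"
 have "h.subspace {0}" by simp
 then obtain g where g:"linear_on hs (*) UNIV g" "g x = 1"
  using h.functional_separating[of "{0}" x] x by auto
 obtain y where "y:hc" "g x = frob (x * y)"
  using frob_represents[OF linear_on_subset[OF g(1)]] assms(1) by auto
 then show False using g(2) assms(2) by simp
qed

text \<open>An element outside the left ideal \<open>L\<close> is separated from it by some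
  \<open>frob (_ * r)\<close>. As \<open>L\<close> is closed under left multiplication,
  nondegeneracy gives \<open>l * r = 0\<close> on \<open>L\<close>; hence \<open>x * r = 0\<close>,
  contrary to the separation.\<close>

lemma double_annihilator:
 assumes L:"h.subspace L" "L <= hc" "!!y l. y:hc==>l:L==>y * l:L"
  and x:"x:hc" "!!r. r:hc==>(!!l. l:L==>l * r = 0)==>x * r = 0"
 shows "x:L"
proof (rule ccontr)
 assume "x ~: L"
 then obtain g where g:"linear_on hs (*) UNIV g" "g x = 1" "!!l. l:L==>g l = 0"
  using h.functional_separating[OF L(1)] by blast
 obtain r where r:"r:hc" "!!y. y:hc==>g y = frob (y * r)"
  using frob_represents[OF linear_on_subset[OF g(1)]] by auto
 have "l * r = 0" if "l:L" for l
 proof (rule frob_nondeg)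
  fix y assume y:"y:hc"
  have "frob (y * (l * r)) = g (y * l)" using r y that L(2) by(auto simp:mult.assoc)
  then show "frob (y * (l * r)) = 0" using g(3) L(3)[OF y that] by simp
 qed (use that L(2) r in auto)
 then have "g x = 0" using x r by simp
 then show False using g by simp
qed

text \<open>Some homogeneous left multiple of \<open>x\<close> has nonzero \<open>frob\<close>,
  which makes it a nonzero multiple of \<open>Lam\<close>.\<close>

lemma left_ideal_Lam:
 assumes "x:hg n" "x ~= 0"
 obtains y where "y:hg (htop - n)" "y * x = Lam"
proof -
 obtain j y where y:"y:hg j" "frob (y * x) ~= 0" using frob_nondeg_homog[OF assms(1)] assms(2) by blast
 have yx:"y * x:hg (j + n)" using mult_hg y assms by blast
 then have j:"j + n = htop" using frob_hg y(2) by blast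
 then obtain c where c:"y * x = hs c Lam" using hg_htop yx by auto
 then have "c ~= 0" using y(2) by auto
 then have "hs (inverse c) y * x = Lam" using c y assms hg_hc by(simp add:scale_mult_left)
 moreover have "j = htop - n" using j by simp
 ultimately show thesis using that[of "hs (inverse c) y"] y h.subspace_scale[OF h.subG] by auto
qed

end

subsection \<open>Hopf subalgebras\<close>

locale hopf_sub = hopf +
 fixes A :: "'b set"
 assumes A:"hopf_subalgebra H A"
begin

lemma A_hc:"x:A==>x:hc" and A_sub:"h.subspace A" and A_1 [simp]: "1:A"
 and A_mult [simp]: "x:A==>y:A==>x * y:A"
 and A_hcomp:"x:A==>hcomp hg x i:A"
 and A_coprod:"x:A==>coprod H x:tprod hs hs A A"
 and A_S:"x:A==>S x:A"
 using A by(auto simp:hopf_subalgebra_def)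

lemma A_graded:"h.graded_sub A"
 by(rule h.graded_subI) (auto simp:A_sub A_hc A_hcomp)

sublocale a: fgvs hs A "%i. hg i Int A"
 by(rule h.fgvs_sub[OF A_graded])

lemma A_comp [simp]: "x:A==>hcomp (%i. hg i Int A) x = hcomp hg x"
 by(rule h.gvs_sub(2)[OF A_graded])

lemma sub_list:
 assumes "x:A"
 obtains xs where "set xs <= A \<times> A" "coprod H x = (SUM (a,b)<-xs. T a b)"
 using tprod_rep[OF h.vector_space_axioms A_sub A_coprod[OF assms]] by blast

lemma sum_list_concat_map:"(SUM z<-concat (map f xs). g z) = (SUM x<-xs. SUM z<-f x. g z)"
 by(induction xs) auto

text \<open>One list for the coproduct has entries in \<open>A\<close>, another has homogeneous
  entries. The bilinear map \<open>P\<close>, extracting the parts of bidegree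
  \<open>(i, n - i)\<close>, fixes the terms of the second list and turns the first into a list with
  both properties.\<close>

lemma sub_rep:
 assumes "x:A" "x:hg n"
 obtains xs where "rep n x xs" "!!i a b. (i,a,b):set xs==>a:A & b:A"
proof -
 interpret F: vector_space "fscale :: 'a => ('a,'b,'b) tensor => _" by(rule vector_space_fscale)
 obtain xs where xs:"set xs <= A \<times> A" "coprod H x = (SUM (a,b)<-xs. T a b)" using sub_list[OF assms(1)] .
 obtain zs where zs:"rep n x zs" using rep_ex[OF assms(2)] by blast
 define P where "P v w = (SUM i:degs. T (hcomp hg v i) (hcomp hg w (n - i)))" for v w
 have bil:"bilinear_on hs hs fscale hc hc P"
  by(rule bilinear_onI) (simp_all add:P_def h.hcomp_add h.hcomp_scale tens_add_left tens_add_right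
  tens_scale_left tens_scale_right sum.distrib F.scale_sum_right)
 obtain ds where ds:"set ds = degs" "distinct ds" using finite_distinct_list[OF finite_degs] by blast
 define ys where "ys = concat (map (%(v,w). map (%i. (i,hcomp hg v i,hcomp hg w (n - i))) ds) xs)"
 have "coprod H x = (SUM (i,a,b)<-zs. T a b)" using zs by(simp add:rep_def)
 also have "... = (SUM (i,a,b)<-zs. P a b)"
 proof (rule sum_list_cong2)
  fix i a b assume "(i,a,b):set zs"
  then have ab:"a:hg i" "b:hg (n - i)" using rep_mem[OF zs] by auto
  have "P a b = (SUM j:degs. if j = i then T a b else 0)"
  unfolding P_def using ab by(intro sum.cong) (auto simp:h.hcomp_homog)
  also have "... = T a b" using ab finite_degs by(auto simp:degs_def)
  finally show "T a b = P a b" by simp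
 qed
 also have "... = sweedler H P x" by(rule rep_eval[OF zs vector_space_fscale bil,symmetric])
 also have "... = (SUM (v,w)<-xs. P v w)"
  by(rule sweedler_list[OF vector_space_fscale bil _ xs(2)]) (use xs(1) A_hc in auto)
 also have "... = (SUM (i,a,b)<-ys. T a b)"
  unfolding ys_def sum_list_concat_map P_def
  by(simp add:case_prod_unfold o_def sum_list_distinct_conv_sum_set ds)
 finally have "coprod H x = (SUM (i,a,b)<-ys. T a b)" .
 moreover have m:"a:hg i & b:hg (n - i) & a:A & b:A" if t:"(i,a,b):set ys" for i a b
  using t xs(1) by(auto simp:ys_def A_hcomp intro!:h.hcomp_G A_hc)
 ultimately have "rep n x ys" by(auto simp:rep_def)
 then show thesis using that[of ys] m by blast
qed

abbreviation "HA == subhopf H A"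

lemma HA_simps [simp]: "hcarrier HA = A" "hscale HA = hs" "hgrade HA = (%i. hg i Int A)"
 "coprod HA = coprod H" "counit HA = eps" "antipode HA = S"
 by(auto simp:subhopf_def)

lemma sub_sweedler_list:
 assumes "vector_space scu" "bilinear_on hs hs scu A A F" "set xs <= A \<times> A"
  "coprod H x = (SUM (a,b)<-xs. T a b)"
 shows "sweedler HA F x = (SUM (a,b)<-xs. F a b)"
 unfolding sweedler_def HA_simps assms(4)
 by(rule tlift_eval[OF h.vector_space_axioms h.vector_space_axioms assms(1) A_sub A_sub assms(2,3)])

lemma sub_sweedler:
 assumes "vector_space scu" "bilinear_on hs hs scu hc hc F" "x:A"
 shows "sweedler HA F x = sweedler H F x"
proof -
 obtain xs where xs:"set xs <= A \<times> A" "coprod H x = (SUM (a,b)<-xs. T a b)" using sub_list[OF assms(3)] .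
 have "bilinear_on hs hs scu A A F" by(rule bilinear_on_subset[OF assms(2)]) (use A_hc in auto)
 from sub_sweedler_list[OF assms(1) this xs] sweedler_list[OF assms(1,2) _ xs(2)] xs(1) A_hc
 show ?thesis by(auto simp:subset_iff)
qed

lemma sub_sweedler_cong:
 "(!!a b. a:A==>b:A==>F a b = F' a b)==>sweedler HA F x = sweedler HA F' x"
 unfolding sweedler_def HA_simps by(rule tlift_cong)

lemma sub_hext:"v:A==>hext (%i. hg i Int A) F v = hext hg F v"
 by(simp add:hext_def)

lemma bilinear_braid_swap:"bilinear_on hs hs fscale hc hc (%a b. braid 1 a b 1)"
 using braid_bilinear_ab[OF _ one_hc] braid_bilinear_cd[OF one_hc]
 by(auto simp:bilinear_on_def)

lemma bilinear_T3:
 "b:hc==>bilinear_on hs hs fscale hc hc (%a' a''. tens hs fscale a' (T a'' b))"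
 by(rule bilinear_onI) (auto simp:tens_add_left tens_add_right tens_scale_left tens_scale_right)

lemma bilinear_coassoc_left:
 "bilinear_on hs hs fscale hc hc (%a b. sweedler H (%a' a''. tens hs fscale a' (T a'' b)) a)"
proof -
 interpret F: vector_space "fscale :: 'a => ('a,'b,('a,'b,'b) tensor) tensor => _" by(rule vector_space_fscale)
 have l:"linear_on hs fscale hc (sweedler H (%a' a''. tens hs fscale a' (T a'' b)))" if "b:hc" for b
  by(rule sweedler_linear[OF vector_space_fscale bilinear_T3[OF that]])
 have e:"sweedler H (%a' a''. tens hs fscale a' (T a'' b)) a = (SUM (c,d)<-xs. tens hs fscale c (T d b))"
  if "b:hc" "set xs <= hc \<times> hc" "coprod H a = (SUM (c,d)<-xs. T c d)" for a b xs
  by(rule sweedler_list[OF vector_space_fscale bilinear_T3]) fact+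
 show ?thesis
 proof (rule bilinear_onI)
  fix v w w' assume a:"v:hc" "w:hc" "w':hc"
  obtain xs where xs:"set xs <= hc \<times> hc" "coprod H v = (SUM (a,b)<-xs. T a b)" using coprod_list[OF a(1)] .
  show "sweedler H (%a' a''. tens hs fscale a' (T a'' (w + w'))) v =
  sweedler H (%a' a''. tens hs fscale a' (T a'' w)) v + sweedler H (%a' a''. tens hs fscale a' (T a'' w')) v"
  unfolding e[OF a(2) xs] e[OF a(3) xs] e[OF hc_add[OF a(2,3)] xs]
  by(simp add:tens_add_right sum_list_addf case_prod_unfold)
 next
  fix c v w assume a:"v:hc" "w:hc"
  obtain xs where xs:"set xs <= hc \<times> hc" "coprod H v = (SUM (a,b)<-xs. T a b)" using coprod_list[OF a(1)] .
  show "sweedler H (%a' a''. tens hs fscale a' (T a'' (hs c w))) v =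
  fscale c (sweedler H (%a' a''. tens hs fscale a' (T a'' w)) v)"
  unfolding e[OF a(2) xs] e[OF hc_scale[OF a(2)] xs]
  by(simp add:tens_scale_right F.scale_sum_list case_prod_unfold)
 qed (use linear_on_add[OF l] linear_on_scale[OF l] in auto)
qed

lemma bilinear_coassoc_right:"bilinear_on hs hs fscale hc hc (%a b. tens hs fscale a (coprod H b))"
 by(rule bilinear_onI) (auto simp:tens_add_left tens_add_right tens_scale_left tens_scale_right
  linear_on_add[OF coprod_linear] linear_on_scale[OF coprod_linear])

lemma sub_algebra_part:"graded_algebra_part HA"
proof -
 obtain B where B:"B <= A" "h.independent B" "A <= h.span B"
  using h.maximal_independent_subset by blast
 have "finite B" "A = h.span B"
  using a.independent_finite[OF B(2,1)] h.span_subspace[OF B(1,3) A_sub] by auto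
 moreover have "hg 0 Int A = range (%c. hs c 1)"
  using h.subspace_scale[OF A_sub A_1] by(auto simp:hg_0)
 ultimately show ?thesis
  unfolding graded_algebra_part_def HA_simps
  using h.vector_space_axioms A_sub a.graded hg_neg mult_hg A_mult h.subspace_0[OF A_sub]
  by(auto simp:scale_mult_left scale_mult_right A_hc)
qed

lemma sub_coalgebra_part:"graded_coalgebra_part HA"
 unfolding graded_coalgebra_part_def HA_simps
proof (intro conjI allI ballI impI)
 show "linear_on hs fscale A (coprod H)" by(rule linear_on_subset[OF coprod_linear]) (use A_hc in auto)
 show "linear_on hs (*) A eps" by(rule linear_on_subset[OF counit_linear]) (use A_hc in auto)
 fix i x assume x:"x:hg i Int A"
 then obtain xs where xs:"rep i x xs" "!!j a b. (j,a,b):set xs==>a:A & b:A"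
  using sub_rep by(metis IntE)
 interpret F: vector_space "fscale :: 'a => ('a,'b,'b) tensor => _" by(rule vector_space_fscale)
 show "coprod H x:tgrade hs hs (%i. hg i Int A) (%i. hg i Int A) i"
  using xs rep_mem[OF xs(1)] unfolding rep_def
  by(auto intro!:F.subspace_sum_list subspace_tgrade tens_in_tgrade)
next
 fix x assume x:"x:A"
 show "coprod H x:tprod hs hs A A" by(rule A_coprod[OF x])
 show "sweedler HA (%a b. hs (eps a) b) x = x" "sweedler HA (%a b. hs (eps b) a) x = x"
  using sub_sweedler[OF h.vector_space_axioms bilinear_counit(1) x]
  sub_sweedler[OF h.vector_space_axioms bilinear_counit(2) x] counit_left counit_right A_hc[OF x] by auto
 have "sweedler HA (%a b. sweedler HA (%a' a''. tens hs fscale a' (T a'' b)) a) x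
  = sweedler HA (%a b. sweedler H (%a' a''. tens hs fscale a' (T a'' b)) a) x"
  by(rule sub_sweedler_cong) (rule sub_sweedler[OF vector_space_fscale bilinear_T3[OF A_hc]])
 also have "... = sweedler H (%a b. sweedler H (%a' a''. tens hs fscale a' (T a'' b)) a) x"
  by(rule sub_sweedler[OF vector_space_fscale bilinear_coassoc_left x])
 also have "... = sweedler H (%a b. tens hs fscale a (coprod H b)) x" by(rule coassoc[OF A_hc[OF x]])
 also have "... = sweedler HA (%a b. tens hs fscale a (coprod H b)) x"
  by(rule sub_sweedler[OF vector_space_fscale bilinear_coassoc_right x,symmetric])
 finally show "sweedler HA (%a b. sweedler HA (%a' a''. tens hs fscale a' (T a'' b)) a) x
  = sweedler HA (%a b. tens hs fscale a (coprod H b)) x" .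
qed (use counit_hg in auto)

text \<open>A \<open>sweedler\<close> sum of \<open>HA\<close> is lifted from \<open>A\<close> only,
  but for bilinear functions it agrees with the one of H, so each axiom is inherited.\<close>

lemma sub_hopf:"hopf s HA"
proof (unfold_locales,rule sign)
 have mult:"coprod H (x * y) = sweedler HA (%a b. sweedler HA (%c d.
  hext (%i. hg i Int A) (%i b. hext (%i. hg i Int A) (%j c.
  fscale (xsign s i j) (T (a * c) (b * d))) c) b) y) x" if xy:"x:A" "y:A" for x y
 proof -
  have "sweedler HA (%a b. sweedler HA (%c d.
  hext (%i. hg i Int A) (%i b. hext (%i. hg i Int A) (%j c.
  fscale (xsign s i j) (T (a * c) (b * d))) c) b) y) x
  = sweedler HA (%a b. sweedler HA (braid a b) y) x"
  by(intro sub_sweedler_cong) (simp add:braid_def sub_hext)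
  also have "... = sweedler HA (%a b. sweedler H (braid a b) y) x"
  by(intro sub_sweedler_cong sub_sweedler[OF vector_space_fscale braid_bilinear_cd] A_hc xy)
  also have "... = sweedler H (%a b. sweedler H (braid a b) y) x"
  by(intro sub_sweedler[OF vector_space_fscale] xy A_hc[OF xy(2)]
  bilinear_sweedler[OF vector_space_fscale braid_bilinear_cd braid_bilinear_ab])
  also have "... = coprod H (x * y)"
  using coprod_mult[of x y] xy A_hc by(simp add:braid_def[abs_def])
  finally show ?thesis by simp
 qed
 have cocom:"sweedler HA (%a b. hext (%i. hg i Int A) (%i a. hext (%i. hg i Int A) (%j b.
  fscale (xsign s i j) (T b a)) b) a) x = coprod H x" if x:"x:A" for x
 proof -
  have "sweedler HA (%a b. hext (%i. hg i Int A) (%i a. hext (%i. hg i Int A) (%j b.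
  fscale (xsign s i j) (T b a)) b) a) x = sweedler HA (%a b. braid 1 a b 1) x"
  by(intro sub_sweedler_cong) (simp add:braid_def sub_hext)
  also have "... = sweedler H (%a b. braid 1 a b 1) x"
  by(rule sub_sweedler[OF vector_space_fscale bilinear_braid_swap x])
  also have "... = coprod H x" using cocomm[OF A_hc[OF x]] by(simp add:braid_def)
  finally show ?thesis .
 qed
 have anti:"sweedler HA (%a b. S a * b) x = hs (eps x) 1" "sweedler HA (%a b. a * S b) x = hs (eps x) 1"
  if "x:A" for x
  using sub_sweedler[OF h.vector_space_axioms bilinear_mult[OF S_linear linear_id S_hc] that]
  sub_sweedler[OF h.vector_space_axioms bilinear_mult[OF linear_id S_linear _ S_hc] that]
  S_left[OF A_hc[OF that]] S_right[OF A_hc[OF that]] by auto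
 have "linear_on hs hs A S" by(rule linear_on_subset[OF S_linear]) (use A_hc in auto)
 then show "hopf_algebra s HA"
  unfolding hopf_algebra_def HA_simps
  using sub_algebra_part sub_coalgebra_part mult cocom anti A_S S_hg A_hc counit_mult coprod_1
  by(intro conjI) auto
qed

sublocale HA: hopf s HA
 by(rule sub_hopf)

end

lemma (in hopf) hopf_subalgebra_self:"hopf_subalgebra H hc"
 unfolding hopf_subalgebra_def using h.hcomp_V coprod_tprod h.subV by auto

lemma (in hopf) subhopf_self:"subhopf H hc = H"
 unfolding subhopf_def using hg_hc by(intro hopf.equality) (auto simp:fun_eq_iff)

subsection \<open>Freeness over Hopf subalgebras\<close>

context hopf_sub
begin

text \<open>The right ideal generated by the augmentation ideal of \<open>A\<close>. By
  connectedness that ideal is spanned by elements of positive degree, and homogeneous generators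
  make the grading visible.\<close>

definition aug_right :: "'b set" where
 "aug_right = h.span {a * y | a y i j. i > 0 & a:A & a:hg i & y:hg j}"

lemma aug_right_graded:"h.graded_sub aug_right"
 unfolding aug_right_def by(rule h.graded_sub_span) (use mult_hg in blast)

lemma aug_right_hc:"x:aug_right==>x:hc"
 using aug_right_graded by(auto simp:h.graded_sub_def)

lemma aug_right_sub:"h.subspace aug_right"
 using aug_right_graded by(auto simp:h.graded_sub_def)

lemma mult_aug_right:
 assumes "a:A" "a:hg i" "i > 0" "y:hc"
 shows "a * y:aug_right"
 using assms(4)
proof (induction rule: h.homog_induct)
 case zero
 show ?case using h.subspace_0[OF aug_right_sub] by simp
next
 case (add x y)
 then show ?case using h.subspace_add[OF aug_right_sub] by(simp add:distrib_left)
next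
 case (homog j x)
 then show ?case unfolding aug_right_def using assms by(intro h.span_base) blast
qed

lemma aug_A_sum:
 assumes "a:A"
 shows "a = hs (eps a) 1 + (SUM i:degs - {0}. hcomp hg a i)"
proof -
 have a:"a:hc" using assms A_hc by auto
 have "eps a = (SUM i:degs. eps (hcomp hg a i))"
  by(subst h.hcomp_sum[OF a finite_degs])
  (use a hcomp_degs h.hcomp_V in "auto intro!:h.linear_on_sum[OF counit_linear h.subV]")
 also have "... = (SUM i:degs. if i = 0 then eps (hcomp hg a 0) else 0)"
  using counit_hg[OF h.hcomp_G[OF a]] by(intro sum.cong) auto
 also have "... = eps (hcomp hg a 0)" using finite_degs degs_0 by simp
 finally have "hcomp hg a 0 = hs (eps a) 1" using hg_0_counit[OF h.hcomp_G[OF a]] by simp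
 moreover have "a = hcomp hg a 0 + (SUM i:degs - {0}. hcomp hg a i)"
  by(subst h.hcomp_sum[OF a finite_degs]) (use a hcomp_degs degs_0 finite_degs in "auto simp:sum.remove")
 ultimately show ?thesis by simp
qed

lemma aug_A_mult:
 assumes "a:A" "eps a = 0" "y:hc"
 shows "a * y:aug_right"
proof -
 have "a * y = (SUM i:degs - {0}. hcomp hg a i * y)"
  by(subst aug_A_sum[OF assms(1)]) (simp add:assms(2) sum_distrib_right)
 also have "...:aug_right"
 proof (intro h.subspace_sum aug_right_sub)
  fix i assume "i:degs - {0}"
  then have "i > 0" using hg_neg[of i] by(cases "i < 0") (auto simp:degs_def)
  then show "hcomp hg a i * y:aug_right"
  using assms A_hcomp h.hcomp_G[OF A_hc] by(intro mult_aug_right) auto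
 qed
 finally show ?thesis .
qed

lemma aug_right_set_prod:"set_prod H (augmentation_ideal H A) hc = aug_right"
proof
 show "set_prod H (augmentation_ideal H A) hc <= aug_right"
  unfolding set_prod_def
  by(rule h.span_minimal) (use aug_A_mult aug_right_sub in "auto simp:augmentation_ideal_def")
 show "aug_right <= set_prod H (augmentation_ideal H A) hc"
  unfolding aug_right_def set_prod_def
  by(rule h.span_mono) (use counit_hg hg_hc in "fastforce simp:augmentation_ideal_def")
qed

lemma counit_aug_right:"x:aug_right==>eps x = 0"
proof -
 have "aug_right <= {x:hc. eps x = 0}"
  unfolding aug_right_def
  by(rule h.span_minimal) (auto intro!:h.subspaceI simp:counit_mult counit_hg hg_hc
  linear_on_add[OF counit_linear] linear_on_scale[OF counit_linear])
 then show "x:aug_right==>eps x = 0" by auto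
qed

lemma bilinear_contract:
 "linear_on hs (*) hc mu==>bilinear_on hs hs hs hc hc (%a b. hs (mu b) a)"
 by(auto intro!:bilinear_onI simp:h.scale_right_distrib h.scale_left_distrib linear_on_def mult_ac)


text \<open>Contracting the second tensor factor with a functional that kills
  \<open>aug_right\<close> is left \<open>A\<close>-linear: in the coproduct of \<open>a\<close>
  every term but \<open>a \<otimes> 1\<close> has a second factor of positive degree in
  \<open>A\<close>, so its product with any element lies in \<open>aug_right\<close>.\<close>

lemma contract_mult:
 assumes lam:"linear_on hs (*) hc mu" "!!w. w:aug_right==>mu w = 0"
  and a:"a:A" and x:"x:hc"
 shows "sweedler H (%a b. hs (mu b) a) (a * x) = a * sweedler H (%a b. hs (mu b) a) x"
proof -
 let ?T = "sweedler H (%a b. hs (mu b) a)"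
 note bil = bilinear_contract[OF lam(1)]
 note lin = sweedler_linear[OF h.vector_space_axioms bil]
 have homog:"?T (a * x) = a * ?T x" if a:"a:A" "a:hg n" and x:"x:hg m" for a x n m
 proof -
  have hc:"a:hc" "x:hc" using a x hg_hc by auto
  obtain as0 where as0:"rep n a as0" "!!i b c. (i,b,c):set as0==>b:A & c:A" using sub_rep[OF a] by blast
  obtain as where as:"rep n a ((n,a,1) # as)" "!!i b c. (i,b,c):set as==>c:A & i < n"
  using rep_right[OF a(2) as0(1)] as0(2) by fastforce
  obtain xs where xs:"rep m x xs" using rep_ex[OF x] by blast
  have z:"(SUM (i,a,b)<-as. SUM (j,c,e)<-xs. hs (xsign s (n - i) j) (hs (mu (b * e)) (a * c))) = 0"
  proof (intro sum_list_zero2)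
  fix i a b j c e assume 1:"(i,a,b):set as" "(j,c,e):set xs"
  have "b * e:aug_right"
  by(rule mult_aug_right[of _ "n - i"])
  (use as(2)[OF 1(1)] rep_mem[OF as(1),of i a b] rep_mem_hc[OF xs 1(2)] 1 in auto)
  then show "hs (xsign s (n - i) j) (hs (mu (b * e)) (a * c)) = 0" using lam(2) by simp
  qed
  have "?T (a * x) = (SUM (i,a,b)<-(n,a,1) # as. SUM (j,c,e)<-xs. hs (xsign s (n - i) j) (hs (mu (b * e)) (a * c)))"
  by(rule rep_times_eval[OF as(1) hc(1) xs hc(2) h.vector_space_axioms bil])
  also have "... = (SUM (j,c,e)<-xs. hs (mu e) (a * c))" using z by simp
  also have "... = (SUM (j,c,e)<-xs. a * hs (mu e) c)"
  by(rule sum_list_cong2) (use hc rep_mem_hc[OF xs] in "simp add:scale_mult_right")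
  also have "... = a * ?T x"
  unfolding rep_eval[OF xs h.vector_space_axioms bil] by(rule sum_list_mult_left2)
  finally show ?thesis .
 qed
 have T_hc:"?T x:hc" if t:"x:hc" for x
 proof -
  obtain xs where xs:"set xs <= hc \<times> hc" "coprod H x = (SUM (a,b)<-xs. T a b)" using coprod_list[OF t] .
  show ?thesis unfolding sweedler_list[OF h.vector_space_axioms bil xs]
  using xs(1) by(auto intro!:h.subspace_sum_list h.subV)
 qed
 have T0:"?T 0 = 0" by(rule h.linear_on_0[OF lin h.subV])
 have 1:"?T (a * x) = a * ?T x" if x:"x:hg m" for x m
  using a
 proof (induction rule: a.homog_induct)
  case (add b c)
  then show ?case using x hg_hc A_hc by(simp add:distrib_right linear_on_add[OF lin])
 qed (use T0 homog x in auto)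
 show ?thesis using x
 proof (induction rule: h.homog_induct)
  case (add y z)
  then show ?case using A_hc[OF a] by(simp add:distrib_left linear_on_add[OF lin])
 qed (use T0 1 in auto)
qed

text \<open>All terms but \<open>1 \<otimes> x\<close> have a second factor of degree below
  \<open>d\<close>, where \<open>mu\<close> vanishes.\<close>

lemma contract_top:
 assumes lam:"linear_on hs (*) hc mu" "!!i y. y:hg i==>i ~= d==>mu y = 0"
  and x:"x:hg n" "n <= d"
 shows "sweedler H (%a b. hs (mu b) a) x = hs (mu x) 1"
proof -
 obtain xs where xs:"rep n x ((0,1,x) # xs)" "!!i a b. (i,a,b):set xs==>0 < i & i <= n"
  using rep_left_ex[OF x(1)] by blast
 have "(SUM (i,a,b)<-xs. hs (mu b) a) = 0"
 proof (rule sum_list_zero2)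
  fix i a b assume i:"(i,a,b):set xs"
  then have "b:hg (n - i)" "n - i ~= d" using rep_mem[OF xs(1),of i a b] xs(2)[OF i] x(2) by auto
  then show "hs (mu b) a = 0" using lam(2) by simp
 qed
 then show ?thesis
  using rep_eval[OF xs(1) h.vector_space_axioms bilinear_contract[OF lam(1)]] by simp
qed

text \<open>A homogeneous basis of H as a left \<open>A\<close>-module that lifts a basis modulo
  \<open>aug_right\<close>. That it contains 1 and is independent modulo \<open>aug_right\<close>
  serves \<open>detect_nonempty\<close>.\<close>

definition left_basis :: "'b set => bool" where
 "left_basis X \<longleftrightarrow> finite X & 1:X & X <= (UN i. hg i)
  & (ALL x:X. x ~: h.span (aug_right Un (X - {x})))
  & (ALL y:hc. EX f. (ALL x:X. f x:A) & y = (SUM x:X. f x * x))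
  & (ALL f. (ALL x:X. f x:A) --> (SUM x:X. f x * x) = 0 --> (ALL x:X. f x = 0))"

text \<open>Generation is Nakayama's lemma by degree. For freeness, let \<open>x0\<close> have the
  largest degree among the basis elements with nonzero coefficient in a relation; contraction with a
  functional dual to \<open>x0\<close> is \<open>A\<close>-linear, sends \<open>x0\<close> to 1 and
  the other relevant basis elements to 0, and so isolates the coefficient of
  \<open>x0\<close>.\<close>

lemma free_over_sub:"EX X. left_basis X"
proof -
 obtain B where B:"B <= aug_right" "h.independent B" "aug_right <= h.span B"
  using h.maximal_independent_subset by blast
 have spB:"h.span B = aug_right" by(rule h.span_subspace[OF B(1,3) aug_right_sub])
 have "1 ~: h.span B" using spB counit_aug_right by fastforce
 then have ind1:"h.independent (B Un {1})" "B Int {1} = {}"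
  using h.independent_insertI[OF _ B(2)] h.span_base by auto
 have one:"{1} <= (UN i. hg i)" using one_hg by blast
 obtain X where X:"finite X" "{1} <= X" "X <= (UN i. hg i)" "hc = h.span (B Un X)" "h.independent (B Un X)" "B Int X = {}"
  using h.homog_basis_extend[OF aug_right_graded one B(1,3) ind1] .
 have Xhc:"X <= hc" using X(3) hg_hc by auto
 have ind:"x ~: h.span (aug_right Un (X - {x}))" if "x:X" for x
 proof -
  have "x ~: h.span (B Un X - {x})" using X(5) that by(auto simp:h.dependent_def)
  moreover have "aug_right Un (X - {x}) <= h.span (B Un X - {x})"
  proof -
  have "B <= B Un X - {x}" "X - {x} <= B Un X - {x}" using X(6) that by auto
  then show ?thesis using spB h.span_mono[of B "B Un X - {x}"] h.span_superset[of "B Un X - {x}"] by auto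
  qed
  ultimately show ?thesis using h.span_minimal[OF _ h.subspace_span] by blast
 qed
 define M where "M = {y. EX f. (ALL x:X. f x:A) & y = (SUM x:X. f x * x)}"
 have M0:"0:M" unfolding M_def using h.subspace_0[OF A_sub] by(auto intro!:exI[of _ "%_. 0"])
 have Madd:"x + y:M" if xy:"x:M" "y:M" for x y
 proof -
  obtain f g where "ALL x:X. f x:A" "x = (SUM x:X. f x * x)" "ALL x:X. g x:A" "y = (SUM x:X. g x * x)"
  using xy by(auto simp:M_def)
  then show ?thesis unfolding M_def
  by(auto intro!:exI[of _ "%z. f z + g z"] h.subspace_add[OF A_sub] simp:distrib_right sum.distrib)
 qed
 have Mmult:"a * y:M" if ay:"a:A" "y:M" for a y
 proof -
  obtain f where "ALL x:X. f x:A" "y = (SUM x:X. f x * x)" using ay by(auto simp:M_def)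
  then show ?thesis unfolding M_def using ay
  by(auto intro!:exI[of _ "%z. a * f z"] simp:sum_distrib_left mult.assoc)
 qed
 have Mhc:"M <= hc" unfolding M_def using Xhc A_hc by(auto intro!:h.subspace_sum h.subV mult_hc)
 have Mscale:"hs c y:M" if "y:M" for c y
  using Mmult[of "hs c 1" y] h.subspace_scale[OF A_sub A_1] that Mhc by(auto simp:scale_mult_left)
 have Msub:"h.subspace M" using M0 Madd Mscale by(intro h.subspaceI)
 have XM:"x:M" if x:"x:X" for x
  unfolding M_def
 proof (intro CollectI exI conjI)
  show "ALL y:X. (if y = x then 1 else 0):A" using h.subspace_0[OF A_sub] by auto
  show "x = (SUM y:X. (if y = x then 1 else 0) * y)"
  using X(1) x by(simp add:if_distrib[of "%t. t * _"] cong: if_cong)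
 qed
 \<comment> \<open>In degree \<open>n\<close>, \<open>aug_right\<close> is spanned by products
   \<open>a * z\<close> with \<open>z\<close> of smaller degree, to which induction applies.\<close>
 have gen:"y:M" if "y:hg n" for y n
  using that
 proof (induction "nat n" arbitrary: n y rule: less_induct)
  case less
  let ?U = "{y:hc. hcomp hg y n:M}"
  have "h.subspace ?U"
  by(rule h.subspaceI) (auto simp:h.hcomp_add h.hcomp_scale M0 Madd Mscale)
  moreover have "X <= ?U"
  proof
  fix x assume x:"x:X"
  then obtain j where "x:hg j" using X(3) by auto
  then show "x:?U" using x Xhc XM M0 by(auto simp:h.hcomp_homog)
  qed
  moreover have "B <= ?U"
  proof -
  have "aug_right <= ?U"
  unfolding aug_right_def
  proof (rule h.span_minimal[OF _ \<open>h.subspace ?U\<close>],safe)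
  fix a z i j assume a:"(0::int) < i" "a:A" "a:hg i" "z:hg j"
  then show "a * z:hc" using hg_hc by auto
  have az:"a * z:hg (i + j)" using mult_hg a by blast
  show "hcomp hg (a * z) n:M"
  proof (cases "n = i + j & z ~= 0")
  case True
  then have "j >= 0" using hg_nonneg a by auto
  then have "z:M" using less.hyps[OF _ a(4)] True a by auto
  then show ?thesis using True az Mmult a by(simp add:h.hcomp_homog)
  next
  case False
  then show ?thesis using h.hcomp_homog[OF az] M0 by auto
  qed
  qed
  then show ?thesis using B(1) by auto
  qed
  ultimately have "hc <= ?U" unfolding X(4) by(intro h.span_minimal) auto
  then have "hcomp hg y n:M" using less.prems hg_hc by blast
  then show "y:M" using less.prems by(simp add:h.hcomp_homog)
 qed
 have hcM:"y:M" if "y:hc" for y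
  using that by(induction rule: h.homog_induct) (use M0 Madd gen in auto)
 have free:"f x = 0" if f:"!!x. x:X==>f x:A" "(SUM x:X. f x * x) = 0" and x:"x:X" for f x
 proof (rule ccontr)
  assume "f x ~= 0"
  define deg where "deg x = (SOME i. x:hg i)" for x
  have deg:"x:hg (deg x)" if t:"x:X" for x
  proof -
  have "EX i. x:hg i" using t X(3) by auto
  then show ?thesis unfolding deg_def by(rule someI_ex)
  qed
  define Y where "Y = {x:X. f x ~= 0}"
  have Y:"finite (deg ` Y)" "deg ` Y ~= {}" using X(1) x \<open>f x ~= 0\<close> by(auto simp:Y_def)
  obtain x0 where x0:"x0:Y" "deg x0 = Max (deg ` Y)" using Max_in[OF Y] by auto
  have max:"deg x <= deg x0" if "x:Y" for x using that Y(1) x0(2) by simp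
  have x0X:"x0:X" "f x0 ~= 0" using x0 by(auto simp:Y_def)
  \<comment> \<open>\<open>mu\<close> has to vanish on \<open>aug_right\<close> to make the
    contraction \<open>A\<close>-linear, and on the other basis elements to isolate
    \<open>x0\<close>.\<close>
  define W where "W = h.span (aug_right Un (X - {x0}))"
  have W:"h.graded_sub W"
  proof (rule h.graded_subI)
  have "W <= {w:hc. ALL i. hcomp hg w i:W}"
  unfolding W_def
  proof (rule h.span_minimal)
  let ?S = "aug_right Un (X - {x0})"
  show "h.subspace {w:hc. ALL i. hcomp hg w i:h.span ?S}"
  by(rule h.subspaceI) (auto simp:h.hcomp_add h.hcomp_scale h.span_zero h.span_add h.span_scale)
  show "?S <= {w:hc. ALL i. hcomp hg w i:h.span ?S}"
  proof (safe)
  fix w i assume w:"w:aug_right"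
  then show "w:hc" by(rule aug_right_hc)
  show "hcomp hg w i:h.span ?S"
  using w aug_right_graded by(intro h.span_base) (auto simp:h.graded_sub_def)
  next
  fix w i assume w:"w:X" "w ~= x0"
  then show "w:hc" using Xhc by auto
  show "hcomp hg w i:h.span ?S"
  using w h.hcomp_homog[OF deg[OF w(1)]] by(auto simp:h.span_zero h.span_base)
  qed
  qed
  then show "w:hc" "hcomp hg w i:W" if "w:W" for w i using that by auto
  qed (simp add:W_def)
  have "x0 ~: W" unfolding W_def by(rule ind[OF x0X(1)])
  then obtain mu where lam:"linear_on hs (*) hc mu" "mu x0 = 1" "!!w. w:W==>mu w = 0"
  "!!i y. y:hg i==>i ~= deg x0==>mu y = 0"
  using h.graded_functional[OF W deg[OF x0X(1)]] by blast
  have lamW:"mu w = 0" if "w:aug_right" for w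
  using that by(intro lam(3)) (auto simp:W_def intro: h.span_base)
  let ?T = "sweedler H (%a b. hs (mu b) a)"
  have lin:"linear_on hs hs hc ?T"
  by(rule sweedler_linear[OF h.vector_space_axioms bilinear_contract[OF lam(1)]])
  have "0 = ?T (SUM x:X. f x * x)" using f(2) h.linear_on_0[OF lin h.subV] by simp
  also have "... = (SUM x:X. ?T (f x * x))"
  by(rule h.linear_on_sum[OF lin h.subV]) (use f Xhc A_hc in auto)
  also have "... = (SUM x:X. if x = x0 then f x0 else 0)"
  proof (rule sum.cong[OF refl])
  fix x assume x:"x:X"
  have "?T (f x * x) = f x * ?T x" by(rule contract_mult[OF lam(1) lamW f(1)[OF x]]) (use x Xhc in auto)
  also have "... = (if x = x0 then f x0 else 0)"
  proof (cases "f x = 0")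
  case False
  then have "deg x <= deg x0" using x max by(auto simp:Y_def)
  then have "?T x = hs (mu x) 1" by(intro contract_top[where d = "deg x0",OF lam(1) _ deg[OF x]] lam(4))
  moreover have "x ~= x0==>mu x = 0" using x by(intro lam(3)) (auto simp:W_def intro: h.span_base)
  ultimately show ?thesis using lam(2) by auto
  qed (use x0X in auto)
  finally show "?T (f x * x) = (if x = x0 then f x0 else 0)" .
  qed
  also have "... = f x0" using X(1) x0X by simp
  finally show False using x0X by simp
 qed
 have "EX f. (ALL x:X. f x:A) & y = (SUM x:X. f x * x)" if "y:hc" for y
  using hcM[OF that] by(simp add:M_def)
 moreover have "ALL f. (ALL x:X. f x:A) --> (SUM x:X. f x * x) = 0 --> (ALL x:X. f x = 0)"
  using free by simp
 ultimately have "left_basis X"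
  unfolding left_basis_def using X(1-3) ind by simp
 then show ?thesis by(rule exI)
qed

end

subsection \<open>Normal Hopf subalgebras\<close>

locale hopf_normal = hopf_sub s H Z for s :: "'k::field" and H :: "('k,'h::ring_1) hopf" and Z +
 assumes normal:"normal_hopf_subalgebra H Z" and nontriv:"Z ~= range (%c. hscale H c 1)"
begin

abbreviation "J == set_prod H hc (augmentation_ideal H Z)"

text \<open>Normality enters here: the left ideal \<open>J\<close> is also the right ideal generated
  by the augmentation ideal of Z, so it is two-sided.\<close>

lemma J_eq:"J = aug_right"
 using normal aug_right_set_prod by(auto simp:normal_hopf_subalgebra_def)

lemma J_hc:"x:J==>x:hc"
 using aug_right_hc J_eq by auto

lemma J_sub:"h.subspace J"
 using aug_right_sub J_eq by auto

lemma J_graded:"h.graded_sub J"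
 using aug_right_graded J_eq by auto

lemma J_left:"x:hc==>y:J==>x * y:J"
proof -
 assume x:"x:hc"
 have "J <= {y:hc. x * y:J}"
 proof (subst (1) set_prod_def,rule h.span_minimal)
  show "h.subspace {y:hc. x * y:J}"
  using x h.subspace_0[OF J_sub] h.subspace_add[OF J_sub] h.subspace_scale[OF J_sub]
  by(intro h.subspaceI) (auto simp:distrib_left scale_mult_right)
  show "{u * v |u v. u:hc & v:augmentation_ideal H Z} <= {y:hc. x * y:J}"
  proof safe
  fix u v assume uv:"u:hc" "v:augmentation_ideal H Z"
  then show "u * v:hc" using A_hc by(auto simp:augmentation_ideal_def)
  have "x * (u * v) = (x * u) * v" "x * u:hc" using x uv by(auto simp:mult.assoc)
  then show "x * (u * v):J" unfolding set_prod_def using uv(2) by(intro h.span_base) blast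
  qed
 qed
 then show "y:J==>x * y:J" by auto
qed

lemma J_right:"x:J==>y:hc==>x * y:J"
proof -
 assume y:"y:hc"
 have "J <= {x:hc. x * y:J}"
 proof (subst (1) J_eq,subst (1) aug_right_def,rule h.span_minimal)
  show "h.subspace {x:hc. x * y:J}"
  using y h.subspace_0[OF J_sub] h.subspace_add[OF J_sub] h.subspace_scale[OF J_sub]
  by(intro h.subspaceI) (auto simp:distrib_right scale_mult_left)
  show "{a * y |a y i j. 0 < i & a:Z & a:hg i & y:hg j} <= {x:hc. x * y:J}"
  using y A_hc hg_hc mult_aug_right J_eq by(auto simp:mult.assoc)
 qed
 then show "x:J==>x * y:J" by auto
qed

lemma counit_J:"x:J==>eps x = 0"
 using counit_aug_right J_eq by auto

abbreviation "N == HA.Lam"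
abbreviation "dN == HA.htop"

lemma N_Z [simp]: "N:Z" and N_hg:"N:hg dN" and N_hc [simp]: "N:hc" and N_neq_0:"N ~= 0"
 using HA.Lam_hg HA.Lam_neq_0 A_hc by auto

lemma mult_N:"a:Z==>a:hg i==>i > 0==>a * N = 0" "a:Z==>a:hg i==>i > 0==>N * a = 0"
 using HA.mult_Lam by auto

text \<open>Degree 0 holds only scalars and negative degrees are zero, so a top degree of 0 would
  make Z trivial.\<close>

lemma dN_pos:"dN > 0"
proof (rule ccontr)
 assume "~ dN > 0"
 then have "Z <= range (%c. hs c 1)"
 proof -
  have d:"dN = 0" using HA.htop_nonneg \<open>~ dN > 0\<close> by simp
  have "z:hg 0" if "z:Z" for z
  using that
  proof (induction rule: a.homog_induct)
  case (homog i x)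
  then show ?case using HA.hg_above[of i] hg_neg[of i] d by(cases "i = 0"; cases "i < 0") auto
  qed (auto intro: h.subspace_add[OF h.subG])
  then show ?thesis using hg_0 by auto
 qed
 moreover have "range (%c. hs c 1) <= Z" using h.subspace_scale[OF A_sub A_1] by auto
 ultimately show False using nontriv by auto
qed

lemma J_N:"x:J==>x * N = 0"
proof -
 have "{u * v |u v. u:hc & v:augmentation_ideal H Z} <= {x:hc. x * N = 0}"
 proof (intro subsetI,clarify,intro conjI)
  fix u v assume u:"u:hc" and v:"v:augmentation_ideal H Z"
  then show "u * v:hc" using A_hc by(auto simp:augmentation_ideal_def)
  have "v * N = (SUM i:degs - {0}. hcomp hg v i * N)"
  using v by(subst aug_A_sum) (auto simp:augmentation_ideal_def sum_distrib_right)
  also have "... = 0"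
  proof (rule sum.neutral,intro ballI)
  fix i assume "i:degs - {0}"
  then have "i > 0" using hg_neg[of i] by(cases "i < 0") (auto simp:degs_def)
  then show "hcomp hg v i * N = 0"
  using v by(intro mult_N(1)[of _ i]) (auto simp:augmentation_ideal_def A_hcomp intro!:h.hcomp_G A_hc)
  qed
  finally show "u * v * N = 0" by(simp add:mult.assoc)
 qed
 moreover have "h.subspace {x:hc. x * N = 0}"
  by(rule h.subspaceI) (auto simp:distrib_right scale_mult_left)
 ultimately have "J <= {x:hc. x * N = 0}" unfolding set_prod_def by(rule h.span_minimal)
 then show "x:J==>x * N = 0" by auto
qed

lemma N_J:"x:J==>N * x = 0"
proof -
 have "h.subspace {x:hc. N * x = 0}"
  by(rule h.subspaceI) (auto simp:distrib_left scale_mult_right)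
 then have "aug_right <= {x:hc. N * x = 0}"
  unfolding aug_right_def
  by(rule h.span_minimal[rotated]) (use mult_N hg_hc in "auto simp:mult.assoc[symmetric]")
 then show "x:J==>N * x = 0" using J_eq by auto
qed

text \<open>In a left Z-basis, \<open>N * x = 0\<close> says that \<open>N\<close> kills each
  coefficient from the left. As \<open>N\<close> multiplies a coefficient by its counit, all
  coefficients lie in the augmentation ideal.\<close>

lemma annihilator_right:
 assumes "x:hc" "N * x = 0"
 shows "x:J"
proof -
 obtain X where "left_basis X" using free_over_sub by blast
 then have X:"finite X" "X <= (UN i. hg i)"
  "!!y. y:hc==>EX f. (ALL x:X. f x:Z) & y = (SUM x:X. f x * x)"
  "!!f x. (!!x. x:X==>f x:Z)==>(SUM x:X. f x * x) = 0==>x:X==>f x = 0"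
  by(simp_all add:left_basis_def)
 obtain f where f:"ALL x:X. f x:Z" "x = (SUM x:X. f x * x)" using X(3)[OF assms(1)] by blast
 have "f y * y:J" if y:"y:X" for y
 proof -
  have "N * f y = 0"
  by(rule X(4)[of "%y. N * f y"]) (use f assms(2) y in "auto simp:mult.assoc sum_distrib_left[symmetric]")
  moreover have "f y - hs (eps (f y)) 1:Z" "eps (f y - hs (eps (f y)) 1) = 0"
  using f y h.subspace_diff[OF A_sub] h.subspace_scale[OF A_sub] A_hc
  by(auto simp:h.linear_on_diff[OF counit_linear h.subV] linear_on_scale[OF counit_linear])
  then have 1:"(f y - hs (eps (f y)) 1) * z:J" if "z:hc" for z
  using aug_A_mult that J_eq by auto
  from N_J[OF 1[OF one_hc]] have "N * f y = hs (eps (f y)) N"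
  by(simp add:right_diff_distrib scale_mult_right)
  ultimately have "eps (f y) = 0" using N_neq_0 by simp
  then show ?thesis using 1[of y] y X(2) hg_hc by auto
 qed
 then show ?thesis unfolding f(2) by(intro h.subspace_sum[OF J_sub])
qed

text \<open>\<open>left_basis\<close> gives no coordinates on the right, so the coproduct is used
  instead. If \<open>mu\<close> kills \<open>J\<close> and has \<open>mu x = 1\<close>, contracting
  the coproduct of \<open>x * N\<close> with \<open>mu\<close> leaves only \<open>N\<close> up to
  sign, coming from the leading terms \<open>1 \<otimes> x\<close> and
  \<open>N \<otimes> 1\<close>.\<close>

lemma annihilator_left_homog:
 assumes "x:hg n" "x * N = 0"
 shows "x:J"
proof (rule ccontr)
 assume "x ~: J"
 then obtain mu where lam:"linear_on hs (*) hc mu" "mu x = 1" "!!w. w:J==>mu w = 0"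
  "!!i y. y:hg i==>i ~= n==>mu y = 0"
  using h.graded_functional[OF J_graded assms(1)] by blast
 note bil = bilinear_contract[OF lam(1)]
 obtain ns0 where ns0:"rep dN N ns0" "!!i b c. (i,b,c):set ns0==>b:Z & c:Z"
  using sub_rep[OF N_Z N_hg] by blast
 obtain ns where ns:"rep dN N ((dN,N,1) # ns)" "!!i b c. (i,b,c):set ns==>c:Z & i < dN"
  using rep_right[OF N_hg ns0(1)] ns0(2) by fastforce
 obtain xs where xs:"rep n x ((0,1,x) # xs)" "!!i a b. (i,a,b):set xs==>0 < i & i <= n"
  using rep_left_ex[OF assms(1)] by blast
 have inner:"(SUM (j,c,e)<-(dN,N,1) # ns. hs (xsign s (n - i) j) (hs (mu (b * e)) (a * c)))
  = hs (xsign s (n - i) dN) (hs (mu b) (a * N))" if b:"b:hc" for i a b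
 proof -
  have "(SUM (j,c,e)<-ns. hs (xsign s (n - i) j) (hs (mu (b * e)) (a * c))) = 0"
  proof (rule sum_list_zero2)
  fix j c e assume j:"(j,c,e):set ns"
  then have "e:Z" "e:hg (dN - j)" "j < dN" using ns(2)[OF j] rep_mem[OF ns(1),of j c e] by auto
  then have "b * e:J"
  unfolding set_prod_def using b counit_hg[of e "dN - j"]
  by(intro h.span_base) (auto simp:augmentation_ideal_def)
  then show "hs (xsign s (n - i) j) (hs (mu (b * e)) (a * c)) = 0" using lam(3) by simp
  qed
  then show ?thesis by simp
 qed
 have "0 = sweedler H (%a b. hs (mu b) a) (x * N)"
  using assms(2) rep_eval[OF rep_zero h.vector_space_axioms bil] by simp
 also have "... = (SUM (i,a,b)<-(0,1,x) # xs. SUM (j,c,e)<-(dN,N,1) # ns.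
  hs (xsign s (n - i) j) (hs (mu (b * e)) (a * c)))"
  by(rule rep_times_eval[OF xs(1) hg_hc[OF assms(1)] ns(1) N_hc h.vector_space_axioms bil])
 also have "... = (SUM (i,a,b)<-(0,1,x) # xs. hs (xsign s (n - i) dN) (hs (mu b) (a * N)))"
  by(rule sum_list_cong2) (use inner rep_mem_hc[OF xs(1)] in blast)
 also have "... = hs (xsign s n dN) N + (SUM (i,a,b)<-xs. hs (xsign s (n - i) dN) (hs (mu b) (a * N)))"
  using lam(2) by simp
 also have "(SUM (i,a,b)<-xs. hs (xsign s (n - i) dN) (hs (mu b) (a * N))) = 0"
 proof (rule sum_list_zero2)
  fix i a b assume i:"(i,a,b):set xs"
  then have "b:hg (n - i)" "i > 0" using rep_mem[OF xs(1),of i a b] xs(2)[OF i] by auto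
  then show "hs (xsign s (n - i) dN) (hs (mu b) (a * N)) = 0" using lam(4)[of b "n - i"] by simp
 qed
 finally have "hs (xsign s n dN) N = 0" by simp
 then show False using N_neq_0 sign by(auto simp:xsign_def split: if_splits)
qed

lemma hcomp_mult_right:
 assumes "x:hc" "y:hg m"
 shows "hcomp hg (x * y) n = hcomp hg x (n - m) * y"
 using assms(1)
proof (induction rule: h.homog_induct)
 case (add u v)
 then show ?case using assms hg_hc by(simp add:distrib_right h.hcomp_add)
next
 case (homog i u)
 then show ?case using mult_hg[OF homog assms(2)] by(auto simp:h.hcomp_homog)
qed auto

lemma annihilator_left:
 assumes "x:hc" "x * N = 0"
 shows "x:J"
proof -
 have "hcomp hg x n:J" for n
  using annihilator_left_homog[OF h.hcomp_G[OF assms(1)]] hcomp_mult_right[OF assms(1) N_hg,of "n + dN"] assms(2)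
  by simp
 then show ?thesis
  by(subst h.hcomp_sum'[OF assms(1)]) (rule h.subspace_sum[OF J_sub])
qed

end

subsection \<open>Graded modules\<close>

lemma alg_simps [simp]: "acarrier (alg H) = hcarrier H" "aadd (alg H) = (+)" "azero (alg H) = 0"
 "amult (alg H) = (*)" "aone (alg H) = 1" "ascale (alg H) = hscale H" "agrade (alg H) = hgrade H"
 by(auto simp:alg_def)

definition msub :: "('k,'a,'v) gmodule => 'v set => ('k,'a,'v) gmodule" where
 "msub M K = M\<lparr>mcarrier := K,mgrade := (%i. mgrade M i Int K)\<rparr>"

lemma msub_simps [simp]: "mcarrier (msub M K) = K" "mscale (msub M K) = mscale M"
 "mact (msub M K) = mact M" "mgrade (msub M K) = (%i. mgrade M i Int K)"
 by(auto simp:msub_def)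

text \<open>Over the finite-dimensional H, finitely generated means finite-dimensional: products of
  a basis of H with the generators span, and conversely scalars act through
  \<open>hs c 1\<close>.\<close>

lemma (in hopf) gr_iff:"gr (alg H) M \<longleftrightarrow> graded_module (alg H) M
 & (EX B. finite B & mcarrier M <= Modules.module.span (mscale M) B)"
proof (cases "graded_module (alg H) M")
 case True
 then interpret m: gvs "mscale M" "mcarrier M" "mgrade M"
  by(simp add:graded_module_def gvs_def gvs_axioms_def)
 have lin:"!!a. a:hc==>linear_on (mscale M) (mscale M) (mcarrier M) (mact M a)"
  and closed:"!!a m. a:hc==>m:mcarrier M==>mact M a m:mcarrier M"
  and lin2:"!!m. m:mcarrier M==>linear_on hs (mscale M) hc (%a. mact M a m)"
  and one:"!!m. m:mcarrier M==>mact M 1 m = m"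
  using True by(auto simp:graded_module_def linear_on_def)
 show ?thesis
 proof
  assume "gr (alg H) M"
  then obtain S where S:"finite S" "S <= mcarrier M"
  "!!m. m:mcarrier M==>EX f. (ALL x:S. f x:hc) & m = (SUM x:S. mact M (f x) x)"
  unfolding gr_def by auto
  obtain B where B:"B <= hc" "h.independent B" "hc <= h.span B"
  using h.maximal_independent_subset by blast
  have finB:"finite B" by(rule h.independent_finite[OF B(2,1)])
  let ?C = "(%(b,x). mact M b x) ` (B \<times> S)"
  have 1:"mact M a x:m.span ?C" if x:"x:S" and a:"a:hc" for a x
  proof -
  have "a:hc & mact M a x:m.span ?C"
  if "a:h.span B" for a
  using that
  proof (induction rule: h.span_induct_alt)
  case base
  show ?case using h.linear_on_0[OF lin2 h.subV] S(2) x by(auto simp:m.span_zero)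
  next
  case (step c b a)
  have "b:hc" "x:mcarrier M" using step B(1) S(2) x by auto
  moreover have "mact M b x:m.span ?C" using step x by(intro m.span_base) auto
  ultimately show ?case using step
  by(auto simp:linear_on_add[OF lin2] linear_on_scale[OF lin2] m.span_add m.span_scale)
  qed
  then show ?thesis using a B(3) by blast
  qed
  have "mcarrier M <= m.span ?C"
  proof
  fix m assume "m:mcarrier M"
  then obtain f where "ALL x:S. f x:hc" "m = (SUM x:S. mact M (f x) x)" using S(3) by blast
  then show "m:m.span ?C" using 1 by(auto intro!:m.span_sum)
  qed
  then show "graded_module (alg H) M & (EX B. finite B & mcarrier M <= m.span B)"
  using True S(1) finB by(intro conjI exI[of _ ?C]) auto
 next
  assume *: "graded_module (alg H) M & (EX B. finite B & mcarrier M <= m.span B)"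
  interpret m: fgvs "mscale M" "mcarrier M" "mgrade M" using * by unfold_locales auto
  obtain B where B:"B <= mcarrier M" "m.independent B" "mcarrier M <= m.span B"
  using m.maximal_independent_subset by blast
  have finB:"finite B" by(rule m.independent_finite[OF B(2,1)])
  have "EX f. (ALL x:B. f x:hc) & m = (SUM x:B. mact M (f x) x)" if m:"m:mcarrier M" for m
  proof -
  obtain c where c:"m = (SUM x:B. mscale M (c x) x)"
  using m B(3) by(auto simp:m.span_finite[OF finB])
  have "mscale M (c x) x = mact M (hs (c x) 1) x" if "x:B" for x
  using that B(1) by(auto simp:linear_on_scale[OF lin2] one)
  then have "m = (SUM x:B. mact M (hs (c x) 1) x)" using c by simp
  then show ?thesis by(intro exI[of _ "%x. hs (c x) 1"]) auto
  qed
  then show "gr (alg H) M" using True B(1) finB unfolding gr_def by auto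
 qed
qed (simp add:gr_def)

locale hmod = hopf s H for s and H :: "('k::field,'h::ring_1) hopf" +
 fixes M :: "('k,'h,'v::ab_group_add) gmodule"
 assumes M:"gr (alg H) M"
begin

abbreviation "mV == mcarrier M"
abbreviation "sc == mscale M"
abbreviation "mG == mgrade M"
abbreviation "act == mact M"

lemma gmod:"graded_module (alg H) M"
 using M by(simp add:gr_iff)

sublocale m: fgvs sc mV mG
proof -
 interpret m: gvs sc mV mG
  using gmod by(simp add:graded_module_def gvs_def gvs_axioms_def)
 show "fgvs sc mV mG" using M by unfold_locales (simp add:gr_iff)
qed

lemma act_closed [simp]: "a:hc==>m:mV==>act a m:mV"
 and act_linear:"a:hc==>linear_on sc sc mV (act a)"
 and act_add_left:"a:hc==>b:hc==>m:mV==>act (a + b) m = act a m + act b m"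
 and act_mult:"a:hc==>b:hc==>m:mV==>act (a * b) m = act a (act b m)"
 and act_scale_left:"a:hc==>m:mV==>act (hs c a) m = sc c (act a m)"
 and act_one [simp]: "m:mV==>act 1 m = m"
 and act_deg:"a:hg i==>m:mG j==>act a m:mG (i + j)"
 using gmod by(auto simp:graded_module_def)

lemma act_linear_left:"m:mV==>linear_on hs sc hc (%a. act a m)"
 by(auto intro!:linear_onI simp:act_add_left act_scale_left)

lemma act_add:"a:hc==>m:mV==>m':mV==>act a (m + m') = act a m + act a m'"
 and act_scale:"a:hc==>m:mV==>act a (sc c m) = sc c (act a m)"
 using act_linear by(auto simp:linear_on_def)

lemma act_0 [simp]: "a:hc==>act a 0 = 0"
 by(rule m.linear_on_0[OF act_linear m.subV])

lemma act_0_left [simp]: "m:mV==>act 0 m = 0"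
 by(rule h.linear_on_0[OF act_linear_left h.subV])

lemma act_sum:"a:hc==>(!!i. i:I==>f i:mV)==>act a (SUM i:I. f i) = (SUM i:I. act a (f i))"
 by(rule m.linear_on_sum[OF act_linear m.subV])

lemma act_sum_left:"m:mV==>(!!i. i:I==>f i:hc)==>act (SUM i:I. f i) m = (SUM i:I. act (f i) m)"
 by(rule h.linear_on_sum[OF act_linear_left h.subV])

lemma act_diff:"a:hc==>m:mV==>m':mV==>act a (m - m') = act a m - act a m'"
 by(rule m.linear_on_diff[OF act_linear m.subV])

lemma act_diff_left:"a:hc==>b:hc==>m:mV==>act (a - b) m = act a m - act b m"
 by(rule h.linear_on_diff[OF act_linear_left h.subV])

lemma mV_add [simp]: "x:mV==>y:mV==>x + y:mV"
 and mV_scale [simp]: "x:mV==>sc c x:mV"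
 and mV_0 [simp]: "0:mV"
 and mV_uminus [simp]: "x:mV==>- x:mV"
 and mV_diff [simp]: "x:mV==>y:mV==>x - y:mV"
 by(auto intro: m.subspace_add m.subspace_scale m.subspace_0 m.subspace_neg m.subspace_diff m.subV)

lemma mG_mV:"x:mG i==>x:mV"
 by(rule m.G_V)

lemma hcomp_act:
 assumes "a:hg i" "x:mV"
 shows "hcomp mG (act a x) n = act a (hcomp mG x (n - i))"
 using assms(2)
proof (induction rule: m.homog_induct)
 case zero
 show ?case using assms hg_hc by simp
next
 case (add u v)
 then show ?case using assms hg_hc by(simp add:act_add m.hcomp_add m.hcomp_V)
next
 case (homog j u)
 then show ?case using act_deg[OF assms(1) homog] assms hg_hc by(auto simp:m.hcomp_homog)
qed

lemma hcomp_act_right: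
 assumes "a:hc" "x:mG j"
 shows "hcomp mG (act a x) n = act (hcomp hg a (n - j)) x"
 using assms(1)
proof (induction rule: h.homog_induct)
 case zero
 show ?case using assms mG_mV by simp
next
 case (add u v)
 then show ?case using assms mG_mV by(simp add:act_add_left m.hcomp_add h.hcomp_add h.hcomp_V)
next
 case (homog i u)
 then show ?case using act_deg[OF homog assms(2)] assms mG_mV by(auto simp:h.hcomp_homog m.hcomp_homog)
qed

text \<open>The invariants of the module: positive degree elements span the augmentation ideal, so H
  acts on them through the counit, as \<open>soc_act\<close> states.\<close>

definition soc :: "'v => bool" where
 "soc m \<longleftrightarrow> m:mV & (ALL i a. i > 0 --> a:hg i --> act a m = 0)"

lemma soc_act:
 assumes "soc m" "a:hc"
 shows "act a m = sc (eps a) m"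
 using assms(2)
proof (induction rule: h.homog_induct)
 case zero
 show ?case using assms by(simp add:soc_def)
next
 case (add u v)
 then show ?case using assms by(simp add:soc_def act_add_left linear_on_add[OF counit_linear] m.scale_left_distrib)
next
 case (homog i u)
 show ?case
 proof (cases "i > 0")
  case True
  then show ?thesis using homog assms counit_hg[OF homog] by(auto simp:soc_def)
 next
  case False
  then consider "u = 0" | "i = 0" using hg_nonneg[OF homog] by force
  then show ?thesis
  proof cases
  case 2
  then have "u = hs (eps u) 1" using hg_0_counit homog by simp
  then have "act u m = act (hs (eps u) 1) m" by simp
  then show ?thesis using assms by(simp add:soc_def act_scale_left)
  qed (use assms in "simp add:soc_def")
 qed
qed

lemma soc_Lam:"m:mV==>soc (act Lam m)"
 unfolding soc_def using mult_Lam(1) hg_hc by(auto simp:act_mult[symmetric])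

definition gsub :: "'v set => bool" where
 "gsub K \<longleftrightarrow> m.graded_sub K & (ALL a:hc. ALL k:K. act a k:K)"

lemma gsubD:"gsub K==>m.subspace K" "gsub K==>k:K==>k:mV"
 "gsub K==>k:K==>hcomp mG k i:K" "gsub K==>a:hc==>k:K==>act a k:K"
 by(auto simp:gsub_def m.graded_sub_def)

lemma gsub_mV:"gsub mV"
 by(auto simp:gsub_def m.graded_sub_V)

lemma gsub_Int:"gsub K==>gsub L==>gsub (K Int L)"
 by(auto simp:gsub_def m.graded_sub_def m.subspace_inter)

lemma hmod_msub:
 assumes "gsub K"
 shows "hmod s H (msub M K)"
proof -
 have K:"m.graded_sub K" "!!a k. a:hc==>k:K==>act a k:K" "!!k. k:K==>k:mV"
  using assms by(auto simp:gsub_def m.graded_sub_def)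
 interpret k: fgvs sc K "%i. mG i Int K" by(rule m.fgvs_sub[OF K(1)])
 have "graded_module (alg H) (msub M K)"
  unfolding graded_module_def msub_simps alg_simps
  using k.subV k.graded K(2,3) act_deg m.vector_space_axioms
  by(intro conjI linear_on_subset[OF act_linear] allI ballI)
  (auto simp:act_add_left act_mult act_scale_left hg_hc intro!:linear_on_subset[OF act_linear])
 then show ?thesis using k.fd by unfold_locales (simp add:gr_iff)
qed

text \<open>A nonzero homogeneous element of \<open>K\<close> in the highest possible degree is
  killed by everything of positive degree.\<close>

lemma socle_nonzero:
 assumes K:"gsub K" and x:"x:K" "x ~= 0"
 obtains y i where "y:K" "y:mG i" "y ~= 0" "soc y"
proof -
 let ?D = "{i. EX y:K. y:mG i & y ~= 0}"
 have "finite ?D" by(rule finite_subset[OF _ m.finite_degrees]) auto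
 have "x:mV" using K x gsubD by blast
 then have "EX i. hcomp mG x i ~= 0" using m.V_eqI[of x 0] x by auto
 then have "?D ~= {}" using K x gsubD(3) m.hcomp_G[OF \<open>x:mV\<close>] by blast
 from Max_in[OF \<open>finite ?D\<close> this] obtain y where y:"y:K" "y:mG (Max ?D)" "y ~= 0" by blast
 have "act a y = 0" if "i > 0" "a:hg i" for i a
 proof (rule ccontr)
  assume "act a y ~= 0"
  moreover have "act a y:K" "act a y:mG (i + Max ?D)"
  using gsubD(4)[OF K hg_hc y(1)] act_deg y that by auto
  ultimately have "i + Max ?D:?D" by blast
  then have "i + Max ?D <= Max ?D" using \<open>finite ?D\<close> by(rule Max_ge[rotated])
  then show False using that by simp
 qed
 then have "soc y" using y mG_mV by(auto simp:soc_def)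
 then show thesis using that[of y "Max ?D"] y by auto
qed

subsection \<open>Free submodules\<close>

definition hspan :: "'v set => 'v set" where
 "hspan X = {SUM x:X. act (f x) x | f. ALL x:X. f x:hc}"

text \<open>Homogeneous free generators of the submodule \<open>hspan X\<close>, which may be
  smaller than the whole module.\<close>

definition free_basis :: "'v set => bool" where
 "free_basis X \<longleftrightarrow> finite X & X <= (UN i. mG i)
  & (ALL f. (ALL x:X. f x:hc) --> (SUM x:X. act (f x) x) = 0 --> (ALL x:X. f x = 0))"

lemma hspanI:"(!!x. x:X==>f x:hc)==>(SUM x:X. act (f x) x):hspan X"
 by(auto simp:hspan_def)

lemma hspan_ex:"p:hspan X==>EX f. (ALL x:X. f x:hc) & p = (SUM x:X. act (f x) x)"
 by(auto simp:hspan_def)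

lemma free_basisD:
 assumes "free_basis X"
 shows "finite X" "x:X==>EX i. x:mG i" "x:X==>x:mV"
  "(!!x. x:X==>f x:hc)==>(SUM x:X. act (f x) x) = 0==>x:X==>f x = 0"
 using assms mG_mV by(auto simp:free_basis_def)

lemma gsub_hspan:
 assumes "X <= (UN i. mG i)"
 shows "gsub (hspan X)"
proof -
 have XV:"X <= mV" using assms mG_mV by auto
 have "m.subspace (hspan X)"
 proof (rule m.subspaceI)
  show "0:hspan X" using hspanI[of X "%_. 0"] XV by(auto simp:subset_iff cong: sum.cong)
 next
  fix p q assume pq:"p:hspan X" "q:hspan X"
  obtain f where f:"ALL x:X. f x:hc" "p = (SUM x:X. act (f x) x)"
  using hspan_ex[OF pq(1)] by(elim exE conjE)
  obtain g where g:"ALL x:X. g x:hc" "q = (SUM x:X. act (g x) x)"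
  using hspan_ex[OF pq(2)] by(elim exE conjE)
  have "p + q = (SUM z:X. act (f z + g z) z)"
  unfolding f(2) g(2) sum.distrib[symmetric]
  by(intro sum.cong) (use XV f g in "auto simp:act_add_left")
  then show "p + q:hspan X" using f g hspanI[of X "%z. f z + g z"] by simp
 next
  fix c x assume "x:hspan X"
  then obtain f where f:"ALL x:X. f x:hc" "x = (SUM x:X. act (f x) x)" by(elim hspan_ex[THEN exE] conjE)
  note f = f[rule_format]
  then have "sc c x = (SUM z:X. act (hs c (f z)) z)"
  unfolding f(2) m.scale_sum_right by(intro sum.cong) (use XV f(1) in "auto simp:act_scale_left")
  then show "sc c x:hspan X" using f hspanI[of X "%z. hs c (f z)"] by simp
 qed
 moreover have "hspan X <= mV"
  using XV by(auto simp:hspan_def intro!:m.subspace_sum m.subV)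
 moreover have "hcomp mG p i:hspan X" if p:"p:hspan X" for p i
 proof -
  obtain f where f:"ALL x:X. f x:hc" "p = (SUM x:X. act (f x) x)" using hspan_ex[OF p] by(elim exE conjE)
  note f = f[rule_format]
  have "ALL x:X. EX j. x:mG j" using assms by auto
  then obtain d where d:"!!x. x:X==>x:mG (d x)" by metis
  have "hcomp mG p i = (SUM x:X. hcomp mG (act (f x) x) i)"
  unfolding f(2) by(rule m.hcomp_sums) (use f(1) XV in auto)
  also have "... = (SUM x:X. act (hcomp hg (f x) (i - d x)) x)"
  by(intro sum.cong refl hcomp_act_right f(1) d)
  also have "...:hspan X" by(intro hspanI h.hcomp_V f(1))
  finally show ?thesis .
 qed
 moreover have "act a p:hspan X" if a:"a:hc" and p:"p:hspan X" for a p
 proof -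
  obtain f where f:"ALL x:X. f x:hc" "p = (SUM x:X. act (f x) x)" using hspan_ex[OF p] by(elim exE conjE)
  note f = f[rule_format]
  have "act a p = (SUM x:X. act a (act (f x) x))"
  unfolding f(2) by(rule act_sum[OF a]) (use f(1) XV in auto)
  also have "... = (SUM x:X. act (a * f x) x)"
  by(intro sum.cong) (use f(1) XV a in "auto simp:act_mult")
  also have "...:hspan X" by(intro hspanI mult_hc a f(1))
  finally show ?thesis .
 qed
 ultimately show ?thesis by(auto simp:gsub_def m.graded_sub_def)
qed

lemma free_gsub:"free_basis X==>gsub (hspan X)"
 by(rule gsub_hspan) (simp add:free_basis_def)

lemma hspan_base:"finite X==>X <= mV==>x:X==>x:hspan X"
proof -
 assume a:"finite X" "X <= mV" "x:X"
 have "(SUM y:X. act (if y = x then 1 else 0) y) = (SUM y:X. if y = x then x else 0)"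
  by(intro sum.cong) (use a in auto)
 also have "... = x" using a by simp
 finally show ?thesis using hspanI[of X "%y. if y = x then 1 else 0"] by simp
qed

lemma hspan_minimal:"X <= K==>gsub K==>hspan X <= K"
 by(auto simp:hspan_def gsubD(4) subset_iff intro!:m.subspace_sum gsubD(1))

text \<open>Each homogeneous component of \<open>x\<close> is again an integral, so only the top
  degree can occur.\<close>

lemma integral_general:
 assumes x:"x:hc" and int:"!!i a. i > 0==>a:hg i==>a * x = 0"
 shows "EX c. x = hs c Lam"
proof -
 have "hcomp hg x j = 0 | j = htop" for j
 proof (rule ccontr)
  assume *: "~ (hcomp hg x j = 0 | j = htop)"
  have "a * hcomp hg x j = 0" if "i > 0" "a:hg i" for i a
  proof -
  have "hcomp hg (a * x) n = a * hcomp hg x (n - i)" for n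
  using x
  proof (induction rule: h.homog_induct)
  case (add u v)
  then show ?case using hg_hc[OF that(2)] by(simp add:distrib_left h.hcomp_add)
  next
  case (homog k u)
  then show ?case using mult_hg[OF that(2) homog] by(auto simp:h.hcomp_homog)
  qed auto
  from this[of "i + j"] show ?thesis using int[OF that] by simp
  qed
  then have "j = htop" using integral_unique(1)[OF h.hcomp_G[OF x]] * by blast
  then show False using * by simp
 qed
 then have "x = hcomp hg x htop"
  using h.hcomp_sum[OF x,of "{htop}"] by auto
 then show ?thesis using hg_htop h.hcomp_G[OF x] by metis
qed

text \<open>By freeness the coefficients of an invariant are integrals, that is, multiples of
  \<open>Lam\<close>. Hence an invariant of a free module is \<open>Lam\<close> times an
  element.\<close>

lemma soc_free:
 assumes X:"free_basis X" and y:"y:hspan X" "soc y"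
 obtains c where "y = (SUM x:X. sc (c x) (act Lam x))" "y = act Lam (SUM x:X. sc (c x) x)" "(SUM x:X. sc (c x) x):hspan X"
proof -
 obtain f where f:"ALL x:X. f x:hc" "y = (SUM x:X. act (f x) x)" using hspan_ex[OF y(1)] by(elim exE conjE)
  note f = f[rule_format]
 have XV:"X <= mV" using free_basisD(3)[OF X] by auto
 have "EX c. f x = hs c Lam" if x:"x:X" for x
 proof (rule integral_general[OF f(1)[OF x]])
  fix i a assume a:"(0::int) < i" "a:hg i"
  have "(SUM x:X. act (a * f x) x) = (SUM x:X. act a (act (f x) x))"
  by(intro sum.cong) (use f(1) XV a hg_hc in "auto simp:act_mult")
  also have "... = act a y" unfolding f(2) by(rule act_sum[symmetric]) (use f(1) XV a hg_hc in auto)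
  also have "... = 0" using y(2) a by(auto simp:soc_def)
  finally show "a * f x = 0"
  by(rule free_basisD(4)[OF X,of "%x. a * f x",rotated]) (use f(1) a hg_hc x in auto)
 qed
 then obtain c where c:"!!x. x:X==>f x = hs (c x) Lam" by metis
 have 1:"y = (SUM x:X. sc (c x) (act Lam x))"
  unfolding f(2) by(intro sum.cong) (use c XV in "auto simp:act_scale_left")
 have 2:"act Lam (SUM x:X. sc (c x) x) = (SUM x:X. act Lam (sc (c x) x))"
  by(rule act_sum) (use XV in auto)
 also have "... = y" unfolding 1 by(intro sum.cong) (use XV in "auto simp:act_scale")
 finally have "y = act Lam (SUM x:X. sc (c x) x)" by simp
 moreover have "(SUM x:X. sc (c x) x):hspan X"
  using hspan_base[OF free_basisD(1)[OF X] XV]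
  by(intro m.subspace_sum gsubD(1)[OF free_gsub[OF X]] m.subspace_scale) auto
 ultimately show thesis using that 1 by blast
qed

text \<open>Freeness can be tested on \<open>Lam\<close>-multiples: a homogeneous relation stays one
  after multiplication by positive degree elements, so by downward induction its coefficients are
  killed by these and are multiples of \<open>Lam\<close>.\<close>

lemma free_basisI:
 assumes X:"finite X" "X <= (UN i. mG i)"
  and ind:"!!c x. (SUM x:X. sc (c x) (act Lam x)) = 0==>x:X==>c x = 0"
 shows "free_basis X"
proof -
 have "ALL x:X. EX j. x:mG j" using X by auto
 then obtain d where d:"!!x. x:X==>x:mG (d x)" by metis
 have XV:"X <= mV" using d mG_mV by blast
 have homog:"ALL x:X. f x = 0" if "!!x. x:X==>f x:hg (n - d x)" "(SUM x:X. act (f x) x) = 0" for f n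
  using that
 \<comment> \<open>A nontrivial relation has degree at most the largest
   \<open>htop + d x\<close>.\<close>
 proof (induction "nat (Max ((%x. htop + d x) ` X) - n)" arbitrary: n f rule: less_induct)
  case less
  show ?case
  proof (rule ccontr)
  assume "~ (ALL x:X. f x = 0)"
  then obtain z where z:"z:X" "f z ~= 0" by blast
  let ?m = "Max ((%x. htop + d x) ` X)"
  have "n - d z <= htop" using hg_above[of "n - d z"] less.prems(1)[OF z(1)] z(2) by force
  moreover have "htop + d z <= ?m" using X(1) z(1) by(intro Max_ge) auto
  ultimately have nm:"n <= ?m" by simp
  have fhc:"f x:hc" if "x:X" for x using less.prems(1) that hg_hc by blast
  have kill:"a * f x = 0" if a:"i > 0" "a:hg i" and x:"x:X" for i a x
  proof (cases "n < ?m")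
  case True
  have "(SUM x:X. act (a * f x) x) = (SUM x:X. act a (act (f x) x))"
  by(intro sum.cong) (use fhc XV a hg_hc in "auto simp:act_mult")
  also have "... = act a (SUM x:X. act (f x) x)"
  by(rule act_sum[symmetric]) (use fhc XV a hg_hc in auto)
  also have "... = 0" using less.prems a hg_hc by simp
  finally have s:"(SUM x:X. act (a * f x) x) = 0" .
  have "a * f x:hg (i + n - d x)" if "x:X" for x
  using mult_hg[OF a(2) less.prems(1)[OF that]] by(simp add:algebra_simps)
  moreover have "nat (?m - (i + n)) < nat (?m - n)" using True a by simp
  ultimately show ?thesis using less.hyps[of "i + n" "%x. a * f x"] s x by blast
  next
  case False
  have "htop + d x <= ?m" using X(1) x by(intro Max_ge) auto
  then have "i + (n - d x) > htop" using False nm a by simp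
  then show ?thesis using hg_above mult_hg[OF a(2) less.prems(1)[OF x]] by auto
  qed
  have "EX c. f x = hs c Lam" if "x:X" for x
  by(rule integral_general[OF fhc[OF that]]) (use kill that in blast)
  then obtain c where c:"!!x. x:X==>f x = hs (c x) Lam" by metis
  have "(SUM x:X. sc (c x) (act Lam x)) = (SUM x:X. act (f x) x)"
  by(intro sum.cong) (use c XV in "auto simp:act_scale_left")
  then have "c z = 0" using ind z less.prems(2) by simp
  then show False using c z by simp
  qed
 qed
 have "f x = 0" if f:"!!x. x:X==>f x:hc" "(SUM x:X. act (f x) x) = 0" and x:"x:X" for f x
 proof -
  have "hcomp hg (f x) n = 0" for n
  proof -
  have "(SUM y:X. act (hcomp hg (f y) (n + d x - d y)) y) = (SUM y:X. hcomp mG (act (f y) y) (n + d x))"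
  by(intro sum.cong refl hcomp_act_right[symmetric] f(1) d)
  also have "... = hcomp mG (SUM y:X. act (f y) y) (n + d x)"
  by(rule m.hcomp_sums[symmetric]) (use f(1) XV in auto)
  also have "... = 0" using f(2) by simp
  finally have s:"(SUM y:X. act (hcomp hg (f y) (n + d x - d y)) y) = 0" .
  have "ALL y:X. hcomp hg (f y) (n + d x - d y) = 0"
  by(rule homog[of "%y. hcomp hg (f y) (n + d x - d y)" "n + d x",OF _ s]) (rule h.hcomp_G[OF f(1)])
  then show ?thesis using x by force
  qed
  then show ?thesis using h.V_eqI[OF f(1)[OF x],of 0] by simp
 qed
 then show ?thesis using X by(auto simp:free_basis_def)
qed

definition idirect :: "'v set => 'v set => bool" where
 "idirect P K \<longleftrightarrow> gsub P & gsub K & P Int K = {0} & (ALL m:mV. EX p:P. EX k:K. m = p + k)"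

text \<open>Free modules are injective: the functionals \<open>\<Sum> h\<^sub>x x \<mapsto> frob h\<^sub>x\<close> on a free submodule extend
  to \<open>M\<close>, and the largest submodule in their common kernel is a complement.\<close>

lemma free_complement:
 assumes X:"free_basis X"
 obtains K where "idirect (hspan X) K"
proof -
 have XV:"X <= mV" and finX:"finite X" using free_basisD(1,3)[OF X] by auto
 have P:"gsub (hspan X)" by(rule free_gsub[OF X])
 have "ALL x:X. EX j. x:mG j" using free_basisD(2)[OF X] by auto
 then obtain d where d:"!!x. x:X==>x:mG (d x)" by metis
 define coef where "coef p = (SOME f. (ALL x:X. f x:hc) & p = (SUM x:X. act (f x) x))" for p
 have coef:"coef (SUM x:X. act (f x) x) x = f x" if f:"!!x. x:X==>f x:hc" and x:"x:X" for f x
 proof -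
  let ?g = "coef (SUM x:X. act (f x) x)"
  have "EX g. (ALL x:X. g x:hc) & (SUM x:X. act (f x) x) = (SUM x:X. act (g x) x)" using f by blast
  from someI_ex[OF this] have g:"ALL x:X. ?g x:hc" "(SUM x:X. act (f x) x) = (SUM x:X. act (?g x) x)"
  unfolding coef_def by auto
  have "(SUM x:X. act (?g x - f x) x) = (SUM x:X. act (?g x) x - act (f x) x)"
  by(intro sum.cong) (use f g XV in "auto simp:act_diff_left")
  also have "... = 0" using g(2) by(simp add:sum_subtractf)
  finally have "?g x - f x = 0"
  by(rule free_basisD(4)[OF X,of "%x. ?g x - f x",rotated]) (use f g x in auto)
  then show ?thesis by simp
 qed
 have lin:"linear_on sc (*) (hspan X) (%p. frob (coef p x))" if x:"x:X" for x
 proof (rule linear_onI)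
  fix p q assume pq:"p:hspan X" "q:hspan X"
  obtain f where f:"ALL x:X. f x:hc" "p = (SUM x:X. act (f x) x)"
  using hspan_ex[OF pq(1)] by(elim exE conjE)
  obtain g where g:"ALL x:X. g x:hc" "q = (SUM x:X. act (g x) x)"
  using hspan_ex[OF pq(2)] by(elim exE conjE)
  note fg = f[rule_format] g[rule_format]
  have s:"p + q = (SUM z:X. act (f z + g z) z)"
  unfolding fg(2,4) sum.distrib[symmetric] by(intro sum.cong) (use XV fg in "auto simp:act_add_left")
  have "coef (p + q) x = f x + g x" unfolding s by(rule coef) (use fg x in auto)
  moreover have "coef p x = f x" "coef q x = g x" unfolding fg(2,4) using coef fg x by auto
  ultimately show "frob (coef (p + q) x) = frob (coef p x) + frob (coef q x)"
  using fg x by(simp add:linear_on_add[OF frob_linear])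
 next
  fix c p assume "p:hspan X"
  then obtain f where f:"ALL x:X. f x:hc" "p = (SUM x:X. act (f x) x)" by(elim hspan_ex[THEN exE] conjE)
  note f = f[rule_format]
  have s:"sc c p = (SUM z:X. act (hs c (f z)) z)"
  unfolding f(2) m.scale_sum_right by(intro sum.cong) (use XV f in "auto simp:act_scale_left")
  have "coef (sc c p) x = hs c (f x)" unfolding s by(rule coef) (use f x in auto)
  moreover have "coef p x = f x" unfolding f(2) using coef f x by auto
  ultimately show "frob (coef (sc c p) x) = c * frob (coef p x)"
  using f x by(simp add:linear_on_scale[OF frob_linear])
 qed
 have "EX e. linear_on sc (*) UNIV e & (ALL p:hspan X. e p = frob (coef p x))" if "x:X" for x
  using m.linear_on_extend[OF vector_space_times gsubD(1)[OF P] lin[OF that]] by metis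
 then obtain e where e:"!!x. x:X==>linear_on sc (*) UNIV (e x)"
  "!!x p. x:X==>p:hspan X==>e x p = frob (coef p x)" by metis
 \<comment> \<open>Looking only at degree \<open>d x + htop\<close>, the degree of
   \<open>Lam\<close> times \<open>x\<close>, makes the functional homogeneous, so that the
   submodule \<open>K\<close> below is graded.\<close>
 define nu where "nu x v = e x (hcomp mG v (d x + htop))" for x v
 have nu_lin:"linear_on sc (*) mV (nu x)" if "x:X" for x
  unfolding nu_def using linear_on_add[OF e(1)[OF that]] linear_on_scale[OF e(1)[OF that]]
  by(intro linear_onI) (auto simp:m.hcomp_add m.hcomp_scale)
 have frob_comp:"frob (hcomp hg a htop) = frob a" if "a:hc" for a
  using that
 proof (induction rule: h.homog_induct)
  case (add u v)
  then show ?case by(simp add:h.hcomp_add linear_on_add[OF frob_linear] h.hcomp_V)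
 next
  case (homog i u)
  then show ?case using frob_hg[OF homog] by(auto simp:h.hcomp_homog)
 qed auto
 have nu_P:"nu x (SUM z:X. act (f z) z) = frob (f x)" if f:"!!x. x:X==>f x:hc" and x:"x:X" for f x
 proof -
  have "hcomp mG (SUM z:X. act (f z) z) (d x + htop) = (SUM z:X. hcomp mG (act (f z) z) (d x + htop))"
  by(rule m.hcomp_sums) (use f XV in auto)
  also have "... = (SUM z:X. act (hcomp hg (f z) (d x + htop - d z)) z)"
  by(intro sum.cong refl hcomp_act_right f d)
  finally have *: "hcomp mG (SUM z:X. act (f z) z) (d x + htop) = (SUM z:X. act (hcomp hg (f z) (d x + htop - d z)) z)" .
  have g:"!!z. z:X==>hcomp hg (f z) (d x + htop - d z):hc" using f h.hcomp_V by blast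
  show ?thesis
  unfolding nu_def *
  using e(2)[OF x hspanI[OF g]] coef[OF g x] frob_comp[OF f[OF x]] by simp
 qed
 define K where "K = {v:mV. ALL x:X. ALL y:hc. nu x (act y v) = 0}"
 have nu_act:"linear_on hs (*) hc (%y. nu x (act y v))" if "x:X" "v:mV" for x v
  using linear_on_add[OF nu_lin[OF that(1)]] linear_on_scale[OF nu_lin[OF that(1)]] that(2)
  by(intro linear_onI) (auto simp:act_add_left act_scale_left)
 have nu_homog:"nu x (act y v) = e x (act y (hcomp mG v (d x + htop - j)))"
  if "x:X" "v:mV" "y:hg j" for x v y j
  unfolding nu_def by(subst hcomp_act[OF that(3,2)]) simp
 have e0:"e x 0 = 0" if "x:X" for x
  using m.linear_on_0[OF e(1)[OF that]] by simp
 have gK:"gsub K"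
 proof -
  have "m.subspace K"
  by(rule m.subspaceI)
  (auto simp:K_def act_add act_scale linear_on_add[OF nu_lin] linear_on_scale[OF nu_lin]
  m.linear_on_0[OF nu_lin m.subV])
  moreover have "hcomp mG v n:K" if v:"v:K" for v n
  proof -
  have vV:"v:mV" using v by(simp add:K_def)
  have "nu x (act y (hcomp mG v n)) = 0" if x:"x:X" and y:"y:hc" for x y
  using y
  proof (induction rule: h.homog_induct)
  case zero
  then show ?case using h.linear_on_0[OF nu_act[OF x m.hcomp_V[OF vV]] h.subV] by simp
  next
  case (add a b)
  then show ?case using linear_on_add[OF nu_act[OF x m.hcomp_V[OF vV]]] by simp
  next
  case (homog j a)
  have a:"a:hc" using homog hg_hc by auto
  have "nu x (act a (hcomp mG v n)) = e x (act a (hcomp mG (hcomp mG v n) (d x + htop - j)))"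
  by(rule nu_homog[OF x m.hcomp_V[OF vV] homog])
  also have "... = (if d x + htop - j = n then e x (act a (hcomp mG v (d x + htop - j))) else 0)"
  using m.hcomp_homog[OF m.hcomp_G[OF vV,of n]] e0[OF x] a by simp
  also have "... = (if d x + htop - j = n then nu x (act a v) else 0)"
  using nu_homog[OF x vV homog] by simp
  also have "... = 0" using v x a by(auto simp:K_def)
  finally show ?case .
  qed
  then show ?thesis using m.hcomp_V[OF vV] by(auto simp:K_def)
  qed
  moreover have "act a v:K" if "a:hc" "v:K" for a v
  using that by(auto simp:K_def act_mult[symmetric])
  ultimately show ?thesis by(auto simp:gsub_def m.graded_sub_def K_def)
 qed
 have "p = 0" if p:"p:hspan X" "p:K" for p
 proof -
  obtain f where f:"ALL x:X. f x:hc" "p = (SUM x:X. act (f x) x)" using hspan_ex[OF p(1)] by(elim exE conjE)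
  note f = f[rule_format]
  have "f x = 0" if x:"x:X" for x
  proof (rule frob_nondeg[OF f(1)[OF x]])
  fix y assume y:"y:hc"
  have "act y p = (SUM x:X. act (y * f x) x)"
  unfolding f(2) by(subst act_sum) (use y f XV in "auto simp:act_mult intro!:sum.cong")
  then have "nu x (act y p) = frob (y * f x)" using nu_P[of "%x. y * f x"] f y x by simp
  then show "frob (y * f x) = 0" using p(2) x y by(auto simp:K_def)
  qed
  then show ?thesis unfolding f(2) by(intro sum.neutral) (use XV in auto)
 qed
 moreover have "EX p:hspan X. EX k:K. v = p + k" if v:"v:mV" for v
 proof -
  \<comment> \<open>The Frobenius form represents the functional sending \<open>y\<close> to
    \<open>nu x (act y v)\<close>; the representing elements are the coefficients of the projection
    of \<open>v\<close>.\<close>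
  have "EX h:hc. ALL y:hc. nu x (act y v) = frob (y * h)" if "x:X" for x
  using frob_represents[OF nu_act[OF that v]] by metis
  then obtain g where g:"!!x. x:X==>g x:hc" "!!x y. x:X==>y:hc==>nu x (act y v) = frob (y * g x)"
  by metis
  let ?p = "SUM x:X. act (g x) x"
  have pP:"?p:hspan X" by(rule hspanI[OF g(1)])
  have pV:"?p:mV" using gsubD(2)[OF P pP] .
  have "nu x (act y (v - ?p)) = 0" if x:"x:X" and y:"y:hc" for x y
  proof -
  have "act y ?p = (SUM x:X. act (y * g x) x)"
  by(subst act_sum) (use y g XV in "auto simp:act_mult intro!:sum.cong")
  then have "nu x (act y ?p) = frob (y * g x)" using nu_P[of "%x. y * g x"] g y x by simp
  then show ?thesis using g(2)[OF x y] v y pV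
  by(simp add:act_diff m.linear_on_diff[OF nu_lin[OF x] m.subV])
  qed
  then have "v - ?p:K" using v pV by(auto simp:K_def)
  then show ?thesis using pP by(intro bexI[of _ ?p] bexI[of _ "v - ?p"]) auto
 qed
 ultimately have "idirect (hspan X) K"
  unfolding idirect_def using P gK m.subspace_0[OF gsubD(1)[OF P]] m.subspace_0[OF gsubD(1)[OF gK]] by blast
 then show thesis by(rule that)
qed

text \<open>The elements of \<open>X\<close> are homogeneous preimages of a basis of the image of
  \<open>Lam\<close>. This image then lies in \<open>hspan X\<close>, so \<open>Lam\<close> kills
  any complement.\<close>

lemma decomposition:
 obtains X K where "free_basis X" "idirect (hspan X) K" "!!k. k:K==>act Lam k = 0"
proof -
 let ?S = "act Lam ` (UN i. mG i)"
 obtain C where C:"C <= ?S" "m.independent C" "?S <= m.span C"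
  using m.maximal_independent_subset by blast
 have CV:"C <= mV" using C(1) mG_mV by auto
 have finC:"finite C" by(rule m.independent_finite[OF C(2) CV])
 have "ALL c:C. EX x. (EX i. x:mG i) & act Lam x = c" using C(1) by fast
 then obtain g where g:"!!c. c:C==>(EX i. g c:mG i) & act Lam (g c) = c" by metis
 define X where "X = g ` C"
 have inj:"inj_on g C" by(rule inj_on_inverseI[of _ "act Lam"]) (use g in auto)
 have X:"finite X" "X <= (UN i. mG i)" using finC g by(auto simp:X_def)
 have XV:"X <= mV" using X mG_mV by auto
 have fb:"free_basis X"
 proof (rule free_basisI[OF X])
  fix c x assume s:"(SUM x:X. sc (c x) (act Lam x)) = 0" and x:"x:X"
  have "(SUM x:X. sc (c x) (act Lam x)) = (SUM y:C. sc (c (g y)) y)"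
  unfolding X_def sum.reindex[OF inj] by(intro sum.cong) (use g in auto)
  then have "(SUM y:C. sc (c (g y)) y) = 0" using s by simp
  from m.independentD[OF C(2) finC subset_refl this] show "c x = 0" using x by(auto simp:X_def)
 qed
 obtain K where K:"idirect (hspan X) K" using free_complement[OF fb] .
 have gs:"gsub (hspan X)" "gsub K" using K by(auto simp:idirect_def)
 have CP:"C <= hspan X"
 proof
  fix c assume c:"c:C"
  then have "g c:hspan X" using hspan_base[OF X(1) XV] by(simp add:X_def)
  from gsubD(4)[OF gs(1) Lam_hc this] show "c:hspan X" using g[OF c] by simp
 qed
 have LP:"act Lam v:hspan X" if "v:mV" for v
  using that
 proof (induction rule: m.homog_induct)
  case zero
  show ?case using m.subspace_0[OF gsubD(1)[OF gs(1)]] by simp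
 next
  case (add x y)
  then show ?case using m.subspace_add[OF gsubD(1)[OF gs(1)]] by(simp add:act_add)
 next
  case (homog i x)
  then have "act Lam x:m.span C" using C(3) by auto
  then show ?case using m.span_minimal[OF CP gsubD(1)[OF gs(1)]] by auto
 qed
 have "act Lam k = 0" if "k:K" for k
  using LP[OF gsubD(2)[OF gs(2) that]] gsubD(4)[OF gs(2) Lam_hc that] K by(auto simp:idirect_def)
 then show thesis using that fb K by blast
qed

end

section \<open>Modules consisting of one line in degree 0 and a free part\<close>

context hmod
begin

lemma idirect_sym:"idirect P K==>idirect K P"
 unfolding idirect_def by(metis add.commute Int_commute)

lemma idirectD:
 assumes "idirect P K"
 shows "gsub P" "gsub K" "x:P==>x:K==>x = 0" "m:mV==>EX p:P. EX k:K. m = p + k"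
 using assms by(auto simp:idirect_def)

text \<open>\<open>M\<close> is the direct sum of a free module and the trivial module in degree \<open>0\<close>.\<close>

definition KF :: bool where
 "KF \<longleftrightarrow> (EX X x. free_basis X & x:mG 0 & x ~= 0 & soc x & x ~: hspan X
  & (ALL m:mV. EX p:hspan X. EX c. m = p + sc c x))"

lemma KF_I:
 assumes "free_basis X" "idirect (hspan X) K" "y:mG 0" "y ~= 0" "soc y" "K = range (%c. sc c y)"
 shows KF
proof -
 have "y:K" using assms(6) m.scale_one[of y] by(metis rangeI)
 then have "y ~: hspan X" using idirectD(3)[OF assms(2)] assms(4) by blast
 moreover have "EX p:hspan X. EX c. m = p + sc c y" if "m:mV" for m
  using idirectD(4)[OF assms(2) that] assms(6) by blast
 ultimately show ?thesis unfolding KF_def using assms by blast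
qed

text \<open>This replaces a Krull-Schmidt argument. An invariant common to \<open>K\<close> and
  \<open>hspan X'\<close> is a \<open>Lam\<close>-multiple, hence lies in \<open>hspan X\<close>
  because \<open>Lam\<close> kills \<open>K\<close>, hence is 0. So \<open>K\<close> embeds into the
  line \<open>M / hspan X'\<close>, and \<open>K = 0\<close> would make \<open>x\<close> a
  \<open>Lam\<close>-multiple in \<open>hspan X'\<close>.\<close>

lemma KF_complement:
 assumes pos:"htop > 0" and X:"free_basis X" and K:"idirect (hspan X) K"
  and KL:"!!k. k:K==>act Lam k = 0" and KF
 obtains y where "y:mG 0" "y ~= 0" "soc y" "K = range (%c. sc c y)"
proof -
 obtain X' x where X':"free_basis X'" and x:"x:mG 0" "x ~= 0" "soc x" "x ~: hspan X'"
  and dec:"!!m. m:mV==>EX p:hspan X'. EX c. m = p + sc c x"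
  using \<open>KF\<close> unfolding KF_def by metis
 note P = free_gsub[OF X] and P' = free_gsub[OF X'] and gK = idirectD(2)[OF K]
 note sP = gsubD(1)[OF P] and sP' = gsubD(1)[OF P'] and sK = gsubD(1)[OF gK]
 have xV:"x:mV" using x mG_mV by blast
 have Lx:"act Lam x = 0" using x(3) pos Lam_hg by(auto simp:soc_def)
 have K0:"k = 0" if k:"k:K" "k:hspan X'" for k
 proof (rule ccontr)
  assume "k ~= 0"
  then obtain y i where y:"y:K" "y:hspan X'" "y ~= 0" "soc y"
  using socle_nonzero[OF gsub_Int[OF gK P'],of k] k by blast
  obtain c where c:"y = act Lam (SUM z:X'. sc (c z) z)" "(SUM z:X'. sc (c z) z):hspan X'"
  using soc_free[OF X' y(2,4)] by blast
  let ?v = "SUM z:X'. sc (c z) z"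
  have vV:"?v:mV" using gsubD(2)[OF P' c(2)] .
  obtain q k' where q:"q:hspan X" "k':K" "?v = q + k'" using idirectD(4)[OF K vV] by blast
  have "y = act Lam q" using c(1) q KL gsubD(2)[OF P q(1)] gsubD(2)[OF gK q(2)] by(simp add:act_add)
  then have "y:hspan X" using gsubD(4)[OF P Lam_hc q(1)] by simp
  then show False using idirectD(3)[OF K] y by blast
 qed
 have "K ~= {0}"
 proof
  assume "K = {0}"
  then have "x:hspan X" using idirectD(4)[OF K xV] by auto
  then obtain c where c:"x = act Lam (SUM z:X. sc (c z) z)" "(SUM z:X. sc (c z) z):hspan X"
  using soc_free[OF X _ x(3)] by blast
  let ?v = "SUM z:X. sc (c z) z"
  have vV:"?v:mV" using gsubD(2)[OF P c(2)] .
  obtain p d where p:"p:hspan X'" "?v = p + sc d x" using dec[OF vV] by blast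
  have "x = act Lam p" using c(1) p Lx xV gsubD(2)[OF P' p(1)] by(simp add:act_add act_scale)
  then show False using gsubD(4)[OF P' Lam_hc p(1)] x(4) by simp
 qed
 then obtain k where "k:K" "k ~= 0" using m.subspace_0[OF sK] by blast
 then obtain n where n:"hcomp mG k n ~= 0" "hcomp mG k n:K" "hcomp mG k n:mG n"
  using m.V_eqI[of k 0] gsubD(2,3)[OF gK] m.hcomp_G by auto
 define y where "y = hcomp mG k n"
 have y:"y ~= 0" "y:K" "y:mG n" using n by(auto simp:y_def)
 obtain p c where pc:"p:hspan X'" "y = p + sc c x" using dec y mG_mV by blast
 have "c ~= 0" using K0[OF y(2)] y(1) pc by auto
 \<comment> \<open>In another degree, the degree 0 part of \<open>y = p + sc c x\<close> would put
   \<open>x\<close> into \<open>hspan X'\<close>.\<close>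
 have n0:"n = 0"
 proof (rule ccontr)
  assume "n ~= 0"
  have "0 = hcomp mG y 0" using y(3) \<open>n ~= 0\<close> by(simp add:m.hcomp_homog)
  also have "... = hcomp mG p 0 + sc c x"
  using pc gsubD(2)[OF P' pc(1)] xV x(1) by(simp add:m.hcomp_add m.hcomp_scale m.hcomp_homog)
  finally have "sc c x = - hcomp mG p 0" by(simp add:eq_neg_iff_add_eq_0 add.commute)
  then have "sc c x:hspan X'" using m.subspace_neg[OF sP' gsubD(3)[OF P' pc(1)]] by simp
  then have "sc (inverse c) (sc c x):hspan X'" by(rule m.subspace_scale[OF sP'])
  then show False using \<open>c ~= 0\<close> x(4) by simp
 qed
 have Ky:"k:range (%c. sc c y)" if k:"k:K" for k
 proof -
  obtain q d where q:"q:hspan X'" "k = q + sc d x" using dec gsubD(2)[OF gK k] by blast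
  have "k - sc (d / c) y = q - sc (d / c) p"
  using q pc \<open>c ~= 0\<close> by(simp add:m.scale_right_distrib)
  moreover have "q - sc (d / c) p:hspan X'" using q pc m.subspace_diff[OF sP'] m.subspace_scale[OF sP'] by blast
  moreover have "k - sc (d / c) y:K" using k y m.subspace_diff[OF sK] m.subspace_scale[OF sK] by blast
  ultimately have "k - sc (d / c) y = 0" using K0 by metis
  then show ?thesis by(metis eq_iff_diff_eq_0 rangeI)
 qed
 have K_eq:"K = range (%c. sc c y)" using Ky y(2) m.subspace_scale[OF sK] by auto
 have "act a y = 0" if a:"i > 0" "a:hg i" for i a
 proof -
  have "act a y:mG i" using act_deg[OF a(2) y(3)] n0 by simp
  moreover have "act a y:mG 0"
  using Ky[OF gsubD(4)[OF gK hg_hc[OF a(2)] y(2)]] y(3) n0 m.subspace_scale[OF m.subG] by auto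
  ultimately show ?thesis using m.G_disjoint a(1) by(metis less_irrefl)
 qed
 then have "soc y" using y gsubD(2)[OF gK] by(auto simp:soc_def)
 then show thesis using that[of y] y n0 K_eq by simp
qed

lemma free_basis_empty:"free_basis {}"
 by(simp add:free_basis_def)

lemma hspan_mono:
 assumes "finite Y" "Y <= mV" "X <= Y"
 shows "hspan X <= hspan Y"
proof
 fix p assume "p:hspan X"
 then obtain f where f:"ALL x:X. f x:hc" "p = (SUM x:X. act (f x) x)" by(elim hspan_ex[THEN exE] conjE)
 have "p = (SUM x:Y. act (if x:X then f x else 0) x)"
  unfolding f(2) by(rule sum.mono_neutral_cong_left) (use assms in auto)
 then show "p:hspan Y" using hspanI[of Y "%x. if x:X then f x else 0"] f(1) by auto
qed

end

subsection \<open>Isomorphisms of modules\<close>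

locale hmod_iso = M: hmod s H M + N: hmod s H N
 for s and H :: "('k::field,'h::ring_1) hopf" and M :: "('k,'h,'v::ab_group_add) gmodule"
  and N :: "('k,'h,'w::ab_group_add) gmodule" +
 fixes phi :: "'v => 'w"
 assumes bij:"bij_betw phi (mcarrier M) (mcarrier N)"
  and map_add:"!!x y. x:mcarrier M==>y:mcarrier M==>phi (x + y) = phi x + phi y"
  and map_act:"!!a x. a:hcarrier H==>x:mcarrier M==>phi (mact M a x) = mact N a (phi x)"
  and map_grade:"!!i x. x:mgrade M i==>phi x:mgrade N i"
begin

lemma mem [simp]: "x:M.mV==>phi x:N.mV"
 using bij by(auto simp:bij_betw_def)

lemma inj:"x:M.mV==>y:M.mV==>phi x = phi y==>x = y"
 using bij by(auto simp:bij_betw_def inj_on_def)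

lemma surj:"y:N.mV==>EX x:M.mV. y = phi x"
 using bij by(auto simp:bij_betw_def)

lemma scale:"x:M.mV==>phi (M.sc c x) = N.sc c (phi x)"
 using map_act[of "M.hs c 1" x] M.act_scale_left[of 1 x c] N.act_scale_left[of 1 "phi x" c] by simp

lemma linear:"linear_on M.sc N.sc M.mV phi"
 by(rule linear_onI) (auto simp:map_add scale)

lemma zero [simp]: "phi 0 = 0"
 by(rule M.m.linear_on_0[OF linear M.m.subV])

lemma eq_0:"x:M.mV==>phi x = 0==>x = 0"
 using inj[of x 0] by simp

lemma sum:"(!!i. i:I==>f i:M.mV)==>phi (SUM i:I. f i) = (SUM i:I. phi (f i))"
 by(rule M.m.linear_on_sum[OF linear M.m.subV])

lemma hcomp_eq:"x:M.mV==>hcomp N.mG (phi x) i = phi (hcomp M.mG x i)"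
proof (induction rule: M.m.homog_induct)
 case (add x y)
 then show ?case using \<open>x:M.mV\<close> by(simp add:map_add M.m.hcomp_add N.m.hcomp_add M.m.hcomp_V)
next
 case (homog j x)
 then show ?case using map_grade[OF homog] by(simp add:M.m.hcomp_homog N.m.hcomp_homog)
qed auto

text \<open>An isomorphism is only required to respect degrees forwards; comparing the components of
  \<open>phi x\<close> gives the converse.\<close>

lemma grade_inv:"x:M.mV==>phi x:N.mG i==>x:M.mG i"
proof -
 assume x:"x:M.mV" "phi x:N.mG i"
 have "phi (hcomp M.mG x i) = phi x" using hcomp_eq[OF x(1),of i] x(2) by(simp add:N.m.hcomp_homog)
 then have "hcomp M.mG x i = x" using inj x(1) M.m.hcomp_V by blast
 then show ?thesis using M.m.hcomp_G[OF x(1),of i] by simp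
qed

lemma inverse:"hmod_iso s H N M (inv_into M.mV phi)"
proof
 let ?i = "inv_into M.mV phi"
 have i:"?i y:M.mV" "phi (?i y) = y" if "y:N.mV" for y
  using that bij by(auto simp:bij_betw_def inv_into_into f_inv_into_f)
 show "bij_betw ?i N.mV M.mV" by(rule bij_betw_inv_into[OF bij])
 show "?i (x + y) = ?i x + ?i y" if "x:N.mV" "y:N.mV" for x y
  by(rule inj) (use that i in "auto simp:map_add")
 show "?i (N.act a x) = M.act a (?i x)" if "a:M.hc" "x:N.mV" for a x
  by(rule inj) (use that i in "auto simp:map_act")
 show "?i x:M.mG j" if "x:N.mG j" for j x
  using grade_inv[of "?i x" j] i[of x] that N.mG_mV by auto
qed

lemma soc:"M.soc x==>N.soc (phi x)"
 unfolding M.soc_def N.soc_def using map_act M.hg_hc by(metis mem zero)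

lemma inj_image:"X <= M.mV==>inj_on phi X"
 using inj by(auto simp:inj_on_def)

lemma sum_act:
 assumes "X <= M.mV" "!!x. x:X==>f (phi x):M.hc"
 shows "(SUM y:phi ` X. N.act (f y) y) = phi (SUM x:X. M.act (f (phi x)) x)"
proof -
 have "(SUM y:phi ` X. N.act (f y) y) = (SUM x:X. N.act (f (phi x)) (phi x))"
  by(simp add:sum.reindex[OF inj_image[OF assms(1)]])
 also have "... = (SUM x:X. phi (M.act (f (phi x)) x))"
  by(intro sum.cong) (use assms map_act in auto)
 also have "... = phi (SUM x:X. M.act (f (phi x)) x)"
  by(rule sum[symmetric]) (use assms in auto)
 finally show ?thesis .
qed

lemma hspan:"X <= M.mV==>p:M.mV==>phi p:N.hspan (phi ` X) \<longleftrightarrow> p:M.hspan X"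
proof
 assume X:"X <= M.mV" and p:"p:M.mV"
 {
  assume "phi p:N.hspan (phi ` X)"
  then obtain f where f:"ALL y:phi ` X. f y:M.hc" "phi p = (SUM y:phi ` X. N.act (f y) y)"
  by(elim N.hspan_ex[THEN exE] conjE)
  have "phi p = phi (SUM x:X. M.act (f (phi x)) x)" unfolding f(2) by(rule sum_act[OF X]) (use f in auto)
  moreover have "(SUM x:X. M.act (f (phi x)) x):M.mV"
  using f X by(intro M.m.subspace_sum M.m.subV) auto
  ultimately have "p = (SUM x:X. M.act (f (phi x)) x)" using inj[OF p] by blast
  then show "p:M.hspan X" using M.hspanI[of X "%x. f (phi x)"] f by auto
 next
  assume "p:M.hspan X"
  then obtain f where f:"ALL x:X. f x:M.hc" "p = (SUM x:X. M.act (f x) x)"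
  by(elim M.hspan_ex[THEN exE] conjE)
  define g where "g y = f (inv_into X phi y)" for y
  have g:"g (phi x) = f x" if "x:X" for x
  using inv_into_f_f[OF inj_image[OF X] that] by(simp add:g_def)
  have "phi p = (SUM y:phi ` X. N.act (g y) y)"
  by(subst sum_act[OF X]) (use f g in "auto intro!:arg_cong[of _ _ phi] sum.cong")
  moreover have "g y:M.hc" if "y:phi ` X" for y using that f g by auto
  ultimately show "phi p:N.hspan (phi ` X)" using N.hspanI[of "phi ` X" g] by simp
 }
qed

lemma free_basis:"M.free_basis X==>N.free_basis (phi ` X)"
proof -
 assume X:"M.free_basis X"
 have XV:"X <= M.mV" using M.free_basisD(3)[OF X] by auto
 have "f y = 0" if f:"ALL y:phi ` X. f y:M.hc" "(SUM y:phi ` X. N.act (f y) y) = 0" and y:"y:phi ` X" for f y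
 proof -
  have "phi (SUM x:X. M.act (f (phi x)) x) = 0"
  using f sum_act[OF XV,of f] by simp
  then have "(SUM x:X. M.act (f (phi x)) x) = 0"
  by(rule eq_0[rotated]) (intro M.m.subspace_sum[OF M.m.subV],use f(1) XV in auto)
  then have "f (phi x) = 0" if "x:X" for x
  by(rule M.free_basisD(4)[OF X,of "%x. f (phi x)",rotated]) (use f(1) that in auto)
  then show ?thesis using y by auto
 qed
 moreover have "phi ` X <= (UN i. N.mG i)" using M.free_basisD(2)[OF X] map_grade by blast
 ultimately show ?thesis using M.free_basisD(1)[OF X] by(auto simp:N.free_basis_def)
qed

lemma KF:"M.KF==>N.KF"
proof -
 assume M.KF
 then obtain X x where X:"M.free_basis X" and x:"x:M.mG 0" "x ~= 0" "M.soc x" "x ~: M.hspan X"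
  and dec:"!!m. m:M.mV==>EX p:M.hspan X. EX c. m = p + M.sc c x"
  unfolding M.KF_def by metis
 have XV:"X <= M.mV" using M.free_basisD(3)[OF X] by auto
 have xV:"x:M.mV" using x M.mG_mV by blast
 show N.KF
  unfolding N.KF_def
 proof (intro exI conjI ballI)
  show "N.free_basis (phi ` X)" by(rule free_basis[OF X])
  show "phi x:N.mG 0" "phi x ~= 0" "N.soc (phi x)" using map_grade x eq_0[OF xV] soc by auto
  show "phi x ~: N.hspan (phi ` X)" using hspan[OF XV xV] x by simp
  fix m assume "m:N.mV"
  then obtain m' where m':"m':M.mV" "m = phi m'" using surj by blast
  obtain p c where p:"p:M.hspan X" "m' = p + M.sc c x" using dec[OF m'(1)] by blast
  have pV:"p:M.mV" using M.gsubD(2)[OF M.free_gsub[OF X] p(1)] .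
  show "EX p:N.hspan (phi ` X). EX c. m = p + N.sc c (phi x)"
  using p m' pV xV hspan[OF XV pV] by(intro bexI[of _ "phi p"] exI[of _ c]) (auto simp:map_add scale)
 qed
qed

end

lemma (in hopf) gmod_iso_hmod:
 assumes "hmod s H M" "hmod s H N" "gmod_iso (alg H) M N"
 obtains phi where "hmod_iso s H M N phi"
proof -
 obtain phi where p:"bij_betw phi (mcarrier M) (mcarrier N)"
  "ALL x:mcarrier M. ALL y:mcarrier M. phi (x + y) = phi x + phi y"
  "ALL a:hc. ALL x:mcarrier M. phi (mact M a x) = mact N a (phi x)"
  "ALL i. phi ` mgrade M i <= mgrade N i"
  using assms(3) unfolding gmod_iso_def by auto
 interpret M: hmod s H M by fact
 interpret N: hmod s H N by fact
 have "hmod_iso s H M N phi" using p by unfold_locales (auto simp:image_subset_iff)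
 then show thesis by(rule that)
qed

lemma (in hmod_iso) gmod_iso:"gmod_iso (alg H) M N"
 unfolding gmod_iso_def using bij map_add map_act map_grade by auto

subsection \<open>Direct sums, trivial modules, and models\<close>

lemma (in hmod) hmod_image:
 fixes psi :: "'v => 'w::ab_group_add"
 assumes vs:"vector_space sc'" and lin:"linear_on sc sc' mV psi" and inj:"inj_on psi mV"
 obtains M' where "hmod_iso s H M M' psi"
proof -
 interpret V': vector_space sc' by fact
 define \<chi> where "\<chi> = inv_into mV psi"
 have chi:"\<chi> (psi x) = x" if "x:mV" for x using that inj by(simp add:\<chi>_def)
 note add = linear_on_add[OF lin] and scale = linear_on_scale[OF lin]
 have z:"psi 0 = 0" by(rule m.linear_on_0[OF lin m.subV])
 have sum:"psi (SUM i:I. f i) = (SUM i:I. psi (f i))" if "!!i. i:I==>f i:mV" for I :: "int set" and f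
  by(rule m.linear_on_sum[OF lin m.subV that])
 define M' where "M' = \<lparr>mcarrier = psi ` mV,mscale = sc',mact = (%a w. psi (act a (\<chi> w))),mgrade = (%i. psi ` mG i)\<rparr>"
 have sub:"V'.subspace (psi ` U)" if U:"m.subspace U" "U <= mV" for U
 proof (rule V'.subspaceI)
  show "0:psi ` U" using z m.subspace_0[OF U(1)] by(metis imageI)
  show "x + y:psi ` U" if "x:psi ` U" "y:psi ` U" for x y
  using that U add m.subspace_add[OF U(1)] by(auto simp:subset_iff) (metis imageI)
  show "sc' c x:psi ` U" if "x:psi ` U" for c x
  using that U scale m.subspace_scale[OF U(1)] by(auto simp:subset_iff) (metis imageI)
 qed
 have dec:"EX! c. decomposes (%i. psi ` mG i) (psi v) c" if v:"v:mV" for v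
 proof (rule ex1I[of _ "%i. psi (hcomp mG v i)"])
  have eq0:"psi (hcomp mG v i) = 0 \<longleftrightarrow> hcomp mG v i = 0" for i
  using inj z m.hcomp_V[OF v] by(metis inj_onD mV_0)
  have s:"psi v = (SUM i | hcomp mG v i ~= 0. psi (hcomp mG v i))"
  by(subst (1) m.hcomp_sum'[OF v],rule sum) (rule m.hcomp_V[OF v])
  show "decomposes (%i. psi ` mG i) (psi v) (%i. psi (hcomp mG v i))"
  proof (unfold decomposes_def,intro conjI allI)
  have e:"{i. psi (hcomp mG v i) ~= 0} = {i. hcomp mG v i ~= 0}" using eq0 by blast
  show "psi (hcomp mG v i):psi ` mG i" for i by(rule imageI[OF m.hcomp_G[OF v]])
  show "finite {i. psi (hcomp mG v i) ~= 0}" unfolding e by(rule m.hcomp_finite[OF v])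
  show "psi v = (SUM i | psi (hcomp mG v i) ~= 0. psi (hcomp mG v i))" unfolding e by(rule s)
  qed
 next
  fix c assume c:"decomposes (%i. psi ` mG i) (psi v) c"
  have ci:"\<chi> (c i):mG i & psi (\<chi> (c i)) = c i" for i
  proof -
  have "c i:psi ` mG i" using c unfolding decomposes_def by(elim conjE allE)
  then obtain x where "x:mG i" "c i = psi x" by(elim imageE)
  then show ?thesis using chi[of x] mG_mV by simp
  qed
  have eq0:"\<chi> (c i) = 0 \<longleftrightarrow> c i = 0" for i using ci[of i] chi[of 0] z by auto
  have cV:"\<chi> (c i):mV" for i using ci mG_mV by blast
  have E:"{i. \<chi> (c i) ~= 0} = {i. c i ~= 0}" using eq0 by blast
  have fin:"finite {i. \<chi> (c i) ~= 0}" unfolding E using c unfolding decomposes_def by(elim conjE)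
  have "psi v = (SUM i | c i ~= 0. c i)" using c unfolding decomposes_def by(elim conjE)
  also have "... = (SUM i | \<chi> (c i) ~= 0. psi (\<chi> (c i)))" unfolding E using ci by(intro sum.cong) auto
  also have "... = psi (SUM i | \<chi> (c i) ~= 0. \<chi> (c i))" by(rule sum[symmetric]) (rule cV)
  finally have eq:"psi v = psi (SUM i | \<chi> (c i) ~= 0. \<chi> (c i))" .
  have "(SUM i | \<chi> (c i) ~= 0. \<chi> (c i)):mV" by(intro m.subspace_sum[OF m.subV] cV)
  from inj_onD[OF inj eq v this] have vs:"v = (SUM i | \<chi> (c i) ~= 0. \<chi> (c i))" .
  have "decomposes mG v (%i. \<chi> (c i))"
  unfolding decomposes_def using ci fin by(intro conjI allI vs) auto
  then have "hcomp mG v = (%i. \<chi> (c i))" by(rule m.hcomp_unique[OF v])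
  then show "c = (%i. psi (hcomp mG v i))" using ci by auto
 qed
 have gm:"graded_module (alg H) M'"
  unfolding graded_module_def M'_def alg_simps gmodule.simps graded_by_def
  using vs sub[OF m.subV] sub[OF m.subG] mG_mV dec chi hg_hc act_deg
  by(auto simp:linear_on_def add[symmetric] scale[symmetric] act_add act_scale act_add_left act_mult act_scale_left
  subset_iff image_iff)
 obtain B where B:"finite B" "B <= mV" "mV <= m.span B"
  using m.maximal_independent_subset[of mV] m.independent_finite by metis
 have "psi ` mV <= V'.span (psi ` B)"
 proof safe
  fix v assume "v:mV"
  then have "v:m.span B" using B by auto
  then have "v:mV & psi v:V'.span (psi ` B)"
  proof (induction rule: m.span_induct_alt)
  case (step c x y)
  then show ?case using B(2) V'.span_base[of "psi x" "psi ` B"]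
  by(auto simp:add scale subset_iff V'.span_add V'.span_scale)
  qed (simp add:z V'.span_zero)
  then show "psi v:V'.span (psi ` B)" by simp
 qed
 then have "hmod s H M'" using gm B(1) by unfold_locales (auto simp:gr_iff M'_def)
 then interpret M': hmod s H M' .
 have "hmod_iso s H M M' psi"
  using inj add chi by unfold_locales (auto simp:M'_def bij_betw_def)
 then show thesis by(rule that)
qed

text \<open>Coordinates in a finite basis. Detection, endotriviality and free summands are
  formulated with modules whose elements are functions on the naturals, so modules of other types
  have to be moved there.\<close>

lemma (in hmod) model_exists:
 obtains M' :: "('k,'h) umodule" and psi where "hmod_iso s H M M' psi"
proof -
 obtain B where B:"B <= mV" "m.independent B" "mV <= m.span B"
  using m.maximal_independent_subset by blast
 have finB:"finite B" by(rule m.independent_finite[OF B(2,1)])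
 obtain e where e:"bij_betw e {..<card B} B" using ex_bij_betw_nat_finite[OF finB] by(auto simp:atLeast0LessThan)
 define psi where "psi v = (%n. if n < card B then m.representation B v (e n) else 0)" for v
 have lin:"linear_on sc fscale mV psi"
  using B by(intro linear_onI) (auto simp:psi_def fun_eq_iff fscale_def m.representation_add m.representation_scale subset_iff)
 have "inj_on psi mV"
 proof (rule inj_onI)
  fix x y assume xy:"x:mV" "y:mV" "psi x = psi y"
  have "m.representation B x b = m.representation B y b" if b:"b:B" for b
  proof -
  obtain n where "n < card B" "b = e n" using e b by(auto simp:bij_betw_def)
  then show ?thesis using fun_cong[OF xy(3),of n] by(simp add:psi_def)
  qed
  moreover have "m.representation B x b = m.representation B y b" if b:"b ~: B" for b
  using m.representation_ne_zero b by metis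
  ultimately have eq:"m.representation B x = m.representation B y" by blast
  have r:"(SUM b:B. sc (m.representation B v b) b) = v" if "v:mV" for v
  using m.sum_representation_eq[OF B(2),of v B] that B(3) finB by auto
  show "x = y" using r[OF xy(1)] r[OF xy(2)] unfolding eq by(rule trans[OF sym])
 qed
 from hmod_image[OF vector_space_fscale lin this] that show thesis by blast
qed

lemma (in hopf) hmod_triv:"hmod s H (triv H)"
proof -
 interpret K: vector_space "(*) :: 'k => 'k => 'k" by(rule vector_space_times)
 have dec:"decomposes (%i. if i = 0 then UNIV else {0}) v c \<longleftrightarrow> c = (%i. if i = 0 then v else 0)" for v :: 'k and c
 proof
  assume c:"decomposes (%i. if i = 0 then UNIV else {0}) v c"
  have 0:"c i = 0" if "i ~= 0" for i
  proof -
  have "c i:(if i = 0 then UNIV else {0})" using c unfolding decomposes_def by(elim conjE allE)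
  then show ?thesis using that by simp
  qed
  have "v = (SUM i | c i ~= 0. c i)" using c unfolding decomposes_def by(elim conjE)
  also have "... = (SUM i:{0}. c i)" by(rule sum.mono_neutral_left) (use 0 in auto)
  finally have "v = c 0" by simp
  then show "c = (%i. if i = 0 then v else 0)" using 0 by auto
 next
  assume "c = (%i. if i = 0 then v else 0)"
  then show "decomposes (%i. if i = 0 then UNIV else {0}) v c"
  by(cases "v = 0") (auto simp:decomposes_def)
 qed
 have act0:"eps a * m = 0" if "a:hg i" "i + j ~= 0" "m:(if j = 0 then UNIV else {0})" for a i j and m :: 'k
  using that counit_hg[of a i] by(auto split: if_splits)
 have gr:"eps a * m:(if i + j = 0 then UNIV else {0})"
  if "a:hg i" "m:(if j = 0 then UNIV else {0})" for a i j and m :: 'k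
  using act0[OF that(1) _ that(2)] by simp
 have 1:"linear_on (*) (*) UNIV ((*) (eps a))" for a by(simp add:linear_on_def distrib_left mult.left_commute)
 have 2:"K.subspace (if i = 0 then UNIV else {0})" for i :: int by simp
 have 3:"eps (a + b) * m = eps a * m + eps b * m" if "a:hc" "b:hc" for a b m
  using linear_on_add[OF counit_linear that] by(simp add:distrib_right)
 have 4:"eps (a * b) * m = eps a * (eps b * m)" if "a:hc" "b:hc" for a b m
  unfolding counit_mult[OF that] by(rule mult.assoc)
 have 5:"eps (hs c a) * m = c * (eps a * m)" if "a:hc" for a c m
  unfolding linear_on_scale[OF counit_linear that] by(rule mult.assoc)
 have "graded_by(*) UNIV (%i. if i = 0 then UNIV else {0::'k})"
  unfolding graded_by_def dec using 2 by auto
 then have "graded_module (alg H) (triv H)"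
  unfolding graded_module_def triv_def alg_simps gmodule.simps
  by(intro conjI allI ballI gr 1 3 4 5 K.vector_space_axioms K.subspace_UNIV UNIV_I) auto
 moreover have "UNIV <= K.span {1}" using K.span_singleton[of 1] by auto
 ultimately show ?thesis
  by unfold_locales (auto simp:gr_iff triv_def intro!:exI[of _ "{1}"])
qed

lemma (in hopf) hmod_dsum:
 fixes M :: "('k,'h,'v::ab_group_add) gmodule" and N :: "('k,'h,'w::ab_group_add) gmodule"
 assumes "hmod s H M" "hmod s H N"
 shows "hmod s H (dsum M N)"
proof -
 interpret M: hmod s H M by fact
 interpret N: hmod s H N by fact
 let ?sc = "%c (v,w). (M.sc c v,N.sc c w)"
 interpret P: vector_space ?sc
  by unfold_locales (auto simp:M.m.scale_right_distrib N.m.scale_right_distrib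
  M.m.scale_left_distrib N.m.scale_left_distrib)
 have sub:"P.subspace (U \<times> U')" if "M.m.subspace U" "N.m.subspace U'" for U U'
  using that unfolding P.subspace_def M.m.subspace_def N.m.subspace_def by(auto simp:zero_prod_def)
 have dec:"EX! c. decomposes (%i. M.mG i \<times> N.mG i) (v,w) c" if v:"v:M.mV" and w:"w:N.mV" for v w
 proof (rule ex1I[of _ "%i. (hcomp M.mG v i,hcomp N.mG w i)"])
  let ?c = "%i. (hcomp M.mG v i,hcomp N.mG w i)"
  let ?D = "{i. ?c i ~= 0}"
  have fin:"finite ?D"
  by(rule finite_subset[of _ "{i. hcomp M.mG v i ~= 0} Un {i. hcomp N.mG w i ~= 0}"])
  (use M.m.hcomp_finite[OF v] N.m.hcomp_finite[OF w] in "auto simp:zero_prod_def")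
  have "v = (SUM i:?D. hcomp M.mG v i)" "w = (SUM i:?D. hcomp N.mG w i)"
  by(rule M.m.hcomp_sum[OF v fin],simp add:zero_prod_def)
  (rule N.m.hcomp_sum[OF w fin],simp add:zero_prod_def)
  then have "(v,w) = (SUM i:?D. ?c i)" by(simp add:sum_prod)
  then show "decomposes (%i. M.mG i \<times> N.mG i) (v,w) ?c"
  unfolding decomposes_def using fin M.m.hcomp_G[OF v] N.m.hcomp_G[OF w] by blast
 next
  fix c assume c:"decomposes (%i. M.mG i \<times> N.mG i) (v,w) c"
  let ?D = "{i. c i ~= 0}"
  have fin:"finite ?D" and mem:"!!i. c i:M.mG i \<times> N.mG i" and s:"(v,w) = (SUM i:?D. c i)"
  using c unfolding decomposes_def by auto
  have "v = (SUM i:?D. fst (c i))" "w = (SUM i:?D. snd (c i))"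
  using arg_cong[OF s,of fst] arg_cong[OF s,of snd] by(auto simp:fst_sum snd_sum)
  then have "hcomp M.mG v = (%i. fst (c i))" "hcomp N.mG w = (%i. snd (c i))"
  using mem fin by(auto intro!:M.m.hcomp_eqI[OF fin] N.m.hcomp_eqI[OF fin] simp:mem_Times_iff)
  then show "c = (%i. (hcomp M.mG v i,hcomp N.mG w i))" by auto
 qed
 have gm:"graded_module (alg H) (dsum M N)"
  unfolding graded_module_def dsum_def alg_simps gmodule.simps graded_by_def
  using P.vector_space_axioms sub[OF M.m.subV N.m.subV] sub[OF M.m.subG N.m.subG] M.mG_mV N.mG_mV dec
  M.act_deg N.act_deg
  by(auto simp:linear_on_def M.act_add N.act_add M.act_scale N.act_scale M.act_add_left N.act_add_left
  M.act_mult N.act_mult M.act_scale_left N.act_scale_left)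
 obtain B where B:"finite B" "M.mV <= M.m.span B" using M.m.fd by blast
 obtain C where C:"finite C" "N.mV <= N.m.span C" using N.m.fd by blast
 let ?D = "(%b. (b,0)) ` B Un (%c. (0,c)) ` C"
 have 1:"(v,0):P.span ?D" if "v:M.m.span B" for v
  using that
 proof (induction rule: M.m.span_induct_alt)
  case base
  then show ?case using P.span_zero by(simp add:zero_prod_def)
 next
  case (step c x y)
  have "(x,0):P.span ?D" using step by(intro P.span_base) auto
  from P.span_add[OF P.span_scale[OF this,of c] step(2)] show ?case by simp
 qed
 have 2:"(0,w):P.span ?D" if "w:N.m.span C" for w
  using that
 proof (induction rule: N.m.span_induct_alt)
  case base
  then show ?case using P.span_zero by(simp add:zero_prod_def)
 next
  case (step c x y)
  have "(0,x):P.span ?D" using step by(intro P.span_base) auto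
  from P.span_add[OF P.span_scale[OF this,of c] step(2)] show ?case by simp
 qed
 have "M.mV \<times> N.mV <= P.span ?D"
 proof safe
  fix v w assume "v:M.mV" "w:N.mV"
  then have "(v,0) + (0,w):P.span ?D" using 1 2 B C by(intro P.span_add) auto
  then show "(v,w):P.span ?D" by simp
 qed
 then show ?thesis using gm B(1) C(1)
  by unfold_locales (auto simp:gr_iff dsum_def intro!:exI[of _ ?D])
qed

subsection \<open>Freeness in the sense of \<open>gfree\<close>\<close>

text \<open>These laws suffice to recognize freeness by bases; they hold both for
  \<open>alg H\<close> and for quotients whose elements are cosets.\<close>

locale galg =
 fixes A :: "('k::field,'a) galgebra"
 assumes zero:"azero A:agrade A i" and one:"aone A:agrade A 0"
  and gc:"agrade A i <= acarrier A" and neq:"aone A ~= azero A"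
  and addc:"x:acarrier A==>y:acarrier A==>aadd A x y:acarrier A"
  and mulc:"x:acarrier A==>y:acarrier A==>amult A x y:acarrier A"
  and add0:"x:acarrier A==>aadd A x (azero A) = x" "x:acarrier A==>aadd A (azero A) x = x"
  and mul:"x:acarrier A==>amult A x (aone A) = x" "x:acarrier A==>amult A x (azero A) = azero A"
begin

lemma zero_c:"azero A:acarrier A" and one_c:"aone A:acarrier A"
 using zero one gc by auto

text \<open>Freeness as a product of shifts amounts to a homogeneous basis. Uniqueness compares two
  coefficient families, since \<open>galgebra\<close> has no field for differences.\<close>

lemma gfree_iff:
 fixes M :: "('k,'a,'v::ab_group_add) gmodule"
 assumes M:"graded_module A M"
 shows "gfree A M \<longleftrightarrow> (EX S. finite S & S <= (UN i. mgrade M i)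
  & (ALL m:mcarrier M. EX f. (ALL x:S. f x:acarrier A) & m = (SUM x:S. mact M (f x) x))
  & (ALL f g. (ALL x:S. f x:acarrier A) --> (ALL x:S. g x:acarrier A)
  --> (SUM x:S. mact M (f x) x) = (SUM x:S. mact M (g x) x) --> (ALL x:S. f x = g x)))"
  (is "_ \<longleftrightarrow> (EX S. ?P S)")
proof -
 interpret m: gvs "mscale M" "mcarrier M" "mgrade M"
  using M by(simp add:graded_module_def gvs_def gvs_axioms_def)
 have closed:"!!a m. a:acarrier A==>m:mcarrier M==>mact M a m:mcarrier M"
  and lin:"!!a. a:acarrier A==>linear_on (mscale M) (mscale M) (mcarrier M) (mact M a)"
  and addl:"!!a b m. a:acarrier A==>b:acarrier A==>m:mcarrier M==>mact M (aadd A a b) m = mact M a m + mact M b m"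
  and mull:"!!a b m. a:acarrier A==>b:acarrier A==>m:mcarrier M==>mact M (amult A a b) m = mact M a (mact M b m)"
  and onel:"!!m. m:mcarrier M==>mact M (aone A) m = m"
  and deg:"!!i j a m. a:agrade A i==>m:mgrade M j==>mact M a m:mgrade M (i + j)"
  using M unfolding graded_module_def by blast+
 have z:"mact M (azero A) m = 0" if "m:mcarrier M" for m
  using addl[OF zero_c zero_c that] add0(1)[OF zero_c] by simp
 show ?thesis
 proof
  assume "gfree A M"
  then obtain n :: nat and d :: "nat => int" and phi where phi:"bij_betw phi (\<Pi>\<^sub>E j\<in>{..<n}. acarrier A) (mcarrier M)"
  "ALL x:(\<Pi>\<^sub>E j\<in>{..<n}. acarrier A). ALL y:(\<Pi>\<^sub>E j\<in>{..<n}. acarrier A). phi (\<lambda>j\<in>{..<n}. aadd A (x j) (y j)) = phi x + phi y"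
  "ALL a:acarrier A. ALL x:(\<Pi>\<^sub>E j\<in>{..<n}. acarrier A). phi (\<lambda>j\<in>{..<n}. amult A a (x j)) = mact M a (phi x)"
  "ALL i. phi ` (\<Pi>\<^sub>E j\<in>{..<n}. agrade A (i - d j)) <= mgrade M i"
  unfolding gfree_def Let_def by(elim exE conjE)
  let ?D = "\<Pi>\<^sub>E j\<in>{..<n}. acarrier A"
  define u where "u j = (\<lambda>i\<in>{..<n}. if i = j then aone A else azero A)" for j :: nat
  have uD:"u j:?D" for j using zero_c one_c by(auto simp:u_def)
  define e where "e j = phi (u j)" for j
  have eM:"e j:mcarrier M" for j using phi(1) uD by(auto simp:e_def bij_betw_def)
  have edeg:"e j:mgrade M (d j)" if "j < n" for j
  proof -
  have "u j:(\<Pi>\<^sub>E i\<in>{..<n}. agrade A (d j - d i))" using zero one by(auto simp:u_def)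
  then show ?thesis using phi(4) by(auto simp:e_def)
  qed
  have expand:"phi x = (SUM j<n. mact M (x j) (e j))" if x:"x:?D" for x
  proof -
  \<comment> \<open>\<open>phi\<close> respects sums of two tuples, so a tuple is built up one
    coordinate at a time.\<close>
  define xs where "xs k = (\<lambda>i\<in>{..<n}. if i < k then x i else azero A)" for k
  have xsD:"xs k:?D" for k
  unfolding xs_def restrict_PiE_iff using PiE_mem[OF x] zero_c by simp
  have part:"k <= n==>phi (xs k) = (SUM j<k. mact M (x j) (e j))" for k
  proof (induction k)
  case 0
  have eq:"(\<lambda>j\<in>{..<n}. aadd A (xs 0 j) (xs 0 j)) = xs 0"
  using add0(1)[OF zero_c] by(auto simp:xs_def fun_eq_iff)
  have "phi (xs 0) = phi (xs 0) + phi (xs 0)"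
  using phi(2)[rule_format,OF xsD[of 0] xsD[of 0]] unfolding eq .
  then show ?case by simp
  next
  case (Suc k)
  have xk:"x k:acarrier A" using PiE_mem[OF x] Suc.prems by simp
  let ?y = "\<lambda>j\<in>{..<n}. amult A (x k) (u k j)"
  have yD:"?y:?D" unfolding restrict_PiE_iff using PiE_mem[OF uD[of k]] mulc[OF xk] by simp
  have eq:"(\<lambda>j\<in>{..<n}. aadd A (xs k j) (?y j)) = xs (Suc k)"
  proof
  fix j
  show "(\<lambda>j\<in>{..<n}. aadd A (xs k j) (?y j)) j = xs (Suc k) j"
  using PiE_mem[OF x,of j] xk add0 mul zero_c by(cases "j < n") (auto simp:xs_def u_def less_Suc_eq)
  qed
  have "phi (xs (Suc k)) = phi (xs k) + phi ?y"
  using phi(2)[rule_format,OF xsD[of k] yD] unfolding eq .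
  also have "phi ?y = mact M (x k) (e k)" using phi(3) xk uD[of k] by(simp add:e_def)
  finally show ?case using Suc by simp
  qed
  have "xs n = x"
  by(rule PiE_ext[OF xsD x]) (simp add:xs_def)
  then show ?thesis using part[of n] by simp
  qed
  have inj:"inj_on e {..<n}"
  proof (rule inj_onI)
  fix j k assume jk:"j:{..<n}" "k:{..<n}" "e j = e k"
  then have "u j = u k" using inj_onD[OF bij_betw_imp_inj_on[OF phi(1)] _ uD uD] by(simp add:e_def)
  then have "u j j = u k j" by simp
  then show "j = k" using jk(1,2) neq by(simp add:u_def split: if_splits)
  qed
  have sumS:"(SUM x:e ` {..<n}. mact M (f x) x) = phi (\<lambda>j\<in>{..<n}. f (e j))"
  if "ALL x:e ` {..<n}. f x:acarrier A" for f
  by(subst expand) (use that in "auto simp:sum.reindex[OF inj]")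
  show "EX S. ?P S"
  proof (intro exI[of _ "e ` {..<n}"] conjI ballI allI impI)
  show "e ` {..<n} <= (UN i. mgrade M i)" using edeg by auto
  fix m assume "m:mcarrier M"
  then obtain x where x:"x:?D" "m = phi x" using phi(1) by(auto simp:bij_betw_def)
  define f where "f y = x (inv_into {..<n} e y)" for y
  have f:"f (e j) = x j" if "j < n" for j using inv_into_f_f[OF inj] that by(simp add:f_def)
  have fD:"(\<lambda>j\<in>{..<n}. f (e j)):?D" unfolding restrict_PiE_iff using PiE_mem[OF x(1)] f by simp
  have "(\<lambda>j\<in>{..<n}. f (e j)) = x" by(rule PiE_ext[OF fD x(1)]) (simp add:f)
  moreover have "ALL x:e ` {..<n}. f x:acarrier A" using PiE_mem[OF x(1)] f by simp
  ultimately show "EX f. (ALL x:e ` {..<n}. f x:acarrier A) & m = (SUM x:e ` {..<n}. mact M (f x) x)"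
  using x sumS[of f] by(intro exI[of _ f]) simp
  next
  fix f g x assume fg:"ALL x:e ` {..<n}. f x:acarrier A" "ALL x:e ` {..<n}. g x:acarrier A"
  "(SUM x:e ` {..<n}. mact M (f x) x) = (SUM x:e ` {..<n}. mact M (g x) x)" "x:e ` {..<n}"
  then have "phi (\<lambda>j\<in>{..<n}. f (e j)) = phi (\<lambda>j\<in>{..<n}. g (e j))" using sumS by simp
  moreover have "(\<lambda>j\<in>{..<n}. f (e j)):?D" "(\<lambda>j\<in>{..<n}. g (e j)):?D"
  unfolding restrict_PiE_iff using fg(1,2) by simp_all
  ultimately have eq:"(\<lambda>j\<in>{..<n}. f (e j)) = (\<lambda>j\<in>{..<n}. g (e j))"
  by(rule inj_onD[OF bij_betw_imp_inj_on[OF phi(1)]])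
  obtain j where "j < n" "x = e j" using fg(4) by auto
  then show "f x = g x" using fun_cong[OF eq,of j] by simp
  qed simp
 next
  assume "EX S. ?P S"
  then obtain S where S:"finite S" "S <= (UN i. mgrade M i)"
  and gen:"ALL m:mcarrier M. EX f. (ALL x:S. f x:acarrier A) & m = (SUM x:S. mact M (f x) x)"
  and ind:"ALL f g. (ALL x:S. f x:acarrier A) --> (ALL x:S. g x:acarrier A)
  --> (SUM x:S. mact M (f x) x) = (SUM x:S. mact M (g x) x) --> (ALL x:S. f x = g x)"
  by(elim exE conjE)
  have SM:"S <= mcarrier M" using S(2) m.G_V by auto
  obtain e where e:"bij_betw e {..<card S} S" using ex_bij_betw_nat_finite[OF S(1)] by(auto simp:atLeast0LessThan)
  define n where "n = card S"
  have eS:"e j:S" if "j < n" for j using e that by(auto simp:bij_betw_def n_def)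
  have "ALL j<n. EX i. e j:mgrade M i" using eS S(2) by blast
  then obtain d where d:"!!j. j < n==>e j:mgrade M (d j)" by metis
  define e' where "e' = inv_into {..<n} e"
  have e':"e' (e j) = j" if "j < n" for j
  using e that by(auto simp:e'_def bij_betw_def n_def)
  have e'S:"e' x < n" "e (e' x) = x" if "x:S" for x
  proof -
  have "x:e ` {..<n}" using that e by(auto simp:bij_betw_def n_def)
  then show "e' x < n" "e (e' x) = x"
  using inv_into_into[of x e "{..<n}"] f_inv_into_f[of x e "{..<n}"] by(auto simp:e'_def)
  qed
  let ?D = "\<Pi>\<^sub>E j\<in>{..<n}. acarrier A"
  define phi where "phi x = (SUM j<n. mact M (x j) (e j))" for x
  have phiS:"phi x = (SUM y:S. mact M (x (e' y)) y)" for x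
  unfolding phi_def
  by(rule sum.reindex_bij_witness[of _ e' e]) (use e' e'S eS in auto)
  have eM:"e j:mcarrier M" if "j < n" for j using eS SM that by auto
  have "bij_betw phi ?D (mcarrier M)"
  unfolding bij_betw_def
  proof
  show "inj_on phi ?D"
  proof (rule inj_onI)
  fix x y assume xy:"x:?D" "y:?D" "phi x = phi y"
  have "ALL z:S. x (e' z) = y (e' z)"
  by(rule ind[rule_format,of "%z. x (e' z)" "%z. y (e' z)",THEN ballI])
  (use xy e'S phiS in auto)
  then have "x j = y j" if "j < n" for j using e'[OF that] eS[OF that] by metis
  then show "x = y" using xy by(intro PiE_ext[of x "{..<n}" _ y]) auto
  qed
  show "phi ` ?D = mcarrier M"
  proof (intro equalityI subsetI)
  fix m assume "m:phi ` ?D"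
  then show "m:mcarrier M" unfolding phi_def using eM closed by(auto intro!:m.subspace_sum[OF m.subV])
  next
  fix m assume "m:mcarrier M"
  then obtain f where f:"ALL x:S. f x:acarrier A" "m = (SUM x:S. mact M (f x) x)" using gen by metis
  have "phi (\<lambda>j\<in>{..<n}. f (e j)) = m" unfolding phiS f(2) by(intro sum.cong) (use e'S in auto)
  moreover have "(\<lambda>j\<in>{..<n}. f (e j)):?D" using f eS by auto
  ultimately show "m:phi ` ?D" by blast
  qed
  qed
  moreover have "phi (\<lambda>j\<in>{..<n}. aadd A (x j) (y j)) = phi x + phi y" if "x:?D" "y:?D" for x y
  unfolding phi_def sum.distrib[symmetric] by(intro sum.cong) (use that eM in "auto simp:addl PiE_iff")
  moreover have "phi (\<lambda>j\<in>{..<n}. amult A a (x j)) = mact M a (phi x)" if "a:acarrier A" "x:?D" for a x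
  proof -
  have "mact M a (phi x) = (SUM j<n. mact M a (mact M (x j) (e j)))"
  unfolding phi_def by(rule m.linear_on_sum[OF lin[OF that(1)] m.subV]) (use that eM closed in "auto simp:PiE_iff")
  also have "... = phi (\<lambda>j\<in>{..<n}. amult A a (x j))"
  unfolding phi_def by(intro sum.cong) (use that eM in "auto simp:mull PiE_iff")
  finally show ?thesis by simp
  qed
  moreover have "phi ` (\<Pi>\<^sub>E j\<in>{..<n}. agrade A (i - d j)) <= mgrade M i" for i
  proof safe
  fix x assume x:"x:(\<Pi>\<^sub>E j\<in>{..<n}. agrade A (i - d j))"
  have "mact M (x j) (e j):mgrade M i" if "j < n" for j
  using deg[of "x j" "i - d j" "e j" "d j"] d[OF that] x that by auto
  then show "phi x:mgrade M i" unfolding phi_def by(auto intro!:m.subspace_sum[OF m.subG])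
  qed
  ultimately show "gfree A M"
  unfolding gfree_def Let_def by(intro exI[of _ n] exI[of _ d] exI[of _ phi] conjI ballI allI)
 qed
qed

end

lemma (in hopf) galg_alg:"galg (alg H)"
 by unfold_locales (auto simp:one_neq_0 hg_hc)

lemma (in hmod) gfree_free_basis:"gfree (alg H) M \<longleftrightarrow> (EX X. free_basis X & mV = hspan X)"
proof -
 interpret A: galg "alg H" by(rule galg_alg)
 show ?thesis unfolding A.gfree_iff[OF gmod] alg_simps
 proof (intro ex_cong1 iffI)
  fix X assume "finite X & X <= (UN i. mG i) &
  (ALL m:mV. EX f. (ALL x:X. f x:hc) & m = (SUM x:X. act (f x) x)) &
  (ALL f g. (ALL x:X. f x:hc) --> (ALL x:X. g x:hc) -->
  (SUM x:X. act (f x) x) = (SUM x:X. act (g x) x) --> (ALL x:X. f x = g x))"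
  then have X:"finite X" "X <= (UN i. mG i)"
  and gen:"ALL m:mV. EX f. (ALL x:X. f x:hc) & m = (SUM x:X. act (f x) x)"
  and ind:"!!f g. (ALL x:X. f x:hc)==>(ALL x:X. g x:hc) ==>
  (SUM x:X. act (f x) x) = (SUM x:X. act (g x) x)==>(ALL x:X. f x = g x)"
  by simp_all
  have XV:"X <= mV" using X mG_mV by auto
  have "free_basis X"
  unfolding free_basis_def
  proof (intro conjI X allI impI)
  fix f assume f:"ALL x:X. f x:hc" "(SUM x:X. act (f x) x) = 0"
  have "(SUM x:X. act 0 x) = 0" by(rule sum.neutral) (use XV in auto)
  then show "ALL x:X. f x = 0" using f by(intro ind[of f "%_. 0"]) auto
  qed
  moreover have "mV <= hspan X" using gen by(auto simp:hspan_def)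
  ultimately show "free_basis X & mV = hspan X" using gsubD(2)[OF gsub_hspan[OF X(2)]] by auto
 next
  fix X assume X:"free_basis X & mV = hspan X"
  then have fb:"free_basis X" and sp:"mV = hspan X" by auto
  have XV:"X <= mV" using free_basisD(3)[OF fb] by auto
  show "finite X & X <= (UN i. mG i) &
  (ALL m:mV. EX f. (ALL x:X. f x:hc) & m = (SUM x:X. act (f x) x)) &
  (ALL f g. (ALL x:X. f x:hc) --> (ALL x:X. g x:hc) -->
  (SUM x:X. act (f x) x) = (SUM x:X. act (g x) x) --> (ALL x:X. f x = g x))"
  proof (intro conjI ballI allI impI)
  show "finite X" "X <= (UN i. mG i)" using fb by(auto simp:free_basis_def)
  show "EX f. (ALL x:X. f x:hc) & m = (SUM x:X. act (f x) x)" if "m:mV" for m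
  using hspan_ex that sp by simp
  next
  fix f g x assume fg:"ALL x:X. f x:hc" "ALL x:X. g x:hc"
  "(SUM x:X. act (f x) x) = (SUM x:X. act (g x) x)" "x:X"
  have "(SUM x:X. act (f x - g x) x) = (SUM x:X. act (f x) x - act (g x) x)"
  by(intro sum.cong) (use fg XV in "auto simp:act_diff_left")
  also have "... = 0" using fg by(simp add:sum_subtractf)
  finally have "f x - g x = 0"
  by(rule free_basisD(4)[OF fb,of "%x. f x - g x",rotated]) (use fg in auto)
  then show "f x = g x" by simp
  qed
 qed
qed

subsection \<open>Restriction to Hopf subalgebras\<close>

locale hmod_sub = hmod s H M + hopf_sub s H A
 for s and H :: "('k::field,'h::ring_1) hopf" and M :: "('k,'h,'v::ab_group_add) gmodule" and A
begin

lemma hmod_restrict:"hmod s HA M"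
proof -
 have "graded_module (alg HA) M"
  using gmod A_hc unfolding graded_module_def alg_simps HA_simps by blast
 then show ?thesis using m.fd by unfold_locales (simp add:HA.gr_iff)
qed

sublocale R: hmod s HA M by(rule hmod_restrict)

lemma R_soc:"soc x==>R.soc x"
 by(auto simp:soc_def R.soc_def)

lemma R_gsub:"gsub K==>R.gsub K"
 using A_hc by(auto simp:gsub_def R.gsub_def)

lemma R_idirect:"idirect P K==>R.idirect P K"
 using R_gsub by(auto simp:idirect_def R.idirect_def)

text \<open>The products of a basis of H over \<open>A\<close> with a basis over H form a basis over
  \<open>A\<close> of the same submodule.\<close>

lemma R_free:
 assumes X:"free_basis X"
 obtains Y where "R.free_basis Y" "R.hspan Y = hspan X"
proof -
 obtain B where "left_basis B" using free_over_sub by blast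
 then have B:"finite B" "B <= (UN i. hg i)"
  "!!y. y:hc==>EX f. (ALL x:B. f x:A) & y = (SUM x:B. f x * x)"
  "!!f. (ALL x:B. f x:A)==>(SUM x:B. f x * x) = 0==>(ALL x:B. f x = 0)"
  by(simp_all add:left_basis_def)
 have Bhc:"B <= hc" using B(2) hg_hc by auto
 have XV:"X <= mV" and finX:"finite X" using free_basisD(1,3)[OF X] by auto
 note zeroA = h.subspace_0[OF A_sub]
 have B0:"b ~= 0" if b:"b:B" for b
 proof
  assume "b = 0"
  have "ALL x:B. (if x = b then 1 else 0) = (0::'h)"
  by(rule B(4)) (use \<open>b = 0\<close> zeroA in "auto intro!:sum.neutral")
  then show False using b one_neq_0 by force
 qed
 let ?q = "%(b,x). act b x"
 have single:"c x = 0" if c:"!!x. x:X==>c x:hc" "(SUM x:X. act (c x) x) = 0" "x:X" for c x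
  by(rule free_basisD(4)[OF X c])
 have inj:"inj_on ?q (B \<times> X)"
 proof (rule inj_onI,clarify)
  fix b x b' x' assume 1:"b:B" "x:X" "b':B" "x':X" "act b x = act b' x'"
  \<comment> \<open>The coefficients of the relation \<open>act b x - act b' x' = 0\<close>. The
    cases \<open>x = x'\<close> and \<open>x ~= x'\<close> are treated together; the latter
    contradicts \<open>B0\<close>.\<close>
  let ?c = "%z. (if z = x then b else 0) - (if z = x' then b' else 0)"
  have "(SUM z:X. act (?c z) z) = (SUM z:X. (if z = x then act b x else 0) - (if z = x' then act b' x' else 0))"
  by(intro sum.cong refl,subst act_diff_left) (use 1(1-4) Bhc XV in auto)
  also have "... = 0" using 1 finX by(simp add:sum_subtractf)
  finally have s:"(SUM z:X. act (?c z) z) = 0" .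
  have "?c z = 0" if "z:X" for z
  proof (rule single[of ?c,OF _ s that])
  have "b:hc" "b':hc" using 1 Bhc by auto
  then show "?c z:hc" for z by auto
  qed
  from this[OF 1(2)] this[OF 1(4)] show "b = b' & x = x'"
  using B0[OF 1(1)] B0[OF 1(3)] by(auto split: if_splits)
 qed
 define Y where "Y = ?q ` (B \<times> X)"
 have sumY:"(SUM y:Y. act (f y) y) = (SUM x:X. act (SUM b:B. f (act b x) * b) x)"
  if f:"!!b x. b:B==>x:X==>f (act b x):A" for f
 proof -
  have "(SUM y:Y. act (f y) y) = (SUM (b,x):B \<times> X. act (f (act b x)) (act b x))"
  unfolding Y_def sum.reindex[OF inj] by(simp add:case_prod_unfold)
  also have "... = (SUM b:B. SUM x:X. act (f (act b x)) (act b x))"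
  by(rule sum.cartesian_product[symmetric])
  also have "... = (SUM x:X. SUM b:B. act (f (act b x)) (act b x))" by(rule sum.swap)
  also have "... = (SUM x:X. act (SUM b:B. f (act b x) * b) x)"
  proof (rule sum.cong[OF refl])
  fix x assume x:"x:X"
  have "act (SUM b:B. f (act b x) * b) x = (SUM b:B. act (f (act b x) * b) x)"
  by(rule act_sum_left) (use x XV Bhc f A_hc in auto)
  also have "... = (SUM b:B. act (f (act b x)) (act b x))"
  by(intro sum.cong) (use x XV Bhc f A_hc in "auto simp:act_mult subset_iff")
  finally show "(SUM b:B. act (f (act b x)) (act b x)) = act (SUM b:B. f (act b x) * b) x" by simp
  qed
  finally show ?thesis .
 qed
 have Ygr:"Y <= (UN i. mG i)"
 proof
  fix y assume "y:Y"
  then obtain b x where bx:"b:B" "x:X" "y = act b x" by(auto simp:Y_def)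
  obtain i j where "b:hg i" "x:mG j" using bx B(2) free_basisD(2)[OF X] by blast
  then show "y:(UN i. mG i)" using act_deg bx by blast
 qed
 have fb:"R.free_basis Y"
  unfolding R.free_basis_def HA_simps
 proof (intro conjI allI impI Ygr)
  show "finite Y" using B(1) finX by(simp add:Y_def)
  fix f assume f:"ALL y:Y. f y:A" "(SUM y:Y. act (f y) y) = 0"
  have fA:"f (act b x):A" if "b:B" "x:X" for b x using f that by(auto simp:Y_def)
  have s:"(SUM x:X. act (SUM b:B. f (act b x) * b) x) = 0" using sumY[of f] fA f(2) by simp
  have "(SUM b:B. f (act b x) * b) = 0" if x:"x:X" for x
  by(rule single[of "%x. SUM b:B. f (act b x) * b",OF _ s x])
  (use fA Bhc A_hc in "auto intro!:h.subspace_sum[OF h.subV] mult_hc")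
  then have "f (act b x) = 0" if "b:B" "x:X" for b x
  using B(4)[of "%b. f (act b x)"] fA that by blast
  then show "ALL y:Y. f y = 0" by(auto simp:Y_def)
 qed
 have "R.hspan Y = hspan X"
 proof (intro equalityI)
  have "Y <= hspan X"
  using hspan_base[OF finX XV] gsubD(4)[OF free_gsub[OF X]] Bhc by(auto simp:Y_def)
  then show "R.hspan Y <= hspan X"
  by(rule R.hspan_minimal) (rule R_gsub[OF free_gsub[OF X]])
  show "hspan X <= R.hspan Y"
  proof
  fix p assume "p:hspan X"
  then obtain c where c:"ALL x:X. c x:hc" "p = (SUM x:X. act (c x) x)" by(elim hspan_ex[THEN exE] conjE)
  have "ALL x:X. EX f. (ALL b:B. f b:A) & c x = (SUM b:B. f b * b)" using B(3) c(1) by blast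
  then obtain f where f:"!!x b. x:X==>b:B==>f x b:A" "!!x. x:X==>c x = (SUM b:B. f x b * b)"
  by metis
  define g where "g y = (let (b,x) = inv_into (B \<times> X) ?q y in f x b)" for y
  have g:"g (act b x) = f x b" if "b:B" "x:X" for b x
  using inv_into_f_f[OF inj,of "(b,x)"] that by(simp add:g_def)
  have "p = (SUM y:Y. act (g y) y)"
  unfolding c(2) by(subst sumY) (use f g in "auto intro!:sum.cong")
  moreover have "g y:A" if "y:Y" for y using that g f(1) by(auto simp:Y_def)
  ultimately show "p:R.hspan Y" using R.hspanI[of Y g] by simp
  qed
 qed
 then show thesis using that fb by blast
qed

lemma R_KF:"KF==>R.KF"
proof -
 assume KF
 then obtain X x where X:"free_basis X" and x:"x:mG 0" "x ~= 0" "soc x" "x ~: hspan X"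
  and dec:"ALL m:mV. EX p:hspan X. EX c. m = p + sc c x"
  unfolding KF_def by(elim exE conjE)
 obtain Y where "R.free_basis Y" "R.hspan Y = hspan X" using R_free[OF X] .
 then show R.KF unfolding R.KF_def using x dec R_soc by metis
qed

lemma R_gfree:"gfree (alg H) M==>gfree (alg HA) M"
 unfolding gfree_free_basis R.gfree_free_basis using R_free by metis

end

subsection \<open>Direct sums with free modules\<close>

lemma (in hopf) dsum_free_basis:
 fixes M :: "('k,'h,'v::ab_group_add) gmodule" and F :: "('k,'h,'w::ab_group_add) gmodule"
 assumes M:"hmod s H M" and F:"hmod s H F" and X:"hmod.free_basis H F X"
 shows "hmod.free_basis H (dsum M F) (Pair 0 ` X)" "hmod.hspan H (dsum M F) (Pair 0 ` X) = {0} \<times> hmod.hspan H F X"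
proof -
 interpret M: hmod s H M by fact
 interpret F: hmod s H F by fact
 interpret D: hmod s H "dsum M F" by(rule hmod_dsum[OF M F])
 let ?Y = "Pair (0 :: 'v) ` X"
 have inj:"inj_on (Pair (0 :: 'v)) X" by(auto simp:inj_on_def)
 have sumY:"(SUM y:?Y. D.act (f y) y) = (0,SUM x:X. F.act (f (0,x)) x)" if "!!x. x:X==>f (0,x):hc" for f
  unfolding sum.reindex[OF inj] using that by(simp add:dsum_def sum_prod)
 show "D.free_basis ?Y"
  unfolding D.free_basis_def
 proof (intro conjI allI impI)
  show "finite ?Y" using F.free_basisD(1)[OF X] by simp
  show "?Y <= (UN i. D.mG i)"
  proof
  fix y assume "y:?Y"
  then obtain x i where "y = (0,x)" "x:F.mG i" using F.free_basisD(2)[OF X] by blast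
  then have "y:D.mG i" by(simp add:dsum_def)
  then show "y:(UN i. D.mG i)" by blast
  qed
  fix f assume f:"ALL y:?Y. f y:hc" "(SUM y:?Y. D.act (f y) y) = 0"
  have fx:"f (0,x):hc" if "x:X" for x using f(1) that by simp
  have s:"(SUM x:X. F.act (f (0,x)) x) = 0" using trans[OF sumY[of f,OF fx,symmetric] f(2)] by(simp add:zero_prod_def)
  have "f (0,x) = 0" if "x:X" for x by(rule F.free_basisD(4)[OF X _ s that]) (rule fx)
  then show "ALL y:?Y. f y = 0" by simp
 qed
 show "D.hspan ?Y = {0} \<times> F.hspan X"
 proof (intro equalityI subsetI)
  fix p assume "p:D.hspan ?Y"
  then obtain f where f:"ALL y:?Y. f y:hc" "p = (SUM y:?Y. D.act (f y) y)" by(elim D.hspan_ex[THEN exE] conjE)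
  have "(SUM x:X. F.act (f (0,x)) x):F.hspan X" by(rule F.hspanI) (use f(1) in simp)
  moreover have "p = (0,SUM x:X. F.act (f (0,x)) x)" unfolding f(2) by(rule sumY) (use f(1) in simp)
  ultimately show "p:{0} \<times> F.hspan X" by simp
 next
  fix p :: "'v \<times> 'w" assume "p:{0} \<times> F.hspan X"
  then obtain v where v:"p = (0,v)" "v:F.hspan X" by auto
  then obtain f where f:"ALL x:X. f x:hc" "v = (SUM x:X. F.act (f x) x)" by(elim F.hspan_ex[THEN exE] conjE)
  have "(SUM y:?Y. D.act (f (snd y)) y):D.hspan ?Y" by(rule D.hspanI) (use f(1) in auto)
  also have "(SUM y:?Y. D.act (f (snd y)) y) = p" unfolding v f(2) by(subst sumY) (use f(1) in auto)
  finally show "p:D.hspan ?Y" .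
 qed
qed

lemma (in hopf) dsum_triv_KF:
 fixes F :: "('k,'h,'w::ab_group_add) gmodule"
 assumes F:"hmod s H F" "gfree (alg H) F"
 shows "hmod.KF H (dsum (triv H) F)"
proof -
 interpret F: hmod s H F by fact
 interpret D: hmod s H "dsum (triv H) F" by(rule hmod_dsum[OF hmod_triv F(1)])
 obtain X where X:"F.free_basis X" "F.mV = F.hspan X" using F(2) F.gfree_free_basis by blast
 note fb = dsum_free_basis[OF hmod_triv F(1) X(1)]
 show ?thesis
  unfolding D.KF_def
 proof (intro exI conjI ballI)
  show "D.free_basis (Pair 0 ` X)" by(rule fb(1))
  show "(1,0):D.mG 0" "(1,0) ~= (0 :: 'k \<times> 'w)" by(auto simp:dsum_def triv_def zero_prod_def)
  show "D.soc (1,0)"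
  unfolding D.soc_def using counit_hg hg_hc by(auto simp:dsum_def triv_def zero_prod_def)
  show "(1,0) ~: D.hspan (Pair 0 ` X)" unfolding fb(2) by simp
  fix m assume "m:D.mV"
  then obtain c v where m:"m = (c,v)" "v:F.mV" by(auto simp:dsum_def)
  have "(0,v):D.hspan (Pair 0 ` X)" unfolding fb(2) using m(2) X(2) by simp
  moreover have "m = (0,v) + D.sc c (1,0)" using m by(simp add:dsum_def triv_def)
  ultimately show "EX p:D.hspan (Pair 0 ` X). EX c. m = p + D.sc c (1,0)" by blast
 qed
qed

lemma (in hmod) gfree_hspan:
 assumes "free_basis X"
 shows "gfree (alg H) (msub M (hspan X))"
proof -
 interpret P: hmod s H "msub M (hspan X)" by(rule hmod_msub[OF free_gsub[OF assms]])
 have XP:"X <= hspan X" using hspan_base free_basisD(1,3)[OF assms] by blast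
 have "P.free_basis X"
  unfolding P.free_basis_def msub_simps using assms XP by(auto simp:free_basis_def)
 moreover have "P.hspan X = hspan X"
  unfolding P.hspan_def msub_simps by(simp only: hspan_def)
 ultimately show ?thesis using P.gfree_free_basis by auto
qed

lemma (in hmod_iso) gfree:"gfree (alg H) M==>gfree (alg H) N"
proof -
 assume "gfree (alg H) M"
 then obtain X where X:"M.free_basis X" "M.mV = M.hspan X" using M.gfree_free_basis by blast
 have XV:"X <= M.mV" using M.free_basisD(3)[OF X(1)] by auto
 have "N.mV <= N.hspan (phi ` X)" using surj hspan[OF XV] X(2) by fastforce
 moreover have "N.hspan (phi ` X) <= N.mV" using N.gsubD(2)[OF N.free_gsub[OF free_basis[OF X(1)]]] by auto
 ultimately show ?thesis using free_basis[OF X(1)] N.gfree_free_basis by blast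
qed

text \<open>\<open>P\<close>, free in the applications, becomes the second summand, as in
  \<open>free_summand\<close> and \<open>endotrivial\<close>.\<close>

lemma (in hmod) idirect_dsum:
 assumes "idirect P K"
 obtains phi where "hmod_iso s H M (dsum (msub M K) (msub M P)) phi"
proof -
 note gP = idirectD(1)[OF assms] and gK = idirectD(2)[OF assms]
 note sP = gsubD(1)[OF gP] and sK = gsubD(1)[OF gK]
 interpret P: hmod s H "msub M P" by(rule hmod_msub[OF gP])
 interpret K: hmod s H "msub M K" by(rule hmod_msub[OF gK])
 interpret D: hmod s H "dsum (msub M K) (msub M P)" by(rule hmod_dsum[OF hmod_msub[OF gK] hmod_msub[OF gP]])
 have uniq:"p = p' & k = k'" if "p:P" "p':P" "k:K" "k':K" "p + k = p' + k'" for p p' k k'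
 proof -
  have "p - p' = k' - k" using that(5) by(simp add:algebra_simps)
  then have "p - p' = 0" using idirectD(3)[OF assms] m.subspace_diff[OF sP that(1,2)] m.subspace_diff[OF sK that(4,3)] by metis
  then show ?thesis using that(5) by simp
 qed
 define phi where "phi m = (THE kp. fst kp:K & snd kp:P & m = snd kp + fst kp)" for m
 have phi:"phi (p + k) = (k,p)" if "p:P" "k:K" for p k
  unfolding phi_def
  by(rule the_equality) (use that uniq in "auto simp:prod_eq_iff")
 have ex:"EX p k. p:P & k:K & m = p + k" if "m:mV" for m
  using idirectD(4)[OF assms that] by blast
 have PV:"p:mV" if "p:P" for p using gsubD(2)[OF gP that] .
 have KV:"k:mV" if "k:K" for k using gsubD(2)[OF gK that] .
 have "hmod_iso s H M (dsum (msub M K) (msub M P)) phi"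
 proof
  show "bij_betw phi mV D.mV"
  unfolding bij_betw_def
  proof
  show "inj_on phi mV" using ex phi by(auto intro!:inj_onI) (metis prod.inject)
  show "phi ` mV = D.mV"
  proof (intro equalityI subsetI)
  fix z assume "z:phi ` mV"
  then show "z:D.mV" using ex phi by(auto simp:dsum_def) (metis SigmaI)
  next
  fix z assume "z:D.mV"
  then obtain k p where "z = (k,p)" "k:K" "p:P" by(auto simp:dsum_def)
  then have "z = phi (p + k)" "p + k:mV" using phi PV KV by auto
  then show "z:phi ` mV" by blast
  qed
  qed
  show "phi (x + y) = phi x + phi y" if xy:"x:mV" "y:mV" for x y
  proof -
  obtain p k p' k' where *: "p:P" "k:K" "x = p + k" "p':P" "k':K" "y = p' + k'"
  using ex[OF xy(1)] ex[OF xy(2)] by blast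
  have "x + y = (p + p') + (k + k')" using * by simp
  then have "phi (x + y) = (k + k',p + p')"
  using phi[OF m.subspace_add[OF sP *(1,4)] m.subspace_add[OF sK *(2,5)]] by simp
  then show ?thesis using * phi by simp
  qed
  show "phi (act a x) = D.act a (phi x)" if ax:"a:hc" "x:mV" for a x
  proof -
  obtain p k where *: "p:P" "k:K" "x = p + k" using ex[OF ax(2)] by blast
  have "act a x = act a p + act a k" using * ax PV KV by(simp add:act_add)
  then have "phi (act a x) = (act a k,act a p)"
  using phi[OF gsubD(4)[OF gP ax(1) *(1)] gsubD(4)[OF gK ax(1) *(2)]] by simp
  then show ?thesis using * phi by(simp add:dsum_def)
  qed
  show "phi x:D.mG i" if x:"x:mG i" for i x
  proof -
  obtain p k where *: "p:P" "k:K" "x = p + k" using ex[OF mG_mV[OF x]] by blast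
  have "x = hcomp mG x i" using x by(simp add:m.hcomp_homog)
  also have "... = hcomp mG p i + hcomp mG k i" using * PV KV by(simp add:m.hcomp_add)
  finally have "p + k = hcomp mG p i + hcomp mG k i" using *(3) by simp
  from uniq[OF *(1) gsubD(3)[OF gP *(1)] *(2) gsubD(3)[OF gK *(2)] this]
  have "p:mG i" "k:mG i" using m.hcomp_G[OF PV[OF *(1)],of i] m.hcomp_G[OF KV[OF *(2)],of i] by auto
  then show ?thesis using * phi by(simp add:dsum_def)
  qed
 qed
 then show thesis by(rule that)
qed

subsection \<open>The module of linear maps\<close>

text \<open>\<open>ghom s H N M\<close> is \<open>Hom\<^sub>k(N, M)\<close> with \<open>(h f) v = \<Sum> \<plusminus> h' f (S h'' v)\<close>, where \<open>h''\<close> and \<open>f\<close> are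
  interchanged; \<open>twist s H j\<close> is the sign of an interchange with an element of degree \<open>j\<close>.\<close>

definition twist :: "'k::field => ('k,'h::ring_1) hopf => int => 'h => 'h" where
 "twist s H j b = hext (hgrade H) (%i b. hscale H (xsign s i j) b) b"

definition homcarrier :: "('k::field,'h,'w::ab_group_add) gmodule => ('k,'h,'v::ab_group_add) gmodule => ('w => 'v) set" where
 "homcarrier N M = {f. linear_on (mscale N) (mscale M) (mcarrier N) f & (ALL v:mcarrier N. f v:mcarrier M)
  & (ALL v. v ~: mcarrier N --> f v = 0)}"

definition homgrade :: "('k::field,'h,'w::ab_group_add) gmodule => ('k,'h,'v::ab_group_add) gmodule => int => ('w => 'v) set" where
 "homgrade N M i = {f:homcarrier N M. ALL j. ALL v:mgrade N j. f v:mgrade M (i + j)}"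

definition homact :: "'k::field => ('k,'h::ring_1) hopf => ('k,'h,'w::ab_group_add) gmodule => ('k,'h,'v::ab_group_add) gmodule
  => 'h => int => ('w => 'v) => 'w => 'v" where
 "homact s H N M h j f = (%v. if v:mcarrier N
  then sweedler H (%a b. mact M a (f (mact N (antipode H (twist s H j b)) v))) h else 0)"

definition ghom :: "'k::field => ('k,'h::ring_1) hopf => ('k,'h,'w::ab_group_add) gmodule => ('k,'h,'v::ab_group_add) gmodule
  => ('k,'h,'w => 'v) gmodule" where
 "ghom s H N M = \<lparr>mcarrier = homcarrier N M,mscale = (%c f v. mscale M c (f v)),
  mact = (%h f. hext (homgrade N M) (homact s H N M h) f),mgrade = homgrade N M\<rparr>"

context hopf
begin

lemma twist_homog:"b:hg i==>twist s H j b = hs (xsign s i j) b"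
 unfolding twist_def by(rule h.hext_homog) simp_all

lemma linear_twist:"linear_on hs hs hc (twist s H j)"
 unfolding twist_def
 by(rule h.linear_on_hext[OF h.vector_space_axioms])
  (auto intro!:linear_onI simp:h.scale_right_distrib mult_ac)

lemma twist_hc [simp]: "b:hc==>twist s H j b:hc"
proof (induction rule: h.homog_induct)
 case zero
 show ?case using h.linear_on_0[OF linear_twist h.subV] by simp
next
 case (add x y)
 then show ?case by(simp add:linear_on_add[OF linear_twist])
next
 case (homog i x)
 then show ?case using hg_hc by(simp add:twist_homog)
qed

lemma sum_list_scale_gen:
 assumes "vector_space scu"
 shows "(SUM (i,a,b)<-xs. scu t (F i a b)) = scu t (SUM (i,a,b)<-xs. F i a b)"
proof -
 interpret U: vector_space scu by fact
 show ?thesis by(induction xs) (auto simp:U.scale_right_distrib)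
qed

end

locale hpair = M: hmod s H M + N: hmod s H N
 for s and H :: "('k::field,'h::ring_1) hopf" and M :: "('k,'h,'v::ab_group_add) gmodule"
  and N :: "('k,'h,'w::ab_group_add) gmodule"
begin

abbreviation "L == ghom s H N M"
abbreviation "LV == homcarrier N M"
abbreviation "LG == homgrade N M"
abbreviation "Lact == mact L"
abbreviation Lsc :: "'k => ('w => 'v) => 'w => 'v" where "Lsc == %c f v. M.sc c (f v)"

lemma L_simps [simp]: "mcarrier L = LV" "mscale L = Lsc" "mgrade L = LG"
 by(simp_all add:ghom_def)

lemma LVI:"(!!x y. x:N.mV==>y:N.mV==>f (x + y) = f x + f y)==>(!!c x. x:N.mV==>f (N.sc c x) = M.sc c (f x))
==>(!!v. v:N.mV==>f v:M.mV)==>(!!v. v ~: N.mV==>f v = 0)==>f:LV"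
 by(auto simp:homcarrier_def linear_on_def)

lemma LVD: assumes "f:LV"
 shows "linear_on N.sc M.sc N.mV f" "v:N.mV==>f v:M.mV" "v ~: N.mV==>f v = 0"
  "x:N.mV==>y:N.mV==>f (x + y) = f x + f y" "x:N.mV==>f (N.sc c x) = M.sc c (f x)"
 using assms by(auto simp:homcarrier_def linear_on_def)

lemma LV_0:"f:LV==>f 0 = 0"
 using N.m.linear_on_0[OF LVD(1) N.m.subV] .

lemma LV_eqI:"f:LV==>g:LV==>(!!j v. v:N.mG j==>f v = g v)==>f = g"
proof
 fix v assume a:"f:LV" "g:LV" "!!j v. v:N.mG j==>f v = g v"
 show "f v = g v"
  using N.m.linear_on_eqI[OF LVD(1)[OF a(1)] LVD(1)[OF a(2)] a(3)] LVD(3)[OF a(1)] LVD(3)[OF a(2)]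
  by(cases "v:N.mV") auto
qed

lemma LG_LV:"f:LG i==>f:LV" and LG_deg:"f:LG i==>v:N.mG j==>f v:M.mG (i + j)"
 by(auto simp:homgrade_def)

lemma L_vs:"vector_space Lsc"
 by unfold_locales (auto simp:fun_eq_iff M.m.scale_right_distrib M.m.scale_left_distrib)

sublocale Lv: vector_space Lsc by(rule L_vs)

lemma LV_sub:"Lv.subspace LV"
 by(rule Lv.subspaceI) (auto intro!:LVI simp:LVD M.m.scale_right_distrib mult.commute)

lemma LG_sub:"Lv.subspace (LG i)"
proof (rule Lv.subspaceI)
 show "0:LG i" using Lv.subspace_0[OF LV_sub] by(auto simp:homgrade_def)
 show "f + g:LG i" if "f:LG i" "g:LG i" for f g
  using that Lv.subspace_add[OF LV_sub] M.m.subspace_add[OF M.m.subG] by(auto simp:homgrade_def)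
 show "Lsc c f:LG i" if "f:LG i" for c f
  using that Lv.subspace_scale[OF LV_sub] M.m.subspace_scale[OF M.m.subG] by(auto simp:homgrade_def)
qed

definition Ndeg :: "int set" where "Ndeg = {i. N.mG i ~= {0}}"
definition Mdeg :: "int set" where "Mdeg = {i. M.mG i ~= {0}}"

lemma finite_deg:"finite Ndeg" "finite Mdeg"
 unfolding Ndeg_def Mdeg_def by(rule N.m.finite_degrees,rule M.m.finite_degrees)

definition Lcomp :: "('w => 'v) => int => 'w => 'v" where
 "Lcomp f i v = (if v:N.mV then SUM j:Ndeg. hcomp M.mG (f (hcomp N.mG v j)) (i + j) else 0)"

lemma Lcomp_homog:
 assumes "f:LV" "v:N.mG j"
 shows "Lcomp f i v = hcomp M.mG (f v) (i + j)"
proof -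
 have "Lcomp f i v = (SUM k:Ndeg. if k = j then hcomp M.mG (f v) (i + j) else 0)"
  unfolding Lcomp_def using assms LV_0[OF assms(1)] N.mG_mV
  by(auto simp:N.m.hcomp_homog intro!:sum.cong)
 also have "... = hcomp M.mG (f v) (i + j)"
  using assms LV_0[OF assms(1)] finite_deg by(cases "j:Ndeg") (auto simp:Ndeg_def)
 finally show ?thesis .
qed

lemma Lcomp_LV:"f:LV==>Lcomp f i:LV"
 by(rule LVI) (auto simp:Lcomp_def N.m.hcomp_add N.m.hcomp_scale LVD M.m.hcomp_add M.m.hcomp_scale
  N.m.hcomp_V sum.distrib M.m.scale_sum_right intro!:M.m.subspace_sum[OF M.m.subV] M.m.hcomp_V)

lemma Lcomp_LG:"f:LV==>Lcomp f i:LG i"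
 using Lcomp_LV Lcomp_homog M.m.hcomp_G LVD(2) N.mG_mV by(auto simp:homgrade_def)

lemma Lcomp_finite:"f:LV==>finite {i. Lcomp f i ~= 0}"
proof (rule finite_subset)
 assume f:"f:LV"
 show "finite ((%(a,b). a - b) ` (Mdeg \<times> Ndeg))" using finite_deg by auto
 show "{i. Lcomp f i ~= 0} <= (%(a,b). a - b) ` (Mdeg \<times> Ndeg)"
 proof
  fix i assume "i:{i. Lcomp f i ~= 0}"
  then obtain j v where v:"v:N.mG j" "Lcomp f i v ~= 0"
  using LV_eqI[OF Lcomp_LV[OF f] Lv.subspace_0[OF LV_sub],of i] by auto
  then have "v ~= 0" using LV_0[OF Lcomp_LV[OF f]] by auto
  then have "j:Ndeg" using v by(auto simp:Ndeg_def)
  moreover have "i + j:Mdeg" using LG_deg[OF Lcomp_LG[OF f] v(1)] v(2) by(auto simp:Mdeg_def)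
  ultimately show "i:(%(a,b). a - b) ` (Mdeg \<times> Ndeg)" by(auto intro!:image_eqI[of _ _ "(i + j,j)"])
 qed
qed

lemma Lsum_LV:"(!!i. i:I==>c i:LV)==>(SUM i:I. c i):LV"
 by(rule Lv.subspace_sum[OF LV_sub])

lemma Lcomp_dec:"f:LV==>decomposes LG f (Lcomp f)"
proof -
 assume f:"f:LV"
 have "f = (SUM i | Lcomp f i ~= 0. Lcomp f i)"
 proof (rule LV_eqI[OF f Lsum_LV[OF Lcomp_LV[OF f]]])
  fix j v assume v:"v:N.mG j"
  have fv:"f v:M.mV" using LVD(2)[OF f] v N.mG_mV by blast
  have "(SUM i | Lcomp f i ~= 0. Lcomp f i) v = (SUM i | Lcomp f i ~= 0. hcomp M.mG (f v) (i + j))"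
  unfolding sum_apply using Lcomp_homog[OF f v] by simp
  also have "... = (SUM k:(%i. i + j) ` {i. Lcomp f i ~= 0}. hcomp M.mG (f v) k)"
  by(subst sum.reindex) (auto simp:inj_on_def)
  also have "... = f v"
  proof (rule M.m.hcomp_sum[symmetric,OF fv])
  show "finite ((%i. i + j) ` {i. Lcomp f i ~= 0})" using Lcomp_finite[OF f] by simp
  show "hcomp M.mG (f v) k = 0" if "k ~: (%i. i + j) ` {i. Lcomp f i ~= 0}" for k
  proof -
  have "Lcomp f (k - j) = 0" using that by(auto intro: image_eqI[of _ _ "k - j"])
  then show ?thesis using Lcomp_homog[OF f v,of "k - j"] by simp
  qed
  qed
  finally show "f v = (SUM i | Lcomp f i ~= 0. Lcomp f i) v" by simp
 qed
 then show "decomposes LG f (Lcomp f)"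
  unfolding decomposes_def by(intro conjI allI Lcomp_LG[OF f] Lcomp_finite[OF f])
qed

lemma L_dec:"f:LV==>EX! c. decomposes LG f c"
proof (rule ex1I[of _ "Lcomp f"],erule Lcomp_dec)
 fix c assume f:"f:LV" and c:"decomposes LG f c"
 have mem:"c i:LG i" and fin:"finite {i. c i ~= 0}" and s:"f = (SUM i | c i ~= 0. c i)" for i
  using c unfolding decomposes_def by blast+
 show "c = Lcomp f"
 proof
  fix i
  show "c i = Lcomp f i"
  proof (rule LV_eqI[OF LG_LV[OF mem] Lcomp_LV[OF f]])
  fix j v assume v:"v:N.mG j"
  have "hcomp M.mG (f v) = (%k. c (k - j) v)"
  proof (rule M.m.hcomp_eqI)
  show "finite ((%i. i + j) ` {i. c i ~= 0})" using fin by simp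
  show "c (k - j) v:M.mG k" for k using LG_deg[OF mem v,of "k - j"] by simp
  show "c (k - j) v = 0" if "k ~: (%i. i + j) ` {i. c i ~= 0}" for k
  proof -
  have "c (k - j) = 0" using that by(auto intro: image_eqI[of _ _ "k - j"])
  then show ?thesis by simp
  qed
  have "f v = (SUM i | c i ~= 0. c i v)" using fun_cong[OF s,of v] by(simp add:sum_apply)
  also have "... = (SUM k:(%i. i + j) ` {i. c i ~= 0}. c (k - j) v)"
  by(subst sum.reindex) (auto simp:inj_on_def)
  finally show "f v = (SUM k:(%i. i + j) ` {i. c i ~= 0}. c (k - j) v)" .
  qed
  then show "c i v = Lcomp f i v" using Lcomp_homog[OF f v,of i] by simp
  qed
 qed
qed

lemma L_fd:"EX B. finite B & LV <= Lv.span B"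
proof -
 obtain B where B:"B <= N.mV" "N.m.independent B" "N.mV <= N.m.span B"
  using N.m.maximal_independent_subset by blast
 have finB:"finite B" by(rule N.m.independent_finite[OF B(2,1)])
 obtain C where C:"C <= M.mV" "M.m.independent C" "M.mV <= M.m.span C"
  using M.m.maximal_independent_subset by blast
 have finC:"finite C" by(rule M.m.independent_finite[OF C(2,1)])
 \<comment> \<open>The matrix units for the bases \<open>B\<close> and \<open>C\<close>.\<close>
 define E where "E = (%(b,c) v. if v:N.mV then M.sc (N.m.representation B v b) c else 0)"
 have "f:Lv.span (E ` (B \<times> C))" if f:"f:LV" for f
 proof -
  have "f = (SUM (b,c):B \<times> C. Lsc (M.m.representation C (f b) c) (E (b,c)))"
  proof
  fix v
  have "(SUM (b,c):B \<times> C. Lsc (M.m.representation C (f b) c) (E (b,c))) v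
  = (SUM b:B. SUM c:C. M.sc (M.m.representation C (f b) c) (E (b,c) v))"
  by(simp add:sum_apply case_prod_unfold sum.cartesian_product)
  also have "... = f v"
  proof (cases "v:N.mV")
  case True
  have "(SUM b:B. SUM c:C. M.sc (M.m.representation C (f b) c) (E (b,c) v))
  = (SUM b:B. M.sc (N.m.representation B v b) (SUM c:C. M.sc (M.m.representation C (f b) c) c))"
  using True by(simp add:E_def M.m.scale_sum_right mult.commute)
  also have "... = (SUM b:B. M.sc (N.m.representation B v b) (f b))"
  proof (intro sum.cong refl arg_cong2[where f = M.sc])
  fix b assume "b:B"
  then have "f b:M.m.span C" using LVD(2)[OF f] B(1) C(3) by blast
  then show "(SUM c:C. M.sc (M.m.representation C (f b) c) c) = f b"
  using M.m.sum_representation_eq[OF C(2) _ finC] by blast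
  qed
  also have "... = (SUM b:B. f (N.sc (N.m.representation B v b) b))"
  using B(1) LVD(5)[OF f] by(intro sum.cong) auto
  also have "... = f (SUM b:B. N.sc (N.m.representation B v b) b)"
  by(rule N.m.linear_on_sum[symmetric,OF LVD(1)[OF f] N.m.subV]) (use B(1) in auto)
  also have "(SUM b:B. N.sc (N.m.representation B v b) b) = v"
  using N.m.sum_representation_eq[OF B(2) _ finB,of v] True B(3) by auto
  finally show ?thesis .
  qed (use LVD(3)[OF f] in "simp add:E_def")
  finally show "f v = (SUM (b,c):B \<times> C. Lsc (M.m.representation C (f b) c) (E (b,c))) v" by simp
  qed
  then show ?thesis
  by(rule ssubst[where P = "%f. f:Lv.span (E ` (B \<times> C))"])
  (auto intro!:Lv.span_sum Lv.span_scale[of _ _ c for c] intro: Lv.span_base)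
 qed
 then show ?thesis using finB finC by(intro exI[of _ "E ` (B \<times> C)"]) auto
qed

sublocale Lg: fgvs Lsc LV LG
proof unfold_locales
 show "Lv.subspace LV" by(rule LV_sub)
 show "graded_by Lsc LV LG"
  unfolding graded_by_def using LG_sub LG_LV L_dec by blast
 show "EX B. finite B & LV <= Lv.span B" by(rule L_fd)
qed

lemma homact_bilinear:
 assumes "f:LV" "v:N.mV"
 shows "bilinear_on M.hs M.hs M.sc M.hc M.hc (%a b. M.act a (f (N.act (M.S (twist s H j b)) v)))"
 by(rule bilinear_onI)
  (simp_all add:assms M.act_add_left M.act_scale_left linear_on_add[OF M.linear_twist]
  linear_on_scale[OF M.linear_twist] linear_on_add[OF M.S_linear] linear_on_scale[OF M.S_linear]
  N.act_add_left N.act_scale_left LVD M.act_add M.act_scale)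

lemma homact_list:
 assumes "f:LV" "v:N.mV" "set xs <= M.hc \<times> M.hc" "coprod H h = (SUM (a,b)<-xs. M.T a b)"
 shows "homact s H N M h j f v = (SUM (a,b)<-xs. M.act a (f (N.act (M.S (twist s H j b)) v)))"
 unfolding homact_def using assms(2)
  M.sweedler_list[OF M.m.vector_space_axioms homact_bilinear[OF assms(1,2)] assms(3,4)] by simp

lemma homact_LV:
 assumes "f:LV" "h:M.hc"
 shows "homact s H N M h j f:LV"
proof -
 obtain xs where xs:"set xs <= M.hc \<times> M.hc" "coprod H h = (SUM (a,b)<-xs. M.T a b)" using M.coprod_list[OF assms(2)] .
 note e = homact_list[OF assms(1) _ xs]
 have x:"a:M.hc & b:M.hc" if "(a,b):set xs" for a b using xs(1) that by auto
 show ?thesis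
 proof (rule LVI)
  fix v w assume vw:"v:N.mV" "w:N.mV"
  show "homact s H N M h j f (v + w) = homact s H N M h j f v + homact s H N M h j f w"
  unfolding e[OF vw(1)] e[OF vw(2)] e[OF N.mV_add[OF vw]] sum_list_addf[symmetric]
  by(intro arg_cong[of _ _ sum_list] map_cong) (use x vw in "auto simp:N.act_add LVD[OF assms(1)] M.act_add")
 next
  fix c v assume v:"v:N.mV"
  show "homact s H N M h j f (N.sc c v) = M.sc c (homact s H N M h j f v)"
  unfolding e[OF v] e[OF N.mV_scale[OF v]] M.m.scale_sum_list
  by(intro arg_cong[of _ _ sum_list] map_cong) (use x v in "auto simp:N.act_scale LVD[OF assms(1)] M.act_scale")
 next
  fix v assume v:"v:N.mV"
  show "homact s H N M h j f v:M.mV"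
  unfolding e[OF v] by(intro M.m.subspace_sum_list[OF M.m.subV]) (use x v LVD(2)[OF assms(1)] in auto)
 qed (simp add:homact_def)
qed

lemma homact_linear_f:
 assumes "h:M.hc"
 shows "linear_on Lsc Lsc LV (homact s H N M h j)"
proof -
 obtain xs where xs:"set xs <= M.hc \<times> M.hc" "coprod H h = (SUM (a,b)<-xs. M.T a b)" using M.coprod_list[OF assms] .
 have x:"a:M.hc & b:M.hc" if "(a,b):set xs" for a b using xs(1) that by auto
 show ?thesis
 proof (rule linear_onI; rule ext)
  fix f g v assume fg:"f:LV" "g:LV"
  have sum:"f + g:LV" using fg by(rule Lv.subspace_add[OF LV_sub])
  show "homact s H N M h j (f + g) v = (homact s H N M h j f + homact s H N M h j g) v"
  proof (cases "v:N.mV")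
  case True
  show ?thesis
  unfolding plus_fun_apply homact_list[OF fg(1) True xs] homact_list[OF fg(2) True xs] homact_list[OF sum True xs]
  sum_list_addf[symmetric]
  by(intro arg_cong[of _ _ sum_list] map_cong) (use x True fg in "auto simp:LVD M.act_add")
  qed (simp add:homact_def)
 next
  fix c f v assume f:"f:LV"
  have sum:"Lsc c f:LV" using f by(rule Lv.subspace_scale[OF LV_sub])
  show "homact s H N M h j (Lsc c f) v = Lsc c (homact s H N M h j f) v"
  proof (cases "v:N.mV")
  case True
  show ?thesis
  unfolding homact_list[OF f True xs] homact_list[OF sum True xs] M.m.scale_sum_list
  by(intro arg_cong[of _ _ sum_list] map_cong) (use x True f in "auto simp:LVD M.act_scale")
  qed (simp add:homact_def)
 qed
qed

lemma homact_linear_h: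
 assumes "f:LV"
 shows "linear_on M.hs Lsc M.hc (%h. homact s H N M h j f)"
proof (rule linear_onI; rule ext)
 fix h h' v assume hh:"h:M.hc" "h':M.hc"
 show "homact s H N M (h + h') j f v = (homact s H N M h j f + homact s H N M h' j f) v"
  unfolding homact_def plus_fun_apply
  using hh linear_on_add[OF M.sweedler_linear[OF M.m.vector_space_axioms homact_bilinear[OF assms]]] by simp
next
 fix c h v assume hh:"h:M.hc"
 show "homact s H N M (M.hs c h) j f v = Lsc c (homact s H N M h j f) v"
  unfolding homact_def
  using hh linear_on_scale[OF M.sweedler_linear[OF M.m.vector_space_axioms homact_bilinear[OF assms]]] by simp
qed

lemma Lact_eq:"Lact h f = hext LG (homact s H N M h) f"
 by(simp add:ghom_def)

lemma Lact_linear:"h:M.hc==>linear_on Lsc Lsc LV (Lact h)"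
 unfolding Lact_eq[abs_def]
 by(rule Lg.linear_on_hext[OF L_vs]) (rule linear_on_subset[OF homact_linear_f],auto intro: LG_LV)

lemma Lact_linear_left:"f:LV==>linear_on M.hs Lsc M.hc (%h. Lact h f)"
 unfolding Lact_eq
 by(rule Lg.hext_linear_param[OF L_vs M.h.vector_space_axioms]) (auto intro: homact_linear_h LG_LV)

lemma homact_0:"h:M.hc==>homact s H N M h j 0 = 0"
 by(rule Lv.linear_on_0[OF homact_linear_f LV_sub])

lemma Lact_homog:"f:LG j==>h:M.hc==>Lact h f = homact s H N M h j f"
 unfolding Lact_eq by(rule Lg.hext_homog) (simp_all add:homact_0)

lemma Lact_LV:"f:LV==>h:M.hc==>Lact h f:LV"
 unfolding Lact_eq hext_def
 by(intro Lsum_LV homact_LV LG_LV[OF Lg.hcomp_G])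

text \<open>The working formula for the action: a representing list turns \<open>twist\<close> into
  the sign for moving \<open>b\<close>, of degree \<open>n - i\<close>, past
  \<open>f\<close>.\<close>

lemma Lact_eval:
 assumes "f:LG j" "h:M.hc" "M.rep n h xs" "v:N.mV"
 shows "Lact h f v = (SUM (i,a,b)<-xs. M.sc (xsign s (n - i) j) (M.act a (f (N.act (M.S b) v))))"
proof -
 have f:"f:LV" by(rule LG_LV[OF assms(1)])
 have "Lact h f v = sweedler H (%a b. M.act a (f (N.act (M.S (twist s H j b)) v))) h"
  unfolding Lact_homog[OF assms(1,2)] homact_def using assms(4) by simp
 also have "... = (SUM (i,a,b)<-xs. M.act a (f (N.act (M.S (twist s H j b)) v)))"
  by(rule M.rep_eval[OF assms(3) M.m.vector_space_axioms homact_bilinear[OF f assms(4)]])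
 also have "... = (SUM (i,a,b)<-xs. M.sc (xsign s (n - i) j) (M.act a (f (N.act (M.S b) v))))"
 proof (rule M.sum_list_cong2)
  fix i a b assume i:"(i,a,b):set xs"
  have "b:M.hg (n - i)" "a:M.hc" "b:M.hc" using M.rep_mem[OF assms(3) i] M.rep_mem_hc[OF assms(3) i] by auto
  then show "M.act a (f (N.act (M.S (twist s H j b)) v)) = M.sc (xsign s (n - i) j) (M.act a (f (N.act (M.S b) v)))"
  using assms(4) f by(simp add:M.twist_homog linear_on_scale[OF M.S_linear] N.act_scale_left LVD M.act_scale)
 qed
 finally show ?thesis .
qed

lemma Lact_deg:
 assumes "f:LG j" "h:M.hg n"
 shows "Lact h f:LG (n + j)"
proof -
 obtain xs where xs:"M.rep n h xs" using M.rep_ex[OF assms(2)] by blast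
 have "Lact h f v:M.mG (n + j + k)" if v:"v:N.mG k" for v k
 proof -
  have "M.sc (xsign s (n - i) j) (M.act a (f (N.act (M.S b) v))):M.mG (n + j + k)" if i:"(i,a,b):set xs" for i a b
  proof -
  have ab:"a:M.hg i" "b:M.hg (n - i)" using M.rep_mem[OF xs i] by auto
  have "M.act a (f (N.act (M.S b) v)):M.mG (i + (j + (n - i + k)))"
  by(intro M.act_deg[OF ab(1)] LG_deg[OF assms(1)] N.act_deg M.S_hg ab v)
  moreover have "i + (j + (n - i + k)) = n + j + k" by simp
  ultimately show ?thesis by(auto intro: M.m.subspace_scale[OF M.m.subG])
  qed
  then show ?thesis
  unfolding Lact_eval[OF assms(1) M.hg_hc[OF assms(2)] xs N.mG_mV[OF v]]
  by(intro M.m.subspace_sum_list[OF M.m.subG]) auto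
 qed
 then show ?thesis using Lact_LV[OF LG_LV[OF assms(1)] M.hg_hc[OF assms(2)]] by(auto simp:homgrade_def)
qed

text \<open>The coproduct is multiplicative and \<open>S\<close> reverses products, both up to sign.
  The signs for moving \<open>b\<close> past \<open>c\<close> and past \<open>e\<close> combine into
  the one for degrees \<open>n - i\<close> and \<open>m\<close>.\<close>

lemma Lact_mult_homog:
 assumes f:"f:LG j" and g:"g:M.hg n" and h:"h:M.hg m"
 shows "Lact (g * h) f = Lact g (Lact h f)"
proof
 fix v
 have hc:"g:M.hc" "h:M.hc" using g h M.hg_hc by auto
 have fL:"f:LV" by(rule LG_LV[OF f])
 show "Lact (g * h) f v = Lact g (Lact h f) v"
 proof (cases "v:N.mV")
  case True
  obtain gs where gs:"M.rep n g gs" using M.rep_ex[OF g] by blast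
  obtain hs where hs:"M.rep m h hs" using M.rep_ex[OF h] by blast
  have rgh:"M.rep (n + m) (g * h) (M.rep_times n gs hs)" by(rule M.rep_mult[OF gs hc(1) hs hc(2)])
  have mem:"a:M.hg i" "b:M.hg (n - i)" "a:M.hc" "b:M.hc" if "(i,a,b):set gs" for i a b
  using M.rep_mem[OF gs that] M.rep_mem_hc[OF gs that] by auto
  have mem':"c:M.hg k" "e:M.hg (m - k)" "c:M.hc" "e:M.hc" if "(k,c,e):set hs" for k c e
  using M.rep_mem[OF hs that] M.rep_mem_hc[OF hs that] by auto
  have expand:"(SUM (i,a,b)<-M.rep_times n gs hs. F i a b) =
  (SUM (i,a,b)<-gs. SUM (k,c,e)<-hs. F (i + k) (M.hs (xsign s (n - i) k) (a * c)) (b * e))" for F :: "int => 'h => 'h => 'v"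
  unfolding M.rep_times_def by(induction gs) (auto simp:case_prod_unfold o_def)
  have "Lact (g * h) f v = (SUM (i,a,b)<-gs. SUM (k,c,e)<-hs.
  M.sc (xsign s (n + m - (i + k)) j) (M.act (M.hs (xsign s (n - i) k) (a * c)) (f (N.act (M.S (b * e)) v))))"
  unfolding Lact_eval[OF f M.mult_hc[OF hc] rgh True] by(rule expand)
  also have "... = (SUM (i,a,b)<-gs. SUM (k,c,e)<-hs.
  M.sc (xsign s (n - i) (m + j)) (M.act a (M.sc (xsign s (m - k) j) (M.act c (f (N.act (M.S e) (N.act (M.S b) v)))))))"
  proof (intro M.sum_list_cong2)
  fix i a b k c e assume 1:"(i,a,b):set gs" "(k,c,e):set hs"
  note m = mem[OF 1(1)] and m' = mem'[OF 1(2)]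
  have S:"M.S (b * e) = M.hs (xsign s (n - i) (m - k)) (M.S e * M.S b)" by(rule M.S_mult[OF m(2) m'(2)])
  have e1:"f (N.act (M.S (b * e)) v) = M.sc (xsign s (n - i) (m - k)) (f (N.act (M.S e) (N.act (M.S b) v)))"
  unfolding S using m m' True fL by(simp add:N.act_scale_left N.act_mult LVD)
  have "xsign s (n + m - (i + k)) j * xsign s (n - i) (m - k) * xsign s (n - i) k = xsign s (n - i) (m + j) * xsign s (m - k) j"
  proof -
  have "n + m - (i + k) = (n - i) + (m - k)" by simp
  then have a:"xsign s (n + m - (i + k)) j = xsign s (n - i) j * xsign s (m - k) j" by(simp only: M.xsign_add)
  have "xsign s (n - i) k * xsign s (n - i) (m - k) = xsign s (n - i) (k + (m - k))" by(simp only: M.xsign_add)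
  then have b:"xsign s (n - i) k * xsign s (n - i) (m - k) = xsign s (n - i) m" by simp
  show ?thesis unfolding a M.xsign_add(1) b[symmetric] by(simp only: mult_ac)
  qed
  then show "M.sc (xsign s (n + m - (i + k)) j) (M.act (M.hs (xsign s (n - i) k) (a * c)) (f (N.act (M.S (b * e)) v)))
  = M.sc (xsign s (n - i) (m + j)) (M.act a (M.sc (xsign s (m - k) j) (M.act c (f (N.act (M.S e) (N.act (M.S b) v))))))"
  unfolding e1 using m m' True fL
  by(simp add:M.act_scale_left M.act_scale M.act_mult LVD mult.assoc[symmetric])
  qed
  also have "... = (SUM (i,a,b)<-gs. M.sc (xsign s (n - i) (m + j)) (M.act a (Lact h f (N.act (M.S b) v))))"
  proof (rule M.sum_list_cong2)
  fix i a b assume 1:"(i,a,b):set gs"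
  note m = mem[OF 1]
  have v':"N.act (M.S b) v:N.mV" using m True by simp
  have "(SUM (k,c,e)<-hs. M.sc (xsign s (n - i) (m + j)) (M.act a (M.sc (xsign s (m - k) j) (M.act c (f (N.act (M.S e) (N.act (M.S b) v)))))))
  = M.sc (xsign s (n - i) (m + j)) (SUM (k,c,e)<-hs. M.act a (M.sc (xsign s (m - k) j) (M.act c (f (N.act (M.S e) (N.act (M.S b) v))))))"
  by(rule M.sum_list_scale_gen[OF M.m.vector_space_axioms])
  also have "(SUM (k,c,e)<-hs. M.act a (M.sc (xsign s (m - k) j) (M.act c (f (N.act (M.S e) (N.act (M.S b) v))))))
  = M.act a (SUM (k,c,e)<-hs. M.sc (xsign s (m - k) j) (M.act c (f (N.act (M.S e) (N.act (M.S b) v)))))"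
  unfolding case_prod_unfold
  by(rule M.m.linear_on_sum_list[OF M.act_linear[OF m(3)] M.m.subV,symmetric])
  (use mem' v' fL in "force simp:LVD")
  finally show "(SUM (k,c,e)<-hs. M.sc (xsign s (n - i) (m + j)) (M.act a (M.sc (xsign s (m - k) j) (M.act c (f (N.act (M.S e) (N.act (M.S b) v)))))))
  = M.sc (xsign s (n - i) (m + j)) (M.act a (Lact h f (N.act (M.S b) v)))"
  unfolding Lact_eval[OF f hc(2) hs v'] .
  qed
  also have "... = Lact g (Lact h f) v"
  by(rule Lact_eval[symmetric,OF Lact_deg[OF f h] hc(1) gs True])
  finally show ?thesis .
 next
  case False
  then show ?thesis using LVD(3) Lact_LV fL hc M.mult_hc by metis
 qed
qed

lemma Lact_mult:
 assumes f:"f:LV" and g:"g:M.hc" and h:"h:M.hc"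
 shows "Lact (g * h) f = Lact g (Lact h f)"
proof -
 note add = linear_on_add[OF Lact_linear] linear_on_add[OF Lact_linear_left]
 have 1:"Lact (g * h) f = Lact g (Lact h f)" if f:"f:LG j" and h:"h:M.hg m" and g:"g:M.hc" for f g h j m
  using g
 proof (induction rule: M.h.homog_induct)
  case zero
  have z:"Lact 0 k = 0" if "k:LV" for k using M.h.linear_on_0[OF Lact_linear_left[OF that] M.h.subV] .
  show ?case using z Lact_LV LG_LV[OF f] M.hg_hc[OF h] by simp
 next
  case (add x y)
  then show ?case using f h M.hg_hc LG_LV Lact_LV by(simp add:distrib_right add linear_on_add[OF Lact_linear_left])
 qed (rule Lact_mult_homog[OF f _ h])
 have 2:"Lact (g * h) f = Lact g (Lact h f)" if f:"f:LG j" and h:"h:M.hc" for f h j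
  using h
 proof (induction rule: M.h.homog_induct)
  case zero
  have z:"Lact 0 f = 0" using M.h.linear_on_0[OF Lact_linear_left[OF LG_LV[OF f]] M.h.subV] .
  show ?case unfolding mult_zero_right z by(rule Lv.linear_on_0[OF Lact_linear[OF g] LV_sub,symmetric])
 next
  case (add x y)
  note fL = LG_LV[OF f] and x = add.hyps(1) and y = add.hyps(2)
  show ?case
  unfolding distrib_left linear_on_add[OF Lact_linear_left[OF fL] M.mult_hc[OF g x] M.mult_hc[OF g y]]
  linear_on_add[OF Lact_linear_left[OF fL] x y]
  linear_on_add[OF Lact_linear[OF g] Lact_LV[OF fL x] Lact_LV[OF fL y]] add.IH ..
 qed (rule 1[OF f _ g])
 show ?thesis using f
 proof (induction rule: Lg.homog_induct)
  case zero
  have z:"Lact k 0 = 0" if "k:M.hc" for k by(rule Lv.linear_on_0[OF Lact_linear[OF that] LV_sub])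
  show ?case unfolding z[OF M.mult_hc[OF g h]] z[OF h] z[OF g] ..
 next
  case (add x y)
  show ?case
  unfolding linear_on_add[OF Lact_linear[OF M.mult_hc[OF g h]] add.hyps] linear_on_add[OF Lact_linear[OF h] add.hyps]
  linear_on_add[OF Lact_linear[OF g] Lact_LV[OF add.hyps(1) h] Lact_LV[OF add.hyps(2) h]] add.IH ..
 qed (rule 2[OF _ h])
qed

lemma Lact_one:"f:LV==>Lact 1 f = f"
proof (induction rule: Lg.homog_induct)
 case zero
 show ?case by(rule Lv.linear_on_0[OF Lact_linear[OF M.one_hc] LV_sub])
next
 case (add x y)
 show ?case unfolding linear_on_add[OF Lact_linear[OF M.one_hc] add.hyps(1,2)] add.IH ..
next
 case (homog j f)
 have r:"M.rep 0 1 [(0,1,1)]" by(simp add:M.rep_def M.coprod_1)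
 show ?case
 proof
  fix v
  show "Lact 1 f v = f v"
  using Lact_eval[OF homog M.one_hc r,of v] LVD[OF LG_LV[OF homog]] LVD(3)[OF Lact_LV[OF LG_LV[OF homog] M.one_hc]]
  by(cases "v:N.mV") auto
 qed
qed

lemma hmod_ghom:"hmod s H L"
proof -
 have "graded_module (alg H) L"
  unfolding graded_module_def L_simps alg_simps
  by(intro conjI allI ballI L_vs LV_sub Lg.graded Lact_LV Lact_linear Lact_mult Lact_one Lact_deg
  linear_on_add[OF Lact_linear_left] linear_on_scale[OF Lact_linear_left])
 then show ?thesis using L_fd by unfold_locales (simp add:M.gr_iff)
qed

sublocale L: hmod s H L by(rule hmod_ghom)

lemma hcomp_L:"f:LV==>hcomp LG f = Lcomp f"
 by(rule Lg.hcomp_unique[OF _ Lcomp_dec])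

text \<open>For submodules \<open>K\<close> and \<open>U\<close> this is \<open>Hom(N/K, U)\<close>
  inside \<open>Hom(N, M)\<close>.\<close>

definition hsub :: "'w set => 'v set => ('w => 'v) set" where
 "hsub K U = {f:LV. (ALL v:K. f v = 0) & (ALL v:N.mV. f v:U)}"

lemma gsub_hsub:
 assumes K:"N.gsub K" and U:"M.gsub U"
 shows "L.gsub (hsub K U)"
proof -
 note sU = M.gsubD(1)[OF U]
 have sub:"Lv.subspace (hsub K U)"
  unfolding hsub_def
  by(rule Lv.subspaceI)
  (auto simp:Lv.subspace_0[OF LV_sub] Lv.subspace_add[OF LV_sub] Lv.subspace_scale[OF LV_sub]
  M.m.subspace_0[OF sU] M.m.subspace_add[OF sU] M.m.subspace_scale[OF sU])
 have comp:"hcomp LG f i:hsub K U" if f:"f:hsub K U" for f i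
 proof -
  have fL:"f:LV" using f by(simp add:hsub_def)
  have "Lcomp f i v:U" if "v:N.mV" for v
  unfolding Lcomp_def using that f N.m.hcomp_V
  by(auto simp:hsub_def intro!:M.m.subspace_sum[OF sU] M.gsubD(3)[OF U])
  moreover have "Lcomp f i v = 0" if "v:K" for v
  unfolding Lcomp_def using f N.gsubD(3)[OF K that] by(simp add:hsub_def)
  ultimately show ?thesis using hcomp_L[OF fL] Lcomp_LV[OF fL] by(simp add:hsub_def)
 qed
 have hact:"homact s H N M h j f:hsub K U" if f:"f:hsub K U" and h:"h:M.hc" for f h j
 proof -
  have fL:"f:LV" using f by(simp add:hsub_def)
  obtain xs where xs:"set xs <= M.hc \<times> M.hc" "coprod H h = (SUM (a,b)<-xs. M.T a b)" using M.coprod_list[OF h] .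
  have x:"a:M.hc & b:M.hc" if "(a,b):set xs" for a b using xs(1) that by auto
  have "homact s H N M h j f v:U" if v:"v:N.mV" for v
  unfolding homact_list[OF fL v xs] using x v f
  by(intro M.m.subspace_sum_list[OF sU]) (auto simp:hsub_def intro!:M.gsubD(4)[OF U])
  moreover have "homact s H N M h j f v = 0" if v:"v:K" for v
  proof -
  have vV:"v:N.mV" using N.gsubD(2)[OF K v] .
  have "M.act a (f (N.act (M.S (twist s H j b)) v)) = 0" if ab:"(a,b):set xs" for a b
  using x[OF ab] f N.gsubD(4)[OF K _ v,of "M.S (twist s H j b)"] by(simp add:hsub_def)
  then have "(SUM (a,b)<-zs. M.act a (f (N.act (M.S (twist s H j b)) v))) = 0" if "set zs <= set xs" for zs
  using that by(induction zs) auto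
  then show ?thesis unfolding homact_list[OF fL vV xs] by simp
  qed
  ultimately show ?thesis using homact_LV[OF fL h] by(simp add:hsub_def)
 qed
 have "Lact h f:hsub K U" if "f:hsub K U" "h:M.hc" for f h
  unfolding Lact_eq hext_def by(intro Lv.subspace_sum[OF sub] hact comp that)
 moreover have "L.m.graded_sub (hsub K U)"
  by(rule L.m.graded_subI) (use sub comp in "auto simp:hsub_def")
 ultimately show ?thesis by(simp add:L.gsub_def)
qed

end

text \<open>Homogeneous dual functionals make the inverse map in \<open>tensor_hom_iso\<close>
  degree-preserving.\<close>

lemma (in fgvs) homog_dual_basis:
 obtains B d mu where "finite B" "!!b. b:B==>b:G (d b)" "!!b. b:B==>linear_on sc (*) V (mu b)"
  "!!b i y. b:B==>y:G i==>i ~= d b==>mu b y = 0"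
  "!!b c. b:B==>c:B==>mu b c = (if b = c then 1 else 0)"
  "!!v. v:V==>v = (SUM b:B. sc (mu b v) b)"
proof -
 have g0:"graded_sub {0}" by(rule graded_subI) (auto simp:subspace_0[OF subV])
 obtain B where B:"finite B" "B <= (UN i. G i)" "V = span ({} Un B)" "independent ({} Un B)"
  by(rule homog_basis_extend[OF g0,of "{}" "{}"]) (auto simp:independent_empty)
 have sp:"V = span B" and ind:"independent B" using B(3,4) by auto
 have "ALL b:B. EX i. b:G i" using B(2) by auto
 then obtain d where d:"!!b. b:B==>b:G (d b)" by metis
 have "EX mu. linear_on sc (*) V mu & mu b = 1 & (ALL w:span (B - {b}). mu w = 0) & (ALL i y. y:G i --> i ~= d b --> mu y = 0)"
  if b:"b:B" for b
 proof -
  have "graded_sub (span (B - {b}))" by(rule graded_sub_span) (use B(2) in auto)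
  moreover have "b ~: span (B - {b})" using ind b by(auto simp:dependent_def)
  ultimately show ?thesis using graded_functional[of "span (B - {b})" b "d b"] d[OF b] by metis
 qed
 then have "EX mu. ALL b:B. linear_on sc (*) V (mu b) & mu b b = 1 & (ALL w:span (B - {b}). mu b w = 0)
  & (ALL i y. y:G i --> i ~= d b --> mu b y = 0)" by(intro bchoice ballI)
 then obtain mu where mu0:"ALL b:B. linear_on sc (*) V (mu b) & mu b b = 1 & (ALL w:span (B - {b}). mu b w = 0)
  & (ALL i y. y:G i --> i ~= d b --> mu b y = 0)" ..
 then have mu:"!!b. b:B==>linear_on sc (*) V (mu b)" "!!b. b:B==>mu b b = 1"
  "!!b w. b:B==>w:span (B - {b})==>mu b w = 0"
  "!!b i y. b:B==>y:G i==>i ~= d b==>mu b y = 0" by blast+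
 have delta:"mu b c = (if b = c then 1 else 0)" if "b:B" "c:B" for b c
  using that mu(2) mu(3)[of b c] span_base[of c "B - {b}"] by auto
 have dual:"v = (SUM b:B. sc (mu b v) b)" if v:"v:V" for v
 proof -
  obtain c where c:"v = (SUM b:B. sc (c b) b)" using v sp span_finite[OF B(1)] by auto
  have BV:"B <= V" using d G_V by blast
  have "mu b v = c b" if b:"b:B" for b
  proof -
  have "mu b v = (SUM z:B. mu b (sc (c z) z))"
  unfolding c by(rule linear_on_sum[OF mu(1)[OF b] subV]) (use BV subspace_scale[OF subV] in auto)
  also have "... = (SUM z:B. if z = b then c b else 0)"
  by(intro sum.cong) (use BV b linear_on_scale[OF mu(1)[OF b]] delta in auto)
  also have "... = c b" using B(1) b by simp
  finally show ?thesis .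
  qed
  then have "(SUM b:B. sc (mu b v) b) = (SUM b:B. sc (c b) b)" by(intro sum.cong refl) simp
  then show ?thesis by(rule trans[OF c sym])
 qed
 show thesis by(rule that[OF B(1) d mu(1,4) delta dual])
qed

section \<open>Submodules, removal of free summands, and coordinate functionals\<close>

context hmod
begin

lemma gsub_0:"gsub {0}"
 by(auto simp:gsub_def m.graded_sub_def)

lemma sub_hspan:"hmod.hspan H (msub M K) X = hspan X" if "gsub K" for K X
proof -
 interpret K: hmod s H "msub M K" by(rule hmod_msub[OF that])
 show ?thesis unfolding K.hspan_def hspan_def by simp
qed

lemma sub_free:"hmod.free_basis H (msub M K) X \<longleftrightarrow> X <= K & free_basis X" if "gsub K" for K X
proof -
 interpret K: hmod s H "msub M K" by(rule hmod_msub[OF that])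
 show ?thesis unfolding K.free_basis_def free_basis_def by auto
qed

lemma sub_soc:"hmod.soc H (msub M K) x \<longleftrightarrow> x:K & soc x" if "gsub K" for K x
proof -
 interpret K: hmod s H "msub M K" by(rule hmod_msub[OF that])
 show ?thesis unfolding K.soc_def soc_def using gsubD(2)[OF that] by auto
qed

lemma sub_gsub:"hmod.gsub H (msub M K) Q \<longleftrightarrow> Q <= K & gsub Q" if K:"gsub K" for K Q
proof -
 interpret K: hmod s H "msub M K" by(rule hmod_msub[OF K])
 have gK:"m.graded_sub K" using K by(simp add:gsub_def)
 have c:"hcomp (%i. mG i Int K) w = hcomp mG w" if "w:K" for w
  by(rule m.gvs_sub(2)[OF gK that])
 show ?thesis
  unfolding K.gsub_def K.m.graded_sub_def unfolding gsub_def m.graded_sub_def msub_simps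
  using c gsubD(2)[OF K] by(auto simp:subset_iff)
qed

lemma zero_notin_free:"free_basis X==>0 ~: X"
proof
 assume X:"free_basis X" and 0:"0:X"
 have "(SUM x:X. act (if x = 0 then 1 else 0) x) = 0"
  by(rule sum.neutral) (use free_basisD(3)[OF X] in auto)
 moreover have "(if x = 0 then 1 else 0):hc" for x :: 'v by simp
 ultimately show False using free_basisD(4)[OF X,of "%x. if x = 0 then 1 else 0" 0] 0 one_neq_0 by simp
qed

lemma free_Un:
 assumes Y:"free_basis Y" and Y':"free_basis Y'" and int:"hspan Y Int hspan Y' <= {0}"
 shows "free_basis (Y Un Y')" "hspan (Y Un Y') = {p + q | p q. p:hspan Y & q:hspan Y'}"
proof -
 note fin = free_basisD(1)[OF Y] free_basisD(1)[OF Y']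
 have YV:"Y <= mV" "Y' <= mV" using free_basisD(3)[OF Y] free_basisD(3)[OF Y'] by auto
 have disj:"Y Int Y' = {}"
  using hspan_base[OF fin(1) YV(1)] hspan_base[OF fin(2) YV(2)] int zero_notin_free[OF Y] by blast
 have split:"(SUM x:Y Un Y'. act (f x) x) = (SUM x:Y. act (f x) x) + (SUM x:Y'. act (f x) x)" for f
  by(rule sum.union_disjoint[OF fin disj])
 show "free_basis (Y Un Y')"
  unfolding free_basis_def
 proof (intro conjI allI impI)
  show "finite (Y Un Y')" using fin by simp
  show "Y Un Y' <= (UN i. mG i)" using Y Y' by(auto simp:free_basis_def)
  fix f assume f:"ALL x:Y Un Y'. f x:hc" "(SUM x:Y Un Y'. act (f x) x) = 0"
  let ?p = "SUM x:Y. act (f x) x" and ?q = "SUM x:Y'. act (f x) x"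
  have pq:"?p:hspan Y" "?q:hspan Y'" using f(1) by(auto intro!:hspanI)
  have "?p = - ?q" using f(2) split by(simp add:eq_neg_iff_add_eq_0)
  then have "?p:hspan Y'" using pq(2) m.subspace_neg[OF gsubD(1)[OF free_gsub[OF Y']]] by simp
  then have p0:"?p = 0" using int pq(1) by blast
  then have q0:"?q = 0" using f(2) split by simp
  have "f x = 0" if "x:Y" for x by(rule free_basisD(4)[OF Y _ p0 that]) (use f(1) in auto)
  moreover have "f x = 0" if "x:Y'" for x by(rule free_basisD(4)[OF Y' _ q0 that]) (use f(1) in auto)
  ultimately show "ALL x:Y Un Y'. f x = 0" by blast
 qed
 show "hspan (Y Un Y') = {p + q | p q. p:hspan Y & q:hspan Y'}"
 proof (intro equalityI subsetI)
  fix v assume "v:hspan (Y Un Y')"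
  then obtain f where f:"ALL x:Y Un Y'. f x:hc" "v = (SUM x:Y Un Y'. act (f x) x)" by(elim hspan_ex[THEN exE] conjE)
  have "(SUM x:Y. act (f x) x):hspan Y" "(SUM x:Y'. act (f x) x):hspan Y'" using f(1) by(auto intro!:hspanI)
  then show "v:{p + q | p q. p:hspan Y & q:hspan Y'}" unfolding f(2) split by blast
 next
  fix v assume "v:{p + q | p q. p:hspan Y & q:hspan Y'}"
  then obtain p q where pq:"p:hspan Y" "q:hspan Y'" "v = p + q" by blast
  have gs:"gsub (hspan (Y Un Y'))" by(rule gsub_hspan) (use Y Y' in "auto simp:free_basis_def")
  have "hspan Y <= hspan (Y Un Y')" "hspan Y' <= hspan (Y Un Y')"
  using hspan_mono[of "Y Un Y'" Y] hspan_mono[of "Y Un Y'" Y'] fin YV by auto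
  then show "v:hspan (Y Un Y')" using pq m.subspace_add[OF gsubD(1)[OF gs]] by blast
 qed
qed

text \<open>A maximal free part of \<open>K\<close> together with \<open>Y\<close> is a maximal free
  part of the whole module, with the same complement \<open>K'\<close>; by
  \<open>KF_complement\<close> both conditions say that \<open>K'\<close> is an invariant line in
  degree 0.\<close>

lemma KF_sub:
 assumes pos:"htop > 0" and Y:"free_basis Y" and K:"idirect (hspan Y) K"
 shows "KF \<longleftrightarrow> hmod.KF H (msub M K)"
proof -
 note gK = idirectD(2)[OF K] and gP = idirectD(1)[OF K]
 note sK = gsubD(1)[OF gK] and sP = gsubD(1)[OF gP]
 interpret K: hmod s H "msub M K" by(rule hmod_msub[OF gK])
 obtain Y' K' where Y'K:"K.free_basis Y'" and K'K:"K.idirect (K.hspan Y') K'" and L0:"!!k. k:K'==>K.act Lam k = 0"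
  using K.decomposition by blast
 have hs':"K.hspan Y' = hspan Y'" by(rule sub_hspan[OF gK])
 have Y':"free_basis Y'" "Y' <= K" using Y'K sub_free[OF gK] by auto
 have gK':"gsub K'" "K' <= K" using K.idirectD(2)[OF K'K] sub_gsub[OF gK] by auto
 have sub':"hspan Y' <= K" by(rule hspan_minimal[OF Y'(2) gK])
 have int:"hspan Y Int hspan Y' <= {0}" using sub' idirectD(3)[OF K] by blast
 note U = free_Un[OF Y Y'(1) int]
 have dir:"idirect (hspan (Y Un Y')) K'"
  unfolding idirect_def
 proof (intro conjI ballI)
  show "gsub (hspan (Y Un Y'))" by(rule free_gsub[OF U(1)])
  show "gsub K'" by(rule gK'(1))
  show "hspan (Y Un Y') Int K' = {0}"
  proof (intro equalityI subsetI)
  fix v assume v:"v:hspan (Y Un Y') Int K'"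
  then obtain p q where pq:"p:hspan Y" "q:hspan Y'" "v = p + q" using U(2) by blast
  have "p = v - q" using pq by simp
  then have "p:K" using v gK'(2) sub' pq(2) m.subspace_diff[OF sK] by blast
  then have "p = 0" using pq(1) idirectD(3)[OF K] by blast
  then have "v:K.hspan Y'" using pq hs' by simp
  then show "v:{0}" using K.idirectD(3)[OF K'K] v by blast
  next
  fix v assume "v:{0::'v}"
  then show "v:hspan (Y Un Y') Int K'"
  using m.subspace_0[OF gsubD(1)[OF free_gsub[OF U(1)]]] m.subspace_0[OF gsubD(1)[OF gK'(1)]] by auto
  qed
  fix v assume "v:mV"
  then obtain p k where pk:"p:hspan Y" "k:K" "v = p + k" using idirectD(4)[OF K] by blast
  obtain q k' where qk:"q:hspan Y'" "k':K'" "k = q + k'" using K.idirectD(4)[OF K'K] pk(2) hs' by force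
  have "p + q:hspan (Y Un Y')" using U(2) pk qk by blast
  then show "EX p:hspan (Y Un Y'). EX k:K'. v = p + k"
  using pk qk by(intro bexI[of _ "p + q"] bexI[of _ k']) (auto simp:add.assoc)
 qed
 have L0':"act Lam k = 0" if "k:K'" for k using L0[OF that] by simp
 show ?thesis
 proof
  assume KF
  from KF_complement[OF pos U(1) dir L0' this] obtain y where
  y:"y:mG 0" "y ~= 0" "soc y" "K' = range (%c. sc c y)" by blast
  have "y:K'" using y(4) m.scale_one[of y] by(metis rangeI)
  then have "y:K" using gK' by blast
  then show K.KF using K.KF_I[OF Y'K K'K,of y] y sub_soc[OF gK] by auto
 next
  assume K.KF
  from K.KF_complement[OF pos Y'K K'K L0 this] obtain y where
  y:"y:K.mG 0" "y ~= 0" "K.soc y" "K' = range (%c. K.sc c y)" by blast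
  then show KF using KF_I[OF U(1) dir,of y] sub_soc[OF gK] by auto
 qed
qed

text \<open>The functional \<open>nu x\<close> is \<open>frob\<close> of the coefficient at
  \<open>x\<close>, extended by 0 to \<open>K\<close>; its support lies in degree
  \<open>d x + htop\<close>, the degree of \<open>Lam\<close> times \<open>x\<close>.\<close>

lemma free_functionals:
 assumes X:"free_basis X" and K:"idirect (hspan X) K"
 obtains nu d where "!!x. x:X==>x:mG (d x)" "!!x. x:X==>linear_on sc (*) mV (nu x)"
  "!!x k. x:X==>k:K==>nu x k = 0"
  "!!x f. x:X==>(!!z. z:X==>f z:hc)==>nu x (SUM z:X. act (f z) z) = frob (f x)"
  "!!x i v. x:X==>v:mG i==>i ~= d x + htop==>nu x v = 0"
proof -
 note gP = idirectD(1)[OF K] and gK = idirectD(2)[OF K]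
 have XV:"X <= mV" using free_basisD(3)[OF X] by auto
 have "ALL x:X. EX j. x:mG j" using free_basisD(2)[OF X] by auto
 then obtain d where d:"!!x. x:X==>x:mG (d x)" by metis
 define R where "R v f k \<longleftrightarrow> (ALL z:X. f z:hc) & k:K & v = (SUM z:X. act (f z) z) + k" for v f k
 \<comment> \<open>The coefficient function of \<open>v\<close> is unique only on \<open>X\<close>,
   and only its value at \<open>x\<close> in \<open>X\<close> matters.\<close>
 define nu where "nu x v = frob ((SOME f. EX k. R v f k) x)" for x v
 have uniq:"f x = g x" if R:"R v f k" "R v g k'" and x:"x:X" for v f g k k' x
 proof -
  have fg:"ALL z:X. f z:hc" "ALL z:X. g z:hc" and k:"k:K" "k':K"
  and eq:"(SUM z:X. act (f z) z) + k = (SUM z:X. act (g z) z) + k'" using R by(auto simp:R_def)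
  have s:"(SUM z:X. act (f z - g z) z) = (SUM z:X. act (f z) z) - (SUM z:X. act (g z) z)"
  unfolding sum_subtractf[symmetric] by(intro sum.cong) (use fg XV in "auto simp:act_diff_left")
  also have "... = k' - k" using eq by(simp add:algebra_simps)
  finally have "(SUM z:X. act (f z - g z) z) = k' - k" .
  moreover have "(SUM z:X. act (f z - g z) z):hspan X" by(rule hspanI) (use fg in auto)
  moreover have "k' - k:K" by(rule m.subspace_diff[OF gsubD(1)[OF gK] k(2,1)])
  ultimately have "(SUM z:X. act (f z - g z) z) = 0" using idirectD(3)[OF K] by metis
  then have "f x - g x = 0"
  by(rule free_basisD(4)[OF X,of "%z. f z - g z",rotated]) (use fg x in auto)
  then show ?thesis by simp
 qed
 have nu:"nu x v = frob (f x)" if R:"R v f k" and x:"x:X" for v f k x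
 proof -
  have "EX f k. R v f k" using R by blast
  from someI_ex[OF this] obtain k' where "R v (SOME f. EX k. R v f k) k'" by blast
  from uniq[OF this R x] show ?thesis by(simp add:nu_def)
 qed
 have ex:"EX f k. R v f k" if "v:mV" for v
 proof -
  obtain p k where pk:"p:hspan X" "k:K" "v = p + k" using idirectD(4)[OF K \<open>v:mV\<close>] by blast
  obtain f where "ALL z:X. f z:hc" "p = (SUM z:X. act (f z) z)" using hspan_ex[OF pk(1)] by(elim exE conjE)
  then show ?thesis using pk unfolding R_def by blast
 qed
 have lin:"linear_on sc (*) mV (nu x)" if x:"x:X" for x
 proof (rule linear_onI)
  fix v w assume "v:mV" "w:mV"
  then obtain f k g l where R:"R v f k" "R w g l" using ex by meson
  have "R (v + w) (%z. f z + g z) (k + l)"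
  proof -
  have "(SUM z:X. act (f z + g z) z) = (SUM z:X. act (f z) z) + (SUM z:X. act (g z) z)"
  unfolding sum.distrib[symmetric] by(intro sum.cong) (use R XV in "auto simp:R_def act_add_left")
  then show ?thesis using R m.subspace_add[OF gsubD(1)[OF gK]] by(auto simp:R_def)
  qed
  from nu[OF this x] nu[OF R(1) x] nu[OF R(2) x]
  show "nu x (v + w) = nu x v + nu x w" using R x by(simp add:R_def linear_on_add[OF frob_linear])
 next
  fix c v assume "v:mV"
  then obtain f k where R:"R v f k" using ex by meson
  have "R (sc c v) (%z. hs c (f z)) (sc c k)"
  proof -
  have "(SUM z:X. act (hs c (f z)) z) = sc c (SUM z:X. act (f z) z)"
  unfolding m.scale_sum_right by(intro sum.cong) (use R XV in "auto simp:R_def act_scale_left")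
  then show ?thesis using R m.subspace_scale[OF gsubD(1)[OF gK]] by(auto simp:R_def m.scale_right_distrib)
  qed
  from nu[OF this x] nu[OF R(1) x]
  show "nu x (sc c v) = c * nu x v" using R x by(simp add:R_def linear_on_scale[OF frob_linear])
 qed
 have supp:"nu x v = 0" if x:"x:X" and v:"v:mG i" "i ~= d x + htop" for x i v
 proof -
  obtain f k where R:"R v f k" using ex v mG_mV by meson
  then have f:"!!z. z:X==>f z:hc" and k:"k:K" and veq:"v = (SUM z:X. act (f z) z) + k" by(auto simp:R_def)
  have fV:"!!z. z:X==>act (f z) z:mV" using f XV by auto
  have "v = hcomp mG v i" using v by(simp add:m.hcomp_homog)
  also have "... = hcomp mG (SUM z:X. act (f z) z) i + hcomp mG k i"
  proof -
  have "(SUM z:X. act (f z) z):mV" by(intro m.subspace_sum[OF m.subV] fV)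
  from m.hcomp_add[OF this gsubD(2)[OF gK k]] show ?thesis unfolding veq by simp
  qed
  also have "hcomp mG (SUM z:X. act (f z) z) i = (SUM z:X. act (hcomp hg (f z) (i - d z)) z)"
  by(subst m.hcomp_sums[OF fV],assumption) (intro sum.cong refl hcomp_act_right f d)
  finally have "R v (%z. hcomp hg (f z) (i - d z)) (hcomp mG k i)"
  using f h.hcomp_V gsubD(3)[OF gK k] by(auto simp:R_def)
  from nu[OF this x] show ?thesis using frob_hg[OF h.hcomp_G[OF f[OF x]],of "i - d x"] v(2) by simp
 qed
 have zK:"0:K" by(rule m.subspace_0[OF gsubD(1)[OF gK]])
 show thesis
 proof (rule that[OF d lin _ _ supp])
  fix x k assume x:"x:X" and k:"k:K"
  have "(SUM z:X. act 0 z) = 0" by(rule sum.neutral) (use XV in auto)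
  then have "R k (%z. 0) k" using k by(simp add:R_def)
  from nu[OF this x] show "nu x k = 0" by simp
 next
  fix x f assume x:"x:X" and f:"!!z. z:X==>f z:hc"
  have "R (SUM z:X. act (f z) z) f 0" using f zK by(simp add:R_def)
  from nu[OF this x] show "nu x (SUM z:X. act (f z) z) = frob (f x)" .
 qed auto
qed

end

definition hlin :: "('k,'h) hopf => ('k,'h,'v::ab_group_add) gmodule => ('k,'h,'w::ab_group_add) gmodule => ('v => 'w) => bool" where
 "hlin H M N g \<longleftrightarrow> (ALL x:mcarrier M. g x:mcarrier N) & (ALL x:mcarrier M. ALL y:mcarrier M. g (x + y) = g x + g y)
  & (ALL a:hcarrier H. ALL x:mcarrier M. g (mact M a x) = mact N a (g x)) & (ALL i. ALL x:mgrade M i. g x:mgrade N i)"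

lemma hlinD:
 assumes "hlin H M N g"
 shows "x:mcarrier M==>g x:mcarrier N" "x:mcarrier M==>y:mcarrier M==>g (x + y) = g x + g y"
  "a:hcarrier H==>x:mcarrier M==>g (mact M a x) = mact N a (g x)" "x:mgrade M i==>g x:mgrade N i"
 using assms by(auto simp:hlin_def)

lemma hlin_compose:"hlin H M N f==>hlin H N K g==>hlin H M K (%x. g (f x))"
 by(auto simp:hlin_def)

subsection \<open>Linear maps from or to a free module\<close>

text \<open>A nonzero complement of a maximal free part would contain a nonzero invariant. By
  hypothesis this is \<open>Lam w\<close>, and since \<open>Lam\<close> kills the complement it
  would also lie in the free part.\<close>

lemma (in hmod) free_if_socle:
 assumes W:"gsub W" and soc:"!!z i. z:W==>z:mG i==>soc z==>z:act Lam ` W"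
 obtains Y where "free_basis Y" "hspan Y = W"
proof -
 interpret W: hmod s H "msub M W" by(rule hmod_msub[OF W])
 obtain Y K where Y:"W.free_basis Y" and K:"W.idirect (W.hspan Y) K" and K0:"!!k. k:K==>W.act Lam k = 0"
  using W.decomposition by blast
 note hs = sub_hspan[OF W] and gP = W.idirectD(1)[OF K] and gK = W.idirectD(2)[OF K]
 have PW:"p:mV" if "p:W.hspan Y" for p using gsubD(2)[OF W] W.gsubD(2)[OF gP that] by simp
 have KW:"k:mV" if "k:K" for k using gsubD(2)[OF W] W.gsubD(2)[OF gK that] by simp
 have Kz:"k = 0" if k:"k:K" for k
 proof (rule ccontr)
  assume "k ~= 0"
  then obtain y i where y:"y:K" "y:W.mG i" "y ~= 0" "W.soc y" using W.socle_nonzero[OF gK k] by blast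
  obtain w where w:"w:W" "y = act Lam w" using soc[of y i] y(2,4) sub_soc[OF W] by auto
  have "w:W.mV" using w(1) by simp
  then obtain p k' where pk:"p:W.hspan Y" "k':K" "w = p + k'" using W.idirectD(4)[OF K] by blast
  have "y = act Lam p" using w(2) K0[OF pk(2)] PW[OF pk(1)] KW[OF pk(2)] unfolding pk(3) by(simp add:act_add)
  then have "y:W.hspan Y" using W.gsubD(4)[OF gP Lam_hc pk(1)] by simp
  then show False using W.idirectD(3)[OF K _ y(1)] y(3) by blast
 qed
 have "hspan Y = W"
 proof (intro equalityI subsetI)
  show "v:W" if "v:hspan Y" for v using W.gsubD(2)[OF gP] that hs by simp
  fix v assume "v:W"
  then have "v:W.mV" by simp
  then obtain p k where pk:"p:W.hspan Y" "k:K" "v = p + k" using W.idirectD(4)[OF K] by blast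
  then have "v = p" using Kz[OF pk(2)] by simp
  then show "v:hspan Y" using pk(1) hs by simp
 qed
 then show thesis using that Y sub_free[OF W] by blast
qed

context hpair
begin

text \<open>The rank one map that corresponds to \<open>m \<otimes> nu\<close>.\<close>

definition E :: "('w => 'k) => 'v => 'w => 'v" where
 "E nu m = (%v. if v:N.mV then M.sc (nu v) m else 0)"

lemma E_LV:"linear_on N.sc (*) N.mV nu==>m:M.mV==>E nu m:LV"
 by(rule LVI) (auto simp:E_def linear_on_def M.m.scale_left_distrib)

lemma E_LG:
 assumes "linear_on N.sc (*) N.mV nu" "!!i v. v:N.mG i==>i ~= l==>nu v = 0" "m:M.mG k"
 shows "E nu m:LG (k - l)"
proof -
 have "E nu m v:M.mG (k - l + j)" if v:"v:N.mG j" for v j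
 proof (cases "j = l")
  case True
  then show ?thesis using v assms(3) N.mG_mV M.m.subspace_scale[OF M.m.subG] by(auto simp:E_def)
 next
  case False
  then show ?thesis using assms(2)[OF v] by(simp add:E_def)
 qed
 then show ?thesis using E_LV[OF assms(1) M.mG_mV[OF assms(3)]] by(simp add:homgrade_def)
qed

lemma E_add_right:"E nu (m + m') = E nu m + E nu m'"
 by(rule ext) (auto simp:E_def M.m.scale_right_distrib)

text \<open>Two identities indexed by the coproduct of \<open>h\<close> are compared at
  \<open>v\<close>: invariance of \<open>f\<close>, and the antipode identity applied to
  \<open>f v\<close>. By induction their terms agree except for those with \<open>S h\<close>.
  Surjectivity of \<open>S\<close> then covers every \<open>a\<close>.\<close>

lemma soc_twist:
 assumes f:"f:LG j" and soc:"L.soc f" and a:"a:M.hg n" and v:"v:N.mV"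
 shows "f (N.act a v) = M.sc (xsign s n j) (M.act a (f v))"
proof -
 note fL = LG_LV[OF f]
 note fv = LVD(2)[OF fL v]
 have S:"f (N.act (M.S h) v) = M.sc (xsign s n j) (M.act (M.S h) (f v))" if "h:M.hg n" for h n
  using that
 proof (induction "nat n" arbitrary: n h rule: less_induct)
  case less
  note hhc = M.hg_hc[OF less.prems]
  consider "n < 0" | "n = 0" | "n > 0" by linarith
  then show ?case
  proof cases
  case 1
  then have "h = 0" using less.prems M.hg_neg by auto
  then show ?thesis using v fv LV_0[OF fL] by simp
  next
  case 2
  then obtain c where "h = M.hs c 1" using less.prems M.hg_0 by auto
  then have "M.S h = M.hs c 1" by(simp add:linear_on_scale[OF M.S_linear])
  then show ?thesis using v fv 2 by(simp add:N.act_scale_left M.act_scale_left LVD(5)[OF fL])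
  next
  case n: 3
  obtain hr where hr:"M.rep n h ((0,1,h) # hr)" "!!i a b. (i,a,b):set hr==>0 < i & i <= n"
  using M.rep_left_ex[OF less.prems] by blast
  have mem:"a:M.hc & b:M.hc & b:M.hg (n - i) & 0 < i & i <= n" if "(i,a,b):set hr" for i a b
  using M.rep_mem[OF hr(1),of i a b] M.rep_mem_hc[OF hr(1),of i a b] hr(2)[OF that] that by auto
  have "Lact h f = 0" using soc n less.prems by(auto simp:L.soc_def)
  then have "0 = (SUM (i,a,b)<-(0,1,h) # hr. M.sc (xsign s (n - i) j) (M.act a (f (N.act (M.S b) v))))"
  using Lact_eval[OF f hhc hr(1) v] by simp
  also have "... = M.sc (xsign s n j) (f (N.act (M.S h) v)) + (SUM (i,a,b)<-hr. M.sc (xsign s (n - i) j) (M.act a (f (N.act (M.S b) v))))"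
  using v fL hhc by(simp add:LVD)
  also have "(SUM (i,a,b)<-hr. M.sc (xsign s (n - i) j) (M.act a (f (N.act (M.S b) v)))) = (SUM (i,a,b)<-hr. M.act (a * M.S b) (f v))"
  proof (rule M.sum_list_cong2)
  fix i a b assume "(i,a,b):set hr"
  note m = mem[OF this]
  have "f (N.act (M.S b) v) = M.sc (xsign s (n - i) j) (M.act (M.S b) (f v))" by(rule less.hyps) (use m in auto)
  then show "M.sc (xsign s (n - i) j) (M.act a (f (N.act (M.S b) v))) = M.act (a * M.S b) (f v)"
  using m fv by(simp add:M.act_mult M.act_scale)
  qed
  finally have 1:"M.sc (xsign s n j) (f (N.act (M.S h) v)) + (SUM (i,a,b)<-hr. M.act (a * M.S b) (f v)) = 0" by simp
  have "0 = M.act (M.hs (M.eps h) 1) (f v)" using M.counit_hg[OF less.prems] n fv by simp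
  also have "M.hs (M.eps h) 1 = (SUM (i,a,b)<-(0,1,h) # hr. a * M.S b)"
  unfolding M.S_right[OF hhc,symmetric]
  by(rule M.rep_eval[OF hr(1) M.h.vector_space_axioms]) (rule M.bilinear_mult[OF M.linear_id M.S_linear],auto)
  also have "M.act ... (f v) = (SUM (i,a,b)<-(0,1,h) # hr. M.act (a * M.S b) (f v))"
  unfolding case_prod_unfold
  by(rule M.h.linear_on_sum_list[OF M.act_linear_left[OF fv] M.h.subV]) (use mem hhc in force)
  also have "... = M.act (M.S h) (f v) + (SUM (i,a,b)<-hr. M.act (a * M.S b) (f v))" by simp
  finally have "M.sc (xsign s n j) (f (N.act (M.S h) v)) = M.act (M.S h) (f v)" using 1 by(metis add_right_cancel)
  then have "M.sc (xsign s n j) (M.act (M.S h) (f v)) = M.sc (xsign s n j * xsign s n j) (f (N.act (M.S h) v))"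
  by(simp only: M.m.scale_scale[symmetric])
  then show ?thesis by simp
  qed
 qed
 obtain y where "y:M.hg n" "a = M.S y" using M.S_surj[OF a] by blast
 then show ?thesis using S by simp
qed

lemma soc_hlin:
 assumes f:"f:LG 0" and soc:"L.soc f"
 shows "hlin H N M f"
proof -
 note fL = LG_LV[OF f]
 have "f (N.act a v) = M.act a (f v)" if a:"a:M.hc" and v:"v:N.mV" for a v
  using a
 proof (induction rule: M.h.homog_induct)
  case zero
  then show ?case using v LVD(2)[OF fL v] LV_0[OF fL] by simp
 next
  case (add x y)
  then show ?case using v LVD(2)[OF fL v] by(simp add:N.act_add_left M.act_add_left LVD(4)[OF fL])
 next
  case (homog i x)
  then show ?case using soc_twist[OF f soc homog v] by simp
 qed
 then show ?thesis using LVD[OF fL] LG_deg[OF f] by(auto simp:hlin_def)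
qed

end

text \<open>A Frobenius functional gives an endomorphism \<open>t\<close> of a free module on which \<open>Lam\<close> acts with value a
  nonzero multiple of the identity; composing with \<open>t\<close> divides linear maps to or from a free module by \<open>Lam\<close>.\<close>

lemma (in hmod) free_section:
 assumes X:"free_basis X" and K:"idirect (hspan X) K"
 obtains t ka where "t:homgrade M M (- htop)" "!!v. v:mV==>t v:hspan X" "!!k. k:K==>t k = 0" "ka ~= 0"
  "!!p. p:hspan X==>mact (ghom s H M M) Lam t p = sc ka p" "!!k. k:K==>mact (ghom s H M M) Lam t k = 0"
proof -
 interpret P: hpair s H M M by unfold_locales
 note gP = idirectD(1)[OF K] and gK = idirectD(2)[OF K]
 note sP = gsubD(1)[OF gP] and finX = free_basisD(1)[OF X]
 have XV:"x:mV" if "x:X" for x using free_basisD(3)[OF X that] .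
 obtain nu d where d:"!!x. x:X==>x:mG (d x)"
  and nu:"!!x. x:X==>linear_on sc (*) mV (nu x)" "!!x k. x:X==>k:K==>nu x k = 0"
  "!!x f. x:X==>ALL z:X. f z:hc==>nu x (SUM z:X. act (f z) z) = frob (f x)"
  "!!x i v. x:X==>v:mG i==>i ~= d x + htop==>nu x v = 0"
 proof (rule free_functionals[OF X K],goal_cases)
  case (1 nu d)
  show ?case
  proof (rule 1(1)[of d nu])
  show "nu x (SUM z:X. act (f z) z) = frob (f x)" if "x:X" "ALL z:X. f z:hc" for x f
  by(rule 1(5)[OF that(1)]) (use that(2) in blast)
  qed (rule 1(2-4,6); assumption)+
 qed
 have nu_act:"nu x (act y z) = (if x = z then frob y else 0)" if "x:X" "z:X" "y:hc" for x y z
 proof -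
  have "(SUM w:X. act (if w = z then y else 0) w) = (SUM w:X. if w = z then act y z else 0)"
  by(intro sum.cong) (use XV in auto)
  also have "... = act y z" using finX that by simp
  finally show ?thesis using nu(3)[OF that(1),of "%w. if w = z then y else 0"] that by auto
 qed
 \<comment> \<open>\<open>t\<close> sends \<open>h x\<close> to \<open>frob h\<close> times
   \<open>x\<close>, so it lowers degrees by \<open>htop\<close>.\<close>
 define t where "t = (SUM x:X. P.E (nu x) x)"
 have tG:"t:P.LG (- htop)"
  unfolding t_def
 proof (rule P.Lv.subspace_sum[OF P.LG_sub])
  fix x assume x:"x:X"
  have "P.E (nu x) x:P.LG (d x - (d x + htop))" by(rule P.E_LG[OF nu(1)[OF x] nu(4)[OF x] d[OF x]])
  then show "P.E (nu x) x:P.LG (- htop)" by simp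
 qed
 have tv:"t v = (SUM x:X. sc (nu x v) x)" if "v:mV" for v using that by(simp add:t_def sum_apply P.E_def)
 have tP:"t v:hspan X" if "v:mV" for v
  unfolding tv[OF that] using hspan_base[OF finX] XV by(intro m.subspace_sum[OF sP] m.subspace_scale[OF sP]) blast
 have tK:"t k = 0" if k:"k:K" for k
  unfolding tv[OF gsubD(2)[OF gK k]] by(rule sum.neutral) (use nu(2) k in simp)
 have ta:"t (act y z) = sc (frob y) z" if z:"z:X" "y:hc" for y z
 proof -
  have "t (act y z) = (SUM x:X. if x = z then sc (frob y) z else 0)"
  unfolding tv[OF act_closed[OF z(2) XV[OF z(1)]]] by(intro sum.cong refl) (use nu_act z in auto)
  then show ?thesis using finX z by simp
 qed
 have tL:"t:P.LV" by(rule P.LG_LV[OF tG])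
 have th:"t:P.hsub K (hspan X)" using tL tP tK by(simp add:P.hsub_def)
 define g where "g = P.Lact Lam t"
 have gK0:"g k = 0" if "k:K" for k
  using P.L.gsubD(4)[OF P.gsub_hsub[OF gK gP] Lam_hc th] that unfolding g_def by(simp add:P.hsub_def)
 have gG:"g:P.LG 0" using P.Lact_deg[OF tG Lam_hg] unfolding g_def by simp
 have "P.L.soc g" unfolding g_def by(rule P.L.soc_Lam) (use tL in simp)
 note hg = P.soc_hlin[OF gG this]
 obtain zr where zr:"rep htop Lam ((0,1,Lam) # zr)" "!!i a b. (i,a,b):set zr==>0 < i & i <= htop"
  using rep_left_ex[OF Lam_hg] by blast
 obtain ka0 where kap:"S Lam = hs ka0 Lam" "ka0 ~= 0" using S_Lam by blast
 \<comment> \<open>In \<open>Lam\<close> acting on \<open>t\<close>, only the term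
   \<open>1 \<otimes> Lam\<close> contributes at \<open>x\<close>, since \<open>frob\<close>
   vanishes on \<open>S b\<close> below the top degree. This leaves the sign of moving
   \<open>Lam\<close> past \<open>t\<close> and the scalar of \<open>S Lam\<close>.\<close>
 define ka where "ka = xsign s htop (- htop) * ka0"
 have k0:"ka ~= 0" unfolding ka_def using kap(2) xsign_square[of htop "- htop"] by(metis mult_eq_0_iff zero_neq_one)
 have gx:"g x = sc ka x" if x:"x:X" for x
 proof -
  have zero:"(SUM (i,a,b)<-zr. sc (xsign s (htop - i) (- htop)) (act a (t (act (S b) x)))) = 0"
  proof (rule sum_list_zero2)
  fix i a b assume i:"(i,a,b):set zr"
  have ab:"a:hc" "b:hc" "b:hg (htop - i)" "0 < i"
  using rep_mem_hc[OF zr(1),of i a b] rep_mem[OF zr(1),of i a b] zr(2)[OF i] i by auto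
  have "frob (S b) = 0" using frob_hg[OF S_hg[OF ab(3)]] ab(4) by simp
  then show "sc (xsign s (htop - i) (- htop)) (act a (t (act (S b) x))) = 0" using ta[OF x,of "S b"] ab by simp
  qed
  have "g x = sc (xsign s htop (- htop)) (t (act (S Lam) x))"
  unfolding g_def P.Lact_eval[OF tG Lam_hc zr(1) XV[OF x]] using zero ta[OF x,of "S Lam"] XV[OF x] by simp
  also have "... = sc ka x" unfolding ka_def using ta[OF x,of "S Lam"] kap(1) by(simp add:linear_on_scale[OF frob_linear])
  finally show ?thesis .
 qed
 have gp:"g p = sc ka p" if p:"p:hspan X" for p
 proof -
  obtain f where f:"ALL x:X. f x:hc" "p = (SUM x:X. act (f x) x)" using hspan_ex[OF p] by(elim exE conjE)
  have "g p = (SUM x:X. g (act (f x) x))"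
  unfolding f(2) by(rule m.linear_on_sum[OF P.LVD(1)[OF P.LG_LV[OF gG]] m.subV]) (use f(1) XV in auto)
  also have "... = (SUM x:X. sc ka (act (f x) x))"
  by(intro sum.cong refl) (use f(1) XV hlinD(3)[OF hg] gx in "auto simp:act_scale")
  finally show ?thesis unfolding f(2) m.scale_sum_right .
 qed
 show thesis by(rule that[OF tG tP tK k0 gp[unfolded g_def] gK0[unfolded g_def]])
qed

context hpair
begin

text \<open>An invariant \<open>z\<close> commutes with the action up to sign. If its values lie in
  the free part, \<open>Lam\<close> acting on \<open>t z\<close> therefore gives
  \<open>(Lam t) z = ka z\<close>; thus \<open>z\<close> is divisible by \<open>Lam\<close>, and
  \<open>free_if_socle\<close> applies.\<close>

lemma ghom_free_right:
 assumes X:"M.free_basis X"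
 obtains Y where "L.free_basis Y" "L.hspan Y = hsub {0} (M.hspan X)"
proof -
 interpret MM: hpair s H M M by unfold_locales
 obtain K where K:"M.idirect (M.hspan X) K" using M.free_complement[OF X] .
 obtain t ka where t:"t:MM.LG (- M.htop)" "!!v. v:M.mV==>t v:M.hspan X" "!!k. k:K==>t k = 0" "ka ~= 0"
  "!!p. p:M.hspan X==>MM.Lact M.Lam t p = M.sc ka p" "!!k. k:K==>MM.Lact M.Lam t k = 0"
  using M.free_section[OF X K] by blast
 note tL = MM.LG_LV[OF t(1)] and gW = gsub_hsub[OF N.gsub_0 M.free_gsub[OF X]]
 show thesis
 proof (rule L.free_if_socle[OF gW _ that])
  fix z j assume zW:"z:hsub {0} (M.hspan X)" and "z:L.mG j" and soc:"L.soc z"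
  then have zG:"z:LG j" by simp
  note zL = LG_LV[OF zG]
  let ?w = "%v. t (z v)"
  have wL:"?w:LV" by(rule LVI) (simp_all add:LVD[OF zL] MM.LVD[OF tL] MM.LV_0[OF tL])
  have "t (z v):M.mG (- M.htop + j + k)" if "v:N.mG k" for v k
  using MM.LG_deg[OF t(1) LG_deg[OF zG that]] by(simp only: add.assoc)
  then have wG:"?w:LG (- M.htop + j)" unfolding homgrade_def using wL by blast
  have wW:"?w:hsub {0} (M.hspan X)" using wL LV_0[OF wL] t(2) LVD(2)[OF zL] by(auto simp:hsub_def)
  obtain xs where xs:"M.rep M.htop M.Lam xs" using M.rep_ex[OF M.Lam_hg] by blast
  have val:"Lact M.Lam ?w v = M.sc ka (z v)" if v:"v:N.mV" for v
  proof -
  have zv:"z v:M.mV" "z v:M.hspan X" using LVD(2)[OF zL v] zW v by(auto simp:hsub_def)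
  have "Lact M.Lam ?w v = MM.Lact M.Lam t (z v)"
  unfolding Lact_eval[OF wG M.Lam_hc xs v] MM.Lact_eval[OF t(1) M.Lam_hc xs zv(1)]
  proof (rule M.sum_list_cong2)
  fix i a b assume i:"(i,a,b):set xs"
  have ab:"b:M.hg (M.htop - i)" "a:M.hc" "b:M.hc" using M.rep_mem[OF xs i] M.rep_mem_hc[OF xs i] by auto
  have tm:"t (M.act (M.S b) (z v)):M.mV" by(rule MM.LVD(2)[OF tL]) (use ab zv in simp)
  have eq:"z (N.act (M.S b) v) = M.sc (xsign s (M.htop - i) j) (M.act (M.S b) (z v))"
  by(rule soc_twist[OF zG soc M.S_hg[OF ab(1)] v])
  have um:"M.act (M.S b) (z v):M.mV" using ab zv by simp
  \<comment> \<open>The sign from moving \<open>b\<close> past \<open>z\<close> cancels the part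
    that depends on the degree \<open>j\<close> of \<open>z\<close>.\<close>
  have sg:"xsign s (M.htop - i) (- M.htop + j) * xsign s (M.htop - i) j = xsign s (M.htop - i) (- M.htop)"
  by(simp only: M.xsign_add(1) mult.assoc M.xsign_square mult_1_right)
  show "M.sc (xsign s (M.htop - i) (- M.htop + j)) (M.act a (t (z (N.act (M.S b) v))))
  = M.sc (xsign s (M.htop - i) (- M.htop)) (M.act a (t (M.act (M.S b) (z v))))"
  unfolding eq MM.LVD(5)[OF tL um] M.act_scale[OF ab(2) tm] M.m.scale_scale sg ..
  qed
  then show ?thesis using t(5)[OF zv(2)] by simp
  qed
  have "z = Lact M.Lam (Lsc (1 / ka) ?w)"
  proof
  fix v show "z v = Lact M.Lam (Lsc (1 / ka) ?w) v"
  unfolding linear_on_scale[OF Lact_linear[OF M.Lam_hc] wL]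
  using val t(4) LVD(3)[OF zL] LVD(3)[OF Lact_LV[OF wL M.Lam_hc]] by(cases "v:N.mV") auto
  qed
  moreover have "Lsc (1 / ka) ?w:hsub {0} (M.hspan X)" using L.m.subspace_scale[OF L.gsubD(1)[OF gW] wW] by simp
  ultimately show "z:Lact M.Lam ` hsub {0} (M.hspan X)" by(rule image_eqI)
 qed
qed

text \<open>Here \<open>t\<close> is composed on the other side. Pulling the action through the
  invariant \<open>z\<close> costs the sign of moving \<open>Lam\<close> past \<open>z\<close>,
  hence the factor in \<open>?ka\<close>.\<close>

lemma ghom_free_left:
 assumes X:"N.free_basis X" and K:"N.idirect (N.hspan X) K" and U:"M.gsub U"
 obtains Y where "L.free_basis Y" "L.hspan Y = hsub K U"
proof -
 interpret NN: hpair s H N N by unfold_locales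
 note gK = N.idirectD(2)[OF K] and gP = N.idirectD(1)[OF K]
 obtain t ka where t:"t:NN.LG (- M.htop)" "!!v. v:N.mV==>t v:N.hspan X" "!!k. k:K==>t k = 0" "ka ~= 0"
  "!!p. p:N.hspan X==>NN.Lact M.Lam t p = N.sc ka p" "!!k. k:K==>NN.Lact M.Lam t k = 0"
  using N.free_section[OF X K] by blast
 note tL = NN.LG_LV[OF t(1)] and gW = gsub_hsub[OF gK U]
 show thesis
 proof (rule L.free_if_socle[OF gW _ that])
  fix z j assume zW:"z:hsub K U" and "z:L.mG j" and soc:"L.soc z"
  then have zG:"z:LG j" by simp
  note zL = LG_LV[OF zG]
  let ?w = "%v. z (t v)" and ?ka = "xsign s M.htop j * ka"
  have wL:"?w:LV" by(rule LVI) (simp_all add:LVD[OF zL] NN.LVD[OF tL] LV_0[OF zL])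
  have "z (t v):M.mG (j + - M.htop + k)" if "v:N.mG k" for v k
  using LG_deg[OF zG NN.LG_deg[OF t(1) that]] by(simp only: add.assoc)
  then have wG:"?w:LG (j + - M.htop)" unfolding homgrade_def using wL by blast
  have wW:"?w:hsub K U" using wL LV_0[OF zL] t(3) NN.LVD(2)[OF tL] zW by(auto simp:hsub_def)
  have k0:"?ka ~= 0" using t(4) M.xsign_square[of M.htop j] by(metis mult_eq_0_iff zero_neq_one)
  obtain xs where xs:"M.rep M.htop M.Lam xs" using M.rep_ex[OF M.Lam_hg] by blast
  have val:"Lact M.Lam ?w v = M.sc ?ka (z v)" if v:"v:N.mV" for v
  proof -
  let ?f = "%i a b. N.sc (xsign s (M.htop - i) (- M.htop)) (N.act a (t (N.act (M.S b) v)))"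
  have tm:"t (N.act (M.S b) v):N.mV" if "b:M.hc" for b by(rule NN.LVD(2)[OF tL]) (use that v in simp)
  have "Lact M.Lam ?w v = (SUM (i,a,b)<-xs. M.sc (xsign s M.htop j) (z (?f i a b)))"
  unfolding Lact_eval[OF wG M.Lam_hc xs v]
  proof (rule M.sum_list_cong2)
  fix i a b assume i:"(i,a,b):set xs"
  have ab:"a:M.hg i" "a:M.hc" "b:M.hc" using M.rep_mem[OF xs i] M.rep_mem_hc[OF xs i] by auto
  let ?u = "t (N.act (M.S b) v)"
  have zu:"M.act a (z ?u):M.mV" using LVD(2)[OF zL tm[OF ab(3)]] ab by simp
  have x:"xsign s M.htop j * xsign s i j = xsign s (M.htop - i) j"
  by(simp add:M.xsign_diff)
  have zf:"z (?f i a b) = M.sc (xsign s (M.htop - i) (- M.htop)) (M.sc (xsign s i j) (M.act a (z ?u)))"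
  unfolding LVD(5)[OF zL N.act_closed[OF ab(2) tm[OF ab(3)]]] soc_twist[OF zG soc ab(1) tm[OF ab(3)]] ..
  have sg:"xsign s M.htop j * (xsign s (M.htop - i) (- M.htop) * xsign s i j) = xsign s (M.htop - i) (j + - M.htop)"
  by(simp only: M.xsign_add(1) x[symmetric] mult_ac)
  show "M.sc (xsign s (M.htop - i) (j + - M.htop)) (M.act a (z ?u)) = M.sc (xsign s M.htop j) (z (?f i a b))"
  unfolding zf M.m.scale_scale sg ..
  qed
  also have "... = M.sc (xsign s M.htop j) (SUM (i,a,b)<-xs. z (?f i a b))"
  by(rule M.sum_list_scale_gen[OF M.m.vector_space_axioms])
  also have "(SUM (i,a,b)<-xs. z (?f i a b)) = z (SUM (i,a,b)<-xs. ?f i a b)"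
  unfolding case_prod_unfold
  by(rule N.m.linear_on_sum_list[OF LVD(1)[OF zL] N.m.subV,symmetric]) (use M.rep_mem_hc[OF xs] tm in force)
  also have "(SUM (i,a,b)<-xs. ?f i a b) = NN.Lact M.Lam t v" by(rule NN.Lact_eval[OF t(1) M.Lam_hc xs v,symmetric])
  also have "z (NN.Lact M.Lam t v) = M.sc ka (z v)"
  proof -
  obtain p k where pk:"p:N.hspan X" "k:K" "v = p + k" using N.idirectD(4)[OF K v] by blast
  have V:"p:N.mV" "k:N.mV" using N.gsubD(2)[OF gP pk(1)] N.gsubD(2)[OF gK pk(2)] .
  have "NN.Lact M.Lam t v = N.sc ka p"
  unfolding pk(3) NN.LVD(4)[OF NN.Lact_LV[OF tL M.Lam_hc] V] t(5)[OF pk(1)] t(6)[OF pk(2)] by simp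
  moreover have "z v = z p" unfolding pk(3) LVD(4)[OF zL V] using zW pk(2) by(simp add:hsub_def)
  ultimately show ?thesis using LVD(5)[OF zL V(1)] by simp
  qed
  finally show ?thesis by simp
  qed
  have "z = Lact M.Lam (Lsc (1 / ?ka) ?w)"
  proof
  fix v show "z v = Lact M.Lam (Lsc (1 / ?ka) ?w) v"
  unfolding linear_on_scale[OF Lact_linear[OF M.Lam_hc] wL]
  using val k0 LVD(3)[OF zL] LVD(3)[OF Lact_LV[OF wL M.Lam_hc]] by(cases "v:N.mV") auto
  qed
  moreover have "Lsc (1 / ?ka) ?w:hsub K U" using L.m.subspace_scale[OF L.gsubD(1)[OF gW] wW] by simp
  ultimately show "z:Lact M.Lam ` hsub K U" by(rule image_eqI)
 qed
qed

end

section \<open>Functoriality of Hom, and removal of free summands from either argument\<close>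

lemma (in hopf) hlin_linear:
 fixes M :: "('k,'h,'v::ab_group_add) gmodule" and N :: "('k,'h,'w::ab_group_add) gmodule"
 assumes "hmod s H M" "hmod s H N" and g:"hlin H M N g"
 shows "linear_on (mscale M) (mscale N) (mcarrier M) g"
proof -
 interpret M: hmod s H M by fact
 interpret N: hmod s H N by fact
 show ?thesis
 proof (rule linear_onI)
  show "g (x + y) = g x + g y" if "x:M.mV" "y:M.mV" for x y using hlinD(2)[OF g that] .
  show "g (M.sc c x) = N.sc c (g x)" if x:"x:M.mV" for c x
  using hlinD(3)[OF g _ x,of "hs c 1"] x hlinD(1)[OF g x] by(simp add:M.act_scale_left N.act_scale_left)
 qed
qed

lemma (in hmod) hlin_sub:"gsub K==>hlin H (msub M K) M (%x. x)"
 using gsubD(2) by(auto simp:hlin_def)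

lemma (in hmod_iso) hlin:"hlin H M N phi"
 by(auto simp:hlin_def map_add map_act map_grade)

lemma (in hmod) idirect_proj:
 assumes d:"idirect P K"
 obtains pr where "hlin H M (msub M P) pr" "!!v. v:mV==>v - pr v:K" "!!v. v:P==>pr v = v" "!!v. v:K==>pr v = 0"
proof -
 note gP = idirectD(1)[OF d] and gK = idirectD(2)[OF d]
 note sP = gsubD(1)[OF gP] and sK = gsubD(1)[OF gK]
 define pr where "pr v = (THE p. p:P & v - p:K)" for v
 have pr:"pr v = p" if "p:P" "v - p:K" for v p
  unfolding pr_def
 proof (rule the_equality)
  show "p:P & v - p:K" using that by simp
  fix q assume q:"q:P & v - q:K"
  have "(v - p) - (v - q):K" using m.subspace_diff[OF sK that(2)] q by blast
  then have "q - p:K" by simp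
  then have "q - p = 0" using idirectD(3)[OF d m.subspace_diff[OF sP]] q that by blast
  then show "q = p" by simp
 qed
 have ex:"pr v:P & v - pr v:K" if v:"v:mV" for v
 proof -
  obtain p k where pk:"p:P" "k:K" "v = p + k" using idirectD(4)[OF d v] by blast
  then have "v - p = k" by simp
  then show ?thesis using pr[OF pk(1),of v] pk by simp
 qed
 have PV:"p:mV" if "p:P" for p using gsubD(2)[OF gP that] .
 have hl:"hlin H M (msub M P) pr"
  unfolding hlin_def msub_simps
 proof (intro conjI ballI allI)
  show "pr x:P" if "x:mV" for x using ex[OF that] by blast
  show "pr (x + y) = pr x + pr y" if "x:mV" "y:mV" for x y
  proof (rule pr)
  have "x + y - (pr x + pr y) = (x - pr x) + (y - pr y)" by simp
  then show "x + y - (pr x + pr y):K" using m.subspace_add[OF sK] ex[OF that(1)] ex[OF that(2)] by metis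
  qed (use ex that m.subspace_add[OF sP] in blast)
  show "pr (act a x) = act a (pr x)" if ax:"a:hc" "x:mV" for a x
  proof (rule pr)
  have "act a x - act a (pr x) = act a (x - pr x)" using ax ex[OF ax(2)] PV by(simp add:act_diff)
  then show "act a x - act a (pr x):K" using gsubD(4)[OF gK ax(1)] ex[OF ax(2)] by simp
  qed (use ex[OF ax(2)] gsubD(4)[OF gP ax(1)] in blast)
  show "pr x:mG i Int P" if x:"x:mG i" for i x
  proof -
  have xV:"x:mV" by(rule mG_mV[OF x])
  note e = ex[OF xV]
  have "x - hcomp mG (pr x) i = hcomp mG (x - pr x) i"
  proof -
  have "hcomp mG x i = hcomp mG (x - pr x) i + hcomp mG (pr x) i"
  using m.hcomp_add[of "x - pr x" "pr x"] xV e PV by simp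
  then show ?thesis using m.hcomp_homog[OF x] by(simp add:algebra_simps)
  qed
  then have "pr x = hcomp mG (pr x) i" using pr[OF gsubD(3)[OF gP],of "pr x" x i] e gsubD(3)[OF gK,of "x - pr x" i] by simp
  then show ?thesis using m.hcomp_G[OF PV,of "pr x" i] e by simp
  qed
 qed
 show thesis
 proof (rule that[OF hl])
  show "v - pr v:K" if "v:mV" for v using ex[OF that] by blast
  show "pr v = v" if "v:P" for v using pr[OF that] m.subspace_0[OF sK] by simp
  show "pr v = 0" if "v:K" for v using pr[OF m.subspace_0[OF sP]] that by simp
 qed
qed

context hpair
begin

lemma hlin_post:
 fixes M' :: "('k,'h,'u::ab_group_add) gmodule"
 assumes M':"hmod s H M'" and g:"hlin H M M' g"
 shows "f:LV==>(%v. g (f v)):homcarrier N M'" "f:LG i==>(%v. g (f v)):homgrade N M' i"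
  "h:M.hc==>f:LV==>mact (ghom s H N M') h (%v. g (f v)) = (%v. g (Lact h f v))"
proof -
 interpret P: hpair s H M' N using M' N.hmod_axioms by(simp add:hpair_def)
 note lin = M.hlin_linear[OF M.hmod_axioms M' g]
 have g0:"g 0 = 0" by(rule M.m.linear_on_0[OF lin M.m.subV])
 show LV':"(%v. g (f v)):homcarrier N M'" if f:"f:LV" for f
  by(rule P.LVI) (simp_all add:LVD[OF f] hlinD[OF g] g0 linear_on_scale[OF lin])
 show "(%v. g (f v)):homgrade N M' i" if f:"f:LG i" for f i
  using LV'[OF LG_LV[OF f]] LG_deg[OF f] hlinD(4)[OF g] by(auto simp:homgrade_def)
 then have LG':"(%v. g (f v)):homgrade N M' i" if f:"f:LG i" for f i using f .
 show "mact (ghom s H N M') h (%v. g (f v)) = (%v. g (Lact h f v))" if h:"h:M.hc" and f:"f:LV" for h f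
  using f
 proof (induction rule: Lg.homog_induct)
  case zero
  have "Lact h 0 = 0" by(rule Lv.linear_on_0[OF Lact_linear[OF h] LV_sub])
  moreover have "P.Lact h 0 = 0" by(rule P.Lv.linear_on_0[OF P.Lact_linear[OF h] P.LV_sub])
  ultimately show ?case by(simp add:g0 zero_fun_def)
 next
  case (add x y)
  have e:"(%v. g ((x + y) v)) = (%v. g (x v)) + (%v. g (y v))"
  proof
  fix v show "g ((x + y) v) = ((%v. g (x v)) + (%v. g (y v))) v"
  using LVD[OF add.hyps(1)] LVD[OF add.hyps(2)] by(cases "v:N.mV") (simp_all add:g0 hlinD(2)[OF g])
  qed
  have e':"(%v. g (Lact h (x + y) v)) = (%v. g (Lact h x v)) + (%v. g (Lact h y v))"
  proof
  fix v
  note L = Lact_LV[OF add.hyps(1) h] Lact_LV[OF add.hyps(2) h]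
  show "g (Lact h (x + y) v) = ((%v. g (Lact h x v)) + (%v. g (Lact h y v))) v"
  unfolding linear_on_add[OF Lact_linear[OF h] add.hyps(1,2)] plus_fun_apply
  using LVD[OF L(1)] LVD[OF L(2)] by(cases "v:N.mV") (simp_all add:g0 hlinD(2)[OF g])
  qed
  show ?case
  unfolding e e' linear_on_add[OF P.Lact_linear[OF h] LV'[OF add.hyps(1)] LV'[OF add.hyps(2)]] add.IH ..
 next
  case (homog j f)
  note fL = LG_LV[OF homog]
  obtain xs where xs:"set xs <= M.hc \<times> M.hc" "coprod H h = (SUM (a,b)<-xs. M.T a b)" using M.coprod_list[OF h] .
  have x:"a:M.hc & b:M.hc" if "(a,b):set xs" for a b using xs(1) that by auto
  show ?case
  proof
  fix v
  show "P.Lact h (%v. g (f v)) v = g (Lact h f v)"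
  proof (cases "v:N.mV")
  case True
  show ?thesis
  unfolding P.Lact_homog[OF LG'[OF homog] h] Lact_homog[OF homog h] P.homact_list[OF LV'[OF fL] True xs]
  homact_list[OF fL True xs]
  by(subst M.m.linear_on_sum_list[OF lin M.m.subV],force simp:x True LVD[OF fL] dest!: x)
  (intro arg_cong[of _ _ sum_list] map_cong refl,use x True in "auto simp:LVD[OF fL] hlinD[OF g]")
  next
  case False
  then show ?thesis
  using P.LVD(3)[OF P.Lact_LV[OF LV'[OF fL] h]] LVD(3)[OF Lact_LV[OF fL h]] g0 by simp
  qed
  qed
 qed
qed

text \<open>The value 0 outside the carrier has to be restored after composing, as
  \<open>homcarrier\<close> demands it.\<close>

definition precomp :: "('k,'h,'u::ab_group_add) gmodule => ('u => 'w) => ('w => 'v) => 'u => 'v" where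
 "precomp N' g f = (%v. if v:mcarrier N' then f (g v) else 0)"

lemma hlin_pre:
 fixes N' :: "('k,'h,'u::ab_group_add) gmodule"
 assumes N':"hmod s H N'" and g:"hlin H N' N g"
 shows "f:LV==>precomp N' g f:homcarrier N' M" "f:LG i==>precomp N' g f:homgrade N' M i"
  "h:M.hc==>f:LV==>mact (ghom s H N' M) h (precomp N' g f) = precomp N' g (Lact h f)"
proof -
 interpret P: hpair s H M N' using N' M.hmod_axioms by(simp add:hpair_def)
 note lin = M.hlin_linear[OF N' N.hmod_axioms g]
 show LV':"precomp N' g f:homcarrier N' M" if f:"f:LV" for f
  by(rule P.LVI) (simp_all add:precomp_def LVD[OF f] hlinD[OF g] linear_on_scale[OF lin])
 show "precomp N' g f:homgrade N' M i" if f:"f:LG i" for f i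
  using LV'[OF LG_LV[OF f]] LG_deg[OF f] hlinD(4)[OF g] P.N.mG_mV by(auto simp:homgrade_def precomp_def)
 then have LG':"precomp N' g f:homgrade N' M i" if f:"f:LG i" for f i using f .
 have pre_add:"precomp N' g (x + y) = precomp N' g x + precomp N' g y" for x y :: "'w => 'v"
  by(rule ext) (simp add:precomp_def)
 show "P.Lact h (precomp N' g f) = precomp N' g (Lact h f)" if h:"h:M.hc" and f:"f:LV" for h f
  using f
 proof (induction rule: Lg.homog_induct)
  case zero
  have "Lact h 0 = 0" by(rule Lv.linear_on_0[OF Lact_linear[OF h] LV_sub])
  moreover have "P.Lact h 0 = 0" by(rule P.Lv.linear_on_0[OF P.Lact_linear[OF h] P.LV_sub])
  ultimately show ?case by(simp add:precomp_def zero_fun_def)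
 next
  case (add x y)
  show ?case
  unfolding pre_add linear_on_add[OF P.Lact_linear[OF h] LV'[OF add.hyps(1)] LV'[OF add.hyps(2)]] add.IH
  linear_on_add[OF Lact_linear[OF h] add.hyps(1,2)] ..
 next
  case (homog j f)
  note fL = LG_LV[OF homog]
  obtain xs where xs:"set xs <= M.hc \<times> M.hc" "coprod H h = (SUM (a,b)<-xs. M.T a b)" using M.coprod_list[OF h] .
  have x:"a:M.hc & b:M.hc" if "(a,b):set xs" for a b using xs(1) that by auto
  show ?case
  proof
  fix v
  show "P.Lact h (precomp N' g f) v = precomp N' g (Lact h f) v"
  proof (cases "v:P.N.mV")
  case True
  have e:"precomp N' g (Lact h f) v = Lact h f (g v)" using True by(simp add:precomp_def)
  show ?thesis
  unfolding e unfolding P.Lact_homog[OF LG'[OF homog] h] Lact_homog[OF homog h] P.homact_list[OF LV'[OF fL] True xs]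
  homact_list[OF fL hlinD(1)[OF g True] xs]
  by(intro arg_cong[of _ _ sum_list] map_cong refl) (use x True in "auto simp:precomp_def hlinD[OF g]")
  next
  case False
  then show ?thesis using P.LVD(3)[OF P.Lact_LV[OF LV'[OF fL] h]] by(simp add:precomp_def)
  qed
  qed
 qed
qed

text \<open>The maps into the free part form a free submodule, complementary to the maps into
  \<open>K\<close>; \<open>KF_sub\<close> removes it.\<close>

lemma KF_right:
 assumes pos:"M.htop > 0" and X:"M.free_basis X" and K:"M.idirect (M.hspan X) K"
 shows "L.KF \<longleftrightarrow> hmod.KF H (ghom s H N (msub M K))"
proof -
 note gP = M.idirectD(1)[OF K] and gK = M.idirectD(2)[OF K]
 obtain Y where Y:"L.free_basis Y" "L.hspan Y = hsub {0} (M.hspan X)" using ghom_free_right[OF X] .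
 obtain pr where pr:"hlin H M (msub M (M.hspan X)) pr" "!!v. v:M.mV==>v - pr v:K"
  by(rule M.idirect_proj[OF K]) (assumption | rule)+
 have hp:"hlin H M M pr" using hlin_compose[OF pr(1) M.hlin_sub[OF gP]] .
 interpret P: hpair s H "msub M K" N using M.hmod_msub[OF gK] N.hmod_axioms by(simp add:hpair_def)
 have gsub:"L.gsub (hsub {0} K)" by(rule gsub_hsub[OF N.gsub_0 gK])
 have dir:"L.idirect (L.hspan Y) (hsub {0} K)"
  unfolding L.idirect_def
 proof (intro conjI ballI L.free_gsub[OF Y(1)] gsub)
  show "L.hspan Y Int hsub {0} K = {0}"
  proof (intro equalityI subsetI)
  fix f assume f:"f:L.hspan Y Int hsub {0} K"
  then have fL:"f:LV" by(simp add:hsub_def)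
  have "f = 0"
  proof
  fix v show "f v = 0 v"
  using f M.idirectD(3)[OF K,of "f v"] LVD(3)[OF fL,of v] unfolding Y(2) by(cases "v:N.mV") (auto simp:hsub_def)
  qed
  then show "f:{0}" by simp
  next
  fix f :: "'w => 'v" assume "f:{0}"
  then show "f:L.hspan Y Int hsub {0} K"
  using L.m.subspace_0[OF L.gsubD(1)[OF L.free_gsub[OF Y(1)]]] L.m.subspace_0[OF L.gsubD(1)[OF gsub]] by auto
  qed
  fix f assume "f:L.mV"
  then have f:"f:LV" by simp
  let ?p = "%v. pr (f v)"
  have p:"?p:LV" by(rule hlin_post(1)[OF M.hmod_axioms hp f])
  have "?p:L.hspan Y" unfolding Y(2) using p hlinD(1)[OF pr(1)] LVD(2)[OF f] LV_0[OF p] by(auto simp:hsub_def)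
  moreover have d:"f - ?p:LV" by(rule Lv.subspace_diff[OF LV_sub f p])
  then have "f - ?p:hsub {0} K" using pr(2) LVD(2)[OF f] LV_0[OF d] by(auto simp:hsub_def)
  moreover have "f = ?p + (f - ?p)" by(rule ext) simp
  ultimately show "EX p:L.hspan Y. EX k:hsub {0} K. f = p + k" by blast
 qed
 have eq:"hsub {0} K = P.LV"
 proof (intro equalityI subsetI)
  fix f assume f:"f:hsub {0} K"
  then have fL:"f:LV" by(simp add:hsub_def)
  show "f:P.LV" by(rule P.LVI) (use f LVD[OF fL] in "auto simp:hsub_def")
 next
  fix f assume f:"f:P.LV"
  have fL:"f:LV" using hlin_post f P.hlin_post(1)[OF M.hmod_axioms M.hlin_sub[OF gK] f] by simp
  then show "f:hsub {0} K" using P.LVD(2)[OF f] LV_0[OF fL] by(auto simp:hsub_def)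
 qed
 have iso:"hmod_iso s H (ghom s H N (msub M K)) (msub L (hsub {0} K)) (%f. f)"
 proof (intro hmod_iso.intro P.hmod_ghom L.hmod_msub[OF gsub] hmod_iso_axioms.intro)
  show "bij_betw (%f. f) P.L.mV (mcarrier (msub L (hsub {0} K)))" using eq by(simp add:bij_betw_def)
  show "P.Lact h f = mact (msub L (hsub {0} K)) h f" if "h:M.hc" "f:P.L.mV" for h f
  using P.hlin_post(3)[OF M.hmod_axioms M.hlin_sub[OF gK] that(1),of f] that(2) by simp
  show "f:mgrade (msub L (hsub {0} K)) i" if "f:P.L.mG i" for f i
  using P.hlin_post(2)[OF M.hmod_axioms M.hlin_sub[OF gK],of f i] P.LG_LV[of f i] that eq by simp
 qed (rule refl)
 interpret I: hmod_iso s H "ghom s H N (msub M K)" "msub L (hsub {0} K)" "%f. f" by(rule iso)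
 interpret I': hmod_iso s H "msub L (hsub {0} K)" "ghom s H N (msub M K)" "inv_into (mcarrier (ghom s H N (msub M K))) (%f. f)" by(rule I.inverse)
 show ?thesis using L.KF_sub[OF pos Y(1) dir] I.KF I'.KF by blast
qed

text \<open>The maps vanishing on \<open>K\<close> form a free submodule. Its complement, the maps
  vanishing on \<open>hspan X\<close>, is identified with \<open>Hom(K, M)\<close> by
  restriction.\<close>

lemma KF_left:
 assumes pos:"M.htop > 0" and X:"N.free_basis X" and K:"N.idirect (N.hspan X) K"
 shows "L.KF \<longleftrightarrow> hmod.KF H (ghom s H (msub N K) M)"
proof -
 note gP = N.idirectD(1)[OF K] and gK = N.idirectD(2)[OF K]
 note K' = N.idirect_sym[OF K]
 obtain Y where Y:"L.free_basis Y" "L.hspan Y = hsub K M.mV" using ghom_free_left[OF X K M.gsub_mV] .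
 obtain pr where pr:"hlin H N (msub N K) pr" "!!v. v:N.mV==>v - pr v:N.hspan X"
  "!!v. v:K==>pr v = v" "!!v. v:N.hspan X==>pr v = 0" using N.idirect_proj[OF K'] by blast
 have hp:"hlin H N N pr" using hlin_compose[OF pr(1) N.hlin_sub[OF gK]] .
 have prK:"pr v:K" if "v:N.mV" for v using hlinD(1)[OF pr(1) that] by simp
 have KV:"v:N.mV" if "v:K" for v using N.gsubD(2)[OF gK that] .
 interpret P: hpair s H M "msub N K" using N.hmod_msub[OF gK] M.hmod_axioms by(simp add:hpair_def)
 let ?U = "hsub (N.hspan X) M.mV"
 have gsub:"L.gsub ?U" by(rule gsub_hsub[OF gP M.gsub_mV])
 have on_pr:"f v = f (pr v)" if f:"f:?U" and v:"v:N.mV" for f v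
 proof -
  have fL:"f:LV" using f by(simp add:hsub_def)
  have "f v = f (pr v + (v - pr v))" by simp
  also have "... = f (pr v) + f (v - pr v)" by(rule LVD(4)[OF fL]) (use v prK KV in auto)
  also have "f (v - pr v) = 0" using f pr(2)[OF v] by(simp add:hsub_def)
  finally show ?thesis by simp
 qed
 have dir:"L.idirect (L.hspan Y) ?U"
  unfolding L.idirect_def
 proof (intro conjI ballI L.free_gsub[OF Y(1)] gsub)
  show "L.hspan Y Int ?U = {0}"
  proof (intro equalityI subsetI)
  fix f assume f:"f:L.hspan Y Int ?U"
  then have fL:"f:LV" by(simp add:hsub_def)
  have "f = 0"
  proof
  fix v show "f v = 0 v"
  using f on_pr[of f v] prK[of v] LVD(3)[OF fL,of v] unfolding Y(2) by(cases "v:N.mV") (auto simp:hsub_def)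
  qed
  then show "f:{0}" by simp
  next
  fix f :: "'w => 'v" assume "f:{0}"
  then show "f:L.hspan Y Int ?U"
  using L.m.subspace_0[OF L.gsubD(1)[OF L.free_gsub[OF Y(1)]]] L.m.subspace_0[OF L.gsubD(1)[OF gsub]] by auto
  qed
  fix f assume "f:L.mV"
  then have f:"f:LV" by simp
  let ?p = "precomp N pr f"
  have p:"?p:LV" by(rule hlin_pre(1)[OF N.hmod_axioms hp f])
  have d:"f - ?p:LV" by(rule Lv.subspace_diff[OF LV_sub f p])
  have "(f - ?p) v = 0" if "v:K" for v using pr(3)[OF that] KV[OF that] by(simp add:precomp_def)
  then have "f - ?p:L.hspan Y" unfolding Y(2) using d LVD(2)[OF d] by(simp add:hsub_def)
  moreover have "?p v = 0" if "v:N.hspan X" for v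
  using pr(4)[OF that] LV_0[OF f] by(simp add:precomp_def)
  then have "?p:?U" using p LVD(2)[OF p] by(simp add:hsub_def)
  moreover have "f = (f - ?p) + ?p" by(rule ext) simp
  ultimately show "EX p:L.hspan Y. EX k:?U. f = p + k" by blast
 qed
 let ?r = "precomp (msub N K) (%x. x)"
 note rp = hlin_pre[OF N.hmod_msub[OF gK] N.hlin_sub[OF gK]]
 have UL:"f:LV" if "f:?U" for f using that by(simp add:hsub_def)
 have iso:"hmod_iso s H (msub L ?U) (ghom s H (msub N K) M) ?r"
 proof (intro hmod_iso.intro P.hmod_ghom L.hmod_msub[OF gsub] hmod_iso_axioms.intro)
  show "bij_betw ?r (mcarrier (msub L ?U)) P.L.mV"
  unfolding bij_betw_def
  proof
  show "inj_on ?r (mcarrier (msub L ?U))"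
  proof (rule inj_onI)
  fix f g assume fg:"f:mcarrier (msub L ?U)" "g:mcarrier (msub L ?U)" "?r f = ?r g"
  then have U:"f:?U" "g:?U" by simp_all
  have "f k = g k" if "k:K" for k using fun_cong[OF fg(3),of k] that by(simp add:precomp_def)
  then have "f v = g v" if "v:N.mV" for v using on_pr[OF U(1) that] on_pr[OF U(2) that] prK[OF that] by simp
  then show "f = g" using LVD(3)[OF UL[OF U(1)]] LVD(3)[OF UL[OF U(2)]] by(intro ext) metis
  qed
  show "?r ` mcarrier (msub L ?U) = P.L.mV"
  proof (intro equalityI subsetI)
  fix f assume "f:?r ` mcarrier (msub L ?U)"
  then show "f:P.L.mV" using rp(1) UL by auto
  next
  fix f assume "f:P.L.mV"
  then have f:"f:P.LV" by simp
  let ?g = "P.precomp N pr f"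
  have g:"?g:LV" by(rule P.hlin_pre(1)[OF N.hmod_axioms pr(1) f])
  have "?g v = 0" if "v:N.hspan X" for v using pr(4)[OF that] P.LV_0[OF f] by(simp add:P.precomp_def)
  then have U:"?g:?U" using g LVD(2)[OF g] by(simp add:hsub_def)
  have "?r ?g = f"
  by(rule ext) (use pr(3) KV P.LVD(3)[OF f] in "auto simp:precomp_def P.precomp_def")
  then show "f:?r ` mcarrier (msub L ?U)" using U by(intro image_eqI[of _ _ ?g]) simp_all
  qed
  qed
  show "?r (f + g) = ?r f + ?r g" for f g :: "'w => 'v" by(rule ext) (simp add:precomp_def)
  show "?r (mact (msub L ?U) h f) = P.Lact h (?r f)" if "h:M.hc" "f:mcarrier (msub L ?U)" for h f
  using rp(3)[OF that(1),of f] UL that(2) by simp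
  show "?r f:P.L.mG i" if "f:mgrade (msub L ?U) i" for f i
  using rp(2)[of f i] that by simp
 qed
 interpret I: hmod_iso s H "msub L ?U" "ghom s H (msub N K) M" ?r by(rule iso)
 interpret I': hmod_iso s H "ghom s H (msub N K) M" "msub L ?U" "inv_into (mcarrier (msub L ?U)) ?r" by(rule I.inverse)
 show ?thesis using L.KF_sub[OF pos Y(1) dir] I.KF I'.KF by blast
qed

lemma KF_iso_right:
 fixes M' :: "('k,'h,'u::ab_group_add) gmodule"
 assumes iso:"hmod_iso s H M M' phi" and kf: L.KF
 shows "hmod.KF H (ghom s H N M')"
proof -
 interpret i: hmod_iso s H M M' phi by fact
 interpret j: hmod_iso s H M' M "inv_into M.mV phi" by(rule i.inverse)
 interpret P: hpair s H M' N using i.N.hmod_axioms N.hmod_axioms by(simp add:hpair_def)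
 let ?r = "%f v. phi (f v)" and ?q = "%f v. inv_into M.mV phi (f v)"
 note rp = hlin_post[OF i.N.hmod_axioms i.hlin] and qp = P.hlin_post[OF M.hmod_axioms j.hlin]
 have bij:"bij_betw ?r L.mV P.L.mV"
 proof (rule bij_betw_byWitness[where f' = ?q])
  show "ALL f:L.mV. ?q (?r f) = f"
  proof
  fix f assume "f:L.mV"
  then have f:"f:LV" by simp
  show "?q (?r f) = f"
  proof
  fix v show "?q (?r f) v = f v"
  using LVD(2)[OF f] LVD(3)[OF f] inv_into_f_f[OF bij_betw_imp_inj_on[OF i.bij]] by(cases "v:N.mV") auto
  qed
  qed
  show "ALL f:P.L.mV. ?r (?q f) = f"
  proof
  fix f assume "f:P.L.mV"
  then have f:"f:P.LV" by simp
  show "?r (?q f) = f"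
  proof
  fix v show "?r (?q f) v = f v"
  using P.LVD(2)[OF f] P.LVD(3)[OF f] bij_betw_inv_into_right[OF i.bij] by(cases "v:N.mV") auto
  qed
  qed
  show "?r ` L.mV <= P.L.mV" using rp(1) by auto
  show "?q ` P.L.mV <= L.mV" using qp(1) by auto
 qed
 have "hmod_iso s H L (ghom s H N M') ?r"
 proof (intro hmod_iso.intro P.hmod_ghom hmod_ghom hmod_iso_axioms.intro bij)
  show "?r (f + g) = ?r f + ?r g" if "f:L.mV" "g:L.mV" for f g
  proof
  fix v have fL:"f:LV" "g:LV" using that by simp_all
  show "?r (f + g) v = (?r f + ?r g) v"
  using LVD[OF fL(1)] LVD[OF fL(2)] by(cases "v:N.mV") (simp_all add:i.map_add)
  qed
  show "?r (Lact h f) = P.Lact h (?r f)" if "h:M.hc" "f:L.mV" for h f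
  using rp(3)[OF that(1),of f] that(2) by simp
  show "?r f:P.L.mG i" if "f:L.mG i" for f i using rp(2)[of f i] that by simp
 qed
 then interpret I: hmod_iso s H L "ghom s H N M'" ?r .
 show ?thesis by(rule I.KF[OF kf])
qed

end

section \<open>Invariants of Hom modules modulo multiples of the integral\<close>

context hpair
begin

text \<open>For a homomorphism \<open>f\<close> the factors recombine to the sum of the
  \<open>a * S b\<close>, which is given by the counit and vanishes in positive degree. This is the
  converse of \<open>soc_hlin\<close>.\<close>

lemma hlin_soc:
 assumes g:"hlin H N M f" and fL:"f:LV"
 shows "f:LG 0" "L.soc f"
proof -
 show f:"f:LG 0" using fL hlinD(4)[OF g] by(auto simp:homgrade_def)
 have "Lact h f v = 0" if h:"h:M.hg n" and n:"n > 0" and v:"v:N.mV" for h n v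
 proof -
  note hhc = M.hg_hc[OF h]
  obtain hr where hr:"M.rep n h hr" using M.rep_ex[OF h] by blast
  note mem = M.rep_mem_hc[OF hr]
  have "Lact h f v = (SUM (i,a,b)<-hr. M.act (a * M.S b) (f v))"
  unfolding Lact_eval[OF f hhc hr v]
  by(rule M.sum_list_cong2) (use mem v LVD(2)[OF fL v] in "auto simp:hlinD(3)[OF g] M.act_mult")
  also have "... = M.act (SUM (i,a,b)<-hr. a * M.S b) (f v)"
  unfolding case_prod_unfold
  by(rule M.h.linear_on_sum_list[OF M.act_linear_left[OF LVD(2)[OF fL v]] M.h.subV,symmetric]) (use mem in force)
  also have "(SUM (i,a,b)<-hr. a * M.S b) = M.hs (M.eps h) 1"
  unfolding M.S_right[OF hhc,symmetric]
  by(rule M.rep_eval[OF hr M.h.vector_space_axioms,symmetric]) (rule M.bilinear_mult[OF M.linear_id M.S_linear],auto)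
  finally show ?thesis using M.counit_hg[OF h] n LVD(2)[OF fL v] by simp
 qed
 then have "Lact h f = 0" if "h:M.hg n" "n > 0" for h n
  using LVD(3)[OF Lact_LV[OF fL M.hg_hc[OF that(1)]]] that by(intro ext) (metis zero_fun_apply)
 then show "L.soc f" using fL by(auto simp:L.soc_def)
qed

text \<open>On an invariant \<open>x\<close> every \<open>S b\<close> with \<open>b\<close> of
  positive degree gives 0, so only the term \<open>Lam \<otimes> 1\<close> of the coproduct is
  left.\<close>

lemma Lact_Lam_soc:
 assumes f:"f:LV" and x:"N.soc x"
 shows "Lact M.Lam f x = M.act M.Lam (f x)"
 using f
proof (induction rule: Lg.homog_induct)
 case zero
 have "Lact M.Lam 0 = 0" by(rule Lv.linear_on_0[OF Lact_linear[OF M.Lam_hc] LV_sub])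
 then show ?case by(rule ssubst) simp
next
 case (add f g)
 have "f x:M.mV" "g x:M.mV" using x LVD(2)[OF add.hyps(1)] LVD(2)[OF add.hyps(2)] by(auto simp:N.soc_def)
 then show ?case
  by(subst linear_on_add[OF Lact_linear[OF M.Lam_hc] add.hyps(1,2)]) (simp add:add.IH M.act_add)
next
 case (homog j f)
 note fL = LG_LV[OF homog]
 have xV:"x:N.mV" using x by(simp add:N.soc_def)
 obtain zr where zr:"M.rep M.htop M.Lam ((M.htop,M.Lam,1) # zr)" "!!i a b. (i,a,b):set zr==>0 <= i & i < M.htop"
  using M.rep_right_ex[OF M.Lam_hg] by blast
 have zero:"M.sc (xsign s (M.htop - i) j) (M.act a (f (N.act (M.S b) x))) = 0" if z:"(i,a,b):set zr" for i a b
 proof -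
  have "b:M.hg (M.htop - i)" "a:M.hc" using M.rep_mem[OF zr(1),of i a b] M.rep_mem_hc[OF zr(1),of i a b] z by auto
  moreover have "0 < M.htop - i" using zr(2)[OF z] by simp
  ultimately have "N.act (M.S b) x = 0" using x M.S_hg[of b "M.htop - i"] unfolding N.soc_def by blast
  then show ?thesis using \<open>b:M.hg (M.htop - i)\<close> \<open>a:M.hc\<close> LV_0[OF fL] by simp
 qed
 have "(SUM (i,a,b)<-zr. M.sc (xsign s (M.htop - i) j) (M.act a (f (N.act (M.S b) x)))) = 0"
  by(rule sum_list_zero2) (rule zero)
 then show ?case
  unfolding Lact_eval[OF homog M.Lam_hc zr(1) xV] using xV by simp
qed

end

text \<open>Invariants of the free part are \<open>Lam\<close>-multiples, so modulo these the
  invariants form the line of \<open>x\<close>, on which \<open>f\<close> is nonzero.\<close>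

lemma (in hmod) KF_soc:
 assumes KF "soc f" "soc g" "f ~: act Lam ` mV"
 obtains c psi where "psi:mV" "g = sc c f + act Lam psi"
proof -
 obtain X x where X:"free_basis X" "x:mG 0" "x ~= 0" "soc x"
  and dec:"ALL m:mV. EX p:hspan X. EX c. m = p + sc c x"
  using assms(1) unfolding KF_def by(elim exE conjE)
 note gP = free_gsub[OF X(1)]
 have ex:"EX psi:mV. EX c. f = act Lam psi + sc c x" if f:"soc f" for f
 proof -
  obtain p c where pc:"p:hspan X" "f = p + sc c x" using dec f unfolding soc_def by blast
  have "p = f - sc c x" using pc by simp
  moreover have xV:"x:mV" using X(4) by(simp add:soc_def)
  ultimately have "soc p" using f X(4) hg_hc unfolding soc_def by(auto simp:act_diff act_scale)
  then obtain t where "p = act Lam (SUM x:X. sc (t x) x)" "(SUM x:X. sc (t x) x):hspan X"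
  using soc_free[OF X(1) pc(1)] by blast
  then show ?thesis using pc gsubD(2)[OF gP] by metis
 qed
 obtain phi a where a:"phi:mV" "f = act Lam phi + sc a x" using ex[OF assms(2)] by blast
 obtain psi b where b:"psi:mV" "g = act Lam psi + sc b x" using ex[OF assms(3)] by blast
 have a0:"a ~= 0" using a assms(4) by auto
 have "g = sc (b / a) f + act Lam (psi - sc (b / a) phi)"
  unfolding a(2) b(2) using a(1) b(1) a0 by(simp add:act_diff act_scale m.scale_right_distrib)
 then show thesis using that[of "psi - sc (b / a) phi" "b / a"] a(1) b(1) by simp
qed

text \<open>Stable version of injectivity on invariants: \<open>Lam\<close>-multiples count as zero,
  both among maps and among elements. The property survives adding or removing free summands of
  \<open>M\<close>, and it keeps composites of two such maps from becoming divisible.\<close>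

definition socle_faithful :: "'k::field => ('k,'h::ring_1) hopf => ('k,'h,'w::ab_group_add) gmodule => ('k,'h,'v::ab_group_add) gmodule => bool" where
 "socle_faithful s H N M \<longleftrightarrow> (ALL f. f:homgrade N M 0 --> hmod.soc H (ghom s H N M) f
  --> f ~: mact (ghom s H N M) (hopf.Lam H) ` homcarrier N M
  --> (ALL x. hmod.soc H N x --> f x:mact M (hopf.Lam H) ` mcarrier M --> x:mact N (hopf.Lam H) ` mcarrier N))"

lemma (in hpair) socle_faithfulD:
 assumes "socle_faithful s H N M" "f:LG 0" "L.soc f" "f ~: Lact M.Lam ` LV" "N.soc x" "f x:M.act M.Lam ` M.mV"
 shows "x:N.act M.Lam ` N.mV"
 using assms unfolding socle_faithful_def by blast

text \<open>By \<open>KF_soc\<close> the identity is a scalar multiple of \<open>f\<close> modulo a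
  \<open>Lam\<close>-multiple. Evaluated at \<open>x\<close>, both terms are
  \<open>Lam\<close>-multiples if \<open>f x\<close> is.\<close>

lemma (in hmod) socle_faithful_self:
 assumes "hmod.KF H (ghom s H M M)"
 shows "socle_faithful s H M M"
proof -
 interpret P: hpair s H M M by unfold_locales
 let ?id = "%v. if v:mV then v else 0"
 have id:"?id:P.LV" by(rule P.LVI) auto
 have "hlin H M M ?id" using mG_mV by(auto simp:hlin_def)
 note ids = P.hlin_soc[OF this id]
 show ?thesis
  unfolding socle_faithful_def
 proof (intro allI impI)
  fix f x assume f:"f:P.LG 0" "P.L.soc f" "f ~: P.Lact Lam ` P.LV" and x:"soc x" and fx:"f x:act Lam ` mV"
  have xV:"x:mV" using x by(simp add:soc_def)
  have n:"f ~: P.Lact Lam ` P.L.mV" using f(3) by simp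
  obtain c psi where c':"psi:P.L.mV" "?id = P.L.sc c f + P.Lact Lam psi"
  using P.L.KF_soc[OF assms f(2) ids(2) n] .
  note c = c'[unfolded P.L_simps]
  obtain m where m:"m:mV" "f x = act Lam m" using fx by blast
  have "x = sc c (f x) + P.Lact Lam psi x" using fun_cong[OF c(2),of x] xV by simp
  also have "... = act Lam (sc c m + psi x)"
  unfolding m(2) P.Lact_Lam_soc[OF c(1) x] using m(1) P.LVD(2)[OF c(1) xV] by(simp add:act_add act_scale)
  finally show "x:act Lam ` mV" by(rule image_eqI) (use m(1) P.LVD(2)[OF c(1) xV] in simp)
 qed
qed

lemma (in hpair) hlin_0:"hlin H N M f==>f 0 = 0"
 using N.m.linear_on_0[OF M.hlin_linear[OF N.hmod_axioms M.hmod_axioms] N.m.subV] .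

text \<open>\<open>i f\<close> is not divisible, because applying \<open>q\<close> would divide
  \<open>f\<close>; so faithfulness for \<open>M\<close> applies to it.\<close>

lemma (in hpair) socle_faithful_retract:
 fixes M' :: "('k,'h,'u::ab_group_add) gmodule"
 assumes M':"hmod s H M'" and i:"hlin H M' M i" and q:"hlin H M M' q" and qi:"!!m. m:mcarrier M'==>q (i m) = m"
  and sf:"socle_faithful s H N M"
 shows "socle_faithful s H N M'"
proof -
 interpret P: hpair s H M' N using M' N.hmod_axioms by(simp add:hpair_def)
 show ?thesis
  unfolding socle_faithful_def
 proof (intro allI impI)
  fix f x assume f:"f:P.LG 0" "P.L.soc f" "f ~: P.Lact M.Lam ` P.LV" and x:"N.soc x" and fx:"f x:P.M.act M.Lam ` P.M.mV"
  note fL = P.LG_LV[OF f(1)]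
  have fM:"f v:P.M.mV" for v using P.LVD(2,3)[OF fL,of v] by(cases "v:N.mV") auto
  let ?g = "%v. i (f v)"
  have gL:"?g:LV" by(rule P.hlin_post(1)[OF M.hmod_axioms i fL])
  have "hlin H N M ?g" by(rule hlin_compose[OF P.soc_hlin[OF f(1,2)] i])
  note gs = hlin_soc[OF this gL]
  have "?g ~: Lact M.Lam ` LV"
  proof
  assume "?g:Lact M.Lam ` LV"
  then obtain phi where phi:"phi:LV" "?g = Lact M.Lam phi" by blast
  have "f = (%v. q (?g v))"
  by(rule ext) (simp add:qi fM)
  also have "... = P.Lact M.Lam (%v. q (phi v))" unfolding hlin_post(3)[OF M' q M.Lam_hc phi(1)] by(simp add:fun_cong[OF phi(2)])
  finally show False using f(3) hlin_post(1)[OF M' q phi(1)] by blast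
  qed
  moreover obtain m where m:"m:P.M.mV" "f x = P.M.act M.Lam m" using fx by blast
  have "?g x:M.act M.Lam ` M.mV" unfolding m(2) hlinD(3)[OF i M.Lam_hc m(1)] using hlinD(1)[OF i m(1)] by blast
  ultimately show "x:N.act M.Lam ` N.mV" by(rule socle_faithfulD[OF sf gs _ x])
 qed
qed

text \<open>\<open>q f\<close> is not divisible: \<open>f - i q f\<close> is an invariant of the
  free module of maps into \<open>hspan X\<close>, hence divisible, so dividing \<open>q f\<close>
  would divide \<open>f\<close>.\<close>

lemma (in hpair) socle_faithful_free:
 fixes M' :: "('k,'h,'u::ab_group_add) gmodule"
 assumes M':"hmod s H M'" and i:"hlin H M' M i" and q:"hlin H M M' q"
  and X:"M.free_basis X" and qi:"!!v. v:M.mV==>v - i (q v):M.hspan X"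
  and sf:"socle_faithful s H N M'"
 shows "socle_faithful s H N M"
proof -
 interpret P: hpair s H M' N using M' N.hmod_axioms by(simp add:hpair_def)
 obtain Y where Y:"L.free_basis Y" "L.hspan Y = hsub {0} (M.hspan X)" using ghom_free_right[OF X] .
 show ?thesis
  unfolding socle_faithful_def
 proof (intro allI impI)
  fix f x assume f:"f:LG 0" "L.soc f" "f ~: Lact M.Lam ` LV" and x:"N.soc x" and fx:"f x:M.act M.Lam ` M.mV"
  note fL = LG_LV[OF f(1)]
  let ?g = "%v. q (f v)" and ?h = "%v. i (q (f v))"
  have gL:"?g:P.LV" by(rule hlin_post(1)[OF M' q fL])
  have hL:"?h:LV" by(rule P.hlin_post(1)[OF M.hmod_axioms i gL])
  have lg:"hlin H N M' ?g" by(rule hlin_compose[OF soc_hlin[OF f(1,2)] q])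
  note gs = P.hlin_soc[OF lg gL]
  note hs = hlin_soc[OF hlin_compose[OF lg i] hL]
  have "?g ~: P.Lact M.Lam ` P.LV"
  proof
  assume "?g:P.Lact M.Lam ` P.LV"
  then obtain phi where phi:"phi:P.LV" "?g = P.Lact M.Lam phi" by blast
  let ?phi = "%v. i (phi v)"
  have phiL:"?phi:LV" by(rule P.hlin_post(1)[OF M.hmod_axioms i phi(1)])
  have hLam:"?h = Lact M.Lam ?phi"
  unfolding P.hlin_post(3)[OF M.hmod_axioms i M.Lam_hc phi(1)] phi(2)[symmetric] ..
  have eL:"f - ?h:LV" by(rule Lv.subspace_diff[OF LV_sub fL hL])
  then have "f - ?h:L.hspan Y" unfolding Y(2) using qi LVD(2)[OF fL] LV_0[OF eL] by(auto simp:hsub_def)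
  moreover have "L.soc (f - ?h)"
  unfolding L.soc_def
  proof (intro conjI allI impI)
  show "f - ?h:L.mV" using eL by simp
  fix n a assume a:"0 < n" "a:M.hg n"
  have "Lact a f = 0" "Lact a ?h = 0" using a f(2) hs(2) by(auto simp:L.soc_def)
  then show "Lact a (f - ?h) = 0"
  using Lv.linear_on_diff[OF Lact_linear[OF M.hg_hc[OF a(2)]] LV_sub fL hL] by(simp only: diff_self)
  qed
  ultimately obtain t where t:"f - ?h = (SUM x:Y. L.sc (t x) (Lact M.Lam x))"
  "f - ?h = Lact M.Lam (SUM x:Y. L.sc (t x) x)" "(SUM x:Y. L.sc (t x) x):L.hspan Y"
  by(rule L.soc_free[OF Y(1)])
  define psi where "psi = (SUM x:Y. L.sc (t x) x)"
  have psi:"psi:LV" "f - ?h = Lact M.Lam psi"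
  using L.gsubD(2)[OF L.free_gsub[OF Y(1)] t(3)] t(2) unfolding psi_def L_simps .
  have "Lact M.Lam (psi + ?phi) = (f - ?h) + ?h"
  by(simp only: linear_on_add[OF Lact_linear[OF M.Lam_hc] psi(1) phiL] psi(2)[symmetric] hLam[symmetric])
  also have "... = f" by(rule diff_add_cancel)
  finally show False using f(3) Lv.subspace_add[OF LV_sub psi(1) phiL] by blast
  qed
  moreover obtain m where m:"m:M.mV" "f x = M.act M.Lam m" using fx by blast
  have "?g x:P.M.act M.Lam ` P.M.mV" unfolding m(2) hlinD(3)[OF q M.Lam_hc m(1)] using hlinD(1)[OF q m(1)] by blast
  ultimately show "x:N.act M.Lam ` N.mV" by(rule P.socle_faithfulD[OF sf gs _ x])
 qed
qed

section \<open>Kernels, retractions, and isomorphisms between complements of free parts\<close>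

lemma (in hpair) hlin_hcomp:
 assumes g:"hlin H N M g" and x:"x:N.mV" shows "hcomp M.mG (g x) i = g (hcomp N.mG x i)"
 using x
proof (induction rule: N.m.homog_induct)
 case (add x y)
 then show ?case by(simp add:hlinD[OF g] M.m.hcomp_add N.m.hcomp_add N.m.hcomp_V)
next
 case (homog j x)
 then show ?case using hlinD(4)[OF g homog] by(simp add:M.m.hcomp_homog N.m.hcomp_homog hlin_0[OF g])
qed (simp add:hlin_0[OF g])

lemma (in hpair) hlin_kernel:
 assumes g:"hlin H N M g" shows "N.gsub {x:N.mV. g x = 0}"
proof -
 note lin = M.hlin_linear[OF N.hmod_axioms M.hmod_axioms g]
 have "N.m.graded_sub {x:N.mV. g x = 0}"
 proof (rule N.m.graded_subI)
  show "N.m.subspace {x:N.mV. g x = 0}"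
  by(rule N.m.subspaceI) (auto simp:hlin_0[OF g] hlinD(2)[OF g] linear_on_scale[OF lin])
  show "hcomp N.mG x i:{x:N.mV. g x = 0}" if "x:{x:N.mV. g x = 0}" for x i
  using hlin_hcomp[OF g,of x i] that by(auto simp:N.m.hcomp_V)
 qed auto
 then show ?thesis by(auto simp:N.gsub_def hlinD(3)[OF g])
qed

lemma (in fgvs) inj_endo_surj:
 assumes lin:"linear_on sc sc V g" and V:"!!x. x:V==>g x:V" and ker:"!!x. x:V==>g x = 0==>x = 0" and v:"v:V"
 shows "v:g ` V"
proof (rule ccontr)
 assume v':"v ~: g ` V"
 obtain h where h:"linear_on sc sc UNIV h" "!!x. x:V==>h x = g x"
  using linear_on_extend[OF vector_space_axioms subV lin] by blast
 interpret h: Vector_Spaces.linear sc sc h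
  using h(1) by unfold_locales (auto simp:linear_on_def)
 obtain B where B:"B <= V" "independent B" "V <= span B" using maximal_independent_subset by blast
 have spB:"span B = V" using B(1,3) span_minimal[OF B(1) subV] by blast
 have finB:"finite B" by(rule independent_finite[OF B(2,1)])
 have inj:"inj_on h (span B)"
  unfolding spB
 proof (rule inj_onI)
  fix x y assume xy:"x:V" "y:V" "h x = h y"
  have "h (x - y) = 0" using xy(3) h.diff by simp
  then show "x = y" using ker[of "x - y"] subspace_diff[OF subV xy(1,2)] h(2) by simp
 qed
 have "h ` span B = g ` V" unfolding spB using h(2) by(rule image_cong[OF refl])
 then have "v ~: span (h ` B)" using v' h.span_image[of B] by simp
 moreover have "independent (h ` B)" by(rule h.independent_injective_image[OF B(2) inj])
 ultimately have "independent (insert v (h ` B))" by(rule independent_insertI)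
 moreover have "insert v (h ` B) <= span B" unfolding spB using v V B(1) h(2) by auto
 ultimately have "card (insert v (h ` B)) <= card B" using independent_span_bound[OF finB] by blast
 moreover have "v ~: h ` B" using v' h(2) B(1) by auto
 moreover have "card (h ` B) = card B" by(rule card_image[OF inj_on_subset[OF inj span_superset]])
 ultimately show False using finB by simp
qed

text \<open>Pulls an isomorphism with \<open>dsum M' F\<close> back into \<open>M\<close>:
  \<open>F\<close> becomes a free submodule, and \<open>M'\<close> a retract isomorphic to a
  complement of it.\<close>

lemma (in hopf) free_summandE:
 fixes M :: "('k,'h,'v::ab_group_add) gmodule" and M' :: "('k,'h,'w::ab_group_add) gmodule" and F :: "('k,'h,'u::ab_group_add) gmodule"
 assumes M:"hmod s H M" and M':"hmod s H M'" and F:"hmod s H F" "gfree (alg H) F" and iso:"gmod_iso (alg H) M (dsum M' F)"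
 obtains X i q K where "hmod.free_basis H M X" "hlin H M' M i" "hlin H M M' q" "!!m. m:mcarrier M'==>q (i m) = m"
  "!!v. v:mcarrier M==>v - i (q v):hmod.hspan H M X" "hmod.idirect H M (hmod.hspan H M X) K"
  "hmod_iso s H (msub M K) M' q"
proof -
 interpret M: hmod s H M by fact
 interpret M': hmod s H M' by fact
 interpret F: hmod s H F by fact
 interpret D: hmod s H "dsum M' F" by(rule hmod_dsum[OF M' F(1)])
 interpret MF: hpair s H F M by unfold_locales
 interpret MM: hpair s H M' M by unfold_locales
 obtain phi where phi:"hmod_iso s H M (dsum M' F) phi" using gmod_iso_hmod[OF M D.hmod_axioms iso] .
 interpret p: hmod_iso s H M "dsum M' F" phi by fact
 define psi where "psi = inv_into M.mV phi"
 interpret i: hmod_iso s H "dsum M' F" M psi unfolding psi_def by(rule p.inverse)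
 have pp:"phi (psi d) = d" if "d:D.mV" for d unfolding psi_def by(rule bij_betw_inv_into_right[OF p.bij that])
 have ip:"psi (phi v) = v" if "v:M.mV" for v unfolding psi_def by(rule bij_betw_inv_into_left[OF p.bij that])
 obtain X where X:"F.free_basis X" "F.mV = F.hspan X" using F(2) F.gfree_free_basis by blast
 let ?Y = "Pair (0 :: 'w) ` X"
 have fbY:"D.free_basis ?Y" and hsY:"D.hspan ?Y = {0} \<times> F.mV" using dsum_free_basis[OF M' F(1) X(1)] X(2) by simp_all
 have YD:"?Y <= D.mV" using D.free_basisD(3)[OF fbY] by blast
 define i where "i m = psi (m,0)" for m
 define q where "q v = fst (phi v)" for v
 have hi:"hlin H M' M i"
  unfolding i_def by(rule hlin_compose[OF _ i.hlin]) (auto simp:hlin_def dsum_def)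
 have hq:"hlin H M M' q"
  unfolding q_def by(rule hlin_compose[OF p.hlin]) (auto simp:hlin_def dsum_def)
 have hsn:"hlin H M F (%v. snd (phi v))"
  by(rule hlin_compose[OF p.hlin]) (auto simp:hlin_def dsum_def)
 have DI:"(m,0):D.mV" if "m:M'.mV" for m using that by(simp add:dsum_def)
 have qi:"q (i m) = m" "snd (phi (i m)) = 0" if "m:M'.mV" for m
  using pp[OF DI[OF that]] by(simp_all add:q_def i_def)
 have P:"v:M.hspan (psi ` ?Y) \<longleftrightarrow> q v = 0" if v:"v:M.mV" for v
 proof -
  have "phi v:{0} \<times> F.mV \<longleftrightarrow> q v = 0"
  using p.mem[OF v] by(cases "phi v") (auto simp:dsum_def q_def)
  then show ?thesis using i.hspan[OF YD p.mem[OF v]] ip[OF v] hsY by simp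
 qed
 define K where "K = {v:M.mV. snd (phi v) = 0}"
 have gK:"M.gsub K" unfolding K_def by(rule MF.hlin_kernel[OF hsn])
 note fbX = i.free_basis[OF fbY]
 have v0:"v = 0" if "v:M.mV" "q v = 0" "snd (phi v) = 0" for v
  using p.eq_0[OF that(1)] that(2,3) by(simp add:q_def prod_eq_iff)
 have vi:"v - i (q v):M.hspan (psi ` ?Y)" if v:"v:M.mV" for v
 proof -
  have iq:"i (q v):M.mV" "q v:M'.mV" using hlinD(1)[OF hq v] hlinD(1)[OF hi] by auto
  have "q (v - i (q v)) = q v - q (i (q v))"
  by(rule M.m.linear_on_diff[OF hlin_linear[OF M M' hq] M.m.subV v iq(1)])
  then have "q (v - i (q v)) = 0" using qi(1)[OF iq(2)] by simp
  then show ?thesis using P v iq by simp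
 qed
 have dir:"M.idirect (M.hspan (psi ` ?Y)) K"
  unfolding M.idirect_def
 proof (intro conjI ballI gK M.free_gsub[OF fbX])
  show "M.hspan (psi ` ?Y) Int K = {0}"
  using P v0 M.m.subspace_0[OF M.gsubD(1)[OF gK]] M.m.subspace_0[OF M.gsubD(1)[OF M.free_gsub[OF fbX]]]
  by(auto simp:K_def)
  fix v assume v:"v:M.mV"
  have "i (q v):K" using hlinD(1)[OF hi hlinD(1)[OF hq v]] qi(2)[OF hlinD(1)[OF hq v]] by(simp add:K_def)
  moreover have "v = (v - i (q v)) + i (q v)" by simp
  ultimately show "EX p:M.hspan (psi ` ?Y). EX k:K. v = p + k" using vi[OF v] by blast
 qed
 have "hmod_iso s H (msub M K) M' q"
 proof (intro hmod_iso.intro M.hmod_msub[OF gK] M' hmod_iso_axioms.intro)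
  show "bij_betw q (mcarrier (msub M K)) M'.mV"
  unfolding bij_betw_def
  proof
  show "inj_on q (mcarrier (msub M K))"
  using p.inj by(auto intro!:inj_onI simp:K_def q_def prod_eq_iff)
  show "q ` mcarrier (msub M K) = M'.mV"
  using hlinD(1)[OF hq] hlinD(1)[OF hi] qi by(auto simp:K_def intro!:image_eqI[of m q "i m" for m])
  qed
 qed (use hlinD[OF hq] in "auto simp:K_def")
 then show thesis using that[OF fbX hi hq qi(1) vi dir] by blast
qed

context hpair
begin

text \<open>A nonzero kernel of \<open>pr f\<close> on \<open>N0\<close> would contain a nonzero
  invariant \<open>z\<close>. Then \<open>f z\<close> is an invariant of the free part, so
  \<open>f z = Lam p\<close>, and \<open>c z = Lam (f' p - psi z)\<close>. Thus \<open>z\<close> is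
  a \<open>Lam\<close>-multiple, and these lie in \<open>hspan X'\<close> because \<open>Lam\<close>
  kills \<open>N0\<close>.\<close>

lemma core_inj:
 assumes f:"hlin H N M f" and f':"hlin H M N f'" and c:"c ~= 0" and psi:"psi:homcarrier N N"
  and ff:"!!v. v:N.mV==>f' (f v) = N.sc c v + mact (ghom s H N N) M.Lam psi v"
  and X:"M.free_basis X" and gM:"M.gsub M0"
  and N0:"N.idirect (N.hspan X') N0" "N.free_basis X'" "!!k. k:N0==>N.act M.Lam k = 0"
  and pr:"hlin H M (msub M M0) pr" "!!v. v:M.mV==>v - pr v:M.hspan X"
  and y:"y:N0" "pr (f y) = 0"
 shows "y = 0"
proof (rule ccontr)
 assume y0:"y ~= 0"
 interpret NN: hpair s H N N by unfold_locales
 note gN = N.idirectD(2)[OF N0(1)]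
 have "hlin H N M (%v. pr (f v))" by(rule hlin_compose[OF f hlin_compose[OF pr(1) M.hlin_sub[OF gM]]])
 then have gU:"N.gsub (N0 Int {x:N.mV. pr (f x) = 0})" by(rule N.gsub_Int[OF gN hlin_kernel])
 have "y:N0 Int {x:N.mV. pr (f x) = 0}" using y N.gsubD(2)[OF gN] by simp
 then obtain z i where z:"z:N0 Int {x:N.mV. pr (f x) = 0}" "z:N.mG i" "z ~= 0" "N.soc z"
  using N.socle_nonzero[OF gU _ y0] by metis
 have zV:"z:N.mV" "z:N0" "pr (f z) = 0" using z(1) by auto
 have fz:"f z:M.hspan X" using pr(2)[OF hlinD(1)[OF f zV(1)]] zV(3) by simp
 have "M.soc (f z)"
  unfolding M.soc_def
 proof (intro conjI allI impI hlinD(1)[OF f zV(1)])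
  fix n a assume a:"0 < n" "a:M.hg n"
  then have "N.act a z = 0" using z(4) by(auto simp:N.soc_def)
  then show "M.act a (f z) = 0" using hlinD(3)[OF f M.hg_hc[OF a(2)] zV(1)] hlin_0[OF f] by simp
 qed
 then obtain t where t:"f z = (SUM x:X. M.sc (t x) (M.act M.Lam x))" "f z = M.act M.Lam (SUM x:X. M.sc (t x) x)"
  "(SUM x:X. M.sc (t x) x):M.hspan X" by(rule M.soc_free[OF X fz])
 define p where "p = (SUM x:X. M.sc (t x) x)"
 have p:"p:M.mV" "f z = M.act M.Lam p" unfolding p_def using M.gsubD(2)[OF M.free_gsub[OF X] t(3)] t(2) by simp_all
 have pz:"psi z:N.mV" by(rule NN.LVD(2)[OF psi zV(1)])
 have f'p:"f' p:N.mV" by(rule hlinD(1)[OF f' p(1)])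
 have "N.act M.Lam (f' p) = N.sc c z + N.act M.Lam (psi z)"
  using ff[OF zV(1)] unfolding NN.Lact_Lam_soc[OF psi z(4)] p(2) hlinD(3)[OF f' M.Lam_hc p(1)] .
 then have "N.sc c z = N.act M.Lam (f' p - psi z)" using f'p pz by(simp add:N.act_diff)
 then have "N.sc (1 / c) (N.sc c z) = N.act M.Lam (N.sc (1 / c) (f' p - psi z))" using f'p pz by(simp add:N.act_scale)
 then have zw:"z = N.act M.Lam (N.sc (1 / c) (f' p - psi z))" using c by simp
 define w where "w = N.sc (1 / c) (f' p - psi z)"
 have "w:N.mV" using f'p pz by(simp add:w_def)
 then obtain r k where rk:"r:N.hspan X'" "k:N0" "w = r + k" using N.idirectD(4)[OF N0(1)] by blast
 have rkV:"r:N.mV" "k:N.mV" using N.gsubD(2)[OF N.idirectD(1)[OF N0(1)] rk(1)] N.gsubD(2)[OF gN rk(2)] .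
 have "z = N.act M.Lam r" using zw N0(3)[OF rk(2)] rkV unfolding w_def[symmetric] rk(3) by(simp add:N.act_add)
 then have "z:N.hspan X'" using N.gsubD(4)[OF N.idirectD(1)[OF N0(1)] M.Lam_hc rk(1)] by simp
 then show False using N.idirectD(3)[OF N0(1)] zV(2) z(3) by blast
qed

text \<open>Both maps between the complements are injective by \<open>core_inj\<close>. In finite
  dimension the injective composite \<open>u w\<close> is onto, hence so is
  \<open>u\<close>.\<close>

lemma cores_iso:
 assumes f:"hlin H N M f" and f':"hlin H M N f'"
  and c:"c ~= 0" "psi:homcarrier N N" "!!v. v:N.mV==>f' (f v) = N.sc c v + mact (ghom s H N N) M.Lam psi v"
  and c':"c' ~= 0" "psi':homcarrier M M" "!!v. v:M.mV==>f (f' v) = M.sc c' v + mact (ghom s H M M) M.Lam psi' v"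
  and M0:"M.idirect (M.hspan X) M0" "M.free_basis X" "!!k. k:M0==>M.act M.Lam k = 0"
  and N0:"N.idirect (N.hspan X') N0" "N.free_basis X'" "!!k. k:N0==>N.act M.Lam k = 0"
 obtains u where "hmod_iso s H (msub M M0) (msub N N0) u"
proof -
 interpret P: hpair s H N M by unfold_locales
 note gM = M.idirectD(2)[OF M0(1)] and gN = N.idirectD(2)[OF N0(1)]
 obtain pr where pr:"hlin H M (msub M M0) pr" "!!v. v:M.mV==>v - pr v:M.hspan X"
  by(rule M.idirect_proj[OF M.idirect_sym[OF M0(1)]]) (assumption | rule)+
 obtain pr' where pr':"hlin H N (msub N N0) pr'" "!!v. v:N.mV==>v - pr' v:N.hspan X'"
  by(rule N.idirect_proj[OF N.idirect_sym[OF N0(1)]]) (assumption | rule)+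
 define u where "u x = pr' (f' x)" for x
 define w where "w x = pr (f x)" for x
 have hu:"hlin H (msub M M0) (msub N N0) u"
  unfolding u_def by(rule hlin_compose[OF hlin_compose[OF M.hlin_sub[OF gM] f'] pr'(1)])
 have hw:"hlin H (msub N N0) (msub M M0) w"
  unfolding w_def by(rule hlin_compose[OF hlin_compose[OF N.hlin_sub[OF gN] f] pr(1)])
 have uM:"u x:N0" if "x:M0" for x using hlinD(1)[OF hu] that by simp
 have wN:"w x:M0" if "x:N0" for x using hlinD(1)[OF hw] that by simp
 have u0:"x = 0" if "x:M0" "u x = 0" for x
  by(rule P.core_inj[OF f' f c' N0(2) gN M0 pr' that(1) that(2)[unfolded u_def]])
 have w0:"x = 0" if "x:N0" "w x = 0" for x
  by(rule core_inj[OF f f' c M0(2) gM N0 pr that(1) that(2)[unfolded w_def]])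
 note hm = M.hmod_msub[OF gM] and hn = N.hmod_msub[OF gN]
 interpret n: fgvs N.sc N0 "%i. N.mG i Int N0" by(rule N.m.fgvs_sub) (use gN in "simp add:N.gsub_def")
 have lin:"linear_on N.sc N.sc N0 (%x. u (w x))"
  using M.hlin_linear[OF hn hn hlin_compose[OF hw hu]] by simp
 have surj:"v:(%x. u (w x)) ` N0" if "v:N0" for v
  by(rule n.inj_endo_surj[OF lin _ _ that]) (use uM wN u0 w0 in auto)
 have "hmod_iso s H (msub M M0) (msub N N0) u"
 proof (intro hmod_iso.intro hm hn hmod_iso_axioms.intro)
  show "bij_betw u (mcarrier (msub M M0)) (mcarrier (msub N N0))"
  unfolding bij_betw_def msub_simps
  proof
  show "inj_on u M0"
  proof (rule inj_onI)
  fix x y assume xy:"x:M0" "y:M0" "u x = u y"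
  have lu:"linear_on M.sc N.sc M0 u" using M.hlin_linear[OF hm hn hu] by simp
  have "u (x - y) = u x - u y" by(rule M.m.linear_on_diff[OF lu M.gsubD(1)[OF gM] xy(1,2)])
  then have "u (x - y) = 0" using xy(3) by simp
  then have "x - y = 0" by(rule u0[OF M.m.subspace_diff[OF M.gsubD(1)[OF gM] xy(1,2)]])
  then show "x = y" by simp
  qed
  show "u ` M0 = N0" using uM surj wN by blast
  qed
 qed (use hlinD[OF hu] in auto)
 then show thesis by(rule that)
qed

end

lemma sum_list_swap:"(SUM x<-xs. SUM y<-ys. f x y) = (SUM y<-ys. SUM x<-xs. (f x y :: 'c::comm_monoid_add))"
 by(induction xs) (simp_all add:sum_list_addf)

lemma gmod_iso_trans:"gmod_iso A M N==>gmod_iso A N K==>gmod_iso A M K"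
proof -
 assume "gmod_iso A M N" "gmod_iso A N K"
 then obtain phi psi where phi:"bij_betw phi (mcarrier M) (mcarrier N)"
  "ALL x:mcarrier M. ALL y:mcarrier M. phi (x + y) = phi x + phi y"
  "ALL a:acarrier A. ALL x:mcarrier M. phi (mact M a x) = mact N a (phi x)" "ALL i. phi ` mgrade M i <= mgrade N i"
  and psi:"bij_betw psi (mcarrier N) (mcarrier K)"
  "ALL x:mcarrier N. ALL y:mcarrier N. psi (x + y) = psi x + psi y"
  "ALL a:acarrier A. ALL x:mcarrier N. psi (mact N a x) = mact K a (psi x)" "ALL i. psi ` mgrade N i <= mgrade K i"
  unfolding gmod_iso_def by(elim exE conjE)
 have m:"phi x:mcarrier N" if "x:mcarrier M" for x using phi(1) that by(auto simp:bij_betw_def)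
 show ?thesis
  unfolding gmod_iso_def
  by(rule exI[of _ "psi o phi"],intro conjI bij_betw_trans[OF phi(1) psi(1)]) (use phi(2-4) psi(2-4) m in "simp_all,blast")
qed

lemma gmod_iso_dsum:
 assumes "gmod_iso A M M'" "gmod_iso A N N'"
 shows "gmod_iso A (dsum M N) (dsum M' N')"
proof -
 obtain phi where phi:"bij_betw phi (mcarrier M) (mcarrier M')"
  "ALL x:mcarrier M. ALL y:mcarrier M. phi (x + y) = phi x + phi y"
  "ALL a:acarrier A. ALL x:mcarrier M. phi (mact M a x) = mact M' a (phi x)" "ALL i. phi ` mgrade M i <= mgrade M' i"
  using assms(1) unfolding gmod_iso_def by(elim exE conjE)
 obtain psi where psi:"bij_betw psi (mcarrier N) (mcarrier N')"
  "ALL x:mcarrier N. ALL y:mcarrier N. psi (x + y) = psi x + psi y"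
  "ALL a:acarrier A. ALL x:mcarrier N. psi (mact N a x) = mact N' a (psi x)" "ALL i. psi ` mgrade N i <= mgrade N' i"
  using assms(2) unfolding gmod_iso_def by(elim exE conjE)
 have "bij_betw (map_prod phi psi) (mcarrier M \<times> mcarrier N) (mcarrier M' \<times> mcarrier N')"
  using phi(1) psi(1) by(simp add:bij_betw_def map_prod_inj_on map_prod_surj_on)
 moreover have "phi x:mgrade M' i" if "x:mgrade M i" for x i using phi(4) that by blast
 moreover have "psi x:mgrade N' i" if "x:mgrade N i" for x i using psi(4) that by blast
 ultimately show ?thesis
  unfolding gmod_iso_def by(intro exI[of _ "map_prod phi psi"] conjI) (use phi(2,3) psi(2,3) in "auto simp:dsum_def")
qed

lemma (in hmod) line_iso:
 assumes x:"x:mG 0" "x ~= 0" "soc x" and K:"gsub (range (%c. sc c x))"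
 shows "hmod_iso s H (triv H) (msub M (range (%c. sc c x))) (%c. sc c x)"
proof (intro hmod_iso.intro hmod_triv hmod_msub[OF K] hmod_iso_axioms.intro)
 show "bij_betw (%c. sc c x) (mcarrier (triv H)) (mcarrier (msub M (range (%c. sc c x))))"
  using x(2) by(auto simp:bij_betw_def inj_on_def triv_def)
 show "sc (mact (triv H) a c) x = mact (msub M (range (%c. sc c x))) a (sc c x)" if "a:hc" for a c
  using soc_act[OF x(3) that] x(3) that by(simp add:triv_def soc_def act_scale mult.commute)
 show "sc c x:mgrade (msub M (range (%c. sc c x))) i" if "c:mgrade (triv H) i" for i c
  using that x(1) m.subspace_scale[OF m.subG] by(cases "i = 0") (auto simp:triv_def image_iff intro: exI[of _ 0])
qed (simp add:m.scale_left_distrib)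

lemma (in hmod) KF_dsum:
 assumes KF
 obtains F :: "('k,'h) umodule" where "hmod s H F" "gfree (alg H) F" "gmod_iso (alg H) M (dsum (triv H) F)"
proof -
 obtain X x where X:"free_basis X" and x:"x:mG 0" "x ~= 0" "soc x" and xX:"x ~: hspan X"
  and dec:"ALL m:mV. EX p:hspan X. EX c. m = p + sc c x"
  using assms unfolding KF_def by(elim exE conjE)
 note gP = free_gsub[OF X]
 define K where "K = range (%c. sc c x)"
 have xV:"x:mV" using x(3) by(simp add:soc_def)
 have gK:"gsub K"
  unfolding gsub_def
 proof (intro conjI ballI)
  show "m.graded_sub K"
  proof (rule m.graded_subI)
  have "K = m.span {x}" unfolding K_def by(rule m.span_singleton[symmetric])
  then show "m.subspace K" by simp
  show "w:mV" if "w:K" for w using that xV by(auto simp:K_def)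
  show "hcomp mG w i:K" if "w:K" for w i
  proof -
  obtain c where c:"w = sc c x" using \<open>w:K\<close> by(auto simp:K_def)
  have "hcomp mG w i = sc (if i = 0 then c else 0) x"
  unfolding c using x(1) xV by(simp add:m.hcomp_scale m.hcomp_homog)
  then show ?thesis unfolding K_def by(rule image_eqI) simp
  qed
  qed
  fix a k assume a:"a:hc" "k:K"
  then obtain c where "k = sc c x" by(auto simp:K_def)
  then have "act a k = sc (c * eps a) x" using a soc_act[OF x(3) a(1)] xV by(simp add:act_scale)
  then show "act a k:K" unfolding K_def by(rule range_eqI)
 qed
 have dir:"idirect (hspan X) K"
  unfolding idirect_def
 proof (intro conjI ballI gP gK)
  show "hspan X Int K = {0}"
  proof (intro equalityI subsetI)
  fix v assume v:"v:hspan X Int K"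
  then obtain c where c:"v = sc c x" by(auto simp:K_def)
  have "c = 0"
  proof (rule ccontr)
  assume "c ~= 0"
  then have "x = sc (1 / c) v" using c by simp
  then show False using xX v m.subspace_scale[OF gsubD(1)[OF gP]] by auto
  qed
  then show "v:{0}" using c by simp
  qed (use m.subspace_0[OF gsubD(1)[OF gP]] m.subspace_0[OF gsubD(1)[OF gK]] in auto)
  show "EX p:hspan X. EX k:K. v = p + k" if "v:mV" for v using dec that unfolding K_def by blast
 qed
 obtain th where th:"hmod_iso s H M (dsum (msub M K) (msub M (hspan X))) th" using idirect_dsum[OF dir] .
 interpret P: hmod s H "msub M (hspan X)" by(rule hmod_msub[OF gP])
 obtain F :: "('k,'h) umodule" and psi where F:"hmod_iso s H (msub M (hspan X)) F psi" using P.model_exists .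
 interpret F: hmod_iso s H "msub M (hspan X)" F psi by fact
 interpret T: hmod_iso s H "triv H" "msub M K" "%c. sc c x"
  unfolding K_def by(rule line_iso[OF x]) (use gK K_def in simp)
 have "gmod_iso (alg H) M (dsum (triv H) F)"
  by(rule gmod_iso_trans[OF hmod_iso.gmod_iso[OF th] gmod_iso_dsum[OF hmod_iso.gmod_iso[OF T.inverse] F.gmod_iso]])
 then show thesis using that F.N.hmod_axioms F.gfree[OF gfree_hspan[OF X]] by blast
qed

subsection \<open>\<open>M \<otimes> N\<^sup>*\<close> and linear maps\<close>

context hpair
begin

abbreviation "NK == ghom s H N (triv H)"
abbreviation "Dual == mdual s H N"
abbreviation "DV == mcarrier Dual"

lemma dual_hmod:"hmod s H NK"
proof -
 interpret T: hpair s H "triv H" N using M.hmod_triv N.hmod_axioms by(simp add:hpair_def)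
 show ?thesis by(rule T.hmod_ghom)
qed

lemma dual_eq:"mcarrier NK = DV" "mscale NK = fscale" "mgrade NK = dual_grade N" "mgrade Dual = dual_grade N" "mscale Dual = fscale"
proof -
 show car:"mcarrier NK = DV" by(auto simp:ghom_def mdual_def homcarrier_def triv_def)
 show "mscale NK = fscale" by(simp add:ghom_def triv_def fscale_def fun_eq_iff)
 show "mgrade NK = dual_grade N"
  by(auto simp:ghom_def dual_grade_def homgrade_def homcarrier_def triv_def fun_eq_iff split: if_splits) (smt (verit))+
qed (simp_all add:mdual_def)

sublocale D: hmod s H NK by(rule dual_hmod)

lemma DV_D:"f:DV==>linear_on N.sc (*) N.mV f"
 by(simp add:mdual_def)

lemma DV_simps:"mcarrier NK = DV" "D.sc = fscale" "D.mG = dual_grade N"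
 using dual_eq by auto

lemma twist_twist:"b:M.hc==>twist s H l (twist s H j b) = twist s H (j + l) b"
proof (induction rule: M.h.homog_induct)
 case zero
 have "twist s H k 0 = 0" for k using M.h.linear_on_0[OF M.linear_twist M.h.subV] .
 then show ?case by simp
next
 case (add x y)
 then show ?case by(simp add:linear_on_add[OF M.linear_twist])
next
 case (homog i x)
 note xc = M.hg_hc[OF homog]
 show ?case
  using homog xc by(simp add:M.twist_homog M.xsign_add linear_on_scale[OF M.linear_twist] mult.commute)
qed

text \<open>On the trivial module the first factors act by the counit, and the counit identity
  reduces the sum to one term.\<close>

lemma NK_act_homog:
 assumes f:"f:dual_grade N l" and b:"b:M.hc" and v:"v:N.mV"
 shows "mact NK b f v = f (N.act (M.S (twist s H l b)) v)"
proof -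
 interpret T: hpair s H "triv H" N using M.hmod_triv N.hmod_axioms by(simp add:hpair_def)
 have f':"f:T.LG l" using f dual_eq(3) by simp
 obtain xs where xs:"set xs <= M.hc \<times> M.hc" "coprod H b = (SUM (a,b)<-xs. M.T a b)" using M.coprod_list[OF b] .
 have lin:"linear_on M.hs (*) M.hc (%b. f (N.act (M.S (twist s H l b)) v))"
  using v by(intro linear_onI)
  (simp_all add:linear_on_add[OF M.linear_twist] linear_on_scale[OF M.linear_twist] linear_on_add[OF M.S_linear]
  linear_on_scale[OF M.S_linear] N.act_add_left N.act_scale_left T.LVD[OF T.LG_LV[OF f']] triv_def)
 have x:"a:M.hc & b:M.hc" if "(a,b):set xs" for a b using xs(1) that by auto
 have "mact NK b f v = (SUM (a,b)<-xs. M.eps a * f (N.act (M.S (twist s H l b)) v))"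
  unfolding T.Lact_homog[OF f' b] T.homact_list[OF T.LG_LV[OF f'] v xs] by(simp add:triv_def)
 also have "... = (SUM (a,b)<-xs. f (N.act (M.S (twist s H l (M.hs (M.eps a) b))) v))"
  by(intro arg_cong[of _ _ sum_list] map_cong refl) (use x linear_on_scale[OF lin] in auto)
 also have "... = f (N.act (M.S (twist s H l (SUM (a,b)<-xs. M.hs (M.eps a) b))) v)"
  unfolding case_prod_unfold by(rule M.h.linear_on_sum_list[OF lin M.h.subV,symmetric]) (use x in force)
 also have "(SUM (a,b)<-xs. M.hs (M.eps a) b) = b"
  using M.sweedler_list[OF M.h.vector_space_axioms M.bilinear_counit(2) xs] M.counit_left[OF b] by simp
 finally show ?thesis .
qed

text \<open>This identifies the action on the dual with the one on \<open>Hom(N, k)\<close>, where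
  the module laws are already available.\<close>

lemma Dual_act:
 assumes b:"b:M.hc" and f:"f:DV"
 shows "mact Dual b f = mact NK b f"
proof
 fix v
 have f':"f:D.mV" using f DV_simps by simp
 show "mact Dual b f v = mact NK b f v"
 proof (cases "v:N.mV")
  case False
  have "mact NK b f:DV" using D.act_closed[OF b f'] dual_eq by simp
  then show ?thesis using False by(simp add:mdual_def)
 next
  case True
  have inner:"hext (dual_grade N) (%j f. xsign s i j * f (N.act (M.S b) v)) f = mact NK b f v" if b:"b:M.hg i" for i b
  proof -
  have "hext (dual_grade N) (%j f. xsign s i j * f (N.act (M.S b) v)) f
  = hext (dual_grade N) (%j f. mact NK b f v) f"
  proof (rule D.m.hext_cong[OF f',unfolded DV_simps])
  fix j g assume g:"g:dual_grade N j"
  have "linear_on N.sc (*) N.mV g" using g by(simp add:dual_grade_def)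
  then show "xsign s i j * g (N.act (M.S b) v) = mact NK b g v"
  unfolding NK_act_homog[OF g M.hg_hc[OF b] True] M.twist_homog[OF b]
  using M.hg_hc[OF b] True by(simp add:linear_on_scale[OF M.S_linear] N.act_scale_left linear_on_scale)
  qed
  also have "... = (SUM j | hcomp (dual_grade N) f j ~= 0. mact NK b (hcomp (dual_grade N) f j) v)"
  by(simp add:hext_def)
  also have "... = (SUM j | hcomp (dual_grade N) f j ~= 0. mact NK b (hcomp (dual_grade N) f j)) v"
  by(simp add:sum_apply)
  also have "(SUM j | hcomp (dual_grade N) f j ~= 0. mact NK b (hcomp (dual_grade N) f j)) = mact NK b (SUM j | hcomp (dual_grade N) f j ~= 0. hcomp (dual_grade N) f j)"
  by(rule D.act_sum[OF M.hg_hc[OF b],symmetric]) (use D.m.hcomp_V[OF f',unfolded DV_simps] DV_simps(1) in simp)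
  also have "(SUM j | hcomp (dual_grade N) f j ~= 0. hcomp (dual_grade N) f j) = f"
  using D.m.hcomp_sum'[OF f',unfolded DV_simps] by(rule sym)
  finally show ?thesis .
  qed
  have "mact Dual b f v = hext M.hg (%i b. hext (dual_grade N) (%j f. xsign s i j * f (N.act (M.S b) v)) f) b"
  using True by(simp add:mdual_def)
  also have "... = hext M.hg (%i b. mact NK b f v) b" by(rule M.h.hext_cong[OF b]) (rule inner)
  also have "... = (SUM i | hcomp M.hg b i ~= 0. mact NK (hcomp M.hg b i) f) v" by(simp add:hext_def sum_apply)
  also have "(SUM i | hcomp M.hg b i ~= 0. mact NK (hcomp M.hg b i) f) = mact NK (SUM i | hcomp M.hg b i ~= 0. hcomp M.hg b i) f"
  by(rule D.act_sum_left[OF f',symmetric]) (rule M.h.hcomp_V[OF b])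
  also have "(SUM i | hcomp M.hg b i ~= 0. hcomp M.hg b i) = b" using M.h.hcomp_sum'[OF b] by(rule sym)
  finally show ?thesis .
 qed
qed

abbreviation "Ten == mtensor s H M Dual"
abbreviation "pure == tens M.sc (fscale :: 'k => ('w => 'k) => _)"

text \<open>One coproduct term \<open>a \<otimes> b\<close> acting on \<open>m \<otimes> mu\<close>.
  Splitting \<open>m\<close> over the finite set \<open>Mdeg\<close> supplies the degree for the
  sign and keeps the formula bilinear.\<close>

definition tact :: "'h => 'h => 'v => ('w => 'k) => ('k,'v,'w => 'k) tensor" where
 "tact a b m mu = (SUM j:Mdeg. pure (M.act a (hcomp M.mG m j)) (mact NK (twist s H j b) mu))"

lemma D_act_lin:"b:M.hc==>mu:DV==>mu':DV==>mact NK b (mu + mu') = mact NK b mu + mact NK b mu'"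
 "b:M.hc==>mu:DV==>mact NK b (fscale c mu) = fscale c (mact NK b mu)"
 "b:M.hc==>b':M.hc==>mu:DV==>mact NK (b + b') mu = mact NK b mu + mact NK b' mu"
 "b:M.hc==>mu:DV==>mact NK (M.hs c b) mu = fscale c (mact NK b mu)"
 "b:M.hc==>mu:DV==>mact NK b mu:DV"
 using D.act_add D.act_scale D.act_add_left D.act_scale_left D.act_closed unfolding DV_simps by blast+

lemma fsc:"fscale c (SUM i:I. f i) = (SUM i:I. fscale c (f i))"
 by(rule ext) (simp add:fscale_def sum_apply sum_distrib_left)

lemma tact_lin:
 shows "a:M.hc==>b:M.hc==>bilinear_on M.sc fscale fscale M.mV DV (tact a b)"
  and "m:M.mV==>mu:DV==>bilinear_on M.hs M.hs fscale M.hc M.hc (%a b. tact a b m mu)"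
 unfolding tact_def
 by(auto intro!:bilinear_onI simp:M.m.hcomp_add M.m.hcomp_scale M.m.hcomp_V M.act_add M.act_scale D_act_lin
  tens_add_left tens_add_right tens_scale_left tens_scale_right sum.distrib fsc M.act_add_left M.act_scale_left
  linear_on_add[OF M.linear_twist] linear_on_scale[OF M.linear_twist])

lemma tact_homog:"m:M.mG j==>tact a b m mu = pure (M.act a m) (mact NK (twist s H j b) mu)" if "a:M.hc" "b:M.hc" "mu:DV"
proof -
 assume m:"m:M.mG j"
 have z:"pure (0::'v) nu = 0" for nu :: "'w => 'k" using tens_add_left[of M.sc fscale 0 0 nu] by simp
 have "tact a b m mu = (SUM k:Mdeg. if k = j then pure (M.act a m) (mact NK (twist s H j b) mu) else 0)"
  unfolding tact_def by(intro sum.cong refl) (use m that z in "simp add:M.m.hcomp_homog")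
 also have "... = pure (M.act a m) (mact NK (twist s H j b) mu)"
  using finite_deg(2) m z that by(cases "j:Mdeg") (auto simp:Mdeg_def)
 finally show ?thesis .
qed

text \<open>The action on the tensor product nests \<open>sweedler\<close>, \<open>tlift\<close> and
  two \<open>hext\<close>. Once the innermost term is recognized as the bilinear
  \<open>tact\<close>, both lifts can be evaluated on lists.\<close>

lemma tensor_act:
 assumes h:"h:M.hc" and ys:"set ys <= M.hc \<times> M.hc" "coprod H h = (SUM (a,b)<-ys. M.T a b)" and xs:"set xs <= M.mV \<times> DV"
 shows "mact Ten h (SUM (m,mu)<-xs. pure m mu) = (SUM (m,mu)<-xs. SUM (a,b)<-ys. tact a b m mu)"
proof -
 let ?t = "SUM (m,mu)<-xs. pure m mu"
 interpret fs: vector_space "fscale :: 'k => ('w => 'k) => _" by(rule vector_space_fscale)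
 have vs:"vector_space (fscale :: 'k => ('k,'v,'w => 'k) tensor => _)" by(rule vector_space_fscale)
 have F:"hext M.hg (%i b. hext M.mG (%j v. fscale (xsign s i j) (pure (M.act a v) (mact Dual b w))) v) b = tact a b v w"
  if ab:"a:M.hc" "b:M.hc" and v:"v:M.mV" and w:"w:DV" for a b v w
 proof -
  have z:"pure (0::'v) nu = 0" for nu :: "'w => 'k" using tens_add_left[of M.sc fscale 0 0 nu] by simp
  have z':"pure v 0 = 0" for v :: 'v using tens_add_right[of M.sc fscale v 0 0] by simp
  have "hext M.hg (%i b. hext M.mG (%j v. fscale (xsign s i j) (pure (M.act a v) (mact Dual b w))) v) b
  = hext M.hg (%i b. SUM j:Mdeg. pure (M.act a (hcomp M.mG v j)) (mact NK (M.hs (xsign s i j) b) w)) b"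
  proof (rule M.h.hext_cong[OF ab(2)])
  fix i x assume x:"x:M.hg i"
  have "hext M.mG (%j v. fscale (xsign s i j) (pure (M.act a v) (mact Dual x w))) v
  = (SUM j:Mdeg. fscale (xsign s i j) (pure (M.act a (hcomp M.mG v j)) (mact Dual x w)))"
  by(rule M.m.hext_sum[OF finite_deg(2)]) (use M.m.hcomp_G[OF v] ab z in "auto simp:Mdeg_def")
  also have "... = (SUM j:Mdeg. pure (M.act a (hcomp M.mG v j)) (mact NK (M.hs (xsign s i j) x) w))"
  by(simp add:Dual_act[OF M.hg_hc[OF x] w] D_act_lin(4)[OF M.hg_hc[OF x] w] tens_scale_right)
  finally show "hext M.mG (%j v. fscale (xsign s i j) (pure (M.act a v) (mact Dual x w))) v
  = (SUM j:Mdeg. pure (M.act a (hcomp M.mG v j)) (mact NK (M.hs (xsign s i j) x) w))" .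
  qed
  also have "... = (SUM i:M.degs. SUM j:Mdeg. pure (M.act a (hcomp M.mG v j)) (mact NK (M.hs (xsign s i j) (hcomp M.hg b i)) w))"
  by(rule M.h.hext_sum[OF M.finite_degs]) (use M.hcomp_degs[OF ab(2)] D.act_0_left[unfolded DV_simps,OF w] z' in auto)
  also have "... = (SUM j:Mdeg. SUM i:M.degs. pure (M.act a (hcomp M.mG v j)) (mact NK (M.hs (xsign s i j) (hcomp M.hg b i)) w))"
  by(rule sum.swap)
  also have "... = tact a b v w"
  unfolding tact_def
  proof (rule sum.cong[OF refl])
  fix j
  let ?p = "pure (M.act a (hcomp M.mG v j))"
  have tw:"twist s H j b = (SUM i:M.degs. M.hs (xsign s i j) (hcomp M.hg b i))"
  unfolding twist_def by(rule M.h.hext_sum[OF M.finite_degs]) (use M.hcomp_degs[OF ab(2)] in auto)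
  have "linear_on fscale fscale UNIV ?p" by(rule linear_onI) (simp_all add:tens_add_right tens_scale_right)
  then have "?p (SUM i:M.degs. mact NK (M.hs (xsign s i j) (hcomp M.hg b i)) w) = (SUM i:M.degs. ?p (mact NK (M.hs (xsign s i j) (hcomp M.hg b i)) w))"
  by(rule fs.linear_on_sum) auto
  moreover have "mact NK (twist s H j b) w = (SUM i:M.degs. mact NK (M.hs (xsign s i j) (hcomp M.hg b i)) w)"
  unfolding tw by(rule D.act_sum_left) (use w DV_simps M.h.hcomp_V[OF ab(2)] in auto)
  ultimately show "(SUM i:M.degs. ?p (mact NK (M.hs (xsign s i j) (hcomp M.hg b i)) w)) = ?p (mact NK (twist s H j b) w)" by simp
  qed
  finally show ?thesis .
 qed
 have subD:"fs.subspace DV" using D.m.subV unfolding DV_simps .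
 have tl:"tlift M.sc fscale M.mV DV (%v w. hext M.hg (%i b. hext M.mG (%j v. fscale (xsign s i j) (pure (M.act a v) (mact Dual b w))) v) b) ?t
  = (SUM (m,mu)<-xs. tact a b m mu)" if ab:"a:M.hc" "b:M.hc" for a b
 proof -
  have "tlift M.sc fscale M.mV DV (%v w. hext M.hg (%i b. hext M.mG (%j v. fscale (xsign s i j) (pure (M.act a v) (mact Dual b w))) v) b) ?t
  = tlift M.sc fscale M.mV DV (tact a b) ?t" by(rule tlift_cong) (rule F[OF ab])
  also have "... = (SUM (m,mu)<-xs. tact a b m mu)"
  by(rule tlift_eval[OF M.m.vector_space_axioms vector_space_fscale vs M.m.subV subD tact_lin(1)[OF ab] xs])
  finally show ?thesis .
 qed
 have bil:"bilinear_on M.hs M.hs fscale M.hc M.hc (%a b. SUM (m,mu)<-xs. tact a b m mu)"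
  using xs
 proof (induction xs)
  case Nil
  then show ?case by(intro bilinear_onI) (simp_all add:fscale_def zero_fun_def)
 next
  case (Cons x xs)
  obtain m mu where x:"x = (m,mu)" by(cases x)
  have 1:"bilinear_on M.hs M.hs fscale M.hc M.hc (%a b. tact a b m mu)" by(rule tact_lin(2)) (use Cons.prems x in auto)
  have 2:"bilinear_on M.hs M.hs fscale M.hc M.hc (%a b. SUM (m,mu)<-xs. tact a b m mu)" using Cons by simp
  show ?case unfolding x list.map prod.case sum_list.Cons
  by(rule bilinear_onI) (simp_all only: bilinear_onD[OF 1] bilinear_onD[OF 2] vector_space.vector_space_assms(1)[OF vs] add_ac)
 qed
 have "mact Ten h ?t = sweedler H (%a b. SUM (m,mu)<-xs. tact a b m mu) h"
  unfolding mtensor_def dual_eq(5) gmodule.simps by(rule M.sweedler_cong) (rule tl)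
 also have "... = (SUM (a,b)<-ys. SUM (m,mu)<-xs. tact a b m mu)" by(rule M.sweedler_list[OF vs bil ys])
 also have "... = (SUM (m,mu)<-xs. SUM (a,b)<-ys. tact a b m mu)"
  unfolding case_prod_unfold by(rule sum_list_swap)
 finally show ?thesis .
qed

text \<open>The canonical map from the tensor product of \<open>M\<close> with the dual of
  \<open>N\<close> to the linear maps.\<close>

definition Phi :: "('k,'v,'w => 'k) tensor => 'w => 'v" where
 "Phi = tlift M.sc fscale M.mV DV (%m mu. E mu m)"

lemma Phi_sum:
 assumes "set xs <= M.mV \<times> DV"
 shows "Phi (SUM (m,mu)<-xs. pure m mu) = (SUM (m,mu)<-xs. E mu m)"
proof -
 have "bilinear_on M.sc fscale Lsc M.mV DV (%m mu. E mu m)"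
  by(rule bilinear_onI; rule ext)
  (auto simp:E_def fscale_def M.m.scale_right_distrib M.m.scale_left_distrib mult.commute)
 note bil = this
 have "Modules.module.subspace fscale DV" using D.m.subV unfolding DV_simps .
 from tlift_eval[OF M.m.vector_space_axioms vector_space_fscale L_vs M.m.subV this bil assms]
 show ?thesis unfolding Phi_def .
qed

lemma Ten_rep:"t:mcarrier Ten \<longleftrightarrow> (EX xs. set xs <= M.mV \<times> DV & t = (SUM (m,mu)<-xs. pure m mu))"
proof
 assume "t:mcarrier Ten"
 then have "t:tprod M.sc fscale M.mV DV" by(simp add:mtensor_def dual_eq)
 then show "EX xs. set xs <= M.mV \<times> DV & t = (SUM (m,mu)<-xs. pure m mu)"
  by(rule tprod_rep[OF M.m.vector_space_axioms M.m.subV])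
next
 interpret T: vector_space "fscale :: 'k => ('k,'v,'w => 'k) tensor => _" by(rule vector_space_fscale)
 assume "EX xs. set xs <= M.mV \<times> DV & t = (SUM (m,mu)<-xs. pure m mu)"
 then obtain xs where xs:"set xs <= M.mV \<times> DV" "t = (SUM (m,mu)<-xs. pure m mu)" by blast
 have "t:tprod M.sc fscale M.mV DV"
  unfolding xs(2) case_prod_unfold
  by(rule T.subspace_sum_list[OF subspace_tprod]) (use xs(1) in "auto intro!:tens_in_tprod")
 then show "t:mcarrier Ten" by(simp add:mtensor_def dual_eq)
qed

lemma Phi_add:
 assumes "t:mcarrier Ten" "u:mcarrier Ten"
 shows "t + u:mcarrier Ten" "Phi (t + u) = Phi t + Phi u"
proof -
 obtain xs where xs:"set xs <= M.mV \<times> DV" "t = (SUM (m,mu)<-xs. pure m mu)" using assms(1) Ten_rep by blast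
 obtain ys where ys:"set ys <= M.mV \<times> DV" "u = (SUM (m,mu)<-ys. pure m mu)" using assms(2) Ten_rep by blast
 have 1:"set (xs @ ys) <= M.mV \<times> DV" using xs ys by simp
 have 2:"t + u = (SUM (m,mu)<-xs @ ys. pure m mu)" unfolding map_append sum_list_append xs(2) ys(2) ..
 show "t + u:mcarrier Ten" using 1 2 Ten_rep by blast
 show "Phi (t + u) = Phi t + Phi u"
  unfolding 2 Phi_sum[OF 1] unfolding xs(2) ys(2) Phi_sum[OF xs(1)] Phi_sum[OF ys(1)] map_append sum_list_append ..
qed

lemma Phi_0:"0:mcarrier Ten" "Phi 0 = 0"
proof -
 show "0:mcarrier Ten" unfolding Ten_rep by(rule exI[of _ "[]"]) simp
 show "Phi 0 = 0" using Phi_sum[of "[]"] by(simp add:zero_fun_def)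
qed

text \<open>For \<open>m\<close> of degree \<open>j\<close> and \<open>nu\<close> of degree
  \<open>l\<close>, the tensor action twists \<open>b\<close> by \<open>j\<close> and the dual
  action by \<open>l\<close>; acting on \<open>E nu m\<close>, which has degree
  \<open>j + l\<close>, twists it by \<open>j + l\<close> at once.\<close>

lemma Phi_act_pure:
 assumes h:"h:M.hc" and ys:"set ys <= M.hc \<times> M.hc" "coprod H h = (SUM (a,b)<-ys. M.T a b)"
  and nu:"nu:dual_grade N l" and m:"m:M.mV"
 shows "(SUM (a,b)<-ys. tact a b m nu):mcarrier Ten & Phi (SUM (a,b)<-ys. tact a b m nu) = Lact h (E nu m)"
 using m
proof (induction rule: M.m.homog_induct)
 have nuD:"nu:DV" using D.m.G_V[of nu l] nu unfolding DV_simps by blast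
 have y:"a:M.hc & b:M.hc" if "(a,b):set ys" for a b using ys(1) that by auto
 have EL:"E nu m:LV" if "m:M.mV" for m by(rule E_LV[OF DV_D[OF nuD] that])
 {
  case (add m m')
  have "(SUM (a,b)<-ys. tact a b (m + m') nu) = (SUM (a,b)<-ys. tact a b m nu + tact a b m' nu)"
  by(intro arg_cong[of _ _ sum_list] map_cong refl)
  (use y bilinear_onD(1)[OF tact_lin(1) add.hyps(1) nuD add.hyps(2)] in auto)
  also have "... = (SUM (a,b)<-ys. tact a b m nu) + (SUM (a,b)<-ys. tact a b m' nu)"
  by(simp only: case_prod_unfold sum_list_addf)
  finally have e:"(SUM (a,b)<-ys. tact a b (m + m') nu) = (SUM (a,b)<-ys. tact a b m nu) + (SUM (a,b)<-ys. tact a b m' nu)" .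
  show ?case
  unfolding e E_add_right linear_on_add[OF Lact_linear[OF h] EL[OF add.hyps(1)] EL[OF add.hyps(2)]]
  using Phi_add[OF add.IH(1)[THEN conjunct1] add.IH(2)[THEN conjunct1]] add.IH by(simp only: conj_assoc simp_thms)
 next
  case (homog j m)
  note mV = M.mG_mV[OF homog]
  let ?xs = "map (%(a,b). (M.act a m,mact NK (twist s H j b) nu)) ys"
  have xs:"set ?xs <= M.mV \<times> DV" using y mV nuD by(auto simp:D_act_lin)
  have e:"(SUM (a,b)<-ys. tact a b m nu) = (SUM (m,mu)<-?xs. pure m mu)"
  unfolding map_map by(intro arg_cong[of _ _ sum_list] map_cong refl) (use y tact_homog[OF _ _ nuD homog] in auto)
  \<comment> \<open>A functional of degree \<open>l\<close> lives on degree \<open>- l\<close> of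
    \<open>N\<close>, hence the double minus.\<close>
  have EG:"E nu m:LG (j - - l)"
  by(rule E_LG[OF DV_D[OF nuD] _ homog]) (use nu in "auto simp:dual_grade_def")
  have "(SUM (m,mu)<-?xs. E mu m) = Lact h (E nu m)"
  proof
  fix v
  show "(SUM (m,mu)<-?xs. E mu m) v = Lact h (E nu m) v"
  proof (cases "v:N.mV")
  case True
  show ?thesis
  unfolding Lact_homog[OF EG h] homact_list[OF EL[OF mV] True ys] map_map sum_list_apply
  by(intro arg_cong[of _ _ sum_list] map_cong refl)
  (use y True mV in "auto simp:E_def NK_act_homog[OF nu] twist_twist M.act_scale")
  next
  case False
  have "(SUM (m,mu)<-zs. E mu m) v = 0" for zs using False by(induction zs) (auto simp:E_def)
  then show ?thesis using LVD(3)[OF Lact_LV[OF EL[OF mV] h] False] by(simp only:)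
  qed
  qed
  then show ?case using Phi_sum[OF xs] e xs Ten_rep by metis
 next
  case zero
  interpret T: vector_space "fscale :: 'k => ('k,'v,'w => 'k) tensor => _" by(rule vector_space_fscale)
  have z:"tact a b 0 nu = 0" if "a:M.hc" "b:M.hc" for a b
  using bilinear_onD(1)[OF tact_lin(1)[OF that] M.mV_0 nuD M.mV_0] by(simp only: add_0_left add_cancel_right_right)
  have "(SUM (a,b)<-ys. tact a b 0 nu):{0}"
  by(rule T.subspace_sum_list[OF T.subspace_single_0]) (use y z in auto)
  then have "(SUM (a,b)<-ys. tact a b 0 nu) = 0" by(rule singletonD)
  moreover have "E nu 0 = 0" by(rule ext) (simp add:E_def)
  moreover have "Lact h 0 = 0" by(rule Lv.linear_on_0[OF Lact_linear[OF h] LV_sub])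
  ultimately show ?case using Phi_0 by(simp only: simp_thms)
 }
qed

text \<open>The inverse \<open>Psi\<close> is built from a homogeneous dual basis. Compatibility
  with the action is checked on the list given by \<open>Psi (Phi t)\<close>, whose functionals are
  homogeneous; an arbitrary list for \<open>t\<close> need not have that property.\<close>

theorem tensor_hom_iso:"gmod_iso (alg H) Ten L" "gmod_iso (alg H) L Ten"
proof -
 obtain B d mu where B:"finite B" "!!b. b:B==>b:N.mG (d b)"
  and mu:"!!b. b:B==>linear_on N.sc (*) N.mV (mu b)"
  "!!b i y. b:B==>y:N.mG i==>i ~= d b==>mu b y = 0"
  "!!b c. b:B==>c:B==>mu b c = (if b = c then 1 else 0)"
  "!!v. v:N.mV==>v = (SUM b:B. N.sc (mu b v) b)"
  using N.m.homog_dual_basis by blast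
 interpret T: vector_space "fscale :: 'k => ('k,'v,'w => 'k) tensor => _" by(rule vector_space_fscale)
 interpret fs: vector_space "fscale :: 'k => ('w => 'k) => _" by(rule vector_space_fscale)
 have BV:"b:N.mV" if "b:B" for b using B(2)[OF that] N.mG_mV by blast
 obtain bs where bs:"set bs = B" "distinct bs" using finite_distinct_list[OF B(1)] by blast
 define nu where "nu b v = (if v:N.mV then mu b v else 0)" for b v
 have nuG:"nu b:dual_grade N (- d b)" if b:"b:B" for b
  using mu(1,2)[OF b] N.mG_mV by(auto simp:dual_grade_def nu_def linear_on_def)
 have nuD:"nu b:DV" if "b:B" for b using nuG[OF that] by(simp add:dual_grade_def mdual_def)
 define Psi where "Psi f = (SUM b:B. pure (f b) (nu b))" for f
 let ?l = "%f. map (%b. (f b,nu b)) bs"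
 have PsiL:"Psi f = (SUM (m,mu)<-?l f. pure m mu)" for f
  unfolding Psi_def bs(1)[symmetric] map_map by(simp add:sum_list_distinct_conv_sum_set[OF bs(2)] o_def)
 have ls:"set (?l f) <= M.mV \<times> DV" if "f:LV" for f using LVD(2)[OF that] BV nuD bs(1) by auto
 have PsiT:"Psi f:mcarrier Ten" if "f:LV" for f unfolding Ten_rep using ls[OF that] PsiL by blast
 have PP:"Phi (Psi f) = f" if f:"f:LV" for f
 proof
  fix v
  have "Phi (Psi f) = (SUM b:B. E (nu b) (f b))"
  unfolding PsiL Phi_sum[OF ls[OF f]] unfolding bs(1)[symmetric] map_map
  by(simp add:sum_list_distinct_conv_sum_set[OF bs(2)] o_def)
  then have e:"Phi (Psi f) v = (SUM b:B. E (nu b) (f b) v)" by(simp add:sum_apply)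
  show "Phi (Psi f) v = f v"
  proof (cases "v:N.mV")
  case True
  have "f v = f (SUM b:B. N.sc (mu b v) b)" using mu(4)[OF True] by(rule arg_cong)
  also have "... = (SUM b:B. f (N.sc (mu b v) b))"
  by(rule N.m.linear_on_sum[OF LVD(1)[OF f] N.m.subV]) (use BV in auto)
  also have "... = (SUM b:B. E (nu b) (f b) v)"
  by(intro sum.cong refl) (use BV LVD(5)[OF f] True in "simp add:E_def nu_def")
  finally show ?thesis using e by simp
  next
  case False
  then show ?thesis using e LVD(3)[OF f False] by(simp add:E_def)
  qed
 qed
 have Psi_add:"Psi (f + g) = Psi f + Psi g" for f g :: "'w => 'v"
  unfolding Psi_def plus_fun_apply tens_add_left sum.distrib ..
 have Psi_0:"Psi 0 = 0"
 proof -
  have "Psi 0 = Psi 0 + Psi 0" using Psi_add[of 0 0] by(simp only: add_0_left)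
  then show ?thesis by(simp only: add_cancel_right_right)
 qed
 have Psi_E:"Psi (E eta m) = pure m eta" if m:"m:M.mV" and eta:"eta:DV" for m eta
 proof -
  have "eta = (SUM b:B. fscale (eta b) (nu b))"
  proof
  fix v
  show "eta v = (SUM b:B. fscale (eta b) (nu b)) v"
  proof (cases "v:N.mV")
  case True
  have "eta v = eta (SUM b:B. N.sc (mu b v) b)" using mu(4)[OF True] by(rule arg_cong)
  also have "... = (SUM b:B. eta (N.sc (mu b v) b))"
  by(rule N.m.linear_on_sum[OF DV_D[OF eta] N.m.subV]) (use BV in auto)
  also have "... = (SUM b:B. fscale (eta b) (nu b) v)"
  by(intro sum.cong refl) (use BV True linear_on_scale[OF DV_D[OF eta]] in "simp add:fscale_def nu_def mult.commute")
  finally show ?thesis by(simp add:sum_apply)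
  next
  case False
  then have "eta v = 0" using eta by(simp add:mdual_def)
  then show ?thesis using False by(simp add:sum_apply fscale_def nu_def)
  qed
  qed
  then have "pure m eta = pure m (SUM b:B. fscale (eta b) (nu b))" by(rule arg_cong)
  also have "... = (SUM b:B. pure m (fscale (eta b) (nu b)))"
  proof (rule fs.linear_on_sum)
  show "linear_on fscale fscale UNIV (pure m)" by(rule linear_onI) (simp_all add:tens_add_right tens_scale_right)
  qed auto
  also have "... = Psi (E eta m)"
  unfolding Psi_def by(intro sum.cong refl) (use BV in "simp add:E_def tens_scale_left tens_scale_right")
  finally show ?thesis by(rule sym)
 qed
 have PsiPhi:"Psi (Phi t) = t" if t:"t:mcarrier Ten" for t
 proof -
  obtain xs where xs:"set xs <= M.mV \<times> DV" "t = (SUM (m,mu)<-xs. pure m mu)" using t Ten_rep by blast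
  have "Psi (SUM (m,mu)<-xs. E mu m) = (SUM (m,mu)<-xs. pure m mu)"
  using xs(1)
  proof (induction xs)
  case Nil
  then show ?case using Psi_0 by(simp add:zero_fun_def)
  next
  case (Cons x xs)
  obtain m mu where x:"x = (m,mu)" by(cases x)
  have "m:M.mV" "mu:DV" using Cons.prems x by auto
  moreover have "Psi (SUM (m,mu)<-xs. E mu m) = (SUM (m,mu)<-xs. pure m mu)" by(rule Cons.IH) (use Cons.prems in simp)
  ultimately show ?case unfolding x list.map prod.case sum_list.Cons Psi_add by(simp only: Psi_E)
  qed
  then show ?thesis unfolding xs(2) Phi_sum[OF xs(1)] .
 qed
 have PhiL:"Phi t:LV" if t:"t:mcarrier Ten" for t
 proof -
  obtain xs where xs:"set xs <= M.mV \<times> DV" "t = (SUM (m,mu)<-xs. pure m mu)" using t Ten_rep by blast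
  have "(SUM (m,mu)<-xs. E mu m):LV"
  unfolding case_prod_unfold
  by(rule Lv.subspace_sum_list[OF LV_sub]) (use xs(1) in "auto intro!:E_LV DV_D")
  then show ?thesis unfolding xs(2) Phi_sum[OF xs(1)] .
 qed
 have act:"mact Ten h t:mcarrier Ten & Phi (mact Ten h t) = Lact h (Phi t)" if h:"h:M.hc" and t:"t:mcarrier Ten" for h t
 proof -
  note fL = PhiL[OF t]
  obtain ys where ys:"set ys <= M.hc \<times> M.hc" "coprod H h = (SUM (a,b)<-ys. M.T a b)" using M.coprod_list[OF h] .
  have key:"(SUM (m,mu)<-xs. SUM (a,b)<-ys. tact a b m mu):mcarrier Ten
  & Phi (SUM (m,mu)<-xs. SUM (a,b)<-ys. tact a b m mu) = Lact h (SUM (m,mu)<-xs. E mu m)"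
  if "!!m mu. (m,mu):set xs==>m:M.mV & (EX l. mu:dual_grade N l)" for xs
  using that
  proof (induction xs)
  case Nil
  have "Lact h 0 = 0" by(rule Lv.linear_on_0[OF Lact_linear[OF h] LV_sub])
  then show ?case using Phi_0 by(simp only: list.map sum_list.Nil simp_thms)
  next
  case (Cons x xs)
  obtain m mu where x:"x = (m,mu)" by(cases x)
  have mm:"m:M.mV" using Cons.prems[of m mu] x by simp
  obtain l where l:"mu:dual_grade N l" using Cons.prems[of m mu] x by auto
  have l':"mu:DV" using l by(simp add:dual_grade_def mdual_def)
  note p = Phi_act_pure[OF h ys l mm]
  have q:"(SUM (m,mu)<-xs. SUM (a,b)<-ys. tact a b m mu):mcarrier Ten
  & Phi (SUM (m,mu)<-xs. SUM (a,b)<-ys. tact a b m mu) = Lact h (SUM (m,mu)<-xs. E mu m)"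
  by(rule Cons.IH) (use Cons.prems in auto)
  have e1:"E mu m:LV" by(rule E_LV[OF DV_D[OF l'] mm])
  have e2:"(SUM (m,mu)<-xs. E mu m):LV"
  unfolding case_prod_unfold
  by(rule Lv.subspace_sum_list[OF LV_sub]) (use Cons.prems in "force intro!:E_LV simp:dual_grade_def")
  show ?case
  unfolding x list.map prod.case sum_list.Cons linear_on_add[OF Lact_linear[OF h] e1 e2]
  using Phi_add[OF p[THEN conjunct1] q[THEN conjunct1]] p q by(simp only: simp_thms)
  qed
  have e:"t = (SUM (m,mu)<-?l (Phi t). pure m mu)" using PsiPhi[OF t] PsiL by simp
  have 1:"mact Ten h t = (SUM (m,mu)<-?l (Phi t). SUM (a,b)<-ys. tact a b m mu)"
  using tensor_act[OF h ys ls[OF fL]] e by(simp only:)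
  have 2:"Phi t = (SUM (m,mu)<-?l (Phi t). E mu m)" using Phi_sum[OF ls[OF fL]] e by(simp only:)
  have "m:M.mV & (EX l. mu:dual_grade N l)" if "(m,mu):set (?l (Phi t))" for m mu
  using that bs(1) LVD(2)[OF fL] BV nuG by auto
  from key[of "?l (Phi t)",OF this] show ?thesis unfolding 1 2[symmetric] .
 qed
 have bij:"bij_betw Phi (mcarrier Ten) LV"
  by(rule bij_betw_byWitness[where f' = Psi]) (use PsiPhi PP PhiL PsiT in auto)
 have bij':"bij_betw Psi LV (mcarrier Ten)"
  by(rule bij_betw_byWitness[where f' = Phi]) (use PsiPhi PP PhiL PsiT in auto)
 have grade:"Phi t:LG n" if "t:mgrade Ten n" for t n
 proof -
  have "t:tgrade M.sc fscale M.mG (dual_grade N) n" using that by(simp add:mtensor_def dual_eq)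
  from tgrade_rep[OF M.m.vector_space_axioms M.m.subG this]
  obtain xs where xs:"ALL (i,v,w):set xs. v:M.mG i & w:dual_grade N (n - i)" "t = (SUM (i,v,w)<-xs. pure v w)"
  by(elim exE conjE)
  let ?zs = "map (%(i,v,w). (v,w)) xs"
  have zs:"set ?zs <= M.mV \<times> DV" using xs(1) M.mG_mV by(force simp:dual_grade_def mdual_def)
  have t:"t = (SUM (m,mu)<-?zs. pure m mu)" unfolding xs(2) map_map by(simp add:o_def case_prod_unfold)
  have EG:"E w v:LG n" if z:"(i,v,w):set xs" for i v w
  proof -
  have m:"v:M.mG i" "w:dual_grade N (n - i)" using xs(1) z by auto
  have "E w v:LG (i - - (n - i))" by(rule E_LG[OF _ _ m(1)]) (use m(2) in "auto simp:dual_grade_def")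
  then show ?thesis by simp
  qed
  have "(SUM (m,mu)<-?zs. E mu m):LG n"
  unfolding map_map case_prod_unfold by(rule Lv.subspace_sum_list[OF LG_sub]) (use EG in force)
  then show ?thesis unfolding t Phi_sum[OF zs] .
 qed
 have grade':"Psi f:mgrade Ten n" if f:"f:LG n" for f n
 proof -
  have "Psi f:tgrade M.sc fscale M.mG (dual_grade N) n"
  unfolding Psi_def
  proof (rule T.subspace_sum[OF subspace_tgrade])
  fix b assume b:"b:B"
  show "pure (f b) (nu b):tgrade M.sc fscale M.mG (dual_grade N) n"
  by(rule tens_in_tgrade[where i = "n + d b"]) (use LG_deg[OF f B(2)[OF b]] nuG[OF b] in simp_all)
  qed
  then show ?thesis by(simp add:mtensor_def dual_eq)
 qed
 show "gmod_iso (alg H) Ten L"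
  unfolding gmod_iso_def L_simps alg_simps
  by(intro exI[of _ Phi] conjI ballI allI bij Phi_add(2) act[THEN conjunct2] image_subsetI grade)
 have "Psi (Lact h f) = mact Ten h (Psi f)" if "h:M.hc" "f:LV" for h f
  using act[OF that(1) PsiT[OF that(2)]] PsiPhi[of "mact Ten h (Psi f)"] PP[OF that(2)] by(simp only: simp_thms)
 then show "gmod_iso (alg H) L Ten"
  unfolding gmod_iso_def L_simps alg_simps
  by(intro exI[of _ Psi] conjI ballI allI bij' Psi_add image_subsetI grade')
qed

end

text \<open>\<open>tensor_hom_iso\<close> is used in both directions, and \<open>KF_dsum\<close>
  supplies a free summand of the required type.\<close>

lemma (in hopf) endotrivial_iff:
 fixes M :: "('k,'h) umodule"
 shows "endotrivial s H M \<longleftrightarrow> hmod s H M & hmod.KF H (ghom s H M M)"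
proof
 assume e:"endotrivial s H M"
 then have M:"hmod s H M" by(simp add:endotrivial_def hmod_def hmod_axioms_def hopf_axioms)
 then interpret P: hpair s H M M by(simp add:hpair_def)
 obtain F :: "('k,'h) umodule" where F:"gr (alg H) F" "gfree (alg H) F" "gmod_iso (alg H) P.Ten (dsum (triv H) F)"
  using e unfolding endotrivial_def by blast
 have hF:"hmod s H F" using F(1) by(simp add:hmod_def hmod_axioms_def hopf_axioms)
 interpret D: hmod s H "dsum (triv H) F" by(rule hmod_dsum[OF hmod_triv hF])
 obtain phi where "hmod_iso s H P.L (dsum (triv H) F) phi"
  using gmod_iso_hmod[OF P.hmod_ghom D.hmod_axioms gmod_iso_trans[OF P.tensor_hom_iso(2) F(3)]] .
 then interpret i: hmod_iso s H P.L "dsum (triv H) F" phi .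
 interpret j: hmod_iso s H "dsum (triv H) F" P.L "inv_into (mcarrier P.L) phi" by(rule i.inverse)
 have "D.KF" by(rule dsum_triv_KF[OF hF F(2)])
 then show "hmod s H M & hmod.KF H (ghom s H M M)" using M j.KF by blast
next
 assume a:"hmod s H M & hmod.KF H (ghom s H M M)"
 then interpret P: hpair s H M M by(simp add:hpair_def)
 obtain F :: "('k,'h) umodule" where "hmod s H F" "gfree (alg H) F" "gmod_iso (alg H) P.L (dsum (triv H) F)"
  using P.L.KF_dsum a by blast
 then show "endotrivial s H M"
  using gmod_iso_trans[OF P.tensor_hom_iso(1)] a unfolding endotrivial_def hmod_def hmod_axioms_def by blast
qed

subsection \<open>Modules over the quotient\<close>

context hopf_normal
begin

abbreviation "cl == qclass H Z"
abbreviation "quo E == subalg (hquot H Z) (cl ` E)"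

lemma cl_mem:"y:cl x \<longleftrightarrow> y - x:J"
 by(auto simp:qclass_def image_iff algebra_simps intro: bexI[of _ "y - x"])

lemma cl_eq:"cl x = cl y \<longleftrightarrow> x - y:J"
proof
 assume "cl x = cl y"
 moreover have "x:cl x" using h.subspace_0[OF J_sub] by(simp add:cl_mem)
 ultimately show "x - y:J" using cl_mem by blast
next
 assume d:"x - y:J"
 have "z - x:J \<longleftrightarrow> z - y:J" for z
 proof -
  have "z - y = (z - x) + (x - y)" "z - x = (z - y) - (x - y)" by simp_all
  then show ?thesis using h.subspace_add[OF J_sub _ d] h.subspace_diff[OF J_sub _ d] by metis
 qed
 then show "cl x = cl y" by(auto simp:cl_mem)
qed

lemma cl_hc:"x:hc==>y:cl x==>y:hc"
 using J_hc[of "y - x"] hc_add[of "y - x" x] by(simp add:cl_mem)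

lemma cl_self:"x:cl x"
 using h.subspace_0[OF J_sub] by(simp add:cl_mem)

lemma quo_simps [simp]: "acarrier (quo E) = cl ` E" "aadd (quo E) = aadd (hquot H Z)" "azero (quo E) = cl 0"
 "amult (quo E) = amult (hquot H Z)" "aone (quo E) = cl 1" "ascale (quo E) = ascale (hquot H Z)"
 "agrade (quo E) = (%i. cl ` hg i Int cl ` E)"
 by(simp_all add:subalg_def hquot_def)

lemma quo_hc:"quo hc = hquot H Z"
proof -
 have "cl ` hg i Int cl ` hc = cl ` hg i" for i using hg_hc by auto
 then show ?thesis by(simp add:subalg_def hquot_def)
qed

lemma cl_ops:
 assumes x:"x:hc" and y:"y:hc"
 shows "aadd (hquot H Z) (cl x) (cl y) = cl (x + y)" "amult (hquot H Z) (cl x) (cl y) = cl (x * y)"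
proof -
 have a:"cl (x' + y') = cl (x + y)" if "x':cl x" "y':cl y" for x' y'
 proof -
  have "x' + y' - (x + y) = (x' - x) + (y' - y)" by simp
  then show ?thesis using that h.subspace_add[OF J_sub] unfolding cl_eq cl_mem by metis
 qed
 have b:"cl (x' * y') = cl (x * y)" if "x':cl x" "y':cl y" for x' y'
 proof -
  have "x' * y' - x * y = x' * (y' - y) + (x' - x) * y" by(simp add:algebra_simps)
  moreover have "x' * (y' - y):J" "(x' - x) * y:J"
  using that J_left[OF cl_hc[OF x that(1)]] J_right[OF _ y] by(simp_all add:cl_mem)
  ultimately show ?thesis using h.subspace_add[OF J_sub] unfolding cl_eq by metis
 qed
 have un:"(UN i:I. f i) = A" if "i:I" "!!i. i:I==>f i = A" for I :: "'h set" and f i and A :: "'h set"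
  using that by blast
 show "aadd (hquot H Z) (cl x) (cl y) = cl (x + y)"
  unfolding hquot_def galgebra.simps by(rule un[OF cl_self] un[OF cl_self[of y]] a)+ (assumption)+
 show "amult (hquot H Z) (cl x) (cl y) = cl (x * y)"
  unfolding hquot_def galgebra.simps by(rule un[OF cl_self] un[OF cl_self[of y]] b)+ (assumption)+
qed

lemma cl_scale:"ascale (hquot H Z) c (cl x) = cl (hs c x)"
proof -
 have "cl (hs c x') = cl (hs c x)" if "x':cl x" for x'
  using h.subspace_scale[OF J_sub,of "x' - x" c] that unfolding cl_eq cl_mem by(simp add:h.scale_right_diff_distrib)
 then show ?thesis unfolding hquot_def galgebra.simps using cl_self by blast
qed

lemma galg_quo:
 assumes "hopf_subalgebra H E"
 shows "galg (quo E)"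
proof -
 interpret E: hopf_sub s H E using assms by unfold_locales
 have E:"x:E==>x:hc" for x by(rule E.A_hc)
 have 0:"0:E" by(rule h.subspace_0[OF E.A_sub])
 have "1 ~: J" using counit_J[of 1] counit_1 by auto
 then show ?thesis
  by unfold_locales (use 0 E h.subspace_add[OF E.A_sub] in "auto simp:cl_ops cl_eq intro!:imageI")
qed

text \<open>A module killed by \<open>J\<close>, viewed over \<open>H//Z\<close>. The choice of
  representative is harmless by \<open>qmod_act\<close>.\<close>

definition qmod :: "('k,'h,'v) gmodule => ('k,'h set,'v) gmodule" where
 "qmod M = \<lparr>mcarrier = mcarrier M,mscale = mscale M,mact = (%X. mact M (SOME h. h:X & h:hc)),mgrade = mgrade M\<rparr>"

lemma qmod_simps [simp]: "mcarrier (qmod M) = mcarrier M" "mscale (qmod M) = mscale M" "mgrade (qmod M) = mgrade M"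
 by(simp_all add:qmod_def)

text \<open>Freeness over \<open>E//Z\<close> expressed with representatives in \<open>E\<close>:
  coefficients are unique modulo \<open>J\<close>, and cosets disappear from later
  arguments.\<close>

definition qfree :: "('k,'h,'v::ab_group_add) gmodule => 'h set => bool" where
 "qfree M E \<longleftrightarrow> (EX S. finite S & S <= (UN i. mgrade M i)
  & (ALL m:mcarrier M. EX f. (ALL x:S. f x:E) & m = (SUM x:S. mact M (f x) x))
  & (ALL f. (ALL x:S. f x:E) --> (SUM x:S. mact M (f x) x) = 0 --> (ALL x:S. f x:J)))"

context
 fixes M :: "('k,'h,'v::ab_group_add) gmodule"
 assumes M:"hmod s H M" and kill:"!!x m. x:J==>m:mcarrier M==>mact M x m = 0"
begin

interpretation M: hmod s H M by(rule M)

lemma qmod_act:"h:hc==>m:M.mV==>mact (qmod M) (cl h) m = M.act h m"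
proof -
 assume h:"h:hc" and m:"m:M.mV"
 define g where "g = (SOME g. g:cl h & g:hc)"
 have g:"g:cl h & g:hc" unfolding g_def by(rule someI[of _ h]) (use h cl_self in simp)
 then have "M.act (g - h) m = 0" using kill[OF _ m] by(simp add:cl_mem)
 then have "M.act g m = M.act h m" using M.act_diff_left[of g h m] g h m by simp
 then show ?thesis by(simp add:qmod_def g_def)
qed

lemma qmod_gmod:
 assumes "hopf_subalgebra H E"
 shows "graded_module (quo E) (qmod M)"
proof -
 interpret E: hopf_sub s H E using assms by unfold_locales
 have lin:"linear_on M.sc M.sc M.mV (mact (qmod M) (cl h))" if "h:hc" for h
  using M.act_linear[OF that] qmod_act[OF that] by(auto simp:linear_on_def)
 have "mact (qmod M) a m:M.mG (i + j)" if "a:cl ` hg i" "m:M.mG j" for i j a m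
  using that qmod_act[OF hg_hc M.mG_mV] M.act_deg by auto
 then show ?thesis
  unfolding graded_module_def quo_simps qmod_simps
  using M.m.vector_space_axioms M.m.subV M.m.graded E.A_hc
  by(intro conjI allI ballI)
  (auto simp:qmod_act cl_ops cl_scale M.act_add_left M.act_mult M.act_scale_left intro!:lin)
qed

lemma qmod_gr:"gr (hquot H Z) (qmod M)"
proof -
 obtain S where S:"finite S" "S <= M.mV" and gen:"ALL m:M.mV. EX f. (ALL x:S. f x:hc) & m = (SUM x:S. M.act (f x) x)"
  using M.M unfolding gr_def alg_simps by blast
 have "EX f. (ALL x:S. f x:cl ` hc) & m = (SUM x:S. mact (qmod M) (f x) x)" if "m:M.mV" for m
 proof -
  from gen[rule_format,OF that] obtain f where f:"ALL x:S. f x:hc" "m = (SUM x:S. M.act (f x) x)"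
  by(elim exE conjE)
  have "m = (SUM x:S. mact (qmod M) (cl (f x)) x)"
  unfolding f(2) by(intro sum.cong refl qmod_act[symmetric]) (use f(1) S(2) in auto)
  then show ?thesis using f(1) by(intro exI[of _ "%x. cl (f x)"]) simp
 qed
 moreover have "acarrier (hquot H Z) = cl ` hc" by(simp add:hquot_def)
 ultimately show ?thesis
  unfolding gr_def qmod_simps using S qmod_gmod[OF hopf_subalgebra_self] quo_hc by auto
qed

lemma gfree_quo:
 assumes E:"hopf_subalgebra H E"
 shows "gfree (quo E) (qmod M) \<longleftrightarrow> qfree M E"
proof -
 interpret E: hopf_sub s H E using E by unfold_locales
 interpret A: galg "quo E" by(rule galg_quo[OF E])
 show ?thesis
  unfolding A.gfree_iff[OF qmod_gmod[OF E]] qfree_def quo_simps qmod_simps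
 proof (rule ex_cong1,rule conj_cong[OF refl],rule conj_cong[OF refl],rule conj_cong)
  fix S assume "S <= (UN i. M.mG i)"
  then have SV:"x:M.mV" if "x:S" for x using M.mG_mV that by blast
  \<comment> \<open>The representative is taken in \<open>E\<close> itself; a coset of
    \<open>J\<close> may reach beyond \<open>E\<close>.\<close>
  define r where "r X = (SOME e. e:E & X = cl e)" for X
  have r:"r X:E & X = cl (r X)" if "X:cl ` E" for X
  unfolding r_def by(rule someI_ex) (use that in blast)
  have sum_r:"(SUM x:S. mact (qmod M) (f x) x) = (SUM x:S. M.act (r (f x)) x)" if "ALL x:S. f x:cl ` E" for f
  by(intro sum.cong refl) (use that r qmod_act[OF E.A_hc SV] in metis)
  have sum_c:"(SUM x:S. mact (qmod M) (cl (f x)) x) = (SUM x:S. M.act (f x) x)" if "ALL x:S. f x:E" for f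
  by(intro sum.cong refl) (use that qmod_act[OF E.A_hc SV] in auto)
  show "(ALL m:M.mV. EX f. (ALL x:S. f x:cl ` E) & m = (SUM x:S. mact (qmod M) (f x) x))
  \<longleftrightarrow> (ALL m:M.mV. EX f. (ALL x:S. f x:E) & m = (SUM x:S. M.act (f x) x))"
  proof (rule ball_cong[OF refl],rule iffI)
  fix m assume "EX f. (ALL x:S. f x:cl ` E) & m = (SUM x:S. mact (qmod M) (f x) x)"
  then obtain f where f:"ALL x:S. f x:cl ` E" "m = (SUM x:S. mact (qmod M) (f x) x)" by(elim exE conjE)
  then show "EX f. (ALL x:S. f x:E) & m = (SUM x:S. M.act (f x) x)"
  using r sum_r[OF f(1)] by(intro exI[of _ "%x. r (f x)"]) auto
  next
  fix m assume "EX f. (ALL x:S. f x:E) & m = (SUM x:S. M.act (f x) x)"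
  then obtain f where f:"ALL x:S. f x:E" "m = (SUM x:S. M.act (f x) x)" by(elim exE conjE)
  then show "EX f. (ALL x:S. f x:cl ` E) & m = (SUM x:S. mact (qmod M) (f x) x)"
  using sum_c[OF f(1)] by(intro exI[of _ "%x. cl (f x)"]) auto
  qed
  show "(ALL f g. (ALL x:S. f x:cl ` E) --> (ALL x:S. g x:cl ` E)
  --> (SUM x:S. mact (qmod M) (f x) x) = (SUM x:S. mact (qmod M) (g x) x) --> (ALL x:S. f x = g x))
  \<longleftrightarrow> (ALL f. (ALL x:S. f x:E) --> (SUM x:S. M.act (f x) x) = 0 --> (ALL x:S. f x:J))"
  (is "?l \<longleftrightarrow> ?r")
  proof
  assume l: ?l
  show ?r
  proof (intro allI impI)
  fix f assume f:"ALL x:S. f x:E" "(SUM x:S. M.act (f x) x) = 0"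
  have 0:"ALL x:S. 0:E" using h.subspace_0[OF E.A_sub] by simp
  have z:"(SUM x:S. M.act 0 x) = 0" by(rule sum.neutral) (use SV in simp)
  have "ALL x:S. cl (f x) = cl 0"
  by(rule l[rule_format,of "%x. cl (f x)" "%x. cl 0",THEN ballI])
  (use f(1) 0 sum_c[OF f(1)] sum_c[OF 0] f(2) z in auto)
  then show "ALL x:S. f x:J" unfolding cl_eq by simp
  qed
  next
  assume l: ?r
  show ?l
  proof (intro allI impI)
  fix f g assume f:"ALL x:S. f x:cl ` E" and g:"ALL x:S. g x:cl ` E"
  and eq:"(SUM x:S. mact (qmod M) (f x) x) = (SUM x:S. mact (qmod M) (g x) x)"
  have rE:"r (f x):E" "r (g x):E" if "x:S" for x
  using r[OF f[rule_format,OF that]] r[OF g[rule_format,OF that]] by simp_all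
  have d:"ALL x:S. r (f x) - r (g x):E" using h.subspace_diff[OF E.A_sub rE] by simp
  have "(SUM x:S. M.act (r (f x) - r (g x)) x) = (SUM x:S. M.act (r (f x)) x - M.act (r (g x)) x)"
  by(intro sum.cong refl M.act_diff_left E.A_hc rE SV)
  also have "... = 0" using eq unfolding sum_r[OF f] sum_r[OF g] by(simp add:sum_subtractf)
  finally have s:"(SUM x:S. M.act (r (f x) - r (g x)) x) = 0" .
  show "ALL x:S. f x = g x"
  proof
  fix x assume x:"x:S"
  have "r (f x) - r (g x):J" by(rule l[rule_format,of "%x. r (f x) - r (g x)",OF _ s x]) (use d in blast)
  then have "cl (r (f x)) = cl (r (g x))" by(simp only: cl_eq)
  then show "f x = g x" using r[OF f[rule_format,OF x]] r[OF g[rule_format,OF x]] by simp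
  qed
  qed
  qed
 qed
qed

end

lemma qfree_iso:
 fixes M :: "('k,'h,'v::ab_group_add) gmodule" and M' :: "('k,'h,'w::ab_group_add) gmodule"
 assumes iso:"hmod_iso s H M M' phi" and E:"E <= hc" and q:"qfree M E"
 shows "qfree M' E"
proof -
 interpret i: hmod_iso s H M M' phi by fact
 obtain S where S:"finite S" "S <= (UN i. mgrade M i)"
  and gen:"ALL m:mcarrier M. EX f. (ALL x:S. f x:E) & m = (SUM x:S. mact M (f x) x)"
  and ind:"ALL f. (ALL x:S. f x:E) --> (SUM x:S. mact M (f x) x) = 0 --> (ALL x:S. f x:J)"
  using q unfolding qfree_def by(elim exE conjE)
 have SV:"S <= i.M.mV" using S(2) i.M.mG_mV by blast
 show ?thesis
  unfolding qfree_def
 proof (intro exI[of _ "phi ` S"] conjI ballI allI impI)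
  show "finite (phi ` S)" using S(1) by simp
  show "phi ` S <= (UN i. mgrade M' i)" using S(2) i.map_grade by blast
 next
  fix m assume "m:mcarrier M'"
  then obtain m0 where m0:"m0:i.M.mV" "m = phi m0" using i.surj by blast
  obtain f where f:"ALL x:S. f x:E" "m0 = (SUM x:S. i.M.act (f x) x)" using gen m0(1) by blast
  define g where "g y = f (inv_into S phi y)" for y
  have g:"g (phi x) = f x" if "x:S" for x using inv_into_f_f[OF i.inj_image[OF SV] that] by(simp add:g_def)
  have "(SUM y:phi ` S. i.N.act (g y) y) = phi (SUM x:S. i.M.act (g (phi x)) x)"
  by(rule i.sum_act[OF SV]) (use f(1) g E in auto)
  also have "(SUM x:S. i.M.act (g (phi x)) x) = m0" unfolding f(2) by(intro sum.cong refl) (use g in simp)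
  finally show "EX f. (ALL x:phi ` S. f x:E) & m = (SUM x:phi ` S. i.N.act (f x) x)"
  using g f(1) m0(2) by(intro exI[of _ g]) auto
 next
  fix f y assume f:"ALL x:phi ` S. f x:E" "(SUM x:phi ` S. i.N.act (f x) x) = 0" and y:"y:phi ` S"
  have "phi (SUM x:S. i.M.act (f (phi x)) x) = 0"
  using i.sum_act[OF SV,of f] f E by(auto simp:subset_iff)
  moreover have "(SUM x:S. i.M.act (f (phi x)) x):i.M.mV"
  by(intro i.M.m.subspace_sum i.M.m.subV i.M.act_closed) (use f E SV in auto)
  ultimately have "(SUM x:S. i.M.act (f (phi x)) x) = 0" using i.eq_0 by blast
  moreover have "ALL x:S. f (phi x):E" using f(1) by blast
  ultimately have "ALL x:S. f (phi x):J" using ind[rule_format,of "%x. f (phi x)"] by blast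
  then show "f y:J" using y by blast
 qed
qed

text \<open>The left ideal \<open>E N\<close> is its own double annihilator. An \<open>r\<close> in
  \<open>E\<close> that it kills satisfies \<open>N * r = 0\<close>, so \<open>r\<close> lies in
  \<open>J\<close>; as \<open>J\<close> is an ideal, also \<open>N * (e * r) = 0\<close>. Hence
  \<open>N * e\<close> belongs to \<open>E N\<close>.\<close>

lemma N_right:
 assumes E:"hopf_subalgebra H E" "Z <= E" and e:"e:E"
 shows "EX y:E. N * e = y * N"
proof -
 interpret E: hopf_sub s H E using E(1) by unfold_locales
 have NE:"N:E" using E(2) by auto
 have sub:"h.subspace {y * N | y. y:E}"
 proof (rule h.subspaceI)
  show "0:{y * N | y. y:E}" using h.subspace_0[OF E.A_sub] mult_zero_left[of N,symmetric] by blast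
  show "x + y:{y * N | y. y:E}" if "x:{y * N | y. y:E}" "y:{y * N | y. y:E}" for x y
  using that h.subspace_add[OF E.A_sub] distrib_right[of _ _ N,symmetric] by fastforce
  show "hs c x:{y * N | y. y:E}" if "x:{y * N | y. y:E}" for c x
  using that h.subspace_scale[OF E.A_sub] scale_mult_left[OF E.A_hc N_hc,symmetric] by fastforce
 qed
 have "N * e:{y * N | y. y:E}"
 proof (rule E.HA.double_annihilator[of "{y * N | y. y:E}" "N * e",unfolded E.HA_simps])
  show "h.subspace {y * N | y. y:E}" by(rule sub)
  show "{y * N | y. y:E} <= E" using NE by auto
  show "y * l:{y * N | y. y:E}" if yl:"y:E" "l:{y * N | y. y:E}" for y l
  proof -
  obtain z where "z:E" "l = z * N" using yl(2) by blast
  then have "y * l = (y * z) * N" "y * z:E" using yl(1) by(simp_all add:mult.assoc)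
  then show ?thesis by blast
  qed
  show "N * e:E" using NE e by simp
  fix r assume r:"r:E" "!!l. l:{y * N | y. y:E}==>l * r = 0"
  have "1 * N * r = 0" by(rule r(2)) (use E.A_1 in blast)
  then have "r:J" using annihilator_right[OF E.A_hc[OF r(1)]] by simp
  then show "N * e * r = 0" using N_J[OF J_left[OF E.A_hc[OF e]]] by(simp add:mult.assoc)
 qed
 then show ?thesis by blast
qed

text \<open>The antipode reverses \<open>N_right\<close>, taken over all of H, and multiplies
  \<open>N\<close> by a nonzero scalar. The result makes the image of \<open>N\<close> a submodule
  in \<open>detect_KF\<close>.\<close>

lemma N_left:
 assumes h:"h:hg i"
 shows "EX y:hc. h * N = N * y"
proof -
 obtain h' where h':"h':hg i" "h = S h'" using S_surj[OF h] by blast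
 obtain ka where k:"S N = hs ka N" "ka ~= 0" using HA.S_Lam by(auto simp:HA_simps)
 obtain y where y:"y:hc" "N * h' = y * N"
  using N_right[OF hopf_subalgebra_self _ hg_hc[OF h'(1)]] A_hc by blast
 \<comment> \<open>Only the component in the degree of \<open>h\<close> is kept, so that
   \<open>S_mult\<close> applies to \<open>z * N\<close>.\<close>
 define z where "z = hcomp hg y i"
 have z:"z:hg i" unfolding z_def by(rule h.hcomp_G[OF y(1)])
 have "N * h':hg (dN + i)" by(rule mult_hg[OF N_hg h'(1)])
 then have "N * h' = hcomp hg (N * h') (dN + i)" by(simp add:h.hcomp_homog)
 also have "... = z * N" unfolding y(2) z_def using hcomp_mult_right[OF y(1) N_hg,of "dN + i"] by simp
 finally have "S (N * h') = S (z * N)" by simp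
 then have e:"hs (xsign s dN i) (h * hs ka N) = hs (xsign s i dN) (hs ka N * S z)"
  unfolding S_mult[OF N_hg h'(1)] S_mult[OF z N_hg] k(1) h'(2) .
 have hc':"h:hc" "S z:hc" using hg_hc[OF h] hg_hc[OF z] by auto
 have "hs (xsign s dN i * ka) (h * N) = hs (xsign s dN i * ka) (N * S z)"
  using e hc' unfolding xsign_commute[of s i dN] by(simp add:scale_mult_left scale_mult_right)
 moreover have "xsign s dN i * ka ~= 0" using k(2) xsign_square[of dN i] by(metis mult_eq_0_iff zero_neq_one)
 ultimately have "h * N = N * S z" using h.scale_left_imp_eq by blast
 then show ?thesis using hc'(2) by blast
qed

text \<open>With nothing to test, \<open>k\<close> would be free over \<open>H//Z\<close>. A basis
  element is killed by all positive degrees, so uniqueness modulo \<open>J\<close> puts these into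
  \<open>J\<close>; then a basis of H over Z, being independent modulo \<open>aug_right\<close>,
  reduces to 1, and \<open>Z = H\<close>.\<close>

lemma detect_nonempty:
 assumes ne:"Z ~= hc" and d:"detect_property (hquot H Z) {}"
 shows False
proof -
 interpret T: hmod s H "triv H" by(rule hmod_triv)
 obtain T' :: "('k,'h) umodule" and psi where "hmod_iso s H (triv H) T' psi" using T.model_exists .
 then interpret i: hmod_iso s H "triv H" T' psi .
 interpret j: hmod_iso s H T' "triv H" "inv_into T.mV psi" by(rule i.inverse)
 have kill:"mact T' x m = 0" if x:"x:J" and m:"m:mcarrier T'" for x m
 proof -
  obtain c where c:"c:T.mV" "m = psi c" using i.surj[OF m] by blast
  have "mact T' x m = psi (mact (triv H) x c)" unfolding c(2) using i.map_act[OF J_hc[OF x] c(1)] by simp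
  then show ?thesis using counit_J[OF x] by(simp add:triv_def)
 qed
 have "gfree (hquot H Z) (qmod T')"
  using d qmod_gr[OF i.N.hmod_axioms kill] unfolding detect_property_def by blast
 then have "qfree T' hc" using gfree_quo[OF i.N.hmod_axioms kill hopf_subalgebra_self] quo_hc by simp
 then have "qfree (triv H) hc" by(rule qfree_iso[OF j.hmod_iso_axioms subset_refl])
 then obtain X where X:"finite X" "X <= (UN i. T.mG i)"
  and gen:"ALL m:T.mV. EX f. (ALL x:X. f x:hc) & m = (SUM x:X. T.act (f x) x)"
  and ind:"ALL f. (ALL x:X. f x:hc) --> (SUM x:X. T.act (f x) x) = 0 --> (ALL x:X. f x:J)"
  unfolding qfree_def by(elim exE conjE)
 have "X ~= {}"
 proof
  assume "X = {}"
  then have "(1::'k) = 0" using gen by(auto simp:triv_def)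
  then show False by simp
 qed
 then obtain c where c:"c:X" by blast
 have aug:"x:J" if x:"x:hg n" "n ~= 0" for x n
 proof -
  have s:"(SUM y:X. T.act x y) = 0" using counit_hg[OF x] by(simp add:triv_def)
  show ?thesis by(rule ind[rule_format,of "%_. x",OF _ s c]) (rule hg_hc[OF x(1)])
 qed
 obtain Y where Y:"left_basis Y" using free_over_sub by blast
 have "y = 1" if y:"y:Y" for y
 proof (rule ccontr)
  assume y1:"y ~= 1"
  obtain n where n:"y:hg n" using Y y unfolding left_basis_def by blast
  have "y:h.span (aug_right Un (Y - {y}))"
  proof (cases "n = 0")
  case True
  then obtain c where c:"y = hs c 1" using n hg_0 by auto
  have "1:Y - {y}" using Y y1 unfolding left_basis_def by blast
  then have "hs c 1:h.span (aug_right Un (Y - {y}))" by(intro h.span_scale h.span_base) simp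
  then show ?thesis unfolding c[symmetric] .
  next
  case False
  then show ?thesis using aug[OF n] J_eq h.span_base by blast
  qed
  then show False using Y y unfolding left_basis_def by blast
 qed
 then have Y1:"Y = {1}" using Y unfolding left_basis_def by blast
 have "hc <= Z"
 proof
  fix y assume "y:hc"
  then have "EX f. (ALL x:Y. f x:Z) & y = (SUM x:Y. f x * x)" using Y unfolding left_basis_def by blast
  then show "y:Z" unfolding Y1 by auto
 qed
 then show False using ne A_hc by blast
qed

text \<open>Freeness passes through the image \<open>Q\<close> of \<open>N\<close> in both
  directions: a basis over \<open>E i\<close> maps to one of \<open>Q\<close> over its quotient, and
  a basis of \<open>Q\<close> over \<open>H//Z\<close> lifts to a free submodule of
  \<open>M\<close>. Its complement is then identified over a single \<open>E i\<close>.\<close>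

lemma detect_KF:
 fixes M :: "('k,'h,'v::ab_group_add) gmodule" and E :: "'i => 'h set"
 assumes M:"hmod s H M" and ne:"Z ~= hc" and detect:"detect_property (hquot H Z) (B ` I)"
  and E:"!!i. i:I==>hopf_subalgebra H (E i)" "!!i. i:I==>Z <= E i" "!!i. i:I==>cl ` E i = B i"
  and kf:"!!i. i:I==>hmod.KF (subhopf H (E i)) M"
 shows "hmod.KF H M"
proof -
 interpret M: hmod s H M by fact
 define Q where "Q = M.act N ` M.mV"
 have N0:"M.act N 0 = 0" by simp
 have gQ:"M.gsub Q"
  unfolding M.gsub_def
 proof (intro conjI ballI)
  show "M.m.graded_sub Q"
  proof (rule M.m.graded_subI)
  show "M.m.subspace Q"
  proof (rule M.m.subspaceI)
  show "0:Q" unfolding Q_def by(rule image_eqI[of _ _ 0]) simp_all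
  fix x y assume "x:Q" "y:Q"
  then obtain a b where "a:M.mV" "b:M.mV" "x = M.act N a" "y = M.act N b" by(auto simp:Q_def)
  then show "x + y:Q" unfolding Q_def by(intro image_eqI[of _ _ "a + b"]) (simp_all add:M.act_add)
  next
  fix c x assume "x:Q"
  then obtain a where "a:M.mV" "x = M.act N a" by(auto simp:Q_def)
  then show "M.sc c x:Q" unfolding Q_def by(intro image_eqI[of _ _ "M.sc c a"]) (simp_all add:M.act_scale)
  qed
  show "w:M.mV" if "w:Q" for w using that by(auto simp:Q_def)
  show "hcomp M.mG w i:Q" if "w:Q" for w i
  using that M.hcomp_act[OF N_hg] M.m.hcomp_V by(auto simp:Q_def)
  qed
  fix a k assume a:"a:hc" and "k:Q"
  then obtain m where m:"m:M.mV" "k = M.act N m" by(auto simp:Q_def)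
  show "M.act a k:Q"
  using a
  proof (induction rule: h.homog_induct)
  case zero
  show ?case unfolding m(2) Q_def by(rule image_eqI[of _ _ 0]) (use m(1) in simp_all)
  next
  case (add x y)
  then obtain p q where "p:M.mV" "q:M.mV" "M.act x k = M.act N p" "M.act y k = M.act N q" by(auto simp:Q_def)
  then show ?case unfolding Q_def
  by(intro image_eqI[of _ _ "p + q"]) (use add.hyps m in "simp_all add:M.act_add M.act_add_left")
  next
  case (homog i x)
  obtain y where y:"y:hc" "x * N = N * y" using N_left[OF homog] by blast
  have "M.act x k = M.act (x * N) m" unfolding m(2) using hg_hc[OF homog] m(1) by(simp add:M.act_mult)
  also have "... = M.act N (M.act y m)" unfolding y(2) using y(1) m(1) by(simp add:M.act_mult)
  finally show ?case unfolding Q_def using y(1) m(1) by simp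
  qed
 qed
 interpret W: hmod s H "msub M Q" by(rule M.hmod_msub[OF gQ])
 \<comment> \<open>\<open>detect_property\<close> speaks about modules of this type only.\<close>
 obtain W' :: "('k,'h) umodule" and psi where "hmod_iso s H (msub M Q) W' psi" using W.model_exists .
 then interpret i: hmod_iso s H "msub M Q" W' psi .
 interpret j: hmod_iso s H W' "msub M Q" "inv_into (mcarrier (msub M Q)) psi" by(rule i.inverse)
 have kill:"mact W' x m = 0" if x:"x:J" and m:"m:mcarrier W'" for x m
 proof -
  obtain q where q:"q:mcarrier (msub M Q)" "m = psi q" using i.surj[OF m] by blast
  obtain m' where m':"m':M.mV" "q = M.act N m'" using q(1) by(auto simp:Q_def)
  have "M.act x q = M.act (x * N) m'" unfolding m'(2) using J_hc[OF x] m'(1) by(simp add:M.act_mult)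
  then have "M.act x q = 0" using J_N[OF x] m'(1) by simp
  then show ?thesis unfolding q(2) using i.map_act[OF J_hc[OF x] q(1)] by simp
 qed
 note W' = i.N.hmod_axioms
 \<comment> \<open>The \<open>N y\<close>, for \<open>y\<close> in an \<open>E i\<close>-basis, form
   the basis of \<open>Q\<close>. They generate since \<open>N\<close> moves past coefficients by
   \<open>N_right\<close> and kills the invariant \<open>x\<close>; uniqueness modulo
   \<open>J\<close> is \<open>annihilator_left\<close>.\<close>
 have qE:"qfree (msub M Q) (E i)" if i:"i:I" for i
 proof -
  interpret e: hmod_sub s H M "E i" using E(1)[OF i] by unfold_locales
  have NE:"N:E i" using E(2)[OF i] N_Z by blast
  have EH:"x:E i==>x:hc" for x by(rule e.A_hc)
  obtain X x where X:"e.R.free_basis X" and x:"e.R.soc x" and dec:"ALL m:M.mV. EX p:e.R.hspan X. EX c. m = p + M.sc c x"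
  using kf[OF i] unfolding e.R.KF_def by(elim exE conjE)
  have XV:"y:M.mV" if "y:X" for y using e.R.free_basisD(3)[OF X that] .
  note finX = e.R.free_basisD(1)[OF X]
  have xV:"x:M.mV" using x by(simp add:e.R.soc_def)
  have Nx:"M.act N x = 0" using x N_hg NE dN_pos by(auto simp:e.R.soc_def)
  have ind:"f y * N = 0" if f:"ALL y:X. f y:E i" "(SUM y:X. M.act (f y) (M.act N y)) = 0" and y:"y:X" for f y
  proof (rule e.R.free_basisD(4)[OF X _ _ y,of "%y. f y * N"])
  show "f z * N:hcarrier e.HA" if "z:X" for z using f(1) NE that by simp
  have "(SUM z:X. M.act (f z * N) z) = (SUM z:X. M.act (f z) (M.act N z))"
  by(intro sum.cong refl) (use f(1) EH XV in "auto simp:M.act_mult")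
  then show "(SUM z:X. M.act (f z * N) z) = 0" using f(2) by simp
  qed
  have inj:"inj_on (M.act N) X"
  proof (rule inj_onI,rule ccontr)
  fix y z assume yz:"y:X" "z:X" "M.act N y = M.act N z" "y ~= z"
  let ?f = "%w. if w = y then 1 else if w = z then - 1 else (0::'h)"
  have f:"ALL w:X. ?f w:E i" using h.subspace_0[OF e.A_sub] h.subspace_neg[OF e.A_sub e.A_1] by simp
  have m1:"M.act (- 1) w = - w" if "w:M.mV" for w
  using M.act_scale_left[OF one_hc that,of "- 1"] that by simp
  have "(SUM w:X. M.act (?f w) (M.act N w)) = (SUM w:X. (if w = y then M.act N y else 0) - (if w = z then M.act N z else 0))"
  by(intro sum.cong refl) (use XV yz(4) m1 in auto)
  also have "... = 0" unfolding sum_subtractf using finX yz(1-3) by simp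
  finally have "?f y * N = 0" by(rule ind[OF f _ yz(1)])
  then show False using N_neq_0 by simp
  qed
  have sumN:"(SUM q:M.act N ` X. M.act (f q) q) = (SUM y:X. M.act (f (M.act N y)) (M.act N y))" for f
  by(rule sum.reindex[OF inj,unfolded o_def])
  show ?thesis
  unfolding qfree_def msub_simps
  proof (intro exI[of _ "M.act N ` X"] conjI ballI allI impI)
  show "finite (M.act N ` X)" using finX by simp
  show "M.act N ` X <= (UN i. M.mG i Int Q)"
  using e.R.free_basisD(2)[OF X] M.act_deg[OF N_hg] XV by(fastforce simp:Q_def)
  next
  fix q assume "q:Q"
  then obtain m where m:"m:M.mV" "q = M.act N m" by(auto simp:Q_def)
  obtain p c where pc:"p:e.R.hspan X" "m = p + M.sc c x" using dec m(1) by blast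
  obtain f where f:"ALL y:X. f y:E i" "p = (SUM y:X. M.act (f y) y)"
  using e.R.hspan_ex[OF pc(1)] by(elim exE conjE) (simp add:e.HA_simps)
  have "ALL y:X. EX g:E i. N * f y = g * N" using N_right[OF E(1,2)[OF i]] f(1) by blast
  then have "EX g. ALL y:X. g y:E i & N * f y = g y * N" by(intro bchoice) blast
  then obtain g where g:"ALL y:X. g y:E i & N * f y = g y * N" ..
  have pV:"p:M.mV" unfolding f(2) by(intro M.m.subspace_sum M.m.subV M.act_closed) (use f(1) EH XV in auto)
  have "q = M.act N p" unfolding m(2) pc(2) using pV xV Nx by(simp add:M.act_add M.act_scale)
  also have "... = (SUM y:X. M.act N (M.act (f y) y))" unfolding f(2) by(rule M.act_sum) (use f(1) EH XV in auto)
  also have "... = (SUM y:X. M.act (g y) (M.act N y))"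
  proof (rule sum.cong[OF refl])
  fix y assume y:"y:X"
  have "M.act N (M.act (f y) y) = M.act (N * f y) y" using f(1) y EH XV by(simp add:M.act_mult)
  also have "... = M.act (g y) (M.act N y)" using g y EH XV by(simp add:M.act_mult)
  finally show "M.act N (M.act (f y) y) = M.act (g y) (M.act N y)" .
  qed
  finally have q:"q = (SUM y:X. M.act (g y) (M.act N y))" .
  define f' where "f' z = g (inv_into X (M.act N) z)" for z
  have f':"f' (M.act N y) = g y" if "y:X" for y using inv_into_f_f[OF inj that] by(simp add:f'_def)
  have "q = (SUM z:M.act N ` X. M.act (f' z) z)" unfolding q sumN by(intro sum.cong refl) (simp add:f')
  then show "EX f. (ALL x:M.act N ` X. f x:E i) & q = (SUM x:M.act N ` X. M.act (f x) x)"
  using f' g by(intro exI[of _ f']) auto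
  next
  fix f q assume f:"ALL z:M.act N ` X. f z:E i" "(SUM z:M.act N ` X. M.act (f z) z) = 0" and "q:M.act N ` X"
  then obtain y where y:"y:X" "q = M.act N y" by blast
  have "f (M.act N y) * N = 0" by(rule ind[of "%y. f (M.act N y)",OF _ _ y(1)]) (use f sumN in auto)
  then show "f q:J" using annihilator_left f(1) y EH by auto
  qed
 qed
 have "gfree (subalg (hquot H Z) (B i)) (qmod W')" if i:"i:I" for i
  using gfree_quo[OF W' kill E(1)[OF i]] qfree_iso[OF i.hmod_iso_axioms _ qE[OF i]] E(3)[OF i] E(1)[OF i]
  by(auto simp:hopf_subalgebra_def)
 then have "gfree (hquot H Z) (qmod W')"
  using detect qmod_gr[OF W' kill] unfolding detect_property_def by blast
 then have "qfree W' hc" using gfree_quo[OF W' kill hopf_subalgebra_self] quo_hc by simp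
 then have "qfree (msub M Q) hc" by(rule qfree_iso[OF j.hmod_iso_axioms subset_refl])
 then obtain Y where Y:"finite Y" "Y <= (UN i. M.mG i Int Q)"
  and gen:"ALL m:Q. EX f. (ALL x:Y. f x:hc) & m = (SUM x:Y. M.act (f x) x)"
  and ind:"ALL f. (ALL x:Y. f x:hc) --> (SUM x:Y. M.act (f x) x) = 0 --> (ALL x:Y. f x:J)"
  unfolding qfree_def msub_simps by(elim exE conjE)
 \<comment> \<open>A homogeneous component of a preimage under \<open>N\<close> is again a preimage,
   so the lifts can be taken homogeneous.\<close>
 have "EX l j. l:M.mG j & q = M.act N l" if q:"q:Y" for q
 proof -
  obtain i where i:"q:M.mG i" "q:Q" using Y(2) q by blast
  then obtain m where m:"m:M.mV" "q = M.act N m" by(auto simp:Q_def)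
  have "q = hcomp M.mG q i" using i(1) by(simp add:M.m.hcomp_homog)
  also have "... = M.act N (hcomp M.mG m (i - dN))" unfolding m(2) by(rule M.hcomp_act[OF N_hg m(1)])
  finally show ?thesis using M.m.hcomp_G[OF m(1)] by blast
 qed
 then obtain l where l:"!!q. q:Y==>EX j. l q:M.mG j" "!!q. q:Y==>q = M.act N (l q)" by metis
 have lV:"l q:M.mV" if "q:Y" for q using l(1)[OF that] M.mG_mV by blast
 have QV:"q:M.mV" if "q:Y" for q using Y(2) that M.mG_mV by blast
 have injl:"inj_on l Y" by(rule inj_onI) (metis l(2))
 \<comment> \<open>Since \<open>Lam = t * N\<close>, \<open>Lam\<close> acts on a lift
   \<open>l q\<close> as \<open>t\<close> acts on \<open>q\<close>; and \<open>t\<close> is not in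
   \<open>J\<close>, so the test in \<open>free_basisI\<close> reduces to uniqueness modulo
   \<open>J\<close>.\<close>
 obtain t where t:"t:hg (htop - dN)" "t * N = Lam" using left_ideal_Lam[OF N_hg N_neq_0] .
 note thc = hg_hc[OF t(1)]
 have tJ:"t ~: J" using J_N[of t] t(2) Lam_neq_0 by auto
 have tl:"M.act Lam (l q) = M.act t q" if "q:Y" for q
 proof -
  have "M.act Lam (l q) = M.act t (M.act N (l q))" unfolding t(2)[symmetric] by(rule M.act_mult[OF thc N_hc lV[OF that]])
  then show ?thesis using l(2)[OF that] by simp
 qed
 have fb:"M.free_basis (l ` Y)"
 proof (rule M.free_basisI)
  show "finite (l ` Y)" using Y(1) by simp
  show "l ` Y <= (UN i. M.mG i)" using l(1) by blast
  fix c x assume s:"(SUM x:l ` Y. M.sc (c x) (M.act Lam x)) = 0" and "x:l ` Y"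
  then obtain q where q:"q:Y" "x = l q" by blast
  have "(SUM q:Y. M.act (hs (c (l q)) t) q) = (SUM q:Y. M.sc (c (l q)) (M.act Lam (l q)))"
  by(intro sum.cong refl) (simp add:M.act_scale_left[OF thc QV] tl)
  also have "... = 0" using s unfolding sum.reindex[OF injl] o_def .
  finally have z:"(SUM q:Y. M.act (hs (c (l q)) t) q) = 0" .
  have J:"hs (c x) t:J" unfolding q(2) by(rule ind[rule_format,of "%q. hs (c (l q)) t",OF _ z q(1)]) (use thc in simp)
  show "c x = 0"
  proof (rule ccontr)
  assume c:"c x ~= 0"
  have "hs (1 / c x) (hs (c x) t):J" by(rule h.subspace_scale[OF J_sub J])
  then show False using tJ c by simp
  qed
 qed
 obtain K where K:"M.idirect (M.hspan (l ` Y)) K" using M.free_complement[OF fb] .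
 note gP = M.free_gsub[OF fb] and gK = M.idirectD(2)[OF K]
 have lP:"l q:M.hspan (l ` Y)" if "q:Y" for q
  by(rule M.hspan_base) (use Y(1) lV that in auto)
 have QP:"q:M.hspan (l ` Y)" if q:"q:Q" for q
 proof -
  obtain f where f:"ALL x:Y. f x:hc" "q = (SUM x:Y. M.act (f x) x)" using gen q by blast
  have "M.act (f x) x:M.hspan (l ` Y)" if "x:Y" for x
  proof -
  have "M.act N (l x):M.hspan (l ` Y)" by(rule M.gsubD(4)[OF gP N_hc lP[OF that]])
  then have "x:M.hspan (l ` Y)" using l(2)[OF that] by simp
  then show ?thesis by(rule M.gsubD(4)[OF gP f(1)[rule_format,OF that]])
  qed
  then show ?thesis unfolding f(2) by(rule M.m.subspace_sum[OF M.gsubD(1)[OF gP]])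
 qed
 \<comment> \<open>\<open>N k\<close> lies both in \<open>Q\<close>, hence in the free part, and in
   \<open>K\<close>.\<close>
 have NK:"M.act N k = 0" if k:"k:K" for k
  by(rule M.idirectD(3)[OF K QP M.gsubD(4)[OF gK N_hc k]]) (use M.gsubD(2)[OF gK k] in "simp add:Q_def")
 have "I ~= {}" using detect_nonempty[OF ne] detect by auto
 then obtain i where i:"i:I" by blast
 interpret e: hmod_sub s H M "E i" using E(1)[OF i] by unfold_locales
 have NE:"N:E i" using E(2)[OF i] N_Z by blast
 have NEg:"N:hgrade e.HA dN" using NE N_hg by simp
 have pos:"0 < e.HA.htop"
 proof -
  have "~ e.HA.htop < dN" using e.HA.hg_above[of dN] NEg N_neq_0 by auto
  then show ?thesis using dN_pos by simp
 qed
 \<comment> \<open>The integral of \<open>E i\<close> is a left multiple of \<open>N\<close>, so it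
   kills \<open>K\<close>. Thus the free part is also maximal over \<open>E i\<close>, and
   \<open>KF_complement\<close> determines \<open>K\<close>.\<close>
 obtain t' where t':"t':hgrade e.HA (e.HA.htop - dN)" "t' * N = e.HA.Lam" using e.HA.left_ideal_Lam[OF NEg N_neq_0] .
 have LamK:"M.act e.HA.Lam k = 0" if k:"k:K" for k
 proof -
  have "t':hc" using t'(1) e.A_hc by simp
  then have "M.act e.HA.Lam k = M.act t' (M.act N k)"
  unfolding t'(2)[symmetric] using M.gsubD(2)[OF gK k] by(simp add:M.act_mult)
  then show ?thesis using NK[OF k] \<open>t':hc\<close> by simp
 qed
 obtain X where X:"e.R.free_basis X" "e.R.hspan X = M.hspan (l ` Y)" using e.R_free[OF fb] .
 have dir:"e.R.idirect (e.R.hspan X) K" unfolding X(2) by(rule e.R_idirect[OF K])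
 obtain y where y:"y:M.mG 0" "y ~= 0" "e.R.soc y" "K = range (%c. M.sc c y)"
  using e.R.KF_complement[OF pos X(1) dir LamK kf[OF i]] .
 have yK:"y:K" unfolding y(4) by(rule image_eqI[of _ _ 1]) simp_all
 \<comment> \<open>Invariance is known so far over \<open>E i\<close>. Over H it holds because
   \<open>K\<close> is an H-submodule concentrated in degree 0.\<close>
 have "M.soc y"
  unfolding M.soc_def
 proof (intro conjI allI impI M.mG_mV[OF y(1)])
  fix n a assume a:"0 < n" "a:hg n"
  have "M.act a y:K" by(rule M.gsubD(4)[OF gK hg_hc[OF a(2)] yK])
  then obtain c where "M.act a y = M.sc c y" unfolding y(4) by blast
  then have "M.act a y:M.mG 0" using M.m.subspace_scale[OF M.m.subG y(1)] by simp
  moreover have "M.act a y:M.mG n" using M.act_deg[OF a(2) y(1)] by simp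
  ultimately show "M.act a y = 0" using M.m.G_disjoint a(1) by blast
 qed
 then show ?thesis by(rule M.KF_I[OF fb K y(1,2) _ y(4)])
qed

end

subsection \<open>Restriction of endotrivial modules\<close>

lemma gmod_iso_refl:"gmod_iso A M M"
 unfolding gmod_iso_def by(rule exI[of _ "%x. x"]) (simp add:bij_betw_def)

lemma (in hopf) hmod_iff:"hmod s H M \<longleftrightarrow> gr (alg H) M"
 using hopf_axioms by(auto simp:hmod_def hmod_axioms_def)

lemma (in hopf) free_summand_core:
 fixes M :: "('k,'h) umodule" and N :: "('k,'h) umodule"
 assumes M:"hmod s H M" and X:"hmod.free_basis H M X" and K:"hmod.idirect H M (hmod.hspan H M X) K"
  and iso:"hmod_iso s H (msub M K) N u"
 shows "free_summand H M N"
proof -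
 interpret M: hmod s H M by fact
 obtain th where "hmod_iso s H M (dsum (msub M K) (msub M (M.hspan X))) th" using M.idirect_dsum[OF K] .
 from gmod_iso_trans[OF hmod_iso.gmod_iso[OF this] gmod_iso_dsum[OF hmod_iso.gmod_iso[OF iso] gmod_iso_refl]]
 show ?thesis
  unfolding free_summand_def
  using M.hmod_msub[OF M.free_gsub[OF X]] M.gfree_hspan[OF X] by(auto simp:hmod_iff)
qed

lemma (in hopf) endotrivial_hmod:"endotrivial s H M==>hmod s H M"
 by(simp add:endotrivial_iff)

lemma (in hopf) free_summand_self:
 fixes M :: "('k,'h) umodule"
 assumes M:"hmod s H M" shows "free_summand H M M"
proof -
 interpret M: hmod s H M by fact
 have h0:"M.hspan {} = {0}" by(auto simp:M.hspan_def)
 have "M.idirect (M.hspan {}) M.mV"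
  unfolding h0 M.idirect_def using M.gsub_0 M.gsub_mV by force
 moreover have eq:"msub M M.mV = M"
 proof -
  have "(%i. M.mG i Int M.mV) = M.mG" using M.mG_mV by blast
  then show ?thesis by(simp add:msub_def)
 qed
 moreover have "hmod_iso s H M M (%x. x)"
  by(intro hmod_iso.intro M hmod_iso_axioms.intro) (auto simp:bij_betw_def)
 ultimately show ?thesis using free_summand_core[OF M M.free_basis_empty,of M.mV M "%x. x"] by simp
qed

lemma (in hopf) stable_equiv:"equiv {M. endotrivial s H M} (stable_equiv s H)"
proof -
 let ?R = "{(M,N). endotrivial s H M & endotrivial s H N & (free_summand H M N | free_summand H N M)}"
 have "?R <= {M. endotrivial s H M} \<times> {M. endotrivial s H M}" by auto
 then have sub:"?R\<^sup>+ <= {M. endotrivial s H M} \<times> {M. endotrivial s H M}" by(rule trancl_subset_Sigma)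
 have "refl_on {M. endotrivial s H M} (?R\<^sup>+)"
  using free_summand_self endotrivial_hmod by(auto intro!:refl_onI r_into_trancl)
 moreover have "sym (?R\<^sup>+)" by(rule sym_trancl) (auto simp:sym_def)
 ultimately show ?thesis using sub by(auto simp:equiv_def stable_equiv_def trans_trancl)
qed

text \<open>Sweedler sums of bilinear functions over a Hopf subalgebra agree with those over H, so
  Hom commutes with restriction.\<close>

lemma (in hpair) ghom_sub:
 assumes E:"hopf_subalgebra H A" and h:"h:A" and f:"f:LV"
 shows "mact (ghom s (subhopf H A) N M) h f = Lact h f"
proof -
 interpret E: hopf_sub s H A using E by unfold_locales
 have tw:"twist s E.HA j b = twist s H j b" if "b:A" for j b
  unfolding twist_def E.HA_simps by(rule E.sub_hext[OF that])
 have ha:"homact s E.HA N M h j g v = homact s H N M h j g v" if g:"g:LV" for j g v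
 proof (cases "v:N.mV")
  case True
  have "sweedler E.HA (%a b. M.act a (g (N.act (M.S (twist s E.HA j b)) v))) h
  = sweedler E.HA (%a b. M.act a (g (N.act (M.S (twist s H j b)) v))) h"
  by(rule E.sub_sweedler_cong) (simp add:tw)
  also have "... = sweedler H (%a b. M.act a (g (N.act (M.S (twist s H j b)) v))) h"
  by(rule E.sub_sweedler[OF M.m.vector_space_axioms homact_bilinear[OF g True] h])
  finally show ?thesis by(simp add:homact_def)
 qed (simp add:homact_def)
 have "hext LG (homact s E.HA N M h) f = hext LG (homact s H N M h) f"
  by(rule Lg.hext_cong[OF f]) (rule ext,rule ha[OF LG_LV])
 then show ?thesis by(simp add:ghom_def)
qed

lemma (in hpair) ghom_sub_iso:
 assumes E:"hopf_subalgebra H A"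
 shows "hmod_iso s (subhopf H A) L (ghom s (subhopf H A) N M) (%f. f)"
  and "hmod_iso s (subhopf H A) (ghom s (subhopf H A) N M) L (%f. f)"
  and "hmod s (subhopf H A) M" "hmod s (subhopf H A) N"
proof -
 interpret m: hmod_sub s H M A using E by unfold_locales
 interpret n: hmod_sub s H N A using E by unfold_locales
 interpret l: hmod_sub s H L A using E by unfold_locales
 show "hmod s (subhopf H A) M" "hmod s (subhopf H A) N" by(rule m.hmod_restrict n.hmod_restrict)+
 interpret P: hpair s "subhopf H A" M N using m.hmod_restrict n.hmod_restrict by(simp add:hpair_def)
 have i:"bij_betw (%f. f) LV LV" by(simp add:bij_betw_def)
 show "hmod_iso s (subhopf H A) L (ghom s (subhopf H A) N M) (%f. f)"
  by(intro hmod_iso.intro hmod_iso_axioms.intro l.hmod_restrict P.hmod_ghom)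
  (simp_all add:i ghom_sub[OF E] m.HA_simps)
 show "hmod_iso s (subhopf H A) (ghom s (subhopf H A) N M) L (%f. f)"
  by(intro hmod_iso.intro hmod_iso_axioms.intro l.hmod_restrict P.hmod_ghom)
  (simp_all add:i ghom_sub[OF E] m.HA_simps)
qed

section \<open>Restriction of equivalences, and properties carried along chains\<close>

context hopf
begin

lemma endotrivial_sub:
 assumes E:"hopf_subalgebra H E" and M:"endotrivial s H M"
 shows "endotrivial s (subhopf H E) M"
proof -
 interpret E: hopf_sub s H E using E by unfold_locales
 interpret P: hpair s H M M using M endotrivial_hmod by(simp add:hpair_def)
 interpret l: hmod_sub s H P.L E using E by unfold_locales
 have "l.R.KF" using l.R_KF M endotrivial_iff by blast
 then have "hmod.KF (subhopf H E) (ghom s (subhopf H E) M M)" by(rule hmod_iso.KF[OF P.ghom_sub_iso(1)[OF E]])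
 then show ?thesis using E.HA.endotrivial_iff P.ghom_sub_iso(3)[OF E] by blast
qed

lemma free_summand_sub:
 assumes E:"hopf_subalgebra H E" and f:"free_summand H M N"
 shows "free_summand (subhopf H E) M N"
proof -
 interpret E: hopf_sub s H E using E by unfold_locales
 obtain F :: "('k,'h) umodule" where F:"gr (alg H) F" "gfree (alg H) F" "gmod_iso (alg H) M (dsum N F)"
  using f unfolding free_summand_def by blast
 have "hmod s H F" using F(1) by(simp add:hmod_iff)
 then interpret f: hmod_sub s H F E using E by(simp add:hmod_sub_def hopf_sub_def hopf_sub_axioms_def hopf_axioms)
 have "gr (alg E.HA) F" using f.hmod_restrict E.HA.hmod_iff by blast
 moreover have "gmod_iso (alg E.HA) M (dsum N F)"
  using F(3) E.A_hc unfolding gmod_iso_def alg_simps E.HA_simps by blast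
 ultimately show ?thesis unfolding free_summand_def using f.R_gfree[OF F(2)] by blast
qed

lemma stable_equiv_sub:
 assumes E:"hopf_subalgebra H E"
 shows "stable_equiv s H <= stable_equiv s (subhopf H E)"
 unfolding stable_equiv_def
 by(rule trancl_mono_subset) (auto intro: endotrivial_sub[OF E] free_summand_sub[OF E])

text \<open>A free summand of the target is invisible to both properties: to the first by
  \<open>KF_right\<close>, to the second by treating \<open>M'\<close> as a retract of
  \<open>M\<close> with free remainder.\<close>

lemma summand_step:
 fixes M M' N :: "('k,'h) umodule"
 assumes pos:"htop > 0" and h:"hmod s H M" "hmod s H M'" "hmod s H N" and f:"free_summand H M M'"
 shows "hmod.KF H (ghom s H N M) \<longleftrightarrow> hmod.KF H (ghom s H N M')" "socle_faithful s H N M \<longleftrightarrow> socle_faithful s H N M'"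
proof -
 interpret P: hpair s H M N using h by(simp add:hpair_def)
 interpret P': hpair s H M' N using h by(simp add:hpair_def)
 obtain F :: "('k,'h) umodule" where F:"gr (alg H) F" "gfree (alg H) F" "gmod_iso (alg H) M (dsum M' F)"
  using f unfolding free_summand_def by blast
 obtain X i q K where X:"P.M.free_basis X" and i:"hlin H M' M i" and q:"hlin H M M' q"
  and qi:"!!m. m:mcarrier M'==>q (i m) = m" "!!v. v:mcarrier M==>v - i (q v):P.M.hspan X"
  and K:"P.M.idirect (P.M.hspan X) K" and iso:"hmod_iso s H (msub M K) M' q"
  using free_summandE[OF h(1,2) _ F(2,3)] F(1) unfolding hmod_iff by blast
 interpret k: hmod_iso s H "msub M K" M' q by(rule iso)
 interpret k': hmod_iso s H M' "msub M K" "inv_into (mcarrier (msub M K)) q" by(rule k.inverse)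
 interpret PK: hpair s H "msub M K" N using k.M.hmod_axioms h by(simp add:hpair_def)
 show "P.L.KF \<longleftrightarrow> P'.L.KF"
  using P.KF_right[OF pos X K] PK.KF_iso_right[OF iso] P'.KF_iso_right[OF k'.hmod_iso_axioms] by blast
 show "socle_faithful s H N M \<longleftrightarrow> socle_faithful s H N M'"
  using P.socle_faithful_retract[where i = i and q = q,OF h(2) i q qi(1)]
  P.socle_faithful_free[where i = i and q = q,OF h(2) i q X qi(2)] by blast
qed

text \<open>Equivalence is a transitive closure, so both properties are carried along a chain,
  starting from the pair \<open>(N, N)\<close>.\<close>

lemma stable_chain:
 assumes pos:"htop > 0" and e:"(N,M):stable_equiv s H"
 shows "hmod.KF H (ghom s H N M) & socle_faithful s H N M"
 using e unfolding stable_equiv_def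
proof (induction rule: trancl_induct)
 case (base M)
 then have e:"endotrivial s H N" "endotrivial s H M" "free_summand H N M | free_summand H M N" by auto
 note h = endotrivial_hmod[OF e(1)] endotrivial_hmod[OF e(2)]
 have "hmod.KF H (ghom s H N N)" using e(1) endotrivial_iff by blast
 moreover from this have "socle_faithful s H N N" by(rule hmod.socle_faithful_self[OF h(1)])
 ultimately show ?case using summand_step[OF pos h(1,2,1)] summand_step[OF pos h(2,1,1)] e(3) by blast
next
 case (step M M')
 then have e:"endotrivial s H M" "endotrivial s H M'" "free_summand H M M' | free_summand H M' M" by auto
 note h = endotrivial_hmod[OF e(1)] endotrivial_hmod[OF e(2)]
 have "(N,M):stable_equiv s H" using step.hyps(1) by(simp add:stable_equiv_def)
 then have "endotrivial s H N" using equiv_type[OF stable_equiv] by blast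
 then have n:"hmod s H N" by(rule endotrivial_hmod)
 show ?case using summand_step[OF pos h n] summand_step[OF pos h(2,1) n] e(3) step.IH by blast
qed

end

text \<open>\<open>left_ideal_Lam\<close> gives \<open>Lam = t * HA.Lam\<close>; applying the
  antipode moves the integral of \<open>A\<close> to the left.\<close>

lemma (in hopf_sub) Lam_factor:"EX y:hc. Lam = HA.Lam * y"
proof -
 have Ah:"HA.Lam:hg HA.htop" using HA.Lam_hg by simp
 obtain t where t:"t:hg (htop - HA.htop)" "t * HA.Lam = Lam" using left_ideal_Lam[OF Ah HA.Lam_neq_0] .
 obtain ka where k:"S HA.Lam = hs ka HA.Lam" using HA.S_Lam by auto
 obtain ka' where k':"S Lam = hs ka' Lam" "ka' ~= 0" using S_Lam by blast
 have St:"S t:hc" "HA.Lam:hc" using hg_hc[OF t(1)] hg_hc[OF Ah] by auto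
 have "hs ka' Lam = S (t * HA.Lam)" using t(2) k'(1) by simp
 also have "... = hs (xsign s (htop - HA.htop) HA.htop) (hs ka HA.Lam * S t)" unfolding S_mult[OF t(1) Ah] k ..
 also have "... = HA.Lam * hs (xsign s (htop - HA.htop) HA.htop * ka) (S t)"
  using St by(simp add:scale_mult_left scale_mult_right)
 finally have "hs (1 / ka') (hs ka' Lam) = HA.Lam * hs (1 / ka') (hs (xsign s (htop - HA.htop) HA.htop * ka) (S t))"
  using St by(simp add:scale_mult_right)
 then have "Lam = HA.Lam * hs (1 / ka') (hs (xsign s (htop - HA.htop) HA.htop * ka) (S t))" using k'(2) by simp
 then show ?thesis by(rule bexI) (use St in simp)
qed

section \<open>Indivisibility of the identity, and composites of stable maps\<close>

context hmod
begin

abbreviation "idm == (%v. if v:mV then v else 0)"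

text \<open>If the identity were \<open>Lam psi\<close>, the invariant \<open>x\<close> outside the
  free part would be \<open>Lam (x psi)\<close>. Writing \<open>x psi = p + c x\<close> and using
  that \<open>Lam\<close> kills \<open>x\<close>, one finds \<open>x = Lam p\<close> in the free
  part.\<close>

lemma id_notin:
 assumes pos:"htop > 0" and kf:"hmod.KF H (ghom s H M M)"
 shows "idm ~: mact (ghom s H M M) Lam ` homcarrier M M"
proof
 interpret P: hpair s H M M by unfold_locales
 assume "idm:P.Lact Lam ` P.LV"
 then obtain psi where psi:"psi:P.LV" "idm = P.Lact Lam psi" by blast
 obtain X x where X:"P.L.free_basis X" and x:"x:P.L.mG 0" "x ~= 0" "P.L.soc x" "x ~: P.L.hspan X"
  and dec:"ALL m:P.L.mV. EX p:P.L.hspan X. EX c. m = p + P.L.sc c x"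
  using kf unfolding P.L.KF_def by(elim exE conjE)
 have xG:"x:P.LG 0" and xL:"x:P.LV" using x(1) P.LG_LV by auto
 note gP = P.L.free_gsub[OF X]
 have hx:"hlin H M M x" by(rule P.soc_hlin[OF xG x(3)])
 let ?phi = "%v. x (psi v)"
 have phi:"?phi:P.LV" by(rule P.hlin_post(1)[OF hmod_axioms hx psi(1)])
 have "x = (%v. x (idm v))" by(rule ext) (simp add:P.LVD(3)[OF xL] P.LV_0[OF xL])
 also have "... = P.Lact Lam ?phi"
  unfolding P.hlin_post(3)[OF hmod_axioms hx Lam_hc psi(1)] by(rule ext) (rule arg_cong[OF fun_cong[OF psi(2)]])
 finally have e:"x = P.Lact Lam ?phi" .
 have "?phi:P.L.mV" using phi by simp
 from dec[rule_format,OF this] obtain p c where pc:"p:P.L.hspan X" "?phi = p + P.L.sc c x" by blast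
 have pV:"p:P.L.mV" "P.L.sc c x:P.L.mV" "x:P.L.mV"
  using P.L.gsubD(2)[OF gP pc(1)] P.L.mV_scale[OF P.L.mG_mV[OF x(1)]] P.L.mG_mV[OF x(1)] by blast+
 have "P.Lact Lam ?phi = P.Lact Lam p + P.L.sc c (P.Lact Lam x)"
  unfolding pc(2) P.L.act_add[OF Lam_hc pV(1,2)] P.L.act_scale[OF Lam_hc pV(3)] ..
 also have "P.Lact Lam x = P.L.sc (eps Lam) x" by(rule P.L.soc_act[OF x(3) Lam_hc])
 finally have "P.Lact Lam ?phi = P.Lact Lam p + P.L.sc c (P.L.sc (eps Lam) x)" .
 note e' = trans[OF e this]
 have "eps Lam = 0" using counit_hg[OF Lam_hg] pos by simp
 then have z:"P.L.sc c (P.L.sc (eps Lam) x) = 0" by(simp only: P.L.m.scale_zero_left P.L.m.scale_zero_right)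
 have xp:"x = P.Lact Lam p" using e' unfolding z add_0_right .
 show False using P.L.gsubD(4)[OF gP Lam_hc pc(1)] x(4) unfolding xp[symmetric] by blast
qed

text \<open>Otherwise every invariant is a \<open>Lam\<close>-multiple, which makes \<open>M\<close>
  free; then \<open>Hom(M, M)\<close> is free and its invariant, the identity, is divisible by
  \<open>Lam\<close>, against \<open>id_notin\<close>.\<close>

lemma soc_exists:
 assumes pos:"htop > 0" and kf:"hmod.KF H (ghom s H M M)"
 obtains x where "soc x" "x ~: act Lam ` mV"
proof (rule ccontr)
 assume "~ thesis"
 then have all:"x:act Lam ` mV" if "soc x" for x using that \<open>!!x. soc x==>x ~: act Lam ` mV==>thesis\<close> by blast
 interpret P: hpair s H M M by unfold_locales
 obtain X K where X:"free_basis X" and K:"idirect (hspan X) K" and K0:"!!k. k:K==>act Lam k = 0" using decomposition by blast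
 note gP = idirectD(1)[OF K] and gK = idirectD(2)[OF K]
 have Kz:"k = 0" if k:"k:K" for k
 proof (rule ccontr)
  assume "k ~= 0"
  then obtain y i where y:"y:K" "y:mG i" "y ~= 0" "soc y" using socle_nonzero[OF gK k] by blast
  obtain w where w:"w:mV" "y = act Lam w" using all[OF y(4)] by blast
  obtain p k where pk:"p:hspan X" "k:K" "w = p + k" using idirectD(4)[OF K w(1)] by blast
  have "y = act Lam p" unfolding w(2) pk(3) using gsubD(2)[OF gP pk(1)] gsubD(2)[OF gK pk(2)] K0[OF pk(2)] by(simp add:act_add)
  then have "y:hspan X" using gsubD(4)[OF gP Lam_hc pk(1)] by simp
  then show False using idirectD(3)[OF K _ y(1)] y(3) by blast
 qed
 have sp:"v:hspan X" if "v:mV" for v using idirectD(4)[OF K that] Kz by fastforce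
 obtain Y where Y:"P.L.free_basis Y" "P.L.hspan Y = P.hsub {0} (hspan X)" using P.ghom_free_right[OF X] .
 have idL:"idm:P.LV" by(rule P.LVI) auto
 have "hlin H M M idm" using mG_mV by(auto simp:hlin_def)
 note ids = P.hlin_soc[OF this idL]
 have "idm:P.L.hspan Y" unfolding Y(2) using idL sp by(auto simp:P.hsub_def)
 then obtain t where "idm = (SUM x:Y. P.L.sc (t x) (P.Lact Lam x))" "idm = P.Lact Lam (SUM x:Y. P.L.sc (t x) x)"
  "(SUM x:Y. P.L.sc (t x) x):P.L.hspan Y" by(rule P.L.soc_free[OF Y(1) _ ids(2)])
 note t = this
 have "(SUM x:Y. P.L.sc (t x) x):P.LV" using P.L.gsubD(2)[OF P.L.free_gsub[OF Y(1)] t(3)] unfolding P.L_simps .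
 with t(2) have "idm:P.Lact Lam ` P.LV" by(rule image_eqI)
 then show False using id_notin[OF pos kf] by blast
qed

end

text \<open>By \<open>KF_soc\<close> the composite is \<open>c\<close> times the identity plus a
  \<open>Lam\<close>-multiple. If \<open>c = 0\<close>, take an invariant \<open>x\<close> over
  \<open>A\<close> that is not divisible by the integral of \<open>A\<close>: by faithfulness
  neither are \<open>f x\<close> and \<open>f' (f x)\<close>, whereas a \<open>Lam\<close>-multiple
  takes a divisible value there.\<close>

lemma (in hpair) compose_scalar:
 assumes pos:"M.htop > 0" and E:"hopf_subalgebra H A" and Epos:"hopf.htop (subhopf H A) > 0"
  and kf:"hmod.KF H (ghom s H N N)" and f:"hlin H N M f" "f:LV" and f':"hlin H M N f'" "f':homcarrier M N"
  and sf:"socle_faithful s (subhopf H A) N M" and sf':"socle_faithful s (subhopf H A) M N"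
  and nf:"f ~: Lact (hopf.Lam (subhopf H A)) ` LV"
  and nf':"f' ~: mact (ghom s H M N) (hopf.Lam (subhopf H A)) ` homcarrier M N"
 obtains c psi where "c ~= 0" "psi:homcarrier N N" "!!v. v:N.mV==>f' (f v) = N.sc c v + mact (ghom s H N N) M.Lam psi v"
proof -
 interpret NN: hpair s H N N by unfold_locales
 interpret NM: hpair s H N M by unfold_locales
 interpret m: hmod_sub s H M A using E by unfold_locales
 interpret n: hmod_sub s H N A using E by unfold_locales
 interpret e: hpair s m.HA M N using m.hmod_restrict n.hmod_restrict by(simp add:hpair_def)
 interpret e': hpair s m.HA N M using m.hmod_restrict n.hmod_restrict by(simp add:hpair_def)
 interpret nn: hpair s m.HA N N using n.hmod_restrict by(simp add:hpair_def)
 interpret l: hmod_sub s H NN.L A using E by unfold_locales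
 have AE:"m.HA.Lam:A" using m.HA.Lam_hc by simp
 have "l.R.KF" by(rule l.R_KF[OF kf])
 then have kfE:"hmod.KF m.HA (ghom s m.HA N N)" by(rule hmod_iso.KF[OF NN.ghom_sub_iso(1)[OF E]])
 let ?id = "%v. if v:N.mV then v else 0"
 have idL:"?id:NN.LV" by(rule NN.LVI) auto
 have "hlin H N N ?id" using N.mG_mV by(auto simp:hlin_def)
 note ids = NN.hlin_soc[OF this idL]
 let ?g = "%v. f' (f v)"
 have gL:"?g:NN.LV" by(rule hlin_post(1)[OF N.hmod_axioms f'(1) f(2)])
 note gs = NN.hlin_soc[OF hlin_compose[OF f(1) f'(1)] gL]
 have n:"?id ~: NN.Lact M.Lam ` NN.L.mV" using N.id_notin[OF pos kf] by simp
 obtain c psi where c':"psi:NN.L.mV" "?g = NN.L.sc c ?id + NN.Lact M.Lam psi"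
  using NN.L.KF_soc[OF kf ids(2) gs(2) n] .
 note c = c'[unfolded NN.L_simps]
 have val:"f' (f v) = N.sc c v + NN.Lact M.Lam psi v" if "v:N.mV" for v
  using fun_cong[OF c(2),of v] that by simp
 have "c ~= 0"
 proof
  assume c0:"c = 0"
  obtain x where x:"n.R.soc x" "x ~: N.act m.HA.Lam ` N.mV" using n.R.soc_exists[OF Epos kfE] .
  have xV:"x:N.mV" using x(1) by(simp add:n.R.soc_def)
  have hf:"hlin m.HA N M f" "hlin m.HA M N f'" using f(1) f'(1) m.A_hc by(auto simp:hlin_def)
  have ef:"f ~: e.Lact m.HA.Lam ` LV"
  proof
  assume "f:e.Lact m.HA.Lam ` LV"
  then obtain phi where "phi:LV" "f = e.Lact m.HA.Lam phi" by blast
  then show False using nf ghom_sub[OF E AE] by auto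
  qed
  have ef':"f' ~: e'.Lact m.HA.Lam ` NM.LV"
  proof
  assume "f':e'.Lact m.HA.Lam ` NM.LV"
  then obtain phi where "phi:NM.LV" "f' = e'.Lact m.HA.Lam phi" by blast
  then show False using nf' NM.ghom_sub[OF E AE] by auto
  qed
  have fx:"f x ~: M.act m.HA.Lam ` M.mV"
  using e.socle_faithfulD[OF sf e.hlin_soc[OF hf(1) f(2)] ef x(1)] x(2) by blast
  have "m.R.soc (f x)"
  unfolding m.R.soc_def
  proof (intro conjI allI impI hlinD(1)[OF f(1) xV])
  fix k a assume a:"0 < k" "a:hgrade m.HA k"
  have "N.act a x = 0" using x(1) a unfolding n.R.soc_def by blast
  moreover have "a:M.hc" using a(2) m.A_hc by simp
  ultimately show "M.act a (f x) = 0" using hlinD(3)[OF f(1) _ xV] hlin_0[OF f(1)] by metis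
  qed
  then have nf'x:"f' (f x) ~: N.act m.HA.Lam ` N.mV"
  using e'.socle_faithfulD[OF sf' e'.hlin_soc[OF hf(2) f'(2)] ef'] fx by blast
  \<comment> \<open>With the integral of \<open>A\<close> on the left of \<open>Lam\<close>,
    divisibility over H implies divisibility over \<open>A\<close>.\<close>
  obtain y where y:"y:M.hc" "M.Lam = m.HA.Lam * y" using m.Lam_factor by blast
  have yL:"NN.Lact y psi:NN.LV" by(rule NN.Lact_LV[OF c(1) y(1)])
  have "f' (f x) = NN.Lact M.Lam psi x" using val[OF xV] c0 by simp
  also have "NN.Lact M.Lam psi = NN.Lact m.HA.Lam (NN.Lact y psi)"
  unfolding y(2) by(rule NN.Lact_mult[OF c(1) m.A_hc[OF AE] y(1)])
  also have "... = nn.Lact m.HA.Lam (NN.Lact y psi)" by(rule NN.ghom_sub[OF E AE yL,symmetric])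
  also have "... x = N.act m.HA.Lam (NN.Lact y psi x)" by(rule nn.Lact_Lam_soc[OF yL x(1)])
  finally show False using nf'x NN.LVD(2)[OF yL xV] by blast
 qed
 then show thesis using that c(1) val by blast
qed

section \<open>From equivalence over the subalgebras to equivalence over H\<close>

context hopf_normal
begin

lemma htop_pos:
 assumes "hopf_subalgebra H E" "Z <= E"
 shows "hopf.htop (subhopf H E) > 0"
proof -
 interpret E: hopf_sub s H E using assms(1) by unfold_locales
 have "N:hgrade E.HA dN" using N_hg N_Z assms(2) by auto
 then have "~ E.HA.htop < dN" using E.HA.hg_above[of dN] N_neq_0 by auto
 then show ?thesis using dN_pos by simp
qed

text \<open>\<open>f\<close> generates the line in \<open>Hom(N, M)\<close> given by
  \<open>detect_KF\<close>. If it were divisible by the integral of some \<open>E i\<close>, it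
  would fall into the free part, because that integral has positive degree and kills
  \<open>f\<close>.\<close>

lemma stable_hom:
 fixes M N :: "('k,'h) umodule" and E :: "'i => 'h set"
 assumes hM:"hmod s H M" and hN:"hmod s H N" and ne:"Z ~= hc" and detect:"detect_property (hquot H Z) (B ` I)"
  and E:"!!i. i:I==>hopf_subalgebra H (E i)" "!!i. i:I==>Z <= E i" "!!i. i:I==>cl ` E i = B i"
  and st:"!!i. i:I==>(N,M):stable_equiv s (subhopf H (E i))"
 obtains f where "hlin H N M f" "f:homcarrier N M"
  "!!i. i:I==>f ~: mact (ghom s H N M) (hopf.Lam (subhopf H (E i))) ` homcarrier N M"
  "!!i. i:I==>socle_faithful s (subhopf H (E i)) N M"
proof -
 interpret P: hpair s H M N using hM hN by(simp add:hpair_def)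
 have ch:"hmod.KF (subhopf H (E i)) (ghom s (subhopf H (E i)) N M) & socle_faithful s (subhopf H (E i)) N M" if i:"i:I" for i
 proof -
  interpret e: hopf_sub s H "E i" using E(1)[OF i] by unfold_locales
  show ?thesis by(rule e.HA.stable_chain[OF htop_pos[OF E(1,2)[OF i]] st[OF i]])
 qed
 have kfL:"hmod.KF (subhopf H (E i)) P.L" if i:"i:I" for i
  using hmod_iso.KF[OF P.ghom_sub_iso(2)[OF E(1)[OF i]]] ch[OF i] by blast
 have "P.L.KF" by(rule detect_KF[OF P.hmod_ghom ne detect E kfL])
 then obtain X x where X:"P.L.free_basis X" and x:"x:P.L.mG 0" "x ~= 0" "P.L.soc x" "x ~: P.L.hspan X"
  and dec:"ALL m:P.L.mV. EX p:P.L.hspan X. EX c. m = p + P.L.sc c x"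
  unfolding P.L.KF_def by(elim exE conjE)
 have xG:"x:P.LG 0" and xL:"x:P.LV" using x(1) P.LG_LV by auto
 note gP = P.L.free_gsub[OF X]
 have "x ~: P.Lact (hopf.Lam (subhopf H (E i))) ` P.LV" if i:"i:I" for i
 proof
  interpret e: hmod_sub s H P.L "E i" using E(1)[OF i] by unfold_locales
  assume "x:P.Lact e.HA.Lam ` P.LV"
  then obtain phi where phi:"phi:P.L.mV" "x = P.Lact e.HA.Lam phi" by auto
  obtain p c where pc:"p:P.L.hspan X" "phi = p + P.L.sc c x" using dec[rule_format,OF phi(1)] by blast
  have Ah:"e.HA.Lam:hg e.HA.htop" using e.HA.Lam_hg by simp
  have Ahc:"e.HA.Lam:hc" by(rule hg_hc[OF Ah])
  have xV:"x:P.L.mV" using xL by simp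
  have 0:"P.Lact e.HA.Lam x = 0" using x(3) Ah htop_pos[OF E(1,2)[OF i]] unfolding P.L.soc_def by blast
  have "x = P.Lact e.HA.Lam p + P.L.sc c (P.Lact e.HA.Lam x)"
  using phi(2) unfolding pc(2) P.L.act_add[OF Ahc P.L.gsubD(2)[OF gP pc(1)] P.L.mV_scale[OF xV]] P.L.act_scale[OF Ahc xV] .
  then have xp:"x = P.Lact e.HA.Lam p" unfolding 0 by(simp only: P.L.m.scale_zero_right add_0_right)
  show False using P.L.gsubD(4)[OF gP Ahc pc(1)] x(4) unfolding xp[symmetric] by blast
 qed
 then show thesis by(rule that[OF P.soc_hlin[OF xG x(3)] xL]) (use ch in blast)+
qed

text \<open>Both modules are the complement \<open>msub M M0\<close> plus a free module, up to
  isomorphism, so two steps through this endotrivial module connect them.\<close>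

lemma stable_equiv_detect:
 fixes M N :: "('k,'h) umodule" and E :: "'i => 'h set"
 assumes M:"endotrivial s H M" and N:"endotrivial s H N" and ne:"Z ~= hc" and detect:"detect_property (hquot H Z) (B ` I)"
  and E:"!!i. i:I==>hopf_subalgebra H (E i)" "!!i. i:I==>Z <= E i" "!!i. i:I==>cl ` E i = B i"
  and st:"!!i. i:I==>(M,N):stable_equiv s (subhopf H (E i))"
 shows "(M,N):stable_equiv s H"
proof -
 note hM = endotrivial_hmod[OF M] and hN = endotrivial_hmod[OF N]
 interpret P: hpair s H M N using hM hN by(simp add:hpair_def)
 interpret P': hpair s H N M using hM hN by(simp add:hpair_def)
 have kfM:"hmod.KF H (ghom s H M M)" and kfN:"hmod.KF H (ghom s H N N)" using M N endotrivial_iff by blast+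
 have st':"(N,M):stable_equiv s (subhopf H (E i))" if i:"i:I" for i
 proof -
  interpret e: hopf_sub s H "E i" using E(1)[OF i] by unfold_locales
  show ?thesis using e.HA.stable_equiv st[OF i] by(auto simp:equiv_def sym_def)
 qed
 obtain f where f:"hlin H N M f" "f:P.LV" "!!i. i:I==>f ~: P.Lact (hopf.Lam (subhopf H (E i))) ` P.LV"
  "!!i. i:I==>socle_faithful s (subhopf H (E i)) N M" using stable_hom[OF hM hN ne detect E st'] by blast
 obtain f' where f':"hlin H M N f'" "f':P'.LV" "!!i. i:I==>f' ~: P'.Lact (hopf.Lam (subhopf H (E i))) ` P'.LV"
  "!!i. i:I==>socle_faithful s (subhopf H (E i)) M N" using stable_hom[OF hN hM ne detect E st] by blast
 have pos:"htop > 0" using htop_pos[OF hopf_subalgebra_self] A_hc unfolding subhopf_self by blast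
 have "I ~= {}" using detect_nonempty[OF ne] detect by auto
 then obtain i where i:"i:I" by blast
 note Ei = E(1)[OF i] htop_pos[OF E(1,2)[OF i]]
 obtain c psi where c:"c ~= 0" "psi:homcarrier N N" "!!v. v:P.N.mV==>f' (f v) = P.N.sc c v + mact (ghom s H N N) Lam psi v"
  using P.compose_scalar[OF pos Ei kfN f(1,2) f'(1,2) f(4)[OF i] f'(4)[OF i] f(3)[OF i] f'(3)[OF i]] by blast
 obtain c' psi' where c':"c' ~= 0" "psi':homcarrier M M" "!!v. v:P.M.mV==>f (f' v) = P.M.sc c' v + mact (ghom s H M M) Lam psi' v"
  using P'.compose_scalar[OF pos Ei kfM f'(1,2) f(1,2) f'(4)[OF i] f(4)[OF i] f'(3)[OF i] f(3)[OF i]] by blast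
 obtain X M0 where X:"P.M.free_basis X" "P.M.idirect (P.M.hspan X) M0" "!!k. k:M0==>P.M.act Lam k = 0" using P.M.decomposition by blast
 obtain Y N0 where Y:"P.N.free_basis Y" "P.N.idirect (P.N.hspan Y) N0" "!!k. k:N0==>P.N.act Lam k = 0" using P.N.decomposition by blast
 obtain u where u:"hmod_iso s H (msub M M0) (msub N N0) u"
  using P.cores_iso[OF f(1) f'(1) c c' X(2,1,3) Y(2,1,3)] .
 interpret u: hmod_iso s H "msub M M0" "msub N N0" u by(rule u)
 note hW = P.M.hmod_msub[OF P.M.idirectD(2)[OF X(2)]]
 interpret MM: hpair s H M M by unfold_locales
 interpret WM: hpair s H "msub M M0" M using hW hM by(simp add:hpair_def)
 \<comment> \<open>The free part is removed first from the target and then from the source of the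
   linear maps.\<close>
 have "endotrivial s H (msub M M0)"
  using MM.KF_right[OF pos X(1,2)] WM.KF_left[OF pos X(1,2)] kfM hW endotrivial_iff by blast
 moreover have "hmod_iso s H (msub M M0) (msub M M0) (%x. x)"
  by(intro hmod_iso.intro hW hmod_iso_axioms.intro) (auto simp:bij_betw_def)
 then have "free_summand H M (msub M M0)" by(rule free_summand_core[OF hM X(1,2)])
 moreover have "free_summand H N (msub M M0)" by(rule free_summand_core[OF hN Y(1,2) u.inverse])
 ultimately have "(M,msub M M0):stable_equiv s H" "(msub M M0,N):stable_equiv s H"
  using M N unfolding stable_equiv_def by(auto intro: r_into_trancl)
 then show ?thesis unfolding stable_equiv_def by(rule trancl_trans)
qed

end

theorem theorem3p14:
  fixes H :: "('k::field, 'h::ring_1) hopf"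
    and s :: 'k
    and p :: nat
    and Z :: "'h set"
    and I :: "'i set"
    and B :: "'i \<Rightarrow> 'h set set"
    and E :: "'i \<Rightarrow> 'h set"
  assumes char: "CHAR('k) = p" "p > 0"
    and sign: "s = 1 \<or> s = -1"
    and H: "hopf_algebra s H"
    and Z: "normal_hopf_subalgebra H Z" "Z \<noteq> range (\<lambda>c. hscale H c 1)" "Z \<noteq> hcarrier H"
    and detect: "detect_property (hquot H Z) (B ` I)"
    and E: "\<And>i. i \<in> I \<Longrightarrow> hopf_subalgebra H (E i)"
           "\<And>i. i \<in> I \<Longrightarrow> Z \<subseteq> E i"
           "\<And>i. i \<in> I \<Longrightarrow> qclass H Z ` E i = B i"
  shows "restriction_map s H (E ` I) \<in>
           carrier (endotrivial_group s H) \<rightarrow>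
           carrier (product_group (E ` I) (\<lambda>E'. endotrivial_group s (subhopf H E')))
         \<and> inj_on (restriction_map s H (E ` I)) (carrier (endotrivial_group s H))"
proof -
 interpret hopf_normal s H Z
  using sign H Z(1,2) by unfold_locales (simp_all add:normal_hopf_subalgebra_def)
 let ?S = "stable_equiv s H" and ?SE = "%E'. stable_equiv s (subhopf H E')"
 have carr:"carrier (endotrivial_group s H') = {M. endotrivial s H' M} // stable_equiv s H'" for H' :: "('k,'h) hopf"
  by(simp add:endotrivial_group_def)
 have eqE:"equiv {M. endotrivial s (subhopf H (E i)) M} (?SE (E i))" if i:"i:I" for i
 proof -
  interpret e: hopf_sub s H "E i" using E(1)[OF i] by unfold_locales
  show ?thesis by(rule e.HA.stable_equiv)
 qed
 \<comment> \<open>Equivalence over H implies equivalence over each \<open>E i\<close>, so the union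
   in \<open>restriction_map\<close> collapses to a single class.\<close>
 have val:"restriction_map s H (E ` I) (?S `` {M}) = (\<lambda>E'\<in>E ` I. ?SE E' `` {M})" if M:"endotrivial s H M" for M
  unfolding restriction_map_def
 proof (rule restrict_ext)
  fix E' assume "E':E ` I"
  then obtain i where i:"i:I" "E' = E i" by blast
  have "?SE (E i) `` {M'} = ?SE (E i) `` {M}" if "M':?S `` {M}" for M'
  using equiv_class_eq[OF eqE[OF i(1)],of M M'] stable_equiv_sub[OF E(1)[OF i(1)]] that by auto
  moreover have "M:?S `` {M}" using equiv_class_self[OF stable_equiv] M by blast
  ultimately show "(UN M:?S `` {M}. ?SE E' `` {M}) = ?SE E' `` {M}" unfolding i(2) by blast
 qed
 have "restriction_map s H (E ` I) X:carrier (product_group (E ` I) (%E'. endotrivial_group s (subhopf H E')))"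
  if X:"X:carrier (endotrivial_group s H)" for X
 proof -
  obtain M where M:"endotrivial s H M" "X = ?S `` {M}" using X unfolding carr quotient_def by blast
  have "?SE (E i) `` {M}:carrier (endotrivial_group s (subhopf H (E i)))" if "i:I" for i
  unfolding carr by(rule quotientI) (use endotrivial_sub[OF E(1)[OF that] M(1)] in simp)
  then show ?thesis unfolding M(2) val[OF M(1)] by auto
 qed
 moreover have "inj_on (restriction_map s H (E ` I)) (carrier (endotrivial_group s H))"
 proof (rule inj_onI)
  fix X Y assume X:"X:carrier (endotrivial_group s H)" and Y:"Y:carrier (endotrivial_group s H)"
  and eq:"restriction_map s H (E ` I) X = restriction_map s H (E ` I) Y"
  obtain M where M:"endotrivial s H M" "X = ?S `` {M}" using X unfolding carr quotient_def by blast
  obtain N where N:"endotrivial s H N" "Y = ?S `` {N}" using Y unfolding carr quotient_def by blast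
  have st:"(M,N):?SE (E i)" if i:"i:I" for i
  proof -
  have "?SE (E i) `` {M} = ?SE (E i) `` {N}"
  using fun_cong[OF eq,of "E i"] i unfolding M(2) N(2) val[OF M(1)] val[OF N(1)] by simp
  then show ?thesis using eq_equiv_class[OF _ eqE[OF i]] endotrivial_sub[OF E(1)[OF i] N(1)] by blast
  qed
  have "(M,N):?S" by(rule stable_equiv_detect[OF M(1) N(1) Z(3) detect E st])
  then show "X = Y" unfolding M(2) N(2) by(rule equiv_class_eq[OF stable_equiv])
 qed
 ultimately show ?thesis by blast
qed

end
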